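(* Let $\Lambda$ be an associative $k$-algebra, and let $g:B\to C$ and $f:A\to B$ be morphisms in $\operatorname{mod}\Lambda$ with $B=\bigoplus_{i=1}^l V_i^{n_i}$, where $V_1,\dots,V_l$ are nonisomorphic indecomposable $\Lambda$-modules. Let $T:\bigoplus_{i=1}^{l}(V_i\otimes W_i)\to C$ and $S:A\to\bigoplus_{i=1}^{l}(V_i\otimes W_i)$ be the morphisms constructed from $g$ and $f$, respectively, as described in the context. If $g$ is a minimal right almost split morphism in $\operatorname{mod}\Lambda$ then: (a) $T$ satisfies the right omnipresent maximal rank property. (b) For a general choice of $k$-subspaces $U_i\subset V_i$, $i=1,\dots,l$, the restriction of $g$ to $\bigoplus_{i=1}^l U_i^{n_i}$ has maximal rank. (c) If $g$ is surjective then $\dim C<\sum_{i=1}^l(\dim V_i)^2$. If $f$ is a minimal left almost split morphism in $\operatorname{mod}\Lambda$ then: (d) $S$ satisfies the right omnipresent maximal rank property. (e) For a general choice of $k$-subspaces $U_i\subset V_i$, $i=1,\dots,l$, denoting by $\sigma_i:V_i\to V_i/U_i$ the natural projection, the linear transformation $\left(\bigoplus_{i=1}^l\sigma_i^{n_i}\right)\circ f$ has maximal rank. (f) If $f$ is injective then $\dim A<\sum_{i=1}^l(\dim V_i)^2$. If $0\to A\overset{f}{\to} B\overset{g}{\to} C\to 0$ is an almost split sequence in $\operatorname{mod}\Lambda$ then: (g) $\dim B<2\sum_{i=1}^l(\dim V_i)^2-1$.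
   Context: $k$ is a fixed algebraically closed field; $\otimes$ and $\dim$ are over $k$. $\operatorname{mod}\Lambda$ is the category of left $\Lambda$-modules that are finite dimensional over $k$. $l,n_1,\dots,n_l$ are nonnegative integers and $V^m$ denotes the direct sum of $m$ copies of $V$; similarly $\sigma^m$ is the direct sum of $m$ copies of the map $\sigma$. Almost split terminology is the standard one of Auslander–Reiten–Smalø. Construction of $T$ and $S$: $W_i$ is the $k$-space with basis $e_{i1},\dots,e_{in_i}$, and $V_i\otimes W_i$ is a $\Lambda$-module through $V_i$. For $1\le j\le n_i$, let $g_{ij}:V_i\to C$ be the restriction of $g$ to the $j$-th copy of $V_i$ in $B$, and $f_{ij}:A\to V_i$ the component of $f$ into the $j$-th copy of $V_i$ in $B$. Then $T$ is the morphism with $T(v\otimes e_{ij})=g_{ij}(v)$ for $v\in V_i$, and $S$ is the morphism $S(a)=\big(\sum_{j=1}^{n_i}f_{ij}(a)\otimes e_{ij}\big)_{i=1}^l$ for $a\in A$. A linear map has maximal rank if it is injective or surjective. $T$ satisfies the right omnipresent maximal rank property if for every choice of $k$-subspaces $W'_i\subset W_i$, $i=1,\dots,l$, the restriction of $T$ to $\bigoplus_i(V_i\otimes W'_i)$ has maximal rank. $S$ satisfies the right omnipresent maximal rank property if for every choice of $k$-subspaces $W'_i\subset W_i$ the composition of $S$ with the natural projection $\bigoplus_i(V_i\otimes W_i)\to\bigoplus_i(V_i\otimes(W_i/W'_i))$ has maximal rank. "For a general choice of $k$-subspaces $U_i\subset V_i$" means: for any fixed dimensions $d_i$, $0\le d_i\le\dim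 V_i$, there is a dense Zariski open subset of the product of Grassmannians $\prod_i G(d_i,V_i)$ such that the assertion holds whenever $(U_1,\dots,U_l)$ belongs to that subset. *)

theory Defs
  imports
    "Jordan_Normal_Form.VS_Connect"
    "Jordan_Normal_Form.Determinant"
    "HOL-Algebra.AbelCoset"
    "HOL-Library.Poly_Mapping"
    "HOL-Analysis.Abstract_Topology"
begin

text \<open>
  The ground field is a type \<open>'k\<close>, seen as the ring record \<^term>\<open>class_ring\<close>; vector spaces over it
  are records in the locale \<^locale>\<open>vectorspace\<close>. The ring fields \<open>mult\<close> and \<open>one\<close> of a record that
  serves only as a vector space are irrelevant. Functions between spaces matter on carriers only.
\<close>

abbreviation vdim :: "('k::field, 'v, 'z) module_scheme \<Rightarrow> nat"
  where "vdim M \<equiv> vectorspace.dim class_ring M"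

definition max_rank :: "('a \<Rightarrow> 'b) \<Rightarrow> 'a set \<Rightarrow> 'b set \<Rightarrow> bool"
  where "max_rank h X Y \<longleftrightarrow> inj_on h X \<or> h ` X = Y"


section \<open>Constructions with vector spaces\<close>

definition quot_space :: "('k::field, 'v, 'z) module_scheme \<Rightarrow> 'v set \<Rightarrow> ('k, 'v set) module"
  where "quot_space V U =
    \<lparr>carrier = a_rcosets\<^bsub>V\<^esub> U, mult = undefined, one = undefined,
     zero = U, add = set_add V,
     smult = (\<lambda>c X. \<Union>x\<in>X. U +>\<^bsub>V\<^esub> (c \<odot>\<^bsub>V\<^esub> x))\<rparr>"

text \<open>Only used for finite index sets, where direct sum and product agree.\<close>

definition dir_sum :: "'i set \<Rightarrow> ('i \<Rightarrow> ('k::field, 'v, 'z) module_scheme) \<Rightarrow> ('k, 'i \<Rightarrow> 'v) module"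
  where "dir_sum I M =
    \<lparr>carrier = (\<Pi>\<^sub>E i\<in>I. carrier (M i)), mult = undefined, one = undefined,
     zero = (\<lambda>i\<in>I. \<zero>\<^bsub>M i\<^esub>),
     add = (\<lambda>v w. \<lambda>i\<in>I. v i \<oplus>\<^bsub>M i\<^esub> w i),
     smult = (\<lambda>c v. \<lambda>i\<in>I. c \<odot>\<^bsub>M i\<^esub> v i)\<rparr>"

definition dir_sum_incl :: "'i set \<Rightarrow> ('i \<Rightarrow> ('k::field, 'v, 'z) module_scheme) \<Rightarrow> 'i \<Rightarrow> 'v \<Rightarrow> ('i \<Rightarrow> 'v)"
  where "dir_sum_incl I M i v = (\<lambda>k\<in>I. if k = i then v else \<zero>\<^bsub>M k\<^esub>)"

text \<open>The space with basis \<open>X\<close>; the basis vector belonging to \<open>x\<close> is \<^term>\<open>Poly_Mapping.single x 1\<close>.\<close>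

definition free_space :: "'x set \<Rightarrow> ('k::field, 'x \<Rightarrow>\<^sub>0 'k) module"
  where "free_space X =
    \<lparr>carrier = {u. Poly_Mapping.keys u \<subseteq> X}, mult = undefined, one = undefined,
     zero = 0, add = (+), smult = (\<lambda>c. Poly_Mapping.map ((*) c))\<rparr>"

text \<open>The tensor product is the free space on \<open>V \<times> W\<close> modulo the bilinearity relations.\<close>

definition tensor_rels ::
    "('k::field, 'v, 'z) module_scheme \<Rightarrow> ('k, 'w, 'y) module_scheme \<Rightarrow> ('v \<times> 'w \<Rightarrow>\<^sub>0 'k) set"
  where "tensor_rels V W =
      {Poly_Mapping.single (v \<oplus>\<^bsub>V\<^esub> v', w) 1 - Poly_Mapping.single (v, w) 1
          - Poly_Mapping.single (v', w) 1 |v v' w.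
          v \<in> carrier V \<and> v' \<in> carrier V \<and> w \<in> carrier W}
    \<union> {Poly_Mapping.single (v, w \<oplus>\<^bsub>W\<^esub> w') 1 - Poly_Mapping.single (v, w) 1
          - Poly_Mapping.single (v, w') 1 |v w w'.
          v \<in> carrier V \<and> w \<in> carrier W \<and> w' \<in> carrier W}
    \<union> {Poly_Mapping.single (c \<odot>\<^bsub>V\<^esub> v, w) 1 - Poly_Mapping.single (v, w) c |c v w.
          v \<in> carrier V \<and> w \<in> carrier W}
    \<union> {Poly_Mapping.single (v, c \<odot>\<^bsub>W\<^esub> w) 1 - Poly_Mapping.single (v, w) c |c v w.
          v \<in> carrier V \<and> w \<in> carrier W}"

definition tensor_null ::
    "('k::field, 'v, 'z) module_scheme \<Rightarrow> ('k, 'w, 'y) module_scheme \<Rightarrow> ('v \<times> 'w \<Rightarrow>\<^sub>0 'k) set"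
  where "tensor_null V W =
    LinearCombinations.module.span class_ring (free_space (carrier V \<times> carrier W)) (tensor_rels V W)"

definition tensor ::
    "('k::field, 'v, 'z) module_scheme \<Rightarrow> ('k, 'w, 'y) module_scheme \<Rightarrow> ('k, ('v \<times> 'w \<Rightarrow>\<^sub>0 'k) set) module"
  where "tensor V W = quot_space (free_space (carrier V \<times> carrier W)) (tensor_null V W)"

definition tensor_coset ::
    "('k::field, 'v, 'z) module_scheme \<Rightarrow> ('k, 'w, 'y) module_scheme \<Rightarrow> ('v \<times> 'w \<Rightarrow>\<^sub>0 'k) \<Rightarrow> ('v \<times> 'w \<Rightarrow>\<^sub>0 'k) set"
  where "tensor_coset V W u =
    tensor_null V W +>\<^bsub>free_space (carrier V \<times> carrier W) :: ('k, 'v \<times> 'w \<Rightarrow>\<^sub>0 'k) module\<^esub> u"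

definition pure_tensor ::
    "('k::field, 'v, 'z) module_scheme \<Rightarrow> ('k, 'w, 'y) module_scheme \<Rightarrow> 'v \<Rightarrow> 'w \<Rightarrow> ('v \<times> 'w \<Rightarrow>\<^sub>0 'k) set"
  where "pure_tensor V W v w = tensor_coset V W (Poly_Mapping.single (v, w) 1)"

text \<open>
  \<open>tensor_map V' W' p q\<close> is the map \<open>p \<otimes> q\<close> into \<open>V' \<otimes> W'\<close>: all representatives of a coset have
  the same image coset, so the union is that coset.
\<close>

definition tensor_map ::
    "('k::field, 'v2, 'z) module_scheme \<Rightarrow> ('k, 'w2, 'y) module_scheme \<Rightarrow> ('v \<Rightarrow> 'v2) \<Rightarrow> ('w \<Rightarrow> 'w2)
      \<Rightarrow> ('v \<times> 'w \<Rightarrow>\<^sub>0 'k) set \<Rightarrow> ('v2 \<times> 'w2 \<Rightarrow>\<^sub>0 'k) set"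
  where "tensor_map V' W' p q X =
    (\<Union>u\<in>X. tensor_coset V' W'
      (\<Sum>x\<in>Poly_Mapping.keys u. Poly_Mapping.single (p (fst x), q (snd x)) (Poly_Mapping.lookup u x)))"


section \<open>Finite-dimensional modules over an associative algebra\<close>

locale k_algebra = vectorspace class_ring L + ring L
  for L :: "('k::field, 'r) module" (structure) +
  assumes smult_mult_left:
      "\<And>c x y. x \<in> carrier L \<Longrightarrow> y \<in> carrier L \<Longrightarrow> (c \<odot> x) \<otimes> y = c \<odot> (x \<otimes> y)"
    and smult_mult_right:
      "\<And>c x y. x \<in> carrier L \<Longrightarrow> y \<in> carrier L \<Longrightarrow> x \<otimes> (c \<odot> y) = c \<odot> (x \<otimes> y)"

record ('k, 'v, 'r) lmodule = "('k, 'v) module" +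
  lact :: "'r \<Rightarrow> 'v \<Rightarrow> 'v"

locale fd_module = vectorspace class_ring M
  for L :: "('k::field, 'r) module" and M :: "('k, 'v, 'r) lmodule" +
  assumes fin_dim: "vectorspace.fin_dim class_ring M"
    and lact_hom: "\<And>x. x \<in> carrier L \<Longrightarrow> lact M x \<in> LinearCombinations.module_hom class_ring M M"
    and lact_add: "\<And>x y v. x \<in> carrier L \<Longrightarrow> y \<in> carrier L \<Longrightarrow> v \<in> carrier M \<Longrightarrow>
      lact M (x \<oplus>\<^bsub>L\<^esub> y) v = lact M x v \<oplus>\<^bsub>M\<^esub> lact M y v"
    and lact_smult: "\<And>c x v. x \<in> carrier L \<Longrightarrow> v \<in> carrier M \<Longrightarrow>
      lact M (c \<odot>\<^bsub>L\<^esub> x) v = c \<odot>\<^bsub>M\<^esub> lact M x v"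
    and lact_mult: "\<And>x y v. x \<in> carrier L \<Longrightarrow> y \<in> carrier L \<Longrightarrow> v \<in> carrier M \<Longrightarrow>
      lact M (x \<otimes>\<^bsub>L\<^esub> y) v = lact M x (lact M y v)"
    and lact_one: "\<And>v. v \<in> carrier M \<Longrightarrow> lact M \<one>\<^bsub>L\<^esub> v = v"

definition lmod_hom ::
    "('k::field, 'r) module \<Rightarrow> ('k, 'v, 'r) lmodule \<Rightarrow> ('k, 'w, 'r) lmodule \<Rightarrow> ('v \<Rightarrow> 'w) set"
  where "lmod_hom L M N = {h \<in> LinearCombinations.module_hom class_ring M N.
    \<forall>x\<in>carrier L. \<forall>v\<in>carrier M. h (lact M x v) = lact N x (h v)}"

definition lmod_isomorphic ::
    "('k::field, 'r) module \<Rightarrow> ('k, 'v, 'r) lmodule \<Rightarrow> ('k, 'w, 'r) lmodule \<Rightarrow> bool"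
  where "lmod_isomorphic L M N \<longleftrightarrow> (\<exists>h\<in>lmod_hom L M N. bij_betw h (carrier M) (carrier N))"

definition lsubmodule :: "('k::field, 'r) module \<Rightarrow> 'v set \<Rightarrow> ('k, 'v, 'r) lmodule \<Rightarrow> bool"
  where "lsubmodule L N M \<longleftrightarrow>
    VectorSpace.subspace class_ring N M \<and> (\<forall>x\<in>carrier L. \<forall>v\<in>N. lact M x v \<in> N)"

definition indecomposable :: "('k::field, 'r) module \<Rightarrow> ('k, 'v, 'r) lmodule \<Rightarrow> bool"
  where "indecomposable L M \<longleftrightarrow> carrier M \<noteq> {\<zero>\<^bsub>M\<^esub>} \<and>
    (\<forall>N P. lsubmodule L N M \<and> lsubmodule L P M \<and> N \<inter> P = {\<zero>\<^bsub>M\<^esub>} \<and> N <+>\<^bsub>M\<^esub> P = carrier M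
      \<longrightarrow> N = {\<zero>\<^bsub>M\<^esub>} \<or> P = {\<zero>\<^bsub>M\<^esub>})"

definition lmod_dir_sum :: "'i set \<Rightarrow> ('i \<Rightarrow> ('k::field, 'v, 'r) lmodule) \<Rightarrow> ('k, 'i \<Rightarrow> 'v, 'r) lmodule"
  where "lmod_dir_sum I M =
    module.extend (dir_sum I M) (lmodule.fields (\<lambda>x v. \<lambda>i\<in>I. lact (M i) x (v i)))"

definition lmod_power :: "('k::field, 'v, 'r) lmodule \<Rightarrow> nat \<Rightarrow> ('k, nat \<Rightarrow> 'v, 'r) lmodule"
  where "lmod_power V m = lmod_dir_sum {1..m} (\<lambda>_. V)"

definition lmod_tensor ::
    "('k::field, 'v, 'r) lmodule \<Rightarrow> ('k, 'w) module \<Rightarrow> ('k, ('v \<times> 'w \<Rightarrow>\<^sub>0 'k) set, 'r) lmodule"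
  where "lmod_tensor V W =
    module.extend (tensor V W) (lmodule.fields (\<lambda>x. tensor_map V W (lact V x) (\<lambda>w. w)))"


section \<open>Almost split morphisms and sequences\<close>

text \<open>
  HOL cannot quantify over the carrier types of all modules. The test modules in the definition of
  almost split morphisms have their carriers in \<open>'k vec\<close> (with arbitrary operations); every
  finite-dimensional module is isomorphic to such a one, on the column vectors of length its dimension.
\<close>

definition split_epi ::
    "('k::field, 'r) module \<Rightarrow> ('k, 'v, 'r) lmodule \<Rightarrow> ('k, 'w, 'r) lmodule \<Rightarrow> ('v \<Rightarrow> 'w) \<Rightarrow> bool"
  where "split_epi L M N h \<longleftrightarrow> (\<exists>s\<in>lmod_hom L N M. \<forall>y\<in>carrier N. h (s y) = y)"

definition split_mono ::
    "('k::field, 'r) module \<Rightarrow> ('k, 'v, 'r) lmodule \<Rightarrow> ('k, 'w, 'r) lmodule \<Rightarrow> ('v \<Rightarrow> 'w) \<Rightarrow> bool"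
  where "split_mono L M N h \<longleftrightarrow> (\<exists>r\<in>lmod_hom L N M. \<forall>x\<in>carrier M. r (h x) = x)"

definition right_almost_split ::
    "('k::field, 'r) module \<Rightarrow> ('k, 'b, 'r) lmodule \<Rightarrow> ('k, 'c, 'r) lmodule \<Rightarrow> ('b \<Rightarrow> 'c) \<Rightarrow> bool"
  where "right_almost_split L B C g \<longleftrightarrow>
    g \<in> lmod_hom L B C \<and> \<not> split_epi L B C g \<and>
    (\<forall>X :: ('k, 'k vec, 'r) lmodule. \<forall>h. fd_module L X \<and> h \<in> lmod_hom L X C \<and> \<not> split_epi L X C h \<longrightarrow>
      (\<exists>t\<in>lmod_hom L X B. \<forall>x\<in>carrier X. g (t x) = h x))"

definition left_almost_split ::
    "('k::field, 'r) module \<Rightarrow> ('k, 'a, 'r) lmodule \<Rightarrow> ('k, 'b, 'r) lmodule \<Rightarrow> ('a \<Rightarrow> 'b) \<Rightarrow> bool"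
  where "left_almost_split L A B f \<longleftrightarrow>
    f \<in> lmod_hom L A B \<and> \<not> split_mono L A B f \<and>
    (\<forall>Y :: ('k, 'k vec, 'r) lmodule. \<forall>h. fd_module L Y \<and> h \<in> lmod_hom L A Y \<and> \<not> split_mono L A Y h \<longrightarrow>
      (\<exists>t\<in>lmod_hom L B Y. \<forall>x\<in>carrier A. t (f x) = h x))"

definition right_minimal ::
    "('k::field, 'r) module \<Rightarrow> ('k, 'b, 'r) lmodule \<Rightarrow> ('b \<Rightarrow> 'c) \<Rightarrow> bool"
  where "right_minimal L B g \<longleftrightarrow>
    (\<forall>s\<in>lmod_hom L B B. (\<forall>b\<in>carrier B. g (s b) = g b) \<longrightarrow> bij_betw s (carrier B) (carrier B))"

definition left_minimal ::
    "('k::field, 'r) module \<Rightarrow> ('k, 'a, 'r) lmodule \<Rightarrow> ('k, 'b, 'r) lmodule \<Rightarrow> ('a \<Rightarrow> 'b) \<Rightarrow> bool"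
  where "left_minimal L A B f \<longleftrightarrow>
    (\<forall>s\<in>lmod_hom L B B. (\<forall>a\<in>carrier A. s (f a) = f a) \<longrightarrow> bij_betw s (carrier B) (carrier B))"

definition minimal_right_almost_split ::
    "('k::field, 'r) module \<Rightarrow> ('k, 'b, 'r) lmodule \<Rightarrow> ('k, 'c, 'r) lmodule \<Rightarrow> ('b \<Rightarrow> 'c) \<Rightarrow> bool"
  where "minimal_right_almost_split L B C g \<longleftrightarrow> right_almost_split L B C g \<and> right_minimal L B g"

definition minimal_left_almost_split ::
    "('k::field, 'r) module \<Rightarrow> ('k, 'a, 'r) lmodule \<Rightarrow> ('k, 'b, 'r) lmodule \<Rightarrow> ('a \<Rightarrow> 'b) \<Rightarrow> bool"
  where "minimal_left_almost_split L A B f \<longleftrightarrow> left_almost_split L A B f \<and> left_minimal L A B f"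

definition almost_split_sequence ::
    "('k::field, 'r) module \<Rightarrow> ('k, 'a, 'r) lmodule \<Rightarrow> ('a \<Rightarrow> 'b) \<Rightarrow> ('k, 'b, 'r) lmodule
      \<Rightarrow> ('b \<Rightarrow> 'c) \<Rightarrow> ('k, 'c, 'r) lmodule \<Rightarrow> bool"
  where "almost_split_sequence L A f B g C \<longleftrightarrow>
    inj_on f (carrier A) \<and> f ` carrier A = {b \<in> carrier B. g b = \<zero>\<^bsub>C\<^esub>} \<and> g ` carrier B = carrier C \<and>
    left_almost_split L A B f \<and> right_almost_split L B C g"


section \<open>The morphisms \<open>T\<close> and \<open>S\<close>\<close>

definition middle_module ::
    "nat \<Rightarrow> (nat \<Rightarrow> nat) \<Rightarrow> (nat \<Rightarrow> ('k::field, 'v, 'r) lmodule) \<Rightarrow> ('k, nat \<Rightarrow> nat \<Rightarrow> 'v, 'r) lmodule"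
  where "middle_module l n V = lmod_dir_sum {1..l} (\<lambda>i. lmod_power (V i) (n i))"

text \<open>\<open>mult_space m\<close> is the space \<open>W\<^sub>i\<close> for \<open>m = n\<^sub>i\<close>, and \<open>mult_basis j\<close> is \<open>e\<^sub>i\<^sub>j\<close>.\<close>

definition mult_space :: "nat \<Rightarrow> ('k::field, nat \<Rightarrow>\<^sub>0 'k) module"
  where "mult_space m = free_space {1..m}"

definition mult_basis :: "nat \<Rightarrow> (nat \<Rightarrow>\<^sub>0 'k::field)"
  where "mult_basis j = Poly_Mapping.single j 1"

definition middle_tensor ::
    "nat \<Rightarrow> (nat \<Rightarrow> nat) \<Rightarrow> (nat \<Rightarrow> ('k::field, 'v, 'r) lmodule)
      \<Rightarrow> ('k, nat \<Rightarrow> ('v \<times> (nat \<Rightarrow>\<^sub>0 'k) \<Rightarrow>\<^sub>0 'k) set, 'r) lmodule"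
  where "middle_tensor l n V = lmod_dir_sum {1..l} (\<lambda>i. lmod_tensor (V i) (mult_space (n i)))"

definition right_component ::
    "nat \<Rightarrow> (nat \<Rightarrow> nat) \<Rightarrow> (nat \<Rightarrow> ('k::field, 'v, 'r) lmodule)
      \<Rightarrow> ((nat \<Rightarrow> nat \<Rightarrow> 'v) \<Rightarrow> 'c) \<Rightarrow> nat \<Rightarrow> nat \<Rightarrow> 'v \<Rightarrow> 'c"
  where "right_component l n V g i j v =
    g (dir_sum_incl {1..l} (\<lambda>k. lmod_power (V k) (n k)) i (dir_sum_incl {1..n i} (\<lambda>_. V i) j v))"

text \<open>The elements \<open>v \<otimes> e\<^sub>i\<^sub>j\<close> span the source, so there is exactly one such \<open>T\<close>.\<close>

definition T_of ::
    "('k::field, 'r) module \<Rightarrow> nat \<Rightarrow> (nat \<Rightarrow> nat) \<Rightarrow> (nat \<Rightarrow> ('k, 'v, 'r) lmodule) \<Rightarrow> ('k, 'c, 'r) lmodule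
      \<Rightarrow> ((nat \<Rightarrow> nat \<Rightarrow> 'v) \<Rightarrow> 'c) \<Rightarrow> ((nat \<Rightarrow> ('v \<times> (nat \<Rightarrow>\<^sub>0 'k) \<Rightarrow>\<^sub>0 'k) set) \<Rightarrow> 'c) \<Rightarrow> bool"
  where "T_of L l n V C g T \<longleftrightarrow> T \<in> lmod_hom L (middle_tensor l n V) C \<and>
    (\<forall>i\<in>{1..l}. \<forall>j\<in>{1..n i}. \<forall>v\<in>carrier (V i).
      T (dir_sum_incl {1..l} (\<lambda>k. lmod_tensor (V k) (mult_space (n k))) i
           (pure_tensor (V i) (mult_space (n i)) v (mult_basis j)))
      = right_component l n V g i j v)"

definition S_of ::
    "nat \<Rightarrow> (nat \<Rightarrow> nat) \<Rightarrow> (nat \<Rightarrow> ('k::field, 'v, 'r) lmodule)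
      \<Rightarrow> ('a \<Rightarrow> nat \<Rightarrow> nat \<Rightarrow> 'v) \<Rightarrow> 'a \<Rightarrow> nat \<Rightarrow> ('v \<times> (nat \<Rightarrow>\<^sub>0 'k) \<Rightarrow>\<^sub>0 'k) set"
  where "S_of l n V f a = (\<lambda>i\<in>{1..l}.
    finsum (tensor (V i) (mult_space (n i)))
      (\<lambda>j. pure_tensor (V i) (mult_space (n i)) (f a i j) (mult_basis j)) {1..n i})"

text \<open>\<open>V\<^sub>i \<otimes> W'\<close> is identified with its image in \<open>V\<^sub>i \<otimes> W\<^sub>i\<close>.\<close>

definition subtensor ::
    "('k::field, 'v, 'z) module_scheme \<Rightarrow> ('k, 'w, 'y) module_scheme \<Rightarrow> 'w set \<Rightarrow> ('v \<times> 'w \<Rightarrow>\<^sub>0 'k) set set"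
  where "subtensor V W W' = LinearCombinations.module.span class_ring (tensor V W)
    {pure_tensor V W v w |v w. v \<in> carrier V \<and> w \<in> W'}"

definition T_omnipresent ::
    "nat \<Rightarrow> (nat \<Rightarrow> nat) \<Rightarrow> (nat \<Rightarrow> ('k::field, 'v, 'r) lmodule) \<Rightarrow> ('k, 'c, 'r) lmodule
      \<Rightarrow> ((nat \<Rightarrow> ('v \<times> (nat \<Rightarrow>\<^sub>0 'k) \<Rightarrow>\<^sub>0 'k) set) \<Rightarrow> 'c) \<Rightarrow> bool"
  where "T_omnipresent l n V C T \<longleftrightarrow>
    (\<forall>W'. (\<forall>i\<in>{1..l}. VectorSpace.subspace class_ring (W' i) (mult_space (n i))) \<longrightarrow>
      max_rank T (\<Pi>\<^sub>E i\<in>{1..l}. subtensor (V i) (mult_space (n i)) (W' i)) (carrier C))"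

definition S_omnipresent ::
    "nat \<Rightarrow> (nat \<Rightarrow> nat) \<Rightarrow> (nat \<Rightarrow> ('k::field, 'v, 'r) lmodule) \<Rightarrow> ('k, 'a, 'r) lmodule
      \<Rightarrow> ('a \<Rightarrow> nat \<Rightarrow> ('v \<times> (nat \<Rightarrow>\<^sub>0 'k) \<Rightarrow>\<^sub>0 'k) set) \<Rightarrow> bool"
  where "S_omnipresent l n V A S \<longleftrightarrow>
    (\<forall>W'. (\<forall>i\<in>{1..l}. VectorSpace.subspace class_ring (W' i) (mult_space (n i))) \<longrightarrow>
      max_rank
        (\<lambda>a. \<lambda>i\<in>{1..l}. tensor_map (V i) (quot_space (mult_space (n i)) (W' i))
           (\<lambda>v. v) (\<lambda>w. W' i +>\<^bsub>mult_space (n i)\<^esub> w) (S a i))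
        (carrier A)
        (carrier (dir_sum {1..l} (\<lambda>i. tensor (V i) (quot_space (mult_space (n i)) (W' i))))))"


section \<open>General choices of subspaces\<close>

definition scalar_space :: "('k::field, 'k) module"
  where "scalar_space =
    \<lparr>carrier = UNIV, mult = (*), one = 1, zero = 0, add = (+), smult = (*)\<rparr>"

definition grass_prod ::
    "nat \<Rightarrow> (nat \<Rightarrow> nat) \<Rightarrow> (nat \<Rightarrow> ('k::field, 'v, 'r) lmodule) \<Rightarrow> (nat \<Rightarrow> 'v set) set"
  where "grass_prod l d V =
    (\<Pi>\<^sub>E i\<in>{1..l}. {U. VectorSpace.subspace class_ring U (V i) \<and> vdim ((V i)\<lparr>carrier := U\<rparr>) = d i})"

definition frames ::
    "nat \<Rightarrow> (nat \<Rightarrow> nat) \<Rightarrow> (nat \<Rightarrow> ('k::field, 'v, 'r) lmodule) \<Rightarrow> (nat \<Rightarrow> 'v set)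
      \<Rightarrow> (nat \<Rightarrow> nat \<Rightarrow> 'v) set"
  where "frames l d V U = {b. \<forall>i\<in>{1..l}. inj_on (b i) {..<d i} \<and>
    vectorspace.basis class_ring ((V i)\<lparr>carrier := U i\<rparr>) (b i ` {..<d i})}"

text \<open>
  The linear coordinates on the \<open>d\<close>-th exterior power of \<open>V\<close> are spanned by the functions
  \<open>b\<^sub>1 \<and> \<dots> \<and> b\<^sub>d \<mapsto> det (\<phi>\<^sub>r b\<^sub>c)\<close> with linear functionals \<open>\<phi>\<^sub>r\<close> on \<open>V\<close>. \<open>(e, F) \<in> plucker_forms l d V\<close>
  means that \<open>F\<close> is a multihomogeneous polynomial of multidegree \<open>e\<close> in the Plucker coordinates on
  the product of the Grassmannians, evaluated on frames.
\<close>

inductive_set plucker_forms ::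
    "nat \<Rightarrow> (nat \<Rightarrow> nat) \<Rightarrow> (nat \<Rightarrow> ('k::field, 'v, 'r) lmodule)
      \<Rightarrow> ((nat \<Rightarrow> nat) \<times> ((nat \<Rightarrow> nat \<Rightarrow> 'v) \<Rightarrow> 'k)) set"
  for l :: nat and d :: "nat \<Rightarrow> nat" and V :: "nat \<Rightarrow> ('k::field, 'v, 'r) lmodule"
where
  const: "((\<lambda>_. 0), (\<lambda>_. c)) \<in> plucker_forms l d V"
| coord: "i \<in> {1..l} \<Longrightarrow> (\<And>r. r < d i \<Longrightarrow> \<phi> r \<in> LinearCombinations.module_hom class_ring (V i) scalar_space) \<Longrightarrow>
    ((\<lambda>k. if k = i then 1 else 0), (\<lambda>b. det (mat (d i) (d i) (\<lambda>(r, c). \<phi> r (b i c)))))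
      \<in> plucker_forms l d V"
| add: "(e, F) \<in> plucker_forms l d V \<Longrightarrow> (e, G) \<in> plucker_forms l d V \<Longrightarrow>
    (e, (\<lambda>b. F b + G b)) \<in> plucker_forms l d V"
| mult: "(e, F) \<in> plucker_forms l d V \<Longrightarrow> (e', G) \<in> plucker_forms l d V \<Longrightarrow>
    ((\<lambda>k. e k + e' k), (\<lambda>b. F b * G b)) \<in> plucker_forms l d V"

text \<open>
  The closed sets are the common zero sets of multihomogeneous polynomials in the Plucker
  coordinates. A change of frame multiplies \<open>F\<close> by a nonzero scalar, so the vanishing of \<open>F\<close> does
  not depend on the frame.
\<close>

definition zariski_topology ::
    "nat \<Rightarrow> (nat \<Rightarrow> nat) \<Rightarrow> (nat \<Rightarrow> ('k::field, 'v, 'r) lmodule) \<Rightarrow> (nat \<Rightarrow> 'v set) topology"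
  where "zariski_topology l d V = topology_generated_by
    {{U \<in> grass_prod l d V. \<exists>b\<in>frames l d V U. F b \<noteq> 0} |e F. (e, F) \<in> plucker_forms l d V}"

definition general_choice ::
    "nat \<Rightarrow> (nat \<Rightarrow> ('k::field, 'v, 'r) lmodule) \<Rightarrow> ((nat \<Rightarrow> 'v set) \<Rightarrow> bool) \<Rightarrow> bool"
  where "general_choice l V P \<longleftrightarrow> (\<forall>d. (\<forall>i\<in>{1..l}. d i \<le> vdim (V i)) \<longrightarrow>
    (\<exists>Q. openin (zariski_topology l d V) Q \<and>
      zariski_topology l d V closure_of Q = topspace (zariski_topology l d V) \<and>
      (\<forall>U\<in>Q. P U)))"

end

theory Submission
  imports Defs
begin

text \<open>
  If \<open>g\<close> is minimal right almost split and \<open>e\<close> is an idempotent endomorphism of \<open>B\<close>, then \<open>g\<close> restricted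
  to \<open>e B\<close> is injective or maps onto \<open>C\<close>: otherwise the inclusion of \<open>g (e B)\<close> in \<open>C\<close> is not a split epimorphism,
  so it factors through \<open>g\<close> by some \<open>t\<close>, and \<open>s = t g e + (1 - e)\<close> satisfies \<open>g s = g\<close>, hence is bijective.
  The spaces \<open>\<Oplus>\<^sub>i V\<^sub>i \<otimes> W'\<^sub>i\<close> are the images of the idempotents given by projections of \<open>W\<^sub>i\<close> onto \<open>W'\<^sub>i\<close>, and this is (a).
  For (c), a nonzero element of the kernel of \<open>g\<close> lies in such an image with \<open>dim W'\<^sub>i \<le> dim V\<^sub>i\<close>, on which \<open>g\<close> is
  surjective without being injective.

  For (b), bases of the \<open>U\<^sub>i\<close> are parametrized by \<open>u\<close>, and the restriction of \<open>g\<close> becomes a matrix \<open>M u\<close> that is linear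
  in \<open>u\<close>. By (a), for each vector \<open>x\<close> either the values \<open>M u x\<close> fill the target as \<open>u\<close> varies, or \<open>M u x \<noteq> 0\<close> for
  all independent \<open>u\<close> and \<open>x \<noteq> 0\<close>. If \<open>u\<close> has maximal rank \<open>r\<close> but \<open>M u\<close> is neither injective nor surjective, a kernel vector
  \<open>x\<close> and a direction \<open>u'\<close> that moves \<open>M u x\<close> out of the image produce a minor of size \<open>r + 1\<close> that is nonzero at \<open>u + t u'\<close> for almost all \<open>t\<close>.
  Maximal rank is open because in a chart around a subspace both a frame and a set of equations have entries linear
  in the Plucker coordinates; nonempty open sets are dense because a form that is nonzero at one point
  of a line of frames vanishes at only finitely many points of that line.

  Parts (d), (e), (f) are dual, with the matrix of the equations of \<open>U\<^sub>i\<close> in place of that of a frame. In an almost split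
  sequence both maps are minimal, so (g) is the sum of (c) and (f).
\<close>

section \<open>Matrices over finite index sets\<close>

text \<open>The obstacle in (b) and (e) is that they concern general subspaces of the
  \<open>V i\<close>, while almost split morphisms give information on subspaces of the
  \<open>W i\<close>. The bridge is that \<open>M u x\<close> is bilinear: for a fixed
  \<open>x\<close> the vectors built from all \<open>u\<close> fill the sum of the spaces
  \<open>V i \<otimes> W' i\<close>, with \<open>W' i\<close> spanned by the slices of
  \<open>x\<close> in \<open>W i\<close>. So (a) for these \<open>W' i\<close> is a dichotomy for
  \<open>M u x\<close> as a function of \<open>u\<close>. In (c) the bound on
  \<open>dim W' i\<close> is the bound of the rank of a tensor in \<open>V i \<otimes> W i\<close>
  by \<open>dim V i\<close>, and the kernel is nonzero because a bijective \<open>g\<close> would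
  split. Rank is handled by matrices with generalized inverses \<open>X Y X = X\<close>. They
  produce the idempotents \<open>Y X\<close>, and one-sided inverses give constant factors that turn
  maximal rank into a nonzero determinant, a condition that is polynomial in the frame. For (b),
  (c), (e), (f) both morphisms are reduced to one numerical property, \<open>omnipresent\<close>.
  The map \<open>f\<close> enters by its transpose, so injective and surjective trade places there.
  Algebraic closedness provides an infinite field, in which a nonzero polynomial has a
  non-root.\<close>

lemma sum_of_bool_mult:
  fixes f :: "'i \<Rightarrow> 'k::comm_semiring_1"
  assumes "finite K"
  shows "(\<Sum>k\<in>K. of_bool (a = k) * f k) = (if a \<in> K then f a else 0)"
    and "(\<Sum>k\<in>K. of_bool (k = a) * f k) = (if a \<in> K then f a else 0)"
    and "(\<Sum>k\<in>K. f k * of_bool (a = k)) = (if a \<in> K then f a else 0)"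
    and "(\<Sum>k\<in>K. f k * of_bool (k = a)) = (if a \<in> K then f a else 0)"
proof -
  have *: "(\<Sum>k\<in>K. of_bool (a = k) * f k) = (\<Sum>k\<in>K. if a = k then f k else 0)"
    by (intro sum.cong) auto
  show "(\<Sum>k\<in>K. of_bool (a = k) * f k) = (if a \<in> K then f a else 0)"
    unfolding * using assms by simp
  then show "(\<Sum>k\<in>K. of_bool (k = a) * f k) = (if a \<in> K then f a else 0)"
    "(\<Sum>k\<in>K. f k * of_bool (a = k)) = (if a \<in> K then f a else 0)"
    "(\<Sum>k\<in>K. f k * of_bool (k = a)) = (if a \<in> K then f a else 0)"
    by (simp_all only: mult.commute[of "f _"] eq_commute[of a])
qed

lemma sum_mult_assoc:
  fixes x :: "'i \<Rightarrow> 'k::comm_semiring_0"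
  shows "(\<Sum>k\<in>K. x k * (\<Sum>p\<in>P. y k p * z p)) = (\<Sum>p\<in>P. (\<Sum>k\<in>K. x k * y k p) * z p)"
  unfolding sum_distrib_left sum_distrib_right by (subst sum.swap) (simp add: mult.assoc)

text \<open>Induction on the rows gives \<open>X Y X = X\<close>. With \<open>E = 1 - Y X\<close>
  for the rows already treated, the columns of \<open>E\<close> are annihilated by those rows, and
  \<open>x\<close> is the residue of the new row. Later \<open>Y X\<close> serves as an idempotent
  whose image, acting on row vectors, is the row space of \<open>X\<close>.\<close>

lemma generalized_inverse:
  fixes X :: "'i \<Rightarrow> 'j \<Rightarrow> 'k::field"
  assumes "finite I" "finite J"
  shows "\<exists>Y. \<forall>i\<in>I. \<forall>j\<in>J. (\<Sum>j'\<in>J. X i j' * (\<Sum>i'\<in>I. Y j' i' * X i' j)) = X i j"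
  using assms(1)
proof induct
  case empty
  then show ?case by simp
next
  case (insert i0 I)
  then obtain Y where Y: "\<And>i j. i \<in> I \<Longrightarrow> j \<in> J \<Longrightarrow> (\<Sum>j'\<in>J. X i j' * (\<Sum>i'\<in>I. Y j' i' * X i' j)) = X i j"
    by blast
  define E where "E = (\<lambda>j j'. of_bool (j = j') - (\<Sum>i'\<in>I. Y j i' * X i' j'))"
  define x where "x = (\<lambda>j. \<Sum>j'\<in>J. X i0 j' * E j' j)"
  have XE: "(\<Sum>j'\<in>J. X i j' * E j' j) = X i j - (\<Sum>j'\<in>J. X i j' * (\<Sum>i'\<in>I. Y j' i' * X i' j))"
    if "j \<in> J" for i j
    using that assms(2) by (simp add: E_def right_diff_distrib sum_subtractf sum_of_bool_mult)
  have XE0: "(\<Sum>j'\<in>J. X i j' * E j' j) = 0" if "i \<in> I" "j \<in> J" for i j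
    using XE[of j i] Y[OF that] that by simp
  \<comment> \<open>Whatever \<open>q\<close> is, the new \<open>Y'\<close> satisfies
    \<open>Y' X = Y X + q x\<close>. The old rows need \<open>X q = 0\<close>; the new row lacks
    exactly \<open>x\<close>, so it needs \<open>(X i0 q) x = x\<close>.\<close>
  have step: "\<exists>Y'. \<forall>i\<in>insert i0 I. \<forall>j\<in>J. (\<Sum>j'\<in>J. X i j' * (\<Sum>i'\<in>insert i0 I. Y' j' i' * X i' j)) = X i j"
    if q: "\<And>i. i \<in> I \<Longrightarrow> (\<Sum>j\<in>J. X i j * q j) = 0"
      and q0: "\<And>j. j \<in> J \<Longrightarrow> (\<Sum>j\<in>J. X i0 j * q j) * x j = x j" for q
  proof -
    define a where "a = (\<lambda>i'. \<Sum>j'\<in>J. X i0 j' * Y j' i')"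
    define Y' where "Y' = (\<lambda>j i'. if i' = i0 then q j else Y j i' - q j * a i')"
    have x_eq: "x j = X i0 j - (\<Sum>i'\<in>I. a i' * X i' j)" if "j \<in> J" for j
    proof -
      have "(\<Sum>j'\<in>J. X i0 j' * (\<Sum>i'\<in>I. Y j' i' * X i' j)) = (\<Sum>i'\<in>I. a i' * X i' j)"
        unfolding a_def by (rule sum_mult_assoc)
      then show ?thesis using XE[OF that, of i0] by (simp add: x_def)
    qed
    have eq: "(\<Sum>j'\<in>J. X i j' * (\<Sum>i'\<in>insert i0 I. Y' j' i' * X i' j))
        = (\<Sum>j'\<in>J. X i j' * (\<Sum>i'\<in>I. Y j' i' * X i' j)) + (\<Sum>j'\<in>J. X i j' * q j') * x j"
      if "j \<in> J" for i j
    proof -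
      have "(\<Sum>i'\<in>insert i0 I. Y' j' i' * X i' j) = (\<Sum>i'\<in>I. Y j' i' * X i' j) + q j' * x j" for j'
      proof -
        have "(\<Sum>i'\<in>I. Y' j' i' * X i' j) = (\<Sum>i'\<in>I. Y j' i' * X i' j - q j' * (a i' * X i' j))"
          using insert by (intro sum.cong) (auto simp: Y'_def algebra_simps)
        then show ?thesis
          using insert by (simp add: x_eq[OF that] Y'_def sum_subtractf algebra_simps sum_distrib_left)
      qed
      then show ?thesis
        by (simp add: algebra_simps sum.distrib sum_distrib_left)
    qed
    show ?thesis
    proof (intro exI[of _ Y'] ballI)
      fix i j assume i: "i \<in> insert i0 I" and j: "j \<in> J"
      show "(\<Sum>j'\<in>J. X i j' * (\<Sum>i'\<in>insert i0 I. Y' j' i' * X i' j)) = X i j"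
      proof (cases "i = i0")
        case True
        have xj: "x j = X i0 j - (\<Sum>j'\<in>J. X i0 j' * (\<Sum>i'\<in>I. Y j' i' * X i' j))"
          using XE[OF j, of i0] by (simp add: x_def)
        then show ?thesis unfolding True eq[OF j] q0[OF j] unfolding xj by simp
      next
        case False
        then show ?thesis using eq[OF j, of i] q[of i] Y[of i j] i j by simp
      qed
    qed
  qed
  show ?case
  proof (cases "\<forall>j\<in>J. x j = 0")
    case True
    then show ?thesis using step[of "\<lambda>_. 0"] by simp
  next
    case False
    \<comment> \<open>A column of \<open>E\<close> is annihilated by the old rows; division by
      \<open>x j0\<close> makes its product with the new row 1.\<close>
    then obtain j0 where j0: "j0 \<in> J" "x j0 \<noteq> 0" by blast
    have "(\<Sum>j\<in>J. X i j * (E j j0 / x j0)) = (\<Sum>j\<in>J. X i j * E j j0) / x j0" for i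
      by (simp add: sum_divide_distrib)
    then show ?thesis
      using step[of "\<lambda>j. E j j0 / x j0"] XE0[OF _ j0(1)] j0 by (simp add: x_def)
  qed
qed

text \<open>If \<open>M Y M = M\<close>, the columns of \<open>Y M - 1\<close> lie in the kernel of
  \<open>M\<close>, so injectivity makes them vanish.\<close>

lemma left_inverse_of_injective:
  fixes M :: "'p \<Rightarrow> 'x \<Rightarrow> 'k::field"
  assumes "finite P" "finite K"
    and inj: "\<And>x. \<forall>p\<in>P. (\<Sum>k\<in>K. M p k * x k) = 0 \<Longrightarrow> \<forall>k\<in>K. x k = 0"
  obtains Y where "\<And>k k'. k \<in> K \<Longrightarrow> k' \<in> K \<Longrightarrow> (\<Sum>p\<in>P. Y k p * M p k') = of_bool (k = k')"
proof -
  obtain Y where Y: "\<And>p k. p \<in> P \<Longrightarrow> k \<in> K \<Longrightarrow> (\<Sum>k'\<in>K. M p k' * (\<Sum>p'\<in>P. Y k' p' * M p' k)) = M p k"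
    using generalized_inverse[OF assms(1,2), of M] by blast
  have "(\<Sum>p\<in>P. Y k p * M p k') = of_bool (k = k')" if "k \<in> K" "k' \<in> K" for k k'
  proof -
    have "\<forall>k\<in>K. (\<Sum>p\<in>P. Y k p * M p k') - of_bool (k = k') = 0"
      by (rule inj) (use Y[OF _ that(2)] that assms(1,2) in
        \<open>simp add: right_diff_distrib sum_subtractf sum_of_bool_mult\<close>)
    then show ?thesis using that by simp
  qed
  then show ?thesis using that by blast
qed

text \<open>With \<open>M Y M = M\<close>, every row of \<open>1 - M Y\<close> annihilates
  \<open>M\<close>. If all of these rows were zero, \<open>Y z\<close> would be a preimage of
  \<open>z\<close>.\<close>

lemma left_kernel_of_non_surjective:
  fixes M :: "'p \<Rightarrow> 'x \<Rightarrow> 'k::field"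
  assumes "finite P" "finite K"
    and nonsurj: "\<not> (\<exists>x. \<forall>p\<in>P. (\<Sum>k\<in>K. M p k * x k) = z p)"
  obtains y p0 where "p0 \<in> P" "y p0 \<noteq> 0" "\<And>k. k \<in> K \<Longrightarrow> (\<Sum>p\<in>P. y p * M p k) = 0"
proof -
  obtain Y where Y: "\<And>p k. p \<in> P \<Longrightarrow> k \<in> K \<Longrightarrow> (\<Sum>k'\<in>K. M p k' * (\<Sum>p'\<in>P. Y k' p' * M p' k)) = M p k"
    using generalized_inverse[OF assms(1,2), of M] by blast
  define y where "y = (\<lambda>p0 p. of_bool (p0 = p) - (\<Sum>k\<in>K. M p0 k * Y k p))"
  have yM: "(\<Sum>p\<in>P. y p0 p * M p k) = 0" if "p0 \<in> P" "k \<in> K" for p0 k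
  proof -
    have "(\<Sum>p\<in>P. (\<Sum>k\<in>K. M p0 k * Y k p) * M p k) = (\<Sum>k'\<in>K. M p0 k' * (\<Sum>p'\<in>P. Y k' p' * M p' k))"
      by (simp only: sum_mult_assoc)
    then show ?thesis
      using Y[OF that] that assms(1)
      by (simp add: y_def left_diff_distrib sum_subtractf sum_of_bool_mult)
  qed
  have "\<exists>p0\<in>P. \<exists>p\<in>P. y p0 p \<noteq> 0"
  proof (rule ccontr)
    assume *: "\<not> ?thesis"
    have "\<forall>p0\<in>P. (\<Sum>k\<in>K. M p0 k * (\<Sum>p\<in>P. Y k p * z p)) = z p0"
    proof
      fix p0 assume p0: "p0 \<in> P"
      have "(\<Sum>k\<in>K. M p0 k * (\<Sum>p\<in>P. Y k p * z p)) = (\<Sum>p\<in>P. (\<Sum>k\<in>K. M p0 k * Y k p) * z p)"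
        by (simp only: sum_mult_assoc)
      also have "\<dots> = (\<Sum>p\<in>P. of_bool (p0 = p) * z p)"
      proof (rule sum.cong[OF refl])
        fix p assume "p \<in> P"
        then have "y p0 p = 0" using * p0 by blast
        then show "(\<Sum>k\<in>K. M p0 k * Y k p) * z p = of_bool (p0 = p) * z p" by (simp add: y_def)
      qed
      also have "\<dots> = z p0" using p0 assms(1) by (simp add: sum_of_bool_mult)
      finally show "(\<Sum>k\<in>K. M p0 k * (\<Sum>p\<in>P. Y k p * z p)) = z p0" .
    qed
    then have "\<exists>x. \<forall>p\<in>P. (\<Sum>k\<in>K. M p k * x k) = z p"
      by (rule exI[of _ "\<lambda>k. \<Sum>p\<in>P. Y k p * z p"])
    with nonsurj show False ..
  qed
  with yM that show ?thesis by blast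
qed

lemma right_inverse_of_surjective:
  fixes M :: "'p \<Rightarrow> 'x \<Rightarrow> 'k::field"
  assumes "\<And>y. \<exists>x. \<forall>p\<in>P. (\<Sum>k\<in>K. M p k * x k) = y p"
  obtains Y where "\<And>p p'. p \<in> P \<Longrightarrow> p' \<in> P \<Longrightarrow> (\<Sum>k\<in>K. M p k * Y k p') = of_bool (p = p')"
proof -
  have "\<forall>p'. \<exists>x. \<forall>p\<in>P. (\<Sum>k\<in>K. M p k * x k) = of_bool (p = p')"
    by (rule allI, rule assms)
  then obtain Y where "\<forall>p'. \<forall>p\<in>P. (\<Sum>k\<in>K. M p k * Y p' k) = of_bool (p = p')"
    by metis
  then show ?thesis using that[of "\<lambda>k p'. Y p' k"] by blast
qed

text \<open>The matrix factors through the \<open>card P\<close> coordinates of \<open>P\<close>.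
  Were \<open>r\<close> larger, padding both factors with zeros to size \<open>r\<close> would give
  the second a zero row. This bounds the rank, so that a largest nonvanishing minor exists.\<close>

lemma det_product_nonzero_le_card:
  fixes A :: "nat \<Rightarrow> 'p \<Rightarrow> 'k::field"
  assumes "finite P" and nz: "det (mat r r (\<lambda>(a, b). \<Sum>p\<in>P. A a p * B p b)) \<noteq> 0"
  shows "r \<le> card P"
proof (rule ccontr)
  assume "\<not> ?thesis"
  then have n: "card P < r" by simp
  obtain h where h: "bij_betw h {..<card P} P"
    using ex_bij_betw_nat_finite[OF assms(1)] by (auto simp: atLeast0LessThan)
  define A' where "A' = mat r r (\<lambda>(a, c). if c < card P then A a (h c) else 0)"
  define B' where "B' = mat r r (\<lambda>(c, b). if c < card P then B (h c) b else 0)"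
  have "(\<Sum>p\<in>P. A a p * B p b) = (\<Sum>c = 0..<r. (if c < card P then A a (h c) else 0) * (if c < card P then B (h c) b else 0))" for a b
  proof -
    have "(\<Sum>p\<in>P. A a p * B p b) = (\<Sum>c<card P. A a (h c) * B (h c) b)"
      by (rule sum.reindex_bij_betw[OF h, symmetric])
    also have "\<dots> = (\<Sum>c = 0..<r. (if c < card P then A a (h c) else 0) * (if c < card P then B (h c) b else 0))"
      using n by (intro sum.mono_neutral_cong_left) auto
    finally show ?thesis .
  qed
  then have "mat r r (\<lambda>(a, b). \<Sum>p\<in>P. A a p * B p b) = A' * B'"
    by (intro eq_matI) (auto simp: A'_def B'_def scalar_prod_def)
  moreover have "det (A' * B') = det A' * det B'"
    by (rule det_mult[of _ r]) (auto simp: A'_def B'_def)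
  moreover have "det B' = (\<Sum>j<r. B' $$ (card P, j) * cofactor B' (card P) j)"
    using n by (intro laplace_expansion_row) (auto simp: B'_def)
  ultimately show False using nz n by (simp add: B'_def)
qed

lemma det_one_of_bool:
  assumes "inj_on h {..<r}" "\<And>a b. a < r \<Longrightarrow> b < r \<Longrightarrow> F a b = of_bool (h a = h b)"
  shows "det (mat r r (\<lambda>(a, b). F a b)) = (1::'k::field)"
proof -
  have "mat r r (\<lambda>(a, b). F a b) = 1\<^sub>m r"
    using assms by (intro eq_matI) (auto simp: inj_on_def)
  then show ?thesis by simp
qed

lemma right_inverse_le_card:
  fixes M :: "'p \<Rightarrow> 'x \<Rightarrow> 'k::field"
  assumes "finite P" "finite K"
    and "\<And>p p'. p \<in> P \<Longrightarrow> p' \<in> P \<Longrightarrow> (\<Sum>k\<in>K. M p k * Y k p') = of_bool (p = p')"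
  shows "card P \<le> card K"
proof -
  obtain h where h: "bij_betw h {..<card P} P"
    using ex_bij_betw_nat_finite[OF assms(1)] by (auto simp: atLeast0LessThan)
  have "det (mat (card P) (card P) (\<lambda>(a, b). \<Sum>k\<in>K. M (h a) k * Y k (h b))) = 1"
    using h by (intro det_one_of_bool[of h] assms(3)) (auto simp: bij_betw_def)
  then show ?thesis
    using det_product_nonzero_le_card[OF assms(2), of "card P" "\<lambda>a. M (h a)" "\<lambda>k b. Y k (h b)"] by simp
qed

lemma right_inverse_is_left_inverse:
  fixes M :: "'p \<Rightarrow> 'x \<Rightarrow> 'k::field"
  assumes fin: "finite P" "finite K" and card: "card P = card K"
    and MY: "\<And>p p'. p \<in> P \<Longrightarrow> p' \<in> P \<Longrightarrow> (\<Sum>k\<in>K. M p k * Y k p') = of_bool (p = p')"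
    and "k \<in> K" "k' \<in> K"
  shows "(\<Sum>p\<in>P. Y k p * M p k') = of_bool (k = k')"
proof -
  let ?n = "card P"
  obtain h where h: "bij_betw h {..<?n} P"
    using ex_bij_betw_nat_finite[OF fin(1)] by (auto simp: atLeast0LessThan)
  obtain h' where h': "bij_betw h' {..<?n} K"
    using ex_bij_betw_nat_finite[OF fin(2)] card by (auto simp: atLeast0LessThan)
  define A where "A = mat ?n ?n (\<lambda>(a, c). M (h a) (h' c))"
  define B where "B = mat ?n ?n (\<lambda>(c, b). Y (h' c) (h b))"
  have "A * B = 1\<^sub>m ?n"
  proof (rule eq_matI)
    fix a b assume ab: "a < dim_row (1\<^sub>m ?n)" "b < dim_col (1\<^sub>m ?n)"
    have "(\<Sum>c = 0..<?n. M (h a) (h' c) * Y (h' c) (h b)) = (\<Sum>k\<in>K. M (h a) k * Y k (h b))"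
      using sum.reindex_bij_betw[OF h', of "\<lambda>k. M (h a) k * Y k (h b)"] by (simp add: atLeast0LessThan)
    also have "\<dots> = of_bool (h a = h b)"
      using ab h by (intro MY) (auto simp: bij_betw_def)
    finally show "(A * B) $$ (a, b) = 1\<^sub>m ?n $$ (a, b)"
      using ab h by (auto simp: A_def B_def scalar_prod_def bij_betw_def inj_on_def)
  qed (auto simp: A_def B_def)
  then have BA: "B * A = 1\<^sub>m ?n"
    by (rule mat_mult_left_right_inverse[rotated 2]) (auto simp: A_def B_def)
  obtain c where c: "c < ?n" "h' c = k" using h' \<open>k \<in> K\<close> by (auto simp: bij_betw_def)
  obtain c' where c': "c' < ?n" "h' c' = k'" using h' \<open>k' \<in> K\<close> by (auto simp: bij_betw_def)
  have "(B * A) $$ (c, c') = (\<Sum>p\<in>P. Y k p * M p k')"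
    using c c' sum.reindex_bij_betw[OF h, of "\<lambda>p. Y k p * M p k'"]
    by (simp add: A_def B_def scalar_prod_def atLeast0LessThan)
  moreover have "(c = c') = (k = k')"
    using c c' h' by (auto simp: bij_betw_def inj_on_def)
  ultimately show ?thesis using BA c c' by (simp split: if_splits)
qed

text \<open>A right inverse shows that there are at most \<open>card K\<close> rows; with equality
  it is also a left inverse, and the kernel vanishes.\<close>

lemma surjective_not_injective_imp_less:
  fixes M :: "'p \<Rightarrow> 'x \<Rightarrow> 'k::field"
  assumes fin: "finite P" "finite K"
    and surj: "\<And>y. \<exists>x. \<forall>p\<in>P. (\<Sum>k\<in>K. M p k * x k) = y p"
    and ker: "\<forall>p\<in>P. (\<Sum>k\<in>K. M p k * x k) = 0" and k0: "k0 \<in> K" "x k0 \<noteq> 0"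
  shows "card P < card K"
proof (rule ccontr)
  assume *: "\<not> ?thesis"
  obtain Y where Y: "\<And>p p'. p \<in> P \<Longrightarrow> p' \<in> P \<Longrightarrow> (\<Sum>k\<in>K. M p k * Y k p') = of_bool (p = p')"
    using right_inverse_of_surjective[OF surj] by blast
  have "card P = card K" using right_inverse_le_card[OF fin Y] * by simp
  then have YM: "(\<Sum>p\<in>P. Y k p * M p k') = of_bool (k = k')" if "k \<in> K" "k' \<in> K" for k k'
    using right_inverse_is_left_inverse[OF fin _ Y] that by blast
  have "x k0 = (\<Sum>k\<in>K. of_bool (k0 = k) * x k)"
    using k0 fin by (simp add: sum_of_bool_mult)
  also have "\<dots> = (\<Sum>k\<in>K. (\<Sum>p\<in>P. Y k0 p * M p k) * x k)"
    using YM k0 by simp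
  also have "\<dots> = (\<Sum>p\<in>P. Y k0 p * (\<Sum>k\<in>K. M p k * x k))"
    by (simp only: sum_mult_assoc)
  also have "\<dots> = 0" using ker by simp
  finally show False using k0 by simp
qed

text \<open>Basis extension, with the dual basis carried along in \<open>Y\<close>. As long as
  \<open>d < card J\<close>, the matrix \<open>E = 1 - Y X\<close> is nonzero, since
  \<open>Y X = 1\<close> would bound \<open>card J\<close> by \<open>d\<close>. Its rows are killed
  by \<open>Y\<close> and its columns by \<open>X\<close>, so a nonzero entry yields a new row and a
  new column with product 1.\<close>

lemma extend_right_invertible:
  fixes X :: "nat \<Rightarrow> 'j \<Rightarrow> 'k::field"
  assumes "finite J" "d \<le> card J"
    and XY: "\<And>a b. a < d \<Longrightarrow> b < d \<Longrightarrow> (\<Sum>j\<in>J. X a j * Y j b) = of_bool (a = b)"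
  shows "\<exists>X' Y'. (\<forall>a<d. X' a = X a) \<and>
    (\<forall>a<card J. \<forall>b<card J. (\<Sum>j\<in>J. X' a j * Y' j b) = of_bool (a = b))"
  using assms(2,3)
proof (induct "card J - d" arbitrary: d X Y)
  case 0
  then show ?case by (intro exI[of _ X] exI[of _ Y]) auto
next
  case (Suc m)
  define E where "E = (\<lambda>j j'. of_bool (j = j') - (\<Sum>a<d. Y j a * X a j'))"
  have "\<exists>j\<in>J. \<exists>j'\<in>J. E j j' \<noteq> 0"
  proof (rule ccontr)
    assume "\<not> ?thesis"
    then have "card J \<le> card {..<d}"
      using assms(1) by (intro right_inverse_le_card[of _ _ Y X]) (auto simp: E_def)
    then show False using Suc by simp
  qed
  then obtain j0 j1 where j: "j0 \<in> J" "j1 \<in> J" "E j0 j1 \<noteq> 0" by blast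
  define x where "x = E j0"
  define q where "q = (\<lambda>j. E j j1 / E j0 j1)"
  define X' where "X' = (\<lambda>a. if a < d then X a else x)"
  define Y' where "Y' = (\<lambda>j b. if b < d then Y j b else q j)"
  have XE: "(\<Sum>j\<in>J. X a j * E j j') = 0" if "a < d" "j' \<in> J" for a j'
  proof -
    have "(\<Sum>j\<in>J. X a j * (\<Sum>b<d. Y j b * X b j')) = (\<Sum>b<d. (\<Sum>j\<in>J. X a j * Y j b) * X b j')"
      by (simp only: sum_mult_assoc)
    also have "\<dots> = (\<Sum>b<d. of_bool (a = b) * X b j')"
      using Suc(4) that by (intro sum.cong) auto
    also have "\<dots> = X a j'"
      using that by (simp add: sum_of_bool_mult)
    finally show ?thesis
      using that assms(1)
      by (simp add: E_def right_diff_distrib sum_subtractf sum_of_bool_mult)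
  qed
  have EY: "(\<Sum>j\<in>J. E j' j * Y j b) = 0" if "b < d" "j' \<in> J" for b j'
  proof -
    have "(\<Sum>j\<in>J. (\<Sum>a<d. Y j' a * X a j) * Y j b) = (\<Sum>a<d. Y j' a * (\<Sum>j\<in>J. X a j * Y j b))"
      by (simp only: sum_mult_assoc)
    also have "\<dots> = (\<Sum>a<d. Y j' a * of_bool (a = b))"
      using Suc(4) that by (intro sum.cong) auto
    also have "\<dots> = Y j' b"
      using that by (simp add: sum_of_bool_mult)
    finally show ?thesis
      using that assms(1)
      by (simp add: E_def left_diff_distrib sum_subtractf sum_of_bool_mult)
  qed
  \<comment> \<open>\<open>E\<close> is idempotent, so the product of its row \<open>j0\<close> with
    its column \<open>j1\<close> is the entry itself; this is why \<open>q\<close> divides by that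
    entry.\<close>
  have EE: "(\<Sum>j\<in>J. E j0 j * E j j1) = E j0 j1"
  proof -
    have "(\<Sum>j\<in>J. (\<Sum>a<d. Y j0 a * X a j) * E j j1) = (\<Sum>a<d. Y j0 a * (\<Sum>j\<in>J. X a j * E j j1))"
      by (simp only: sum_mult_assoc)
    also have "\<dots> = 0" using XE j by simp
    finally have "(\<Sum>j\<in>J. (of_bool (j0 = j) - (\<Sum>a<d. Y j0 a * X a j)) * E j j1) = E j0 j1"
      using j assms(1)
      by (simp add: left_diff_distrib sum_subtractf sum_of_bool_mult)
    then show ?thesis by (simp add: E_def)
  qed
  have 1: "m = card J - Suc d" and 2: "Suc d \<le> card J" using Suc by auto
  have 3: "(\<Sum>j\<in>J. X' a j * Y' j b) = of_bool (a = b)" if "a < Suc d" "b < Suc d" for a b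
  proof -
    have "(\<Sum>j\<in>J. x j * q j) = 1"
      using EE j by (simp add: x_def q_def flip: sum_divide_distrib)
    moreover have "(\<Sum>j\<in>J. X a j * q j) = 0" if "a < d"
      using XE[OF that j(2)] by (simp add: q_def flip: sum_divide_distrib)
    ultimately show ?thesis
      using that EY j Suc(4) by (cases "a = d"; cases "b = d") (auto simp: X'_def Y'_def x_def)
  qed
  obtain X'' Y'' where "\<forall>a<Suc d. X'' a = X' a"
    "\<forall>a<card J. \<forall>b<card J. (\<Sum>j\<in>J. X'' a j * Y'' j b) = of_bool (a = b)"
    using Suc(1)[OF 1 2 3] by blast
  then show ?case by (intro exI[of _ X''] exI[of _ Y'']) (auto simp: X'_def)
qed

lemma injective_if_det_nonzero:
  fixes M :: "'p \<Rightarrow> 'x \<Rightarrow> 'k::field"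
  assumes h: "bij_betw h {..<r} K"
    and nz: "det (mat r r (\<lambda>(a, b). \<Sum>p\<in>P. Y (h a) p * M p (h b))) \<noteq> 0"
    and ker: "\<forall>p\<in>P. (\<Sum>k\<in>K. M p k * x k) = 0" and "k \<in> K"
  shows "x k = 0"
proof (rule ccontr)
  assume xk: "x k \<noteq> 0"
  obtain c where c: "c < r" "h c = k" using h \<open>k \<in> K\<close> by (auto simp: bij_betw_def)
  let ?A = "mat r r (\<lambda>(a, b). \<Sum>p\<in>P. Y (h a) p * M p (h b))"
  have "vec r (\<lambda>b. x (h b)) \<noteq> 0\<^sub>v r"
  proof
    assume "vec r (\<lambda>b. x (h b)) = 0\<^sub>v r"
    then have "vec r (\<lambda>b. x (h b)) $ c = 0" using c by simp
    with c xk show False by simp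
  qed
  moreover have "?A *\<^sub>v vec r (\<lambda>b. x (h b)) = 0\<^sub>v r"
  proof (rule eq_vecI)
    fix a assume "a < dim_vec (0\<^sub>v r :: 'k vec)"
    then have "(?A *\<^sub>v vec r (\<lambda>b. x (h b))) $ a = (\<Sum>b<r. (\<Sum>p\<in>P. Y (h a) p * M p (h b)) * x (h b))"
      by (simp add: scalar_prod_def atLeast0LessThan)
    also have "\<dots> = (\<Sum>k\<in>K. (\<Sum>p\<in>P. Y (h a) p * M p k) * x k)"
      by (rule sum.reindex_bij_betw[OF h])
    also have "\<dots> = (\<Sum>p\<in>P. Y (h a) p * (\<Sum>k\<in>K. M p k * x k))"
      by (simp only: sum_mult_assoc)
    finally show "(?A *\<^sub>v vec r (\<lambda>b. x (h b))) $ a = 0\<^sub>v r $ a"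
      using ker \<open>a < _\<close> by simp
  qed simp
  ultimately have "det ?A = 0"
    by (subst det_0_iff_vec_prod_zero_field[of _ r]) (auto intro!: exI[of _ "vec r (\<lambda>b. x (h b))"])
  with nz show False by simp
qed

text \<open>The adjugate divided by the determinant inverts \<open>M Y\<close>, and \<open>Y\<close>
  times this inverse is a right inverse of \<open>M\<close>.\<close>

lemma surjective_if_det_nonzero:
  fixes M :: "'p \<Rightarrow> 'x \<Rightarrow> 'k::field"
  assumes h: "bij_betw h {..<r} P"
    and nz: "det (mat r r (\<lambda>(a, b). \<Sum>k\<in>K. M (h a) k * Y k (h b))) \<noteq> 0"
  shows "\<exists>x. \<forall>p\<in>P. (\<Sum>k\<in>K. M p k * x k) = y p"
proof -
  define A where "A = mat r r (\<lambda>(a, b). \<Sum>k\<in>K. M (h a) k * Y k (h b))"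
  define w where "w = (\<lambda>b c. adj_mat A $$ (b, c) / det A)"
  have A: "A \<in> carrier_mat r r" by (simp add: A_def)
  have w: "(\<Sum>b<r. (\<Sum>k\<in>K. M (h a) k * Y k (h b)) * w b c) = of_bool (a = c)" if "a < r" "c < r" for a c
  proof -
    have "(\<Sum>b<r. A $$ (a, b) * adj_mat A $$ (b, c)) = (A * adj_mat A) $$ (a, c)"
      using that A adj_mat(1)[OF A] by (auto simp: scalar_prod_def atLeast0LessThan)
    also have "\<dots> = det A * of_bool (a = c)"
      unfolding adj_mat(2)[OF A] using that by simp
    finally have "(\<Sum>b<r. A $$ (a, b) * adj_mat A $$ (b, c)) / det A = of_bool (a = c)"
      using nz by (simp add: A_def)
    then show ?thesis
      using that by (simp add: w_def sum_divide_distrib A_def)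
  qed
  define z where "z = (\<lambda>b. \<Sum>c<r. w b c * y (h c))"
  have "(\<Sum>k\<in>K. M p k * (\<Sum>b<r. Y k (h b) * z b)) = y p" if "p \<in> P" for p
  proof -
    obtain a where a: "a < r" "h a = p" using h \<open>p \<in> P\<close> by (auto simp: bij_betw_def)
    have "(\<Sum>k\<in>K. M p k * (\<Sum>b<r. Y k (h b) * z b))
        = (\<Sum>c<r. (\<Sum>b<r. (\<Sum>k\<in>K. M p k * Y k (h b)) * w b c) * y (h c))"
      unfolding sum_mult_assoc[of "M p"] z_def by (rule sum_mult_assoc)
    also have "\<dots> = (\<Sum>c<r. of_bool (a = c) * y (h c))"
      using w a by (intro sum.cong) auto
    finally show ?thesis using a by (simp add: sum_of_bool_mult)
  qed
  then show ?thesis by (intro exI[of _ "\<lambda>k. \<Sum>b<r. Y k (h b) * z b"] ballI)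
qed

section \<open>Polynomial functions of one variable\<close>

text \<open>Over a finite field the product of all \<open>x - a\<close>, plus 1, would be a
  nonconstant polynomial without a root.\<close>

lemma infinite_UNIV_alg_closed: "infinite (UNIV :: 'k::alg_closed_field set)"
proof
  assume fin: "finite (UNIV :: 'k set)"
  define p where "p = (\<Prod>a\<in>(UNIV :: 'k set). [:- a, 1:]) + 1"
  have ev: "poly p x = 1" for x
    using fin by (auto simp: p_def poly_prod prod_zero)
  have d: "degree (\<Prod>a\<in>(UNIV :: 'k set). [:- a, 1:]) = card (UNIV :: 'k set)"
    by (subst degree_prod_eq_sum_degree) auto
  have "card (UNIV :: 'k set) > 0"
    using fin by (simp add: card_gt_0_iff)
  then have "degree p > 0"
    using d unfolding p_def by (subst degree_add_eq_left) auto
  then obtain x where "poly p x = 0"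
    using alg_closed_imp_poly_has_root by blast
  with ev show False by simp
qed

text \<open>A predicate on functions instead of a polynomial object, so that determinants with
  entries depending on \<open>t\<close> are covered by closure rules.\<close>

definition polyfun :: "('k::comm_ring_1 \<Rightarrow> 'k) \<Rightarrow> bool"
  where "polyfun f \<longleftrightarrow> (\<exists>p. f = poly p)"

lemma polyfun_const: "polyfun (\<lambda>_. c)"
  unfolding polyfun_def by (rule exI[of _ "[:c:]"]) auto

lemma polyfun_id: "polyfun (\<lambda>t. t)"
  unfolding polyfun_def by (rule exI[of _ "[:0, 1:]"]) auto

lemma polyfun_add: "polyfun f \<Longrightarrow> polyfun g \<Longrightarrow> polyfun (\<lambda>t. f t + g t)"
proof -
  assume "polyfun f" "polyfun g"
  then obtain p q where "f = poly p" "g = poly q" by (auto simp: polyfun_def)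
  then have "(\<lambda>t. f t + g t) = poly (p + q)" by auto
  then show ?thesis by (auto simp: polyfun_def)
qed

lemma polyfun_mult: "polyfun f \<Longrightarrow> polyfun g \<Longrightarrow> polyfun (\<lambda>t. f t * g t)"
proof -
  assume "polyfun f" "polyfun g"
  then obtain p q where "f = poly p" "g = poly q" by (auto simp: polyfun_def)
  then have "(\<lambda>t. f t * g t) = poly (p * q)" by auto
  then show ?thesis by (auto simp: polyfun_def)
qed

lemma polyfun_sum: "(\<And>x. x \<in> X \<Longrightarrow> polyfun (f x)) \<Longrightarrow> polyfun (\<lambda>t. \<Sum>x\<in>X. f x t)"
  by (induct X rule: infinite_finite_induct) (auto intro: polyfun_const polyfun_add)

lemma polyfun_prod: "(\<And>x. x \<in> X \<Longrightarrow> polyfun (f x)) \<Longrightarrow> polyfun (\<lambda>t. \<Prod>x\<in>X. f x t)"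
  by (induct X rule: infinite_finite_induct) (auto intro: polyfun_const polyfun_mult)

lemma polyfun_det:
  assumes "\<And>a b. a < r \<Longrightarrow> b < r \<Longrightarrow> polyfun (f a b)"
  shows "polyfun (\<lambda>t. det (mat r r (\<lambda>(a, b). f a b t)))"
proof -
  have less: "p i < r" if "p permutes {0..<r}" "i < r" for p i
    using permutes_in_image[OF that(1), of i] that(2) by simp
  have eq: "(\<lambda>t. det (mat r r (\<lambda>(a, b). f a b t)))
      = (\<lambda>t. \<Sum>p\<in>{p. p permutes {0..<r}}. of_int (sign p) * (\<Prod>i = 0..<r. f i (p i) t))"
    by (intro ext, subst det_def'[of _ r])
      (auto intro!: sum.cong arg_cong[of _ _ "\<lambda>x. _ * x"] prod.cong simp: less)
  show ?thesis
    unfolding eq using assms by (intro polyfun_sum polyfun_mult polyfun_const polyfun_prod)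
      (auto simp: less)
qed

lemma polyfun_common_nonzero:
  fixes f g :: "'k::alg_closed_field \<Rightarrow> 'k"
  assumes "polyfun f" "polyfun g" "f a \<noteq> 0" "g b \<noteq> 0"
  obtains t where "t \<noteq> 0" "f t \<noteq> 0" "g t \<noteq> 0"
proof -
  obtain p q where pq: "f = poly p" "g = poly q" using assms by (auto simp: polyfun_def)
  \<comment> \<open>The points \<open>a\<close> and \<open>b\<close> serve as witnesses that the
    polynomials are nonzero and may differ; the factor \<open>[:0, 1:]\<close> excludes
    \<open>t = 0\<close>, which matters where \<open>x / t\<close> is formed.\<close>
  then have "[:0, 1:] * p * q \<noteq> 0" using assms by auto
  then have "finite {t. poly ([:0, 1:] * p * q) t = 0}" by (rule poly_roots_finite)
  then have "{t. poly ([:0, 1:] * p * q) t = 0} \<noteq> UNIV" using infinite_UNIV_alg_closed by metis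
  then obtain t where "poly ([:0, 1:] * p * q) t \<noteq> 0" by auto
  then show ?thesis using that pq by auto
qed

section \<open>Existence of a parameter of maximal rank\<close>

text \<open>A parameter whose matrix has the largest possible rank sends the kernel of its matrix, under any
  other parameter, into the image of its matrix; otherwise the rank would grow on the line joining
  the two parameters. The rank is measured by minors taken with respect to arbitrary row and
  column vectors.\<close>

lemma exists_max_rank_parameter:
  fixes M :: "('e \<Rightarrow> 'k::alg_closed_field) \<Rightarrow> 'p \<Rightarrow> 'x \<Rightarrow> 'k"
  assumes fin: "finite P" "finite K"
    and lin: "\<And>u u' t p k. M (\<lambda>e. u e + t * u' e) p k = M u p k + t * M u' p k"
    and good_line: "\<And>u u'. good u \<Longrightarrow> \<exists>F. polyfun F \<and> F 0 \<noteq> 0 \<and> (\<forall>t. F t \<noteq> 0 \<longrightarrow> good (\<lambda>e. u e + t * u' e))"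
    and good_ex: "\<exists>u. good u"
    and dichotomy: "\<And>x. (\<forall>y. \<exists>u. \<forall>p\<in>P. (\<Sum>k\<in>K. M u p k * x k) = y p) \<or>
      (\<forall>u. good u \<longrightarrow> (\<forall>p\<in>P. (\<Sum>k\<in>K. M u p k * x k) = 0) \<longrightarrow> (\<forall>k\<in>K. x k = 0))"
  obtains u where "good u"
    "(\<forall>x. (\<forall>p\<in>P. (\<Sum>k\<in>K. M u p k * x k) = 0) \<longrightarrow> (\<forall>k\<in>K. x k = 0)) \<or>
     (\<forall>y. \<exists>x. \<forall>p\<in>P. (\<Sum>k\<in>K. M u p k * x k) = y p)"
proof -
  define minor where "minor = (\<lambda>r \<alpha> \<kappa> u. det (mat r r (\<lambda>(a, b). \<Sum>p\<in>P. \<alpha> a p * (\<Sum>k\<in>K. M u p k * \<kappa> b k))))"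
  define Q where "Q = (\<lambda>r. \<exists>u \<alpha> \<kappa>. good u \<and> minor r \<alpha> \<kappa> u \<noteq> 0)"
  have "Q 0" using good_ex by (simp add: Q_def minor_def)
  moreover have "r \<le> card P" if Qr: "Q r" for r
  proof -
    obtain u \<alpha> \<kappa> where "minor r \<alpha> \<kappa> u \<noteq> 0" using Qr unfolding Q_def by blast
    then show ?thesis
      using det_product_nonzero_le_card[OF fin(1), of r \<alpha> "\<lambda>p b. \<Sum>k\<in>K. M u p k * \<kappa> b k"]
      by (simp add: minor_def)
  qed
  ultimately obtain r where r: "Q r" "\<And>r'. Q r' \<Longrightarrow> r' \<le> r"
    using GreatestI_nat[of Q 0 "card P"] Greatest_le_nat[of Q _ "card P"] by blast
  then obtain u \<alpha> \<kappa> where u: "good u" and nz: "minor r \<alpha> \<kappa> u \<noteq> 0" unfolding Q_def by blast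
  have "(\<forall>x. (\<forall>p\<in>P. (\<Sum>k\<in>K. M u p k * x k) = 0) \<longrightarrow> (\<forall>k\<in>K. x k = 0)) \<or>
     (\<forall>y. \<exists>x. \<forall>p\<in>P. (\<Sum>k\<in>K. M u p k * x k) = y p)"
  proof (rule ccontr)
    assume *: "\<not> ?thesis"
    then obtain x where x: "\<And>p. p \<in> P \<Longrightarrow> (\<Sum>k\<in>K. M u p k * x k) = 0" "\<not> (\<forall>k\<in>K. x k = 0)" by blast
    from * obtain z where z: "\<not> (\<exists>x. \<forall>p\<in>P. (\<Sum>k\<in>K. M u p k * x k) = z p)" by blast
    obtain y p0 where y: "p0 \<in> P" "y p0 \<noteq> 0" "\<And>k. k \<in> K \<Longrightarrow> (\<Sum>p\<in>P. y p * M u p k) = 0"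
      using left_kernel_of_non_surjective[OF fin z] by blast
    \<comment> \<open>\<open>u\<close> is good and \<open>x\<close> is a nonzero kernel vector of
      \<open>M u\<close>, so the second alternative fails at \<open>x\<close> and some
      \<open>u'\<close> sends \<open>x\<close> to the unit vector at \<open>p0\<close>. That vector
      lies outside the image of \<open>M u\<close>, because \<open>y\<close> annihilates the image
      and \<open>y p0\<close> is nonzero.\<close>
    obtain u' where u': "\<And>p. p \<in> P \<Longrightarrow> (\<Sum>k\<in>K. M u' p k * x k) = of_bool (p = p0)"
    proof -
      have "\<forall>y. \<exists>u. \<forall>p\<in>P. (\<Sum>k\<in>K. M u p k * x k) = y p"
        using dichotomy[of x] u x by auto
      then have "\<exists>u. \<forall>p\<in>P. (\<Sum>k\<in>K. M u p k * x k) = of_bool (p = p0)" by (rule spec)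
      then show ?thesis using that by blast
    qed
    have yux: "(\<Sum>p\<in>P. y p * (\<Sum>k\<in>K. M u' p k * x k)) = y p0"
      using u' y(1) fin by (simp add: sum_of_bool_mult)
    define ut where "ut = (\<lambda>t e. u e + t * u' e)"
    define \<alpha>' where "\<alpha>' = (\<lambda>a. if a < r then \<alpha> a else y)"
    \<comment> \<open>The last column vector is \<open>x / t\<close>: since
      \<open>M u x = 0\<close>, the parameter at \<open>t\<close> sends it to \<open>M u' x\<close>,
      independently of \<open>t\<close>. For \<open>t \<noteq> 0\<close> the enlarged minor thus
      equals \<open>det (E t)\<close>, which is a polynomial defined at \<open>t = 0\<close> as
      well.\<close>
    define \<kappa>' where "\<kappa>' = (\<lambda>t b k. if b < r then \<kappa> b k else x k / t)"
    define E where "E = (\<lambda>t. mat (Suc r) (Suc r) (\<lambda>(a, b). \<Sum>p\<in>P. \<alpha>' a p *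
      (if b < r then \<Sum>k\<in>K. (M u p k + t * M u' p k) * \<kappa> b k else \<Sum>k\<in>K. M u' p k * x k)))"
    have minor_E: "minor (Suc r) \<alpha>' (\<kappa>' t) (ut t) = det (E t)" if "t \<noteq> 0" for t
    proof -
      have "(\<Sum>k\<in>K. M (ut t) p k * (x k / t)) = (\<Sum>k\<in>K. M u' p k * x k)" if "p \<in> P" for p
      proof -
        have "(\<Sum>k\<in>K. M (ut t) p k * (x k / t)) = (\<Sum>k\<in>K. M u p k * x k) / t + (\<Sum>k\<in>K. M u' p k * x k)"
        proof -
          have "(M u p k + t * M u' p k) * (x k / t) = M u p k * x k / t + M u' p k * x k" for k
            using \<open>t \<noteq> 0\<close> by (simp add: field_simps)
          then show ?thesis
            unfolding ut_def lin by (simp add: sum.distrib sum_divide_distrib)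
        qed
        then show ?thesis using x(1)[OF that] by simp
      qed
      then show ?thesis
        unfolding minor_def E_def
        by (intro arg_cong[of _ _ det] eq_matI) (auto simp: \<kappa>'_def lin ut_def intro!: sum.cong)
    qed
    have "polyfun (\<lambda>t. if b < r then \<Sum>k\<in>K. (M u p k + t * M u' p k) * \<kappa> b k else \<Sum>k\<in>K. M u' p k * x k)" for b p
      by (cases "b < r") (auto intro!: polyfun_sum polyfun_mult polyfun_const polyfun_add polyfun_id)
    then have "polyfun (\<lambda>t. det (E t))"
      unfolding E_def by (intro polyfun_det polyfun_sum polyfun_mult polyfun_const)
    \<comment> \<open>At \<open>t = 0\<close> the last row is \<open>y\<close> applied to vectors of
      the image of \<open>M u\<close>, hence zero except for the corner \<open>y p0\<close>;
      expansion along it leaves the old minor.\<close>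
    moreover have "det (E 0) \<noteq> 0"
    proof -
      have "E 0 \<in> carrier_mat (Suc r) (Suc r)" by (simp add: E_def)
      then have "det (E 0) = (\<Sum>j<Suc r. E 0 $$ (r, j) * cofactor (E 0) r j)"
        by (rule laplace_expansion_row) simp
      also have "\<dots> = (\<Sum>j<r. E 0 $$ (r, j) * cofactor (E 0) r j) + y p0 * cofactor (E 0) r r"
        using yux by (simp add: E_def \<alpha>'_def)
      also have "(\<Sum>j<r. E 0 $$ (r, j) * cofactor (E 0) r j) = 0"
      proof (rule sum.neutral, rule ballI)
        fix j assume "j \<in> {..<r}"
        then have "E 0 $$ (r, j) = (\<Sum>p\<in>P. y p * (\<Sum>k\<in>K. M u p k * \<kappa> j k))"
          by (simp add: E_def \<alpha>'_def)
        also have "\<dots> = 0" using y(3) by (simp add: sum_mult_assoc)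
        finally show "E 0 $$ (r, j) * cofactor (E 0) r j = 0" by simp
      qed
      also have "cofactor (E 0) r r = minor r \<alpha> \<kappa> u"
        unfolding cofactor_def minor_def mat_delete_def
        by (auto simp: E_def \<alpha>'_def intro!: arg_cong[of _ _ det] eq_matI)
      finally show ?thesis using nz y(2) by simp
    qed
    moreover obtain F where "polyfun F" "F 0 \<noteq> 0" "\<And>t. F t \<noteq> 0 \<Longrightarrow> good (ut t)"
    proof -
      obtain F where "polyfun F" "F 0 \<noteq> 0" "\<forall>t. F t \<noteq> 0 \<longrightarrow> good (\<lambda>e. u e + t * u' e)"
        using good_line[OF u, of u'] by (elim exE conjE)
      then show ?thesis by (intro that[of F]) (auto simp: ut_def)
    qed
    ultimately obtain t where t: "t \<noteq> 0" "det (E t) \<noteq> 0" "good (ut t)"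
      using polyfun_common_nonzero[of "\<lambda>t. det (E t)" F 0 0] by metis
    have "minor (Suc r) \<alpha>' (\<kappa>' t) (ut t) \<noteq> 0" using t minor_E by simp
    then have "Q (Suc r)" using t(3) unfolding Q_def by (intro exI conjI)
    then show False using r(2) by fastforce
  qed
  from that[OF u this] show ?thesis .
qed

section \<open>Coordinates on vector spaces\<close>

locale kspace = vectorspace class_ring M for M :: "('k::field, 'v, 'z) module_scheme" (structure)
begin

lemma smult_simps [simp]:
  "x \<in> carrier M \<Longrightarrow> 1 \<odot> x = x"
  "x \<in> carrier M \<Longrightarrow> 0 \<odot> x = \<zero>"
  "c \<odot> \<zero> = \<zero>"
  "x \<in> carrier M \<Longrightarrow> c \<odot> x \<in> carrier M"
  using smult_one[of x] lmult_0[of x] rmult_0[of c] smult_closed[of c x] by simp_all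

lemma smult_assoc: "x \<in> carrier M \<Longrightarrow> (a * b) \<odot> x = a \<odot> (b \<odot> x)"
  using smult_assoc1[of a b x] by simp

lemma smult_add_left: "x \<in> carrier M \<Longrightarrow> (a + b) \<odot> x = a \<odot> x \<oplus> b \<odot> x"
  using smult_l_distr[of a b x] by simp

lemma smult_add_right: "x \<in> carrier M \<Longrightarrow> y \<in> carrier M \<Longrightarrow> a \<odot> (x \<oplus> y) = a \<odot> x \<oplus> a \<odot> y"
  using smult_r_distr[of a x y] by simp

lemma smult_minus: "x \<in> carrier M \<Longrightarrow> (- 1) \<odot> x = \<ominus> x"
  using smult_minus_1[of x] by (simp add: class_ring_simps)

lemma minus_conv: "x \<in> carrier M \<Longrightarrow> y \<in> carrier M \<Longrightarrow> x \<ominus> y = x \<oplus> (- 1) \<odot> y"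
  by (simp add: smult_minus a_minus_def)

lemma minus_eq_zero_iff: "x \<in> carrier M \<Longrightarrow> y \<in> carrier M \<Longrightarrow> x \<ominus> y = \<zero> \<longleftrightarrow> x = y"
  by (rule M.minus_other_side)

end

lemma subspace_iff:
  assumes "vectorspace class_ring M"
  shows "VectorSpace.subspace class_ring U M \<longleftrightarrow> U \<subseteq> carrier M \<and> \<zero>\<^bsub>M\<^esub> \<in> U \<and>
    (\<forall>x\<in>U. \<forall>y\<in>U. x \<oplus>\<^bsub>M\<^esub> y \<in> U) \<and> (\<forall>c. \<forall>x\<in>U. c \<odot>\<^bsub>M\<^esub> x \<in> U)"
proof -
  have "Module.module class_ring M" using assms by (simp add: vectorspace_def)
  then show ?thesis
    using assms unfolding VectorSpace.subspace_def submodule_def by auto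
qed

lemma kspaceI:
  assumes "\<zero>\<^bsub>M\<^esub> \<in> carrier M"
    and "\<And>x y. x \<in> carrier M \<Longrightarrow> y \<in> carrier M \<Longrightarrow> x \<oplus>\<^bsub>M\<^esub> y \<in> carrier M"
    and "\<And>c x. x \<in> carrier M \<Longrightarrow> c \<odot>\<^bsub>M\<^esub> x \<in> carrier M"
    and "\<And>x y. x \<in> carrier M \<Longrightarrow> y \<in> carrier M \<Longrightarrow> x \<oplus>\<^bsub>M\<^esub> y = y \<oplus>\<^bsub>M\<^esub> x"
    and "\<And>x y z. x \<in> carrier M \<Longrightarrow> y \<in> carrier M \<Longrightarrow> z \<in> carrier M \<Longrightarrow>
      x \<oplus>\<^bsub>M\<^esub> y \<oplus>\<^bsub>M\<^esub> z = x \<oplus>\<^bsub>M\<^esub> (y \<oplus>\<^bsub>M\<^esub> z)"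
    and "\<And>x. x \<in> carrier M \<Longrightarrow> x \<oplus>\<^bsub>M\<^esub> \<zero>\<^bsub>M\<^esub> = x"
    and "\<And>a b x. x \<in> carrier M \<Longrightarrow> (a * b) \<odot>\<^bsub>M\<^esub> x = a \<odot>\<^bsub>M\<^esub> (b \<odot>\<^bsub>M\<^esub> x)"
    and "\<And>x. x \<in> carrier M \<Longrightarrow> 1 \<odot>\<^bsub>M\<^esub> x = x"
    and "\<And>x. x \<in> carrier M \<Longrightarrow> 0 \<odot>\<^bsub>M\<^esub> x = \<zero>\<^bsub>M\<^esub>"
    and "\<And>a b x. x \<in> carrier M \<Longrightarrow> (a + b) \<odot>\<^bsub>M\<^esub> x = a \<odot>\<^bsub>M\<^esub> x \<oplus>\<^bsub>M\<^esub> b \<odot>\<^bsub>M\<^esub> x"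
    and "\<And>a x y. x \<in> carrier M \<Longrightarrow> y \<in> carrier M \<Longrightarrow>
      a \<odot>\<^bsub>M\<^esub> (x \<oplus>\<^bsub>M\<^esub> y) = a \<odot>\<^bsub>M\<^esub> x \<oplus>\<^bsub>M\<^esub> a \<odot>\<^bsub>M\<^esub> y"
  shows "kspace (M :: ('k::field, 'v, 'z) module_scheme)"
proof -
  have neg: "\<exists>y\<in>carrier M. x \<oplus>\<^bsub>M\<^esub> y = \<zero>\<^bsub>M\<^esub>" if "x \<in> carrier M" for x
    using that assms(3)[of x "- 1"] assms(8)[of x] assms(9)[of x] assms(10)[of x 1 "- 1"]
    by (intro bexI[of _ "(- 1) \<odot>\<^bsub>M\<^esub> x"]) auto
  have "vectorspace class_ring M"
    by (rule vs_criteria) (use assms neg in \<open>auto simp: class_field\<close>)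
  then show ?thesis by (simp add: kspace_def)
qed

lemma kspace_subspace:
  assumes "kspace M" "VectorSpace.subspace class_ring U M"
  shows "kspace (M\<lparr>carrier := U\<rparr>)"
proof -
  interpret kspace M by fact
  show ?thesis using subspace_is_vs[OF assms(2)] by (simp add: kspace_def)
qed

section \<open>Linear maps, functionals and dual bases\<close>

abbreviation khom :: "('k::field, 'v, 'y) module_scheme \<Rightarrow> ('k, 'w, 'z) module_scheme \<Rightarrow> ('v \<Rightarrow> 'w) set"
  where "khom M N \<equiv> LinearCombinations.module_hom class_ring M N"

lemma khom_iff: "h \<in> khom M N \<longleftrightarrow> (\<forall>x\<in>carrier M. h x \<in> carrier N) \<and>
    (\<forall>x\<in>carrier M. \<forall>y\<in>carrier M. h (x \<oplus>\<^bsub>M\<^esub> y) = h x \<oplus>\<^bsub>N\<^esub> h y) \<and>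
    (\<forall>c. \<forall>x\<in>carrier M. h (c \<odot>\<^bsub>M\<^esub> x) = c \<odot>\<^bsub>N\<^esub> h x)"
  by (auto simp: LinearCombinations.module_hom_def)

text \<open>Values lie in the type \<open>'k\<close> itself, so that their sums are ordinary sums;
  \<open>functional_iff\<close> gives the link to maps into \<open>scalar_space\<close>.\<close>

definition functional :: "('k::field, 'v, 'z) module_scheme \<Rightarrow> ('v \<Rightarrow> 'k) \<Rightarrow> bool"
  where "functional M \<phi> \<longleftrightarrow> (\<forall>x\<in>carrier M. \<forall>y\<in>carrier M. \<phi> (x \<oplus>\<^bsub>M\<^esub> y) = \<phi> x + \<phi> y) \<and>
    (\<forall>c. \<forall>x\<in>carrier M. \<phi> (c \<odot>\<^bsub>M\<^esub> x) = c * \<phi> x)"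

lemma functional_iff: "functional M \<phi> \<longleftrightarrow> \<phi> \<in> khom M scalar_space"
  by (auto simp: functional_def khom_iff scalar_space_def)

lemma functional_add: "functional M \<phi> \<Longrightarrow> x \<in> carrier M \<Longrightarrow> y \<in> carrier M \<Longrightarrow> \<phi> (x \<oplus>\<^bsub>M\<^esub> y) = \<phi> x + \<phi> y"
  and functional_smult: "functional M \<phi> \<Longrightarrow> x \<in> carrier M \<Longrightarrow> \<phi> (c \<odot>\<^bsub>M\<^esub> x) = c * \<phi> x"
  by (auto simp: functional_def)

lemma functional_sum:
  "(\<And>i. i \<in> I \<Longrightarrow> functional M (\<phi> i)) \<Longrightarrow> functional M (\<lambda>x. \<Sum>i\<in>I. c i * \<phi> i x)"
  by (auto simp: functional_def sum_distrib_left distrib_left sum.distrib mult.left_commute intro!: sum.cong)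

lemma functional_lin: "functional M \<phi> \<Longrightarrow> functional M \<psi> \<Longrightarrow> functional M (\<lambda>x. a * \<phi> x + b * \<psi> x)"
  by (auto simp: functional_def algebra_simps)

lemma functional_comp:
  "functional N \<phi> \<Longrightarrow> h \<in> khom M N \<Longrightarrow> functional M (\<lambda>x. \<phi> (h x))"
  by (auto simp: functional_def khom_iff)

lemma functional_subset: "functional M \<phi> \<Longrightarrow> U \<subseteq> carrier M \<Longrightarrow> functional (M\<lparr>carrier := U\<rparr>) \<phi>"
  by (auto simp: functional_def subset_eq)

text \<open>Indexed by a family, whereas \<open>lincomb\<close> runs over a set of vectors: entries
  may repeat, and rows of matrices can serve as coefficients.\<close>

definition comb :: "('k::field, 'v, 'z) module_scheme \<Rightarrow> 'j set \<Rightarrow> ('j \<Rightarrow> 'k) \<Rightarrow> ('j \<Rightarrow> 'v) \<Rightarrow> 'v"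
  where "comb M J s v = finsum M (\<lambda>j. s j \<odot>\<^bsub>M\<^esub> v j) J"

context kspace
begin

lemma functional_zero: "functional M \<phi> \<Longrightarrow> \<phi> \<zero> = 0"
  using functional_smult[of M \<phi> \<zero> 0] by simp

lemma functional_minus: "functional M \<phi> \<Longrightarrow> x \<in> carrier M \<Longrightarrow> y \<in> carrier M \<Longrightarrow> \<phi> (x \<ominus> y) = \<phi> x - \<phi> y"
  by (simp add: minus_conv functional_add functional_smult)

lemma comb_closed [simp]: "(\<And>j. j \<in> J \<Longrightarrow> v j \<in> carrier M) \<Longrightarrow> comb M J s v \<in> carrier M"
  by (auto simp: comb_def)

lemma functional_comb:
  assumes "functional M \<phi>" "\<And>j. j \<in> J \<Longrightarrow> v j \<in> carrier M"
  shows "\<phi> (comb M J s v) = (\<Sum>j\<in>J. s j * \<phi> (v j))"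
  using assms(2)
proof (induct J rule: infinite_finite_induct)
  case (insert j J)
  then have "comb M (insert j J) s v = s j \<odot> v j \<oplus> comb M J s v"
    unfolding comb_def by (intro finsum_insert) auto
  then show ?case
    using insert by (simp add: functional_add[OF assms(1)] functional_smult[OF assms(1)])
qed (auto simp: comb_def functional_zero[OF assms(1)])

lemma comb_in_subspace:
  assumes U: "VectorSpace.subspace class_ring U M" and "\<And>j. j \<in> J \<Longrightarrow> v j \<in> U"
  shows "comb M J s v \<in> U"
proof -
  have U': "U \<subseteq> carrier M" "\<zero> \<in> U" "\<And>x y. x \<in> U \<Longrightarrow> y \<in> U \<Longrightarrow> x \<oplus> y \<in> U" "\<And>c x. x \<in> U \<Longrightarrow> c \<odot> x \<in> U"
    using U subspace_iff[OF vectorspace_axioms] by auto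
  show ?thesis using assms(2)
  proof (induct J rule: infinite_finite_induct)
    case (insert j J)
    then have "comb M (insert j J) s v = s j \<odot> v j \<oplus> comb M J s v"
      unfolding comb_def using U' by (intro finsum_insert) (auto simp: subset_eq)
    then show ?case using insert U' by simp
  qed (auto simp: comb_def U')
qed

lemma comb_cong:
  "(\<And>j. j \<in> J \<Longrightarrow> s j \<odot> v j = s' j \<odot> v' j) \<Longrightarrow> (\<And>j. j \<in> J \<Longrightarrow> v j \<in> carrier M) \<Longrightarrow>
    (\<And>j. j \<in> J \<Longrightarrow> v' j \<in> carrier M) \<Longrightarrow> comb M J s v = comb M J s' v'"
  unfolding comb_def by (intro finsum_cong') auto

lemma comb_lincomb:
  assumes "inj_on e I" "e ` I \<subseteq> carrier M"
  shows "comb M I s e = lincomb (\<lambda>v. s (the_inv_into I e v)) (e ` I)"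
  unfolding comb_def lincomb_def using assms
  by (subst finsum_reindex) (auto simp: the_inv_into_f_f image_subset_iff Pi_iff intro!: finsum_cong')

end

lemma hom_comb:
  assumes "kspace M" "kspace N" and h: "h \<in> khom M N"
    and v: "\<And>j. j \<in> J \<Longrightarrow> v j \<in> carrier M"
  shows "h (comb M J s v) = comb N J s (\<lambda>j. h (v j))"
proof -
  interpret M: kspace M by fact
  interpret N: kspace N by fact
  interpret mod_hom class_ring M N h by (unfold_locales, rule h)
  show ?thesis using v
  proof (induct J rule: infinite_finite_induct)
    case (insert j J)
    then have "comb M (insert j J) s v = s j \<odot>\<^bsub>M\<^esub> v j \<oplus>\<^bsub>M\<^esub> comb M J s v"
      unfolding comb_def by (intro M.finsum_insert) auto
    moreover have "comb N (insert j J) s (\<lambda>j. h (v j)) = s j \<odot>\<^bsub>N\<^esub> h (v j) \<oplus>\<^bsub>N\<^esub> comb N J s (\<lambda>j. h (v j))"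
      unfolding comb_def using insert by (intro N.finsum_insert) auto
    ultimately show ?case using insert by simp
  qed (auto simp: comb_def)
qed

text \<open>A finite basis with its coordinate functionals. Spanning is encoded as separation: a
  vector on which all \<open>\<xi> a\<close> vanish is zero.\<close>

definition dual_basis ::
    "('k::field, 'v, 'z) module_scheme \<Rightarrow> 'i set \<Rightarrow> ('i \<Rightarrow> 'v) \<Rightarrow> ('i \<Rightarrow> 'v \<Rightarrow> 'k) \<Rightarrow> bool"
  where "dual_basis M I e \<xi> \<longleftrightarrow> finite I \<and> (\<forall>a\<in>I. e a \<in> carrier M \<and> functional M (\<xi> a)) \<and>
    (\<forall>a\<in>I. \<forall>b\<in>I. \<xi> a (e b) = of_bool (a = b)) \<and>
    (\<forall>x\<in>carrier M. (\<forall>a\<in>I. \<xi> a x = 0) \<longrightarrow> x = \<zero>\<^bsub>M\<^esub>)"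

lemma dual_basisD:
  assumes "dual_basis M I e \<xi>"
  shows "finite I" "a \<in> I \<Longrightarrow> e a \<in> carrier M" "a \<in> I \<Longrightarrow> functional M (\<xi> a)"
    "a \<in> I \<Longrightarrow> b \<in> I \<Longrightarrow> \<xi> a (e b) = of_bool (a = b)"
    "x \<in> carrier M \<Longrightarrow> (\<And>a. a \<in> I \<Longrightarrow> \<xi> a x = 0) \<Longrightarrow> x = \<zero>\<^bsub>M\<^esub>"
  using assms unfolding dual_basis_def by auto

context kspace
begin

context
  fixes I :: "'i set" and e \<xi> assumes db: "dual_basis M I e \<xi>"
begin

lemma dual_basis_eqI:
  assumes "x \<in> carrier M" "y \<in> carrier M" "\<And>a. a \<in> I \<Longrightarrow> \<xi> a x = \<xi> a y"
  shows "x = y"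
proof -
  have "x \<ominus> y = \<zero>"
    using assms by (intro dual_basisD(5)[OF db]) (auto simp: functional_minus dual_basisD(3)[OF db])
  then show ?thesis using assms minus_eq_zero_iff by blast
qed

lemma dual_basis_comb: "a \<in> I \<Longrightarrow> \<xi> a (comb M I s e) = s a"
  using db by (subst functional_comb) (auto simp: dual_basisD sum_of_bool_mult)

lemma dual_basis_expand: "x \<in> carrier M \<Longrightarrow> comb M I (\<lambda>a. \<xi> a x) e = x"
  by (rule dual_basis_eqI) (auto simp: dual_basis_comb dual_basisD[OF db])

lemma functional_expand:
  assumes "functional M \<phi>" "x \<in> carrier M"
  shows "\<phi> x = (\<Sum>a\<in>I. \<xi> a x * \<phi> (e a))"
  using functional_comb[OF assms(1), of I e "\<lambda>a. \<xi> a x"] dual_basis_expand[OF assms(2)] dual_basisD(2)[OF db]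
  by simp

lemma dual_basis_inj: "inj_on e I"
proof (rule inj_onI)
  fix a b assume "a \<in> I" "b \<in> I" "e a = e b"
  then have "of_bool (a = b) = (1::'k)" using dual_basisD(4)[OF db, of a b] dual_basisD(4)[OF db, of a a] by simp
  then show "a = b" by simp
qed

lemma dual_basis_basis: "basis (e ` I)"
proof -
  have fin: "finite (e ` I)" and sub: "e ` I \<subseteq> carrier M"
    using dual_basisD[OF db] by auto
  note inv = the_inv_into_f_f[OF dual_basis_inj]
  have comb: "lincomb a (e ` I) = comb M I (\<lambda>i. a (e i)) e" for a
    unfolding comb_lincomb[OF dual_basis_inj sub] using sub
    by (intro lincomb_cong) (auto simp: inv)
  have "\<exists>!a. a \<in> e ` I \<rightarrow>\<^sub>E carrier class_ring \<and> lincomb a (e ` I) = v" if v: "v \<in> carrier M" for v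
  proof (rule ex1I[of _ "\<lambda>w\<in>e ` I. \<xi> (the_inv_into I e w) v"])
    have "lincomb (\<lambda>w\<in>e ` I. \<xi> (the_inv_into I e w) v) (e ` I) = comb M I (\<lambda>a. \<xi> a v) e"
      unfolding comb using dual_basisD[OF db] by (intro comb_cong) (auto simp: inv)
    then show "(\<lambda>w\<in>e ` I. \<xi> (the_inv_into I e w) v) \<in> e ` I \<rightarrow>\<^sub>E carrier class_ring \<and>
        lincomb (\<lambda>w\<in>e ` I. \<xi> (the_inv_into I e w) v) (e ` I) = v"
      using v by (simp add: dual_basis_expand)
  next
    fix a assume a: "a \<in> e ` I \<rightarrow>\<^sub>E carrier class_ring \<and> lincomb a (e ` I) = v"
    then have "\<xi> i v = a (e i)" if "i \<in> I" for i
      using dual_basis_comb[OF that, of "\<lambda>i. a (e i)"] comb by simp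
    with a show "a = (\<lambda>w\<in>e ` I. \<xi> (the_inv_into I e w) v)"
      by (auto simp: fun_eq_iff inv PiE_def extensional_def)
  qed
  then show ?thesis unfolding basis_criterion[OF fin sub] by (intro allI impI)
qed

lemma dual_basis_dim: "dim = card I"
  using dim_basis[OF _ dual_basis_basis] dual_basisD(1)[OF db] card_image[OF dual_basis_inj] by simp

lemma dual_basis_fin_dim: "fin_dim"
  using dual_basis_basis dual_basisD(1)[OF db] unfolding fin_dim_def basis_def by blast

end

lemma basis_dual_basis:
  assumes fin: "finite I" and inj: "inj_on e I" and basis: "basis (e ` I)"
  shows "\<exists>\<xi>. dual_basis M I e \<xi>"
proof -
  have sub: "e ` I \<subseteq> carrier M" using basis by (simp add: basis_def)
  note inv = the_inv_into_f_f[OF inj]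
  have comb: "lincomb a (e ` I) = comb M I (\<lambda>i. a (e i)) e" for a
    unfolding comb_lincomb[OF inj sub] using sub by (intro lincomb_cong) (auto simp: inv)
  have comb': "comb M I s e = lincomb (\<lambda>w\<in>e ` I. s (the_inv_into I e w)) (e ` I)" for s
    unfolding comb using sub by (intro comb_cong) (auto simp: inv)
  have ex1: "\<exists>!a. a \<in> e ` I \<rightarrow>\<^sub>E UNIV \<and> lincomb a (e ` I) = v" if "v \<in> carrier M" for v
    using basis that basis_criterion[OF finite_imageI[OF fin] sub] by simp
  have uniq: "s i = s' i" if "comb M I s e = comb M I s' e" "i \<in> I" for s s' i
  proof -
    have "comb M I s e \<in> carrier M" using sub by (intro comb_closed) auto
    from ex1[OF this] have "(\<lambda>w\<in>e ` I. s (the_inv_into I e w)) = (\<lambda>w\<in>e ` I. s' (the_inv_into I e w))"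
      using that(1) comb'[of s] comb'[of s'] by (metis (no_types, lifting) PiE_restrict UNIV_I restrict_PiE_iff)
    then have "(\<lambda>w\<in>e ` I. s (the_inv_into I e w)) (e i) = (\<lambda>w\<in>e ` I. s' (the_inv_into I e w)) (e i)" by simp
    then show ?thesis using that(2) by (simp add: inv)
  qed
  have "\<exists>s. v = comb M I s e" if "v \<in> carrier M" for v
    using ex1[OF that] comb by metis
  then obtain s where s: "\<And>v. v \<in> carrier M \<Longrightarrow> v = comb M I (s v) e" by metis
  have add: "comb M I (\<lambda>i. a i + b i) e = comb M I a e \<oplus> comb M I b e" for a b
    unfolding comb_def using sub
    by (subst finsum_addf[symmetric]) (auto intro!: finsum_cong' simp: smult_add_left)
  have smult: "comb M I (\<lambda>i. c * a i) e = c \<odot> comb M I a e" for a c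
    unfolding comb_def using sub fin
    by (subst finsum_smult) (auto intro!: finsum_cong' simp: smult_assoc)
  have "dual_basis M I e (\<lambda>i v. s v i)"
    unfolding dual_basis_def functional_def
  proof (intro conjI ballI allI impI fin)
    show "e a \<in> carrier M" if "a \<in> I" for a using sub that by auto
    show "s (x \<oplus> y) a = s x a + s y a" if "a \<in> I" "x \<in> carrier M" "y \<in> carrier M" for a x y
    proof (rule uniq[OF _ that(1)])
      show "comb M I (s (x \<oplus> y)) e = comb M I (\<lambda>i. s x i + s y i) e"
        unfolding add using that s by (metis a_closed)
    qed
    show "s (c \<odot> x) a = c * s x a" if "a \<in> I" "x \<in> carrier M" for a c x
    proof (rule uniq[OF _ that(1)])
      show "comb M I (s (c \<odot> x)) e = comb M I (\<lambda>i. c * s x i) e"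
        unfolding smult using that s by (metis smult_simps(4))
    qed
    show "s (e b) a = of_bool (a = b)" if "a \<in> I" "b \<in> I" for a b
    proof (rule uniq[OF _ that(1)])
      have "comb M I (\<lambda>i. of_bool (i = b)) e = (\<Oplus>i\<in>I. if b = i then e i else \<zero>)"
        unfolding comb_def using sub by (intro finsum_cong') auto
      also have "\<dots> = e b" using that sub fin by (intro finsum_singleton) auto
      finally show "comb M I (s (e b)) e = comb M I (\<lambda>i. of_bool (i = b)) e"
        using s[of "e b"] that sub by auto
    qed
    show "x = \<zero>" if "x \<in> carrier M" "\<forall>a\<in>I. s x a = 0" for x
    proof -
      have "comb M I (s x) e = (\<Oplus>i\<in>I. \<zero>)"
        unfolding comb_def using sub that by (intro finsum_cong') auto
      then show ?thesis using s[OF that(1)] by simp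
    qed
  qed
  then show ?thesis by blast
qed

lemma dual_basis_exists:
  assumes "fin_dim"
  shows "\<exists>e \<xi>. dual_basis M {..<dim} e \<xi>"
proof -
  obtain \<beta> where \<beta>: "finite \<beta>" "basis \<beta>" using finite_basis_exists[OF assms] by blast
  then have "dim = card \<beta>" by (rule dim_basis)
  then obtain e where "bij_betw e {..<dim} \<beta>"
    using ex_bij_betw_nat_finite[OF \<beta>(1)] by (auto simp: atLeast0LessThan)
  then have "inj_on e {..<dim}" "basis (e ` {..<dim})" using \<beta> by (auto simp: bij_betw_def)
  then show ?thesis using basis_dual_basis[of "{..<dim}" e] by auto
qed

text \<open>Vectors change by \<open>X\<close> and coordinates by its inverse \<open>Y\<close>. For
  square matrices \<open>Y X = 1\<close> follows, and this is what makes the new functionals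
  separate vectors.\<close>

lemma dual_basis_change:
  fixes e :: "nat \<Rightarrow> 'v"
  assumes db: "dual_basis M {..<m} e \<xi>"
    and XY: "\<And>a b. a < m \<Longrightarrow> b < m \<Longrightarrow> (\<Sum>j<m. X a j * Y j b) = of_bool (a = b)"
  shows "dual_basis M {..<m} (\<lambda>a. comb M {..<m} (\<lambda>j. X a j) e) (\<lambda>a x. \<Sum>j<m. Y j a * \<xi> j x)"
proof -
  note d = dual_basisD[OF db]
  have YX: "(\<Sum>a<m. Y j a * X a j') = of_bool (j = j')" if "j < m" "j' < m" for j j'
    using right_inverse_is_left_inverse[of "{..<m}" "{..<m}" X Y j j'] XY that by simp
  show ?thesis
    unfolding dual_basis_def
  proof (intro conjI ballI impI)
    fix a assume a: "a \<in> {..<m}"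
    show "comb M {..<m} (\<lambda>j. X a j) e \<in> carrier M" by (intro comb_closed) (use d in auto)
    show "functional M (\<lambda>x. \<Sum>j<m. Y j a * \<xi> j x)" by (intro functional_sum) (use d in auto)
    fix b assume b: "b \<in> {..<m}"
    have "(\<Sum>j<m. Y j a * \<xi> j (comb M {..<m} (X b) e)) = (\<Sum>j<m. X b j * Y j a)"
      using d by (intro sum.cong) (auto simp: dual_basis_comb[OF db])
    then show "(\<Sum>j<m. Y j a * \<xi> j (comb M {..<m} (\<lambda>j. X b j) e)) = of_bool (a = b)"
      using XY[of b a] a b by auto
  next
    fix x assume x: "x \<in> carrier M" and z: "\<forall>a\<in>{..<m}. (\<Sum>j<m. Y j a * \<xi> j x) = 0"
    show "x = \<zero>"
    proof (rule d(5)[OF x])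
      fix j assume j: "j \<in> {..<m}"
      have "0 = (\<Sum>a<m. X a j * (\<Sum>j'<m. Y j' a * \<xi> j' x))" using z by simp
      also have "\<dots> = (\<Sum>j'<m. (\<Sum>a<m. X a j * Y j' a) * \<xi> j' x)" by (rule sum_mult_assoc)
      also have "\<dots> = (\<Sum>j'<m. of_bool (j' = j) * \<xi> j' x)"
        using YX j by (intro sum.cong) (auto simp: mult.commute)
      also have "\<dots> = \<xi> j x" using j by (simp add: sum_of_bool_mult)
      finally show "\<xi> j x = 0" by simp
    qed
  qed simp
qed

end

section \<open>Homomorphisms of modules\<close>

lemma fd_module_kspace: "fd_module L M \<Longrightarrow> kspace M"
  by (simp add: fd_module_def kspace_def)

lemma khom_zero:
  assumes "kspace M" "kspace N" "h \<in> khom M N"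
  shows "h \<zero>\<^bsub>M\<^esub> = \<zero>\<^bsub>N\<^esub>"
proof -
  interpret M: kspace M by fact
  interpret N: kspace N by fact
  have "h (0 \<odot>\<^bsub>M\<^esub> \<zero>\<^bsub>M\<^esub>) = 0 \<odot>\<^bsub>N\<^esub> h \<zero>\<^bsub>M\<^esub>" "h \<zero>\<^bsub>M\<^esub> \<in> carrier N"
    using assms(3) M.M.zero_closed unfolding khom_iff by blast+
  then show ?thesis by simp
qed

lemma khom_minus:
  assumes "kspace M" "kspace N" "h \<in> khom M N" "x \<in> carrier M" "y \<in> carrier M"
  shows "h (x \<ominus>\<^bsub>M\<^esub> y) = h x \<ominus>\<^bsub>N\<^esub> h y"
proof -
  interpret M: kspace M by fact
  interpret N: kspace N by fact
  show ?thesis using assms(3-5) by (simp add: M.minus_conv N.minus_conv khom_iff)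
qed

lemma khom_comp: "h \<in> khom M N \<Longrightarrow> k \<in> khom N P \<Longrightarrow> (\<lambda>x. k (h x)) \<in> khom M P"
  by (auto simp: khom_iff)

lemma khom_inj_iff:
  assumes "kspace M" "kspace N" "h \<in> khom M N"
  shows "inj_on h (carrier M) \<longleftrightarrow> (\<forall>x\<in>carrier M. h x = \<zero>\<^bsub>N\<^esub> \<longrightarrow> x = \<zero>\<^bsub>M\<^esub>)"
proof -
  interpret M: kspace M by fact
  interpret N: kspace N by fact
  have z: "h \<zero>\<^bsub>M\<^esub> = \<zero>\<^bsub>N\<^esub>" using assms by (rule khom_zero)
  show ?thesis
  proof
    assume "inj_on h (carrier M)"
    then show "\<forall>x\<in>carrier M. h x = \<zero>\<^bsub>N\<^esub> \<longrightarrow> x = \<zero>\<^bsub>M\<^esub>"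
      using z by (metis M.M.zero_closed inj_onD)
  next
    assume *: "\<forall>x\<in>carrier M. h x = \<zero>\<^bsub>N\<^esub> \<longrightarrow> x = \<zero>\<^bsub>M\<^esub>"
    show "inj_on h (carrier M)"
    proof (rule inj_onI)
      fix x y assume xy: "x \<in> carrier M" "y \<in> carrier M" "h x = h y"
      have "h y \<in> carrier N" using xy assms(3) by (auto simp: khom_iff)
      then have "h (x \<ominus>\<^bsub>M\<^esub> y) = \<zero>\<^bsub>N\<^esub>"
        using xy by (simp add: khom_minus[OF assms] N.minus_eq_zero_iff)
      then have "x \<ominus>\<^bsub>M\<^esub> y = \<zero>\<^bsub>M\<^esub>" using * xy by simp
      then show "x = y" using xy by (simp add: M.minus_eq_zero_iff)
    qed
  qed
qed

lemma khom_image_subspace: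
  assumes "kspace M" "kspace N" "h \<in> khom M N"
  shows "VectorSpace.subspace class_ring (h ` carrier M) N"
proof -
  interpret M: kspace M by fact
  interpret N: kspace N by fact
  have "\<zero>\<^bsub>N\<^esub> \<in> h ` carrier M"
    using khom_zero[OF assms] M.M.zero_closed by (metis image_eqI)
  moreover have "h x \<oplus>\<^bsub>N\<^esub> h y \<in> h ` carrier M" if "x \<in> carrier M" "y \<in> carrier M" for x y
    using assms(3) that by (auto simp: khom_iff intro!: image_eqI[of _ _ "x \<oplus>\<^bsub>M\<^esub> y"])
  moreover have "c \<odot>\<^bsub>N\<^esub> h x \<in> h ` carrier M" if "x \<in> carrier M" for c x
    using assms(3) that by (auto simp: khom_iff intro!: image_eqI[of _ _ "c \<odot>\<^bsub>M\<^esub> x"])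
  ultimately show ?thesis
    using assms(3) by (auto simp: subspace_iff[OF N.vectorspace_axioms] khom_iff)
qed

lemma khom_surj_fin_dim:
  assumes "kspace M" "kspace N" "h \<in> khom M N" "vectorspace.fin_dim class_ring M" "h ` carrier M = carrier N"
  shows "vectorspace.fin_dim class_ring N"
proof -
  interpret M: kspace M by fact
  interpret N: kspace N by fact
  interpret linear_map class_ring M N h by (unfold_locales, rule assms(3))
  show ?thesis using surj_fin_dim assms(4,5) by blast
qed

lemma khom_bij_dim:
  assumes "kspace M" "kspace N" "h \<in> khom M N" "vectorspace.fin_dim class_ring M"
    "inj_on h (carrier M)" "h ` carrier M = carrier N"
  shows "vdim M = vdim N"
proof -
  interpret M: kspace M by fact
  interpret N: kspace N by fact
  interpret linear_map class_ring M N h by (unfold_locales, rule assms(3))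
  show ?thesis using dim_eq assms(4-6) by blast
qed

lemma khom_matrix:
  assumes "kspace M" "kspace N" "h \<in> khom M N"
    and M: "dual_basis M I e \<xi>" and N: "dual_basis N J e' \<xi>'"
  shows "x \<in> carrier M \<Longrightarrow> p \<in> J \<Longrightarrow> \<xi>' p (h x) = (\<Sum>k\<in>I. \<xi>' p (h (e k)) * \<xi> k x)"
proof -
  interpret M: kspace M by fact
  assume "x \<in> carrier M" "p \<in> J"
  then show ?thesis
    using M.functional_expand[OF M functional_comp[OF dual_basisD(3)[OF N] assms(3)], of p x]
    by (simp add: mult.commute)
qed

text \<open>In coordinates this is a fact on square matrices. Minimality demands a bijection, while
  the diagram chases below produce injectivity alone or surjectivity alone.\<close>

lemma khom_endo_inj_iff_surj:
  assumes "kspace M" and fd: "vectorspace.fin_dim class_ring M" and h: "h \<in> khom M M"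
  shows "inj_on h (carrier M) \<longleftrightarrow> h ` carrier M = carrier M"
proof -
  interpret M: kspace M by fact
  obtain e \<xi> where db: "dual_basis M {..<M.dim} e \<xi>" using M.dual_basis_exists[OF fd] by blast
  note d = dual_basisD[OF db]
  let ?I = "{..<M.dim}"
  define H where "H = (\<lambda>p k. \<xi> p (h (e k)))"
  have hc: "h x \<in> carrier M" if "x \<in> carrier M" for x using h that by (auto simp: khom_iff)
  have H: "\<xi> p (h x) = (\<Sum>k\<in>?I. H p k * \<xi> k x)" if "x \<in> carrier M" "p \<in> ?I" for x p
    using khom_matrix[OF assms(1,1) h db db that] by (simp add: H_def)
  have cc: "comb M ?I s e \<in> carrier M" for s by (rule M.comb_closed) (use d(2) in auto)
  have Hs: "\<xi> p (h (comb M ?I s e)) = (\<Sum>k\<in>?I. H p k * s k)" if "p \<in> ?I" for s p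
    using H[OF cc that, of s] by (simp add: M.dual_basis_comb[OF db])
  show ?thesis
  proof
    assume inj: "inj_on h (carrier M)"
    have "\<forall>k\<in>?I. s k = 0" if "\<forall>p\<in>?I. (\<Sum>k\<in>?I. H p k * s k) = 0" for s
    proof -
      note c = cc[of s]
      have "h (comb M ?I s e) = \<zero>\<^bsub>M\<^esub>"
        using that by (intro d(5) hc c) (simp add: Hs)
      then have "comb M ?I s e = \<zero>\<^bsub>M\<^esub>"
        using inj c unfolding khom_inj_iff[OF assms(1,1) h] by blast
      then have "s k = 0" if "k \<in> ?I" for k
        using M.dual_basis_comb[OF db that, of s] M.functional_zero[OF d(3)[OF that]] by simp
      then show ?thesis by blast
    qed
    then obtain Y where Y: "\<And>k k'. k \<in> ?I \<Longrightarrow> k' \<in> ?I \<Longrightarrow> (\<Sum>p\<in>?I. Y k p * H p k') = of_bool (k = k')"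
      by (rule left_inverse_of_injective[of ?I ?I H, rotated 2]) auto
    have HY: "(\<Sum>k\<in>?I. H p k * Y k p') = of_bool (p = p')" if "p \<in> ?I" "p' \<in> ?I" for p p'
      by (rule right_inverse_is_left_inverse[OF _ _ _ Y that]) auto
    have "y \<in> h ` carrier M" if y: "y \<in> carrier M" for y
    proof
      let ?x = "comb M ?I (\<lambda>k. \<Sum>p\<in>?I. Y k p * \<xi> p y) e"
      show x: "?x \<in> carrier M" by (rule cc)
      show "y = h ?x"
      proof (rule M.dual_basis_eqI[OF db y hc[OF x]])
        fix p assume p: "p \<in> ?I"
        have "\<xi> p (h ?x) = (\<Sum>p'\<in>?I. (\<Sum>k\<in>?I. H p k * Y k p') * \<xi> p' y)"
          unfolding Hs[OF p] by (rule sum_mult_assoc)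
        also have "\<dots> = (\<Sum>p'\<in>?I. of_bool (p = p') * \<xi> p' y)"
          using HY p by (intro sum.cong) auto
        also have "\<dots> = \<xi> p y" using p by (simp add: sum_of_bool_mult del: of_bool_eq_1_iff)
        finally show "\<xi> p y = \<xi> p (h ?x)" by simp
      qed
    qed
    with hc show "h ` carrier M = carrier M" by auto
  next
    assume surj: "h ` carrier M = carrier M"
    show "inj_on h (carrier M)"
    proof (rule ccontr)
      assume "\<not> ?thesis"
      then obtain x where x: "x \<in> carrier M" "h x = \<zero>\<^bsub>M\<^esub>" "x \<noteq> \<zero>\<^bsub>M\<^esub>"
        unfolding khom_inj_iff[OF assms(1,1) h] by blast
      then obtain k where k: "k \<in> ?I" "\<xi> k x \<noteq> 0" using d(5) by blast
      have "card ?I < card ?I"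
      proof (rule surjective_not_injective_imp_less[where M = H and x = "\<lambda>k. \<xi> k x"])
        fix y
        obtain z where z: "z \<in> carrier M" "h z = comb M ?I y e"
          using surj cc by (metis imageE)
        then have "\<forall>p\<in>?I. (\<Sum>k\<in>?I. H p k * \<xi> k z) = y p"
          using H[OF z(1)] M.dual_basis_comb[OF db, of _ y] by simp
        then show "\<exists>x. \<forall>p\<in>?I. (\<Sum>k\<in>?I. H p k * x k) = y p" by (rule exI[of _ "\<lambda>k. \<xi> k z"])
      next
        show "\<forall>p\<in>?I. (\<Sum>k\<in>?I. H p k * \<xi> k x) = 0"
        proof
          fix p assume p: "p \<in> ?I"
          show "(\<Sum>k\<in>?I. H p k * \<xi> k x) = 0"
            using H[OF x(1) p] x(2) M.functional_zero[OF d(3)[OF p]] by simp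
        qed
      qed (use k in auto)
      then show False by simp
    qed
  qed
qed

section \<open>Homomorphisms that respect the action of the algebra\<close>

lemma lmod_homD:
  assumes "h \<in> lmod_hom L M N"
  shows "h \<in> khom M N" "x \<in> carrier M \<Longrightarrow> h x \<in> carrier N"
    "x \<in> carrier M \<Longrightarrow> y \<in> carrier M \<Longrightarrow> h (x \<oplus>\<^bsub>M\<^esub> y) = h x \<oplus>\<^bsub>N\<^esub> h y"
    "x \<in> carrier M \<Longrightarrow> h (c \<odot>\<^bsub>M\<^esub> x) = c \<odot>\<^bsub>N\<^esub> h x"
    "r \<in> carrier L \<Longrightarrow> x \<in> carrier M \<Longrightarrow> h (lact M r x) = lact N r (h x)"
  using assms by (auto simp: lmod_hom_def khom_iff)

lemma lmod_homI:
  assumes "\<And>x. x \<in> carrier M \<Longrightarrow> h x \<in> carrier N"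
    "\<And>x y. x \<in> carrier M \<Longrightarrow> y \<in> carrier M \<Longrightarrow> h (x \<oplus>\<^bsub>M\<^esub> y) = h x \<oplus>\<^bsub>N\<^esub> h y"
    "\<And>c x. x \<in> carrier M \<Longrightarrow> h (c \<odot>\<^bsub>M\<^esub> x) = c \<odot>\<^bsub>N\<^esub> h x"
    "\<And>r x. r \<in> carrier L \<Longrightarrow> x \<in> carrier M \<Longrightarrow> h (lact M r x) = lact N r (h x)"
  shows "h \<in> lmod_hom L M N"
  using assms by (auto simp: lmod_hom_def khom_iff)

lemma lact_closed:
  assumes "fd_module L M" "r \<in> carrier L" "x \<in> carrier M"
  shows "lact M r x \<in> carrier M"
  using fd_module.lact_hom[OF assms(1,2)] assms(3) by (auto simp: khom_iff)

lemma lact_add_right: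
  assumes "fd_module L M" "r \<in> carrier L" "x \<in> carrier M" "y \<in> carrier M"
  shows "lact M r (x \<oplus>\<^bsub>M\<^esub> y) = lact M r x \<oplus>\<^bsub>M\<^esub> lact M r y"
  using fd_module.lact_hom[OF assms(1,2)] assms(3,4) by (auto simp: khom_iff)

lemma lact_smult_right:
  assumes "fd_module L M" "r \<in> carrier L" "x \<in> carrier M"
  shows "lact M r (c \<odot>\<^bsub>M\<^esub> x) = c \<odot>\<^bsub>M\<^esub> lact M r x"
  using fd_module.lact_hom[OF assms(1,2)] assms(3) by (auto simp: khom_iff)

lemma lmod_hom_comp: "h \<in> lmod_hom L M N \<Longrightarrow> k \<in> lmod_hom L N P \<Longrightarrow> (\<lambda>x. k (h x)) \<in> lmod_hom L M P"
  by (auto simp: lmod_hom_def khom_iff)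

lemma lmod_hom_id: "(\<lambda>x. x) \<in> lmod_hom L M M"
  by (auto simp: lmod_hom_def khom_iff)

lemma lmod_hom_add:
  assumes N: "fd_module L N" and h: "h \<in> lmod_hom L M N" and k: "k \<in> lmod_hom L M N"
  shows "(\<lambda>x. h x \<oplus>\<^bsub>N\<^esub> k x) \<in> lmod_hom L M N"
proof -
  interpret N: kspace N using N by (rule fd_module_kspace)
  note hk = lmod_homD[OF h] lmod_homD[OF k]
  show ?thesis
    by (rule lmod_homI) (auto simp: hk N.smult_add_right lact_add_right[OF N] N.M.a_ac)
qed

lemma lmod_hom_diff:
  assumes N: "fd_module L N" and h: "h \<in> lmod_hom L M N" and k: "k \<in> lmod_hom L M N"
  shows "(\<lambda>x. h x \<ominus>\<^bsub>N\<^esub> k x) \<in> lmod_hom L M N"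
proof -
  interpret N: kspace N using N by (rule fd_module_kspace)
  note hk = lmod_homD[OF h] lmod_homD[OF k]
  have "(\<lambda>x. (- 1) \<odot>\<^bsub>N\<^esub> k x) \<in> lmod_hom L M N"
    by (rule lmod_homI) (auto simp: hk N.smult_add_right lact_smult_right[OF N] mult.commute simp flip: N.smult_assoc)
  note sum = lmod_homD[OF lmod_hom_add[OF N h this]]
  show ?thesis
    using sum by (intro lmod_homI) (auto simp: N.minus_conv hk lact_closed[OF N])
qed

lemma factor_through_mono:
  assumes f: "f \<in> lmod_hom L A B" "inj_on f (carrier A)" and w: "w \<in> lmod_hom L X B"
    and A: "fd_module L A" and X: "fd_module L X" and im: "\<And>x. x \<in> carrier X \<Longrightarrow> w x \<in> f ` carrier A"
  shows "\<exists>r\<in>lmod_hom L X A. \<forall>x\<in>carrier X. f (r x) = w x"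
proof -
  interpret A: kspace A using A by (rule fd_module_kspace)
  interpret X: kspace X using X by (rule fd_module_kspace)
  note fw = lmod_homD[OF f(1)] lmod_homD[OF w]
  obtain r where r: "\<And>x. x \<in> carrier X \<Longrightarrow> r x \<in> carrier A" "\<And>x. x \<in> carrier X \<Longrightarrow> f (r x) = w x"
    using im unfolding image_iff by metis
  have eqI: "a = a'" if "f a = f a'" "a \<in> carrier A" "a' \<in> carrier A" for a a'
    using f(2) that by (auto simp: inj_on_def)
  have "r \<in> lmod_hom L X A"
    by (rule lmod_homI; (rule eqI)?) (auto simp: r fw lact_closed[OF X] lact_closed[OF A])
  then show ?thesis using r by blast
qed

text \<open>Any choice of preimages under \<open>g\<close> gives the same value of \<open>w\<close>,
  since differences of preimages lie in the kernel of \<open>g\<close>.\<close>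

lemma factor_through_epi:
  assumes g: "g \<in> lmod_hom L B C" "g ` carrier B = carrier C" and w: "w \<in> lmod_hom L B X"
    and B: "fd_module L B" and C: "fd_module L C" and X: "fd_module L X"
    and ker: "\<And>b. b \<in> carrier B \<Longrightarrow> g b = \<zero>\<^bsub>C\<^esub> \<Longrightarrow> w b = \<zero>\<^bsub>X\<^esub>"
  shows "\<exists>r\<in>lmod_hom L C X. \<forall>b\<in>carrier B. r (g b) = w b"
proof -
  interpret B: kspace B using B by (rule fd_module_kspace)
  interpret C: kspace C using C by (rule fd_module_kspace)
  interpret X: kspace X using X by (rule fd_module_kspace)
  note gw = lmod_homD[OF g(1)] lmod_homD[OF w]
  have eq: "w b = w b'" if "g b = g b'" "b \<in> carrier B" "b' \<in> carrier B" for b b'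
  proof -
    have "g (b \<ominus>\<^bsub>B\<^esub> b') = \<zero>\<^bsub>C\<^esub>"
      using that by (simp add: khom_minus[OF B.kspace_axioms C.kspace_axioms] gw C.minus_eq_zero_iff)
    then have "w (b \<ominus>\<^bsub>B\<^esub> b') = \<zero>\<^bsub>X\<^esub>" using ker that by simp
    then show ?thesis
      using that by (simp add: khom_minus[OF B.kspace_axioms X.kspace_axioms] gw X.minus_eq_zero_iff)
  qed
  define r where "r = (\<lambda>c. w (SOME b. b \<in> carrier B \<and> g b = c))"
  have r: "r (g b) = w b" if "b \<in> carrier B" for b
  proof -
    have "\<exists>b'. b' \<in> carrier B \<and> g b' = g b" using that by blast
    then have "(SOME b'. b' \<in> carrier B \<and> g b' = g b) \<in> carrier B \<and> g (SOME b'. b' \<in> carrier B \<and> g b' = g b) = g b"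
      by (rule someI_ex)
    then show ?thesis unfolding r_def using that eq by blast
  qed
  have "r \<in> lmod_hom L C X"
  proof (rule lmod_homI)
    fix c c' a x assume "c \<in> carrier C"
    then obtain b where b: "b \<in> carrier B" "c = g b" using g(2) by auto
    show "r c \<in> carrier X" using b r gw by simp
    show "r (a \<odot>\<^bsub>C\<^esub> c) = a \<odot>\<^bsub>X\<^esub> r c" using r[of "a \<odot>\<^bsub>B\<^esub> b"] b r gw by simp
    show "r (lact C x c) = lact X x (r c)" if "x \<in> carrier L"
      using r[of "lact B x b"] b r gw that lact_closed[OF B] by simp
    assume "c' \<in> carrier C"
    then obtain b' where b': "b' \<in> carrier B" "c' = g b'" using g(2) by auto
    show "r (c \<oplus>\<^bsub>C\<^esub> c') = r c \<oplus>\<^bsub>X\<^esub> r c'" using r[of "b \<oplus>\<^bsub>B\<^esub> b'"] b b' r gw by simp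
  qed
  then show ?thesis using r by blast
qed

lemma lmod_hom_inverse:
  assumes "fd_module L M" "fd_module L N" "h \<in> lmod_hom L M N" "inj_on h (carrier M)" "h ` carrier M = carrier N"
  shows "\<exists>r\<in>lmod_hom L N M. (\<forall>y\<in>carrier N. h (r y) = y) \<and> (\<forall>x\<in>carrier M. r (h x) = x)"
proof -
  obtain r where r: "r \<in> lmod_hom L N M" "\<forall>y\<in>carrier N. h (r y) = y"
    using factor_through_mono[OF assms(3,4) lmod_hom_id assms(1,2)] assms(5) by blast
  have "r (h x) = x" if "x \<in> carrier M" for x
    using assms(4) r that lmod_homD(2)[OF r(1)] lmod_homD(2)[OF assms(3)] by (auto simp: inj_on_def)
  with r show ?thesis by blast
qed

text \<open>The image of a homomorphism together with corestriction and inclusion. Such images are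
  the test modules in the two lemmas on idempotents below.\<close>

lemma image_module:
  assumes A: "fd_module L A" and C: "fd_module L C" and h: "h \<in> lmod_hom L A C"
  shows "fd_module L (C\<lparr>carrier := h ` carrier A\<rparr>)" (is "fd_module L ?X")
    and "h \<in> lmod_hom L A (C\<lparr>carrier := h ` carrier A\<rparr>)"
    and "(\<lambda>x. x) \<in> lmod_hom L (C\<lparr>carrier := h ` carrier A\<rparr>) C"
proof -
  interpret A: kspace A using A by (rule fd_module_kspace)
  interpret C: kspace C using C by (rule fd_module_kspace)
  note hD = lmod_homD[OF h]
  have X: "kspace ?X"
    by (rule kspace_subspace[OF C.kspace_axioms khom_image_subspace[OF A.kspace_axioms C.kspace_axioms hD(1)]])
  have hX: "h \<in> khom A ?X" using hD by (auto simp: khom_iff)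
  have fin: "vectorspace.fin_dim class_ring ?X"
    using khom_surj_fin_dim[OF A.kspace_axioms X hX fd_module.fin_dim[OF A]] by simp
  have sub: "h ` carrier A \<subseteq> carrier C" using hD by auto
  have im: "lact C r y \<in> h ` carrier A" if "y \<in> h ` carrier A" "r \<in> carrier L" for r y
    using that hD(5) lact_closed[OF A] by (metis (no_types, lifting) imageE imageI)
  have vs: "vectorspace class_ring ?X" using X by (simp add: kspace_def)
  show "fd_module L ?X"
  proof (intro fd_module.intro fd_module_axioms.intro vs fin)
    fix x assume x: "x \<in> carrier L"
    show "lact ?X x \<in> khom ?X ?X"
      using im x sub by (auto simp: khom_iff lact_add_right[OF C] lact_smult_right[OF C] subset_eq)
  qed (use sub fd_module.lact_add[OF C] fd_module.lact_smult[OF C] fd_module.lact_mult[OF C] fd_module.lact_one[OF C] in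
      \<open>auto simp: subset_eq\<close>)
  show "h \<in> lmod_hom L A ?X" using hD by (intro lmod_homI) auto
  show "(\<lambda>x. x) \<in> lmod_hom L ?X C" using sub by (intro lmod_homI) auto
qed

section \<open>Almost split morphisms and arbitrary test modules\<close>

text \<open>Transport of structure along coordinates. The definitions of almost split morphisms test
  only modules with carrier in \<open>'k vec\<close>; this model brings modules of every carrier
  type within their range.\<close>

lemma exists_vec_model:
  fixes X :: "('k::field, 'x, 'r) lmodule"
  assumes X: "fd_module L X"
  obtains X' :: "('k, 'k vec, 'r) lmodule" and \<alpha> \<beta> where
    "fd_module L X'" "\<alpha> \<in> lmod_hom L X X'" "\<beta> \<in> lmod_hom L X' X"
    "\<And>x. x \<in> carrier X \<Longrightarrow> \<beta> (\<alpha> x) = x" "\<And>y. y \<in> carrier X' \<Longrightarrow> \<alpha> (\<beta> y) = y"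
proof -
  interpret X: kspace X using X by (rule fd_module_kspace)
  obtain e \<xi> where db: "dual_basis X {..<X.dim} e \<xi>"
    using X.dual_basis_exists[OF fd_module.fin_dim[OF X]] by blast
  define \<alpha> where "\<alpha> = (\<lambda>x. vec X.dim (\<lambda>a. \<xi> a x))"
  have inj: "inj_on \<alpha> (carrier X)"
  proof (rule inj_onI)
    fix x y assume xy: "x \<in> carrier X" "y \<in> carrier X" "\<alpha> x = \<alpha> y"
    have "\<xi> a x = \<xi> a y" if "a \<in> {..<X.dim}" for a
      using arg_cong[OF xy(3), of "\<lambda>v. v $ a"] that by (simp add: \<alpha>_def)
    then show "x = y" by (rule X.dual_basis_eqI[OF db xy(1,2)])
  qed
  define \<beta> where "\<beta> = the_inv_into (carrier X) \<alpha>"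
  have \<beta>\<alpha> [simp]: "\<beta> (\<alpha> x) = x" if "x \<in> carrier X" for x
    using the_inv_into_f_f[OF inj that] by (simp add: \<beta>_def)
  define X' :: "('k, 'k vec, 'r) lmodule" where
    "X' = \<lparr>carrier = \<alpha> ` carrier X, mult = undefined, one = undefined, zero = \<alpha> \<zero>\<^bsub>X\<^esub>,
      add = (\<lambda>v w. \<alpha> (\<beta> v \<oplus>\<^bsub>X\<^esub> \<beta> w)), smult = (\<lambda>c v. \<alpha> (c \<odot>\<^bsub>X\<^esub> \<beta> v)),
      lact = (\<lambda>r v. \<alpha> (lact X r (\<beta> v)))\<rparr>"
  note lc = lact_closed[OF X]
  have ks: "kspace X'"
    by (rule kspaceI) (auto simp: X'_def X.M.a_ac X.smult_assoc X.smult_add_left X.smult_add_right)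
  have \<alpha>: "\<alpha> \<in> lmod_hom L X X'" by (rule lmod_homI) (auto simp: X'_def lc)
  have \<beta>: "\<beta> \<in> lmod_hom L X' X" by (rule lmod_homI) (auto simp: X'_def lc)
  have fin: "vectorspace.fin_dim class_ring X'"
    by (rule khom_surj_fin_dim[OF X.kspace_axioms ks lmod_homD(1)[OF \<alpha>] fd_module.fin_dim[OF X]])
      (simp add: X'_def)
  have vs: "vectorspace class_ring X'" using ks by (simp add: kspace_def)
  have "fd_module L X'"
  proof (intro fd_module.intro fd_module_axioms.intro vs fin)
    fix x assume "x \<in> carrier L"
    then show "lact X' x \<in> khom X' X'"
      by (auto simp: khom_iff X'_def lc lact_add_right[OF X] lact_smult_right[OF X])
  qed (auto simp: X'_def lc fd_module.lact_add[OF X] fd_module.lact_smult[OF X]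
      fd_module.lact_mult[OF X] fd_module.lact_one[OF X])
  then show thesis
    by (rule that[OF _ \<alpha> \<beta>]) (auto simp: X'_def)
qed

text \<open>A section of \<open>h \<beta>\<close> followed by \<open>\<beta>\<close> is a section of
  \<open>h\<close>, so the map tested on the model does not split either. The factorization found
  there is pulled back along \<open>\<alpha>\<close>.\<close>

lemma right_almost_splitD:
  fixes X :: "('k::field, 'x, 'r) lmodule"
  assumes g: "right_almost_split L B C g" and X: "fd_module L X"
    and h: "h \<in> lmod_hom L X C" "\<not> split_epi L X C h"
  shows "\<exists>t\<in>lmod_hom L X B. \<forall>x\<in>carrier X. g (t x) = h x"
proof -
  obtain X' :: "('k, 'k vec, 'r) lmodule" and \<alpha> \<beta> where X': "fd_module L X'"
    "\<alpha> \<in> lmod_hom L X X'" "\<beta> \<in> lmod_hom L X' X" "\<And>x. x \<in> carrier X \<Longrightarrow> \<beta> (\<alpha> x) = x"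
    by (rule exists_vec_model[OF X]) (rule that)
  have "\<not> split_epi L X' C (\<lambda>x. h (\<beta> x))"
  proof
    assume "split_epi L X' C (\<lambda>x. h (\<beta> x))"
    then obtain s where "s \<in> lmod_hom L C X'" "\<forall>y\<in>carrier C. h (\<beta> (s y)) = y"
      unfolding split_epi_def by blast
    then have "split_epi L X C h"
      unfolding split_epi_def using lmod_hom_comp[OF _ X'(3), of s C]
      by (intro bexI[of _ "\<lambda>x. \<beta> (s x)"])
    with h(2) show False by simp
  qed
  then obtain t where t: "t \<in> lmod_hom L X' B" "\<forall>x\<in>carrier X'. g (t x) = h (\<beta> x)"
    using g X'(1) lmod_hom_comp[OF X'(3) h(1)] unfolding right_almost_split_def by blast
  have "g (t (\<alpha> x)) = h x" if "x \<in> carrier X" for x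
    using t(2) X'(4)[OF that] lmod_homD(2)[OF X'(2) that] by simp
  then show ?thesis using lmod_hom_comp[OF X'(2) t(1)] by (intro bexI[of _ "\<lambda>x. t (\<alpha> x)"] ballI)
qed

lemma left_almost_splitD:
  fixes Y :: "('k::field, 'x, 'r) lmodule"
  assumes f: "left_almost_split L A B f" and Y: "fd_module L Y"
    and h: "h \<in> lmod_hom L A Y" "\<not> split_mono L A Y h"
  shows "\<exists>t\<in>lmod_hom L B Y. \<forall>x\<in>carrier A. t (f x) = h x"
proof -
  obtain Y' :: "('k, 'k vec, 'r) lmodule" and \<alpha> \<beta> where Y': "fd_module L Y'"
    "\<alpha> \<in> lmod_hom L Y Y'" "\<beta> \<in> lmod_hom L Y' Y" "\<And>x. x \<in> carrier Y \<Longrightarrow> \<beta> (\<alpha> x) = x"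
    by (rule exists_vec_model[OF Y]) (rule that)
  have "\<not> split_mono L A Y' (\<lambda>x. \<alpha> (h x))"
  proof
    assume "split_mono L A Y' (\<lambda>x. \<alpha> (h x))"
    then obtain r where "r \<in> lmod_hom L Y' A" "\<forall>x\<in>carrier A. r (\<alpha> (h x)) = x"
      unfolding split_mono_def by blast
    then have "split_mono L A Y h"
      unfolding split_mono_def using lmod_hom_comp[OF Y'(2), of r A]
      by (intro bexI[of _ "\<lambda>x. r (\<alpha> x)"])
    with h(2) show False by simp
  qed
  then obtain t where t: "t \<in> lmod_hom L B Y'" "\<forall>x\<in>carrier A. t (f x) = \<alpha> (h x)"
    using f Y'(1) lmod_hom_comp[OF h(1) Y'(2)] unfolding left_almost_split_def by blast
  have "\<beta> (t (f x)) = h x" if "x \<in> carrier A" for x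
    using t(2) that Y'(4)[OF lmod_homD(2)[OF h(1) that]] by simp
  then show ?thesis using lmod_hom_comp[OF t(1) Y'(3)] by (intro bexI[of _ "\<lambda>x. \<beta> (t x)"] ballI)
qed

section \<open>Idempotents of the middle term\<close>

text \<open>If \<open>g\<close> does not map the image of \<open>e\<close> onto \<open>C\<close>, the inclusion of \<open>g (e B)\<close> in \<open>C\<close> factors through \<open>g\<close>
  by some \<open>t\<close>, and \<open>g s = g\<close> for \<open>s = t g e + (1 - e)\<close>. By minimality \<open>s\<close> is bijective, so \<open>g\<close> is
  injective on the image of \<open>e\<close>.\<close>

lemma minimal_right_idempotent:
  assumes B: "fd_module L B" and C: "fd_module L C" and g: "minimal_right_almost_split L B C g"
    and e: "e \<in> lmod_hom L B B" "\<And>b. b \<in> carrier B \<Longrightarrow> e (e b) = e b"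
  shows "max_rank g (e ` carrier B) (carrier C)"
proof (cases "g ` e ` carrier B = carrier C")
  case True
  then show ?thesis by (simp add: max_rank_def)
next
  case False
  interpret B: kspace B using B by (rule fd_module_kspace)
  interpret C: kspace C using C by (rule fd_module_kspace)
  have ras: "right_almost_split L B C g" and min: "right_minimal L B g"
    using g by (auto simp: minimal_right_almost_split_def)
  then have gh: "g \<in> lmod_hom L B C" by (simp add: right_almost_split_def)
  note gD = lmod_homD[OF gh] and eD = lmod_homD[OF e(1)]
  have ge: "(\<lambda>b. g (e b)) \<in> lmod_hom L B C" by (rule lmod_hom_comp[OF e(1) gh])
  let ?X = "C\<lparr>carrier := (\<lambda>b. g (e b)) ` carrier B\<rparr>"
  \<comment> \<open>A section of the inclusion is the identity on \<open>C\<close>, so it would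
    force \<open>g (e B) = C\<close>.\<close>
  have "\<not> split_epi L ?X C (\<lambda>x. x)"
  proof
    assume "split_epi L ?X C (\<lambda>x. x)"
    then obtain s where "s \<in> lmod_hom L C ?X" "\<forall>y\<in>carrier C. s y = y" unfolding split_epi_def by blast
    then have "carrier C \<subseteq> carrier ?X" using lmod_homD(2) by fastforce
    moreover have "carrier ?X \<subseteq> carrier C" using gD eD by auto
    ultimately show False using False by (auto simp: image_image)
  qed
  then obtain t where t: "t \<in> lmod_hom L ?X B" "\<forall>x\<in>carrier ?X. g (t x) = x"
    using right_almost_splitD[OF ras image_module(1)[OF B C ge] image_module(3)[OF B C ge]] by blast
  define s where "s = (\<lambda>b. t (g (e b)) \<oplus>\<^bsub>B\<^esub> (b \<ominus>\<^bsub>B\<^esub> e b))"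
  have tge: "(\<lambda>b. t (g (e b))) \<in> lmod_hom L B B"
    by (rule lmod_hom_comp[OF image_module(2)[OF B C ge] t(1)])
  have s: "s \<in> lmod_hom L B B"
    unfolding s_def by (rule lmod_hom_add[OF B tge lmod_hom_diff[OF B lmod_hom_id e(1)]])
  have "g (s b) = g b" if "b \<in> carrier B" for b
  proof -
    have "t (g (e b)) \<in> carrier B" using lmod_homD(2)[OF tge that] .
    then have "g (s b) = g (e b) \<oplus>\<^bsub>C\<^esub> (g b \<ominus>\<^bsub>C\<^esub> g (e b))"
      using that t(2) by (simp add: s_def gD eD khom_minus[OF B.kspace_axioms C.kspace_axioms])
    then show ?thesis using that gD(2) eD(2) by (simp add: a_minus_def C.M.a_lcomm C.M.r_neg)
  qed
  then have "inj_on s (carrier B)"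
    using min s unfolding right_minimal_def by (auto simp: bij_betw_def)
  \<comment> \<open>The summand \<open>1 - e\<close> vanishes on the image of \<open>e\<close>, so
    there \<open>s\<close> is \<open>t g\<close>, and injectivity of \<open>s\<close> passes to
    \<open>g\<close>.\<close>
  moreover have "s (e b) = t (g (e b))" if "b \<in> carrier B" for b
    using that lmod_homD(2)[OF tge that] eD(2) e(2) by (simp add: s_def a_minus_def a_minus_def B.M.r_neg)
  ultimately have "inj_on g (e ` carrier B)"
    using eD(2) by (auto simp: inj_on_def)
  then show ?thesis by (simp add: max_rank_def)
qed

text \<open>The dual argument, with a factorization \<open>t\<close> of \<open>e f : A \<rightarrow> e f A\<close> through \<open>f\<close> and \<open>s = t + (1 - e)\<close>.\<close>

lemma minimal_left_idempotent:
  assumes A: "fd_module L A" and B: "fd_module L B" and f: "minimal_left_almost_split L A B f"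
    and e: "e \<in> lmod_hom L B B" "\<And>b. b \<in> carrier B \<Longrightarrow> e (e b) = e b"
  shows "max_rank (\<lambda>a. e (f a)) (carrier A) (e ` carrier B)"
proof (cases "inj_on (\<lambda>a. e (f a)) (carrier A)")
  case True
  then show ?thesis by (simp add: max_rank_def)
next
  case False
  interpret B: kspace B using B by (rule fd_module_kspace)
  have las: "left_almost_split L A B f" and min: "left_minimal L A B f"
    using f by (auto simp: minimal_left_almost_split_def)
  then have fh: "f \<in> lmod_hom L A B" by (simp add: left_almost_split_def)
  note fD = lmod_homD[OF fh] and eD = lmod_homD[OF e(1)]
  have ef: "(\<lambda>a. e (f a)) \<in> lmod_hom L A B" by (rule lmod_hom_comp[OF fh e(1)])
  let ?Y = "B\<lparr>carrier := (\<lambda>a. e (f a)) ` carrier A\<rparr>"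
  have "\<not> split_mono L A ?Y (\<lambda>a. e (f a))"
    using False unfolding split_mono_def by (metis inj_on_inverseI)
  then obtain t where t: "t \<in> lmod_hom L B ?Y" "\<forall>a\<in>carrier A. t (f a) = e (f a)"
    using left_almost_splitD[OF las image_module(1)[OF A B ef] image_module(2)[OF A B ef]] by blast
  have tB: "t \<in> lmod_hom L B B"
    using lmod_hom_comp[OF t(1) image_module(3)[OF A B ef]] .
  define s where "s = (\<lambda>b. t b \<oplus>\<^bsub>B\<^esub> (b \<ominus>\<^bsub>B\<^esub> e b))"
  have s: "s \<in> lmod_hom L B B"
    unfolding s_def by (rule lmod_hom_add[OF B tB lmod_hom_diff[OF B lmod_hom_id e(1)]])
  have "s (f a) = f a" if "a \<in> carrier A" for a
    using that t(2) fD(2) eD(2) by (simp add: s_def a_minus_def B.M.a_lcomm B.M.r_neg)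
  then have surj: "s ` carrier B = carrier B"
    using min s unfolding left_minimal_def by (auto simp: bij_betw_def)
  \<comment> \<open>Write \<open>y = s b\<close>. Then \<open>y = e y = e (s b) = e (t b)\<close>,
    as \<open>e (1 - e) = 0\<close>, and \<open>e (t b) = t b\<close>, as \<open>t\<close> takes its
    values in the image of \<open>e f\<close>.\<close>
  have "y \<in> (\<lambda>a. e (f a)) ` carrier A" if y: "y \<in> e ` carrier B" for y
  proof -
    have yB: "y \<in> carrier B" and ey: "e y = y" using y eD(2) e(2) by auto
    then have "y \<in> s ` carrier B" using surj by simp
    then obtain b where b: "b \<in> carrier B" "s b = y" by auto
    have tb: "t b \<in> (\<lambda>a. e (f a)) ` carrier A" using lmod_homD(2)[OF t(1) b(1)] by simp
    then have etb: "e (t b) = t b" using e(2) fD(2) by auto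
    have "e (s b) = e (t b) \<oplus>\<^bsub>B\<^esub> (e b \<ominus>\<^bsub>B\<^esub> e (e b))"
      using b(1) lmod_homD(2)[OF tB b(1)]
      by (simp add: s_def eD khom_minus[OF B.kspace_axioms B.kspace_axioms])
    also have "\<dots> = t b"
      using b(1) lmod_homD(2)[OF tB b(1)] eD(2) e(2) etb by (simp add: a_minus_def B.M.r_neg)
    finally show ?thesis using b(2) ey tb by simp
  qed
  then have "(\<lambda>a. e (f a)) ` carrier A = e ` carrier B" using fD(2) by auto
  then show ?thesis by (simp add: max_rank_def)
qed

section \<open>Minimality of the maps of an almost split sequence\<close>

text \<open>An \<open>s\<close> with \<open>g s = g\<close> restricts to an endomorphism
  \<open>u\<close> of \<open>A\<close>. If \<open>u\<close> did not split, then
  \<open>u = t f\<close>, and \<open>s - f t\<close> would vanish on the image of \<open>f\<close>,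
  hence be \<open>r g\<close> with \<open>g r = 1\<close>, a section of \<open>g\<close>. So
  \<open>u\<close> is injective, and a chase makes \<open>s\<close> injective. The left half is
  dual: \<open>s f = f\<close> induces \<open>u\<close> on \<open>C\<close>, and
  \<open>u = g t\<close> would make \<open>s - t g\<close> equal to \<open>f r\<close> with
  \<open>r f = 1\<close>.\<close>

lemma almost_split_sequence_minimal:
  assumes A: "fd_module L A" and B: "fd_module L B" and C: "fd_module L C"
    and seq: "almost_split_sequence L A f B g C"
  shows "minimal_left_almost_split L A B f" "minimal_right_almost_split L B C g"
proof -
  interpret A: kspace A using A by (rule fd_module_kspace)
  interpret B: kspace B using B by (rule fd_module_kspace)
  interpret C: kspace C using C by (rule fd_module_kspace)
  note ks = A.kspace_axioms B.kspace_axioms C.kspace_axioms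
  have inj: "inj_on f (carrier A)" and exact: "f ` carrier A = {b \<in> carrier B. g b = \<zero>\<^bsub>C\<^esub>}"
    and surj: "g ` carrier B = carrier C" and las: "left_almost_split L A B f" and ras: "right_almost_split L B C g"
    using seq by (auto simp: almost_split_sequence_def)
  have f: "f \<in> lmod_hom L A B" "\<not> split_mono L A B f" and g: "g \<in> lmod_hom L B C" "\<not> split_epi L B C g"
    using las ras by (auto simp: left_almost_split_def right_almost_split_def)
  note fD = lmod_homD[OF f(1)] and gD = lmod_homD[OF g(1)]
  have gf: "g (f a) = \<zero>\<^bsub>C\<^esub>" if "a \<in> carrier A" for a using exact that by blast
  have fker: "\<exists>a\<in>carrier A. b = f a" if "b \<in> carrier B" "g b = \<zero>\<^bsub>C\<^esub>" for b using exact that by blast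
  have f0: "f a = \<zero>\<^bsub>B\<^esub> \<Longrightarrow> a = \<zero>\<^bsub>A\<^esub>" if "a \<in> carrier A" for a
    using inj that unfolding khom_inj_iff[OF ks(1,2) fD(1)] by blast
  have bij: "bij_betw s (carrier B) (carrier B)"
    if s: "s \<in> lmod_hom L B B" and z: "\<And>b. b \<in> carrier B \<Longrightarrow> s b = \<zero>\<^bsub>B\<^esub> \<Longrightarrow> b = \<zero>\<^bsub>B\<^esub>" for s
  proof -
    have "inj_on s (carrier B)" unfolding khom_inj_iff[OF ks(2,2) lmod_homD(1)[OF s]] using z by blast
    then show ?thesis
      using khom_endo_inj_iff_surj[OF ks(2) fd_module.fin_dim[OF B] lmod_homD(1)[OF s]] by (simp add: bij_betw_def)
  qed
  have "right_minimal L B g"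
    unfolding right_minimal_def
  proof (intro ballI impI)
    fix s assume s: "s \<in> lmod_hom L B B" and gs: "\<forall>b\<in>carrier B. g (s b) = g b"
    note sD = lmod_homD[OF s]
    obtain u where u: "u \<in> lmod_hom L A A" "\<forall>a\<in>carrier A. f (u a) = s (f a)"
    proof -
      have "s (f x) \<in> f ` carrier A" if "x \<in> carrier A" for x
        unfolding exact using that gs gf fD(2) sD(2) by simp
      then show ?thesis
        using factor_through_mono[OF f(1) inj lmod_hom_comp[OF f(1) s] A A] that by blast
    qed
    note uD = lmod_homD[OF u(1)]
    have "split_mono L A A u"
    proof (rule ccontr)
      assume "\<not> ?thesis"
      then obtain t where t: "t \<in> lmod_hom L B A" "\<forall>a\<in>carrier A. t (f a) = u a"
        using left_almost_splitD[OF las A u(1)] by blast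
      note tD = lmod_homD[OF t(1)]
      define w where "w = (\<lambda>b. s b \<ominus>\<^bsub>B\<^esub> f (t b))"
      have w: "w \<in> lmod_hom L B B"
        unfolding w_def by (rule lmod_hom_diff[OF B s lmod_hom_comp[OF t(1) f(1)]])
      have "w b = \<zero>\<^bsub>B\<^esub>" if "b \<in> carrier B" "g b = \<zero>\<^bsub>C\<^esub>" for b
        using fker[OF that] t u fD(2) sD(2) by (auto simp: w_def B.minus_eq_zero_iff)
      then obtain r where r: "r \<in> lmod_hom L C B" "\<forall>b\<in>carrier B. r (g b) = w b"
        using factor_through_epi[OF g(1) surj w B C B] by blast
      have "g (w b) = g b" if "b \<in> carrier B" for b
      proof -
        have "g (w b) = g (s b) \<ominus>\<^bsub>C\<^esub> g (f (t b))"
          using that sD(2) fD(2) tD(2) by (simp add: w_def khom_minus[OF ks(2,3) gD(1)])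
        then show ?thesis using that gs gf tD(2) gD(2) by (simp add: a_minus_def)
      qed
      moreover have "\<exists>b\<in>carrier B. c = g b" if "c \<in> carrier C" for c
        using that unfolding surj[symmetric] by auto
      ultimately have "\<forall>c\<in>carrier C. g (r c) = c" using r(2) by metis
      then show False using g(2) r(1) unfolding split_epi_def by blast
    qed
    then have u_inj: "a = \<zero>\<^bsub>A\<^esub>" if "a \<in> carrier A" "u a = \<zero>\<^bsub>A\<^esub>" for a
    proof -
      obtain q where "q \<in> lmod_hom L A A" "\<forall>a\<in>carrier A. q (u a) = a"
        using \<open>split_mono L A A u\<close> unfolding split_mono_def by auto
      then show ?thesis using that khom_zero[OF ks(1,1) lmod_homD(1)] by metis
    qed
    show "bij_betw s (carrier B) (carrier B)"
    proof (rule bij[OF s])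
      fix b assume b: "b \<in> carrier B" "s b = \<zero>\<^bsub>B\<^esub>"
      then have "g b = \<zero>\<^bsub>C\<^esub>" using bspec[OF gs b(1)] khom_zero[OF ks(2,3) gD(1)] by simp
      then obtain a where a: "a \<in> carrier A" "b = f a" using fker[OF b(1)] by auto
      then have "f (u a) = \<zero>\<^bsub>B\<^esub>" using u b by simp
      then have "u a = \<zero>\<^bsub>A\<^esub>" using f0[OF uD(2)[OF a(1)]] by simp
      then show "b = \<zero>\<^bsub>B\<^esub>" using u_inj[OF a(1)] a khom_zero[OF ks(1,2) fD(1)] by simp
    qed
  qed
  with ras show "minimal_right_almost_split L B C g" by (simp add: minimal_right_almost_split_def)
  have "left_minimal L A B f"
    unfolding left_minimal_def
  proof (intro ballI impI)
    fix s assume s: "s \<in> lmod_hom L B B" and sf: "\<forall>a\<in>carrier A. s (f a) = f a"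
    note sD = lmod_homD[OF s]
    obtain u where u: "u \<in> lmod_hom L C C" "\<forall>b\<in>carrier B. u (g b) = g (s b)"
    proof -
      have "g (s b) = \<zero>\<^bsub>C\<^esub>" if b: "b \<in> carrier B" "g b = \<zero>\<^bsub>C\<^esub>" for b
      proof -
        obtain a where "a \<in> carrier A" "b = f a" using fker[OF b] by blast
        then show ?thesis using sf gf by simp
      qed
      then show ?thesis
        using factor_through_epi[OF g(1) surj lmod_hom_comp[OF s g(1)] B C C] that by blast
    qed
    note uD = lmod_homD[OF u(1)]
    have "split_epi L C C u"
    proof (rule ccontr)
      assume "\<not> ?thesis"
      then obtain t where t: "t \<in> lmod_hom L C B" "\<forall>c\<in>carrier C. g (t c) = u c"
        using right_almost_splitD[OF ras C u(1)] by blast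
      note tD = lmod_homD[OF t(1)]
      define w where "w = (\<lambda>b. s b \<ominus>\<^bsub>B\<^esub> t (g b))"
      have w: "w \<in> lmod_hom L B B"
        unfolding w_def by (rule lmod_hom_diff[OF B s lmod_hom_comp[OF g(1) t(1)]])
      have "g (w b) = \<zero>\<^bsub>C\<^esub>" if "b \<in> carrier B" for b
        using that t u gD(2) sD(2) tD(2)
        by (simp add: w_def khom_minus[OF ks(2,3) gD(1)] C.minus_eq_zero_iff)
      then obtain r where r: "r \<in> lmod_hom L B A" "\<forall>b\<in>carrier B. f (r b) = w b"
      proof -
        have "w x \<in> f ` carrier A" if "x \<in> carrier B" for x
          unfolding exact using that \<open>\<And>b. b \<in> carrier B \<Longrightarrow> g (w b) = \<zero>\<^bsub>C\<^esub>\<close> lmod_homD(2)[OF w that] by simp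
        then show ?thesis
          using factor_through_mono[OF f(1) inj w A B] that by blast
      qed
      have "r (f a) = a" if "a \<in> carrier A" for a
      proof -
        have "f (r (f a)) = f a"
          using that r sf gf fD(2) khom_zero[OF ks(3,2) tD(1)] by (simp add: w_def a_minus_def)
        then show ?thesis using inj that lmod_homD(2)[OF r(1)] fD(2) by (auto simp: inj_on_def)
      qed
      then show False using f(2) r(1) unfolding split_mono_def by blast
    qed
    then obtain q where q: "q \<in> lmod_hom L C C" "\<forall>c\<in>carrier C. u (q c) = c"
      unfolding split_epi_def by auto
    have "u ` carrier C = carrier C"
    proof (rule subset_antisym)
      show "u ` carrier C \<subseteq> carrier C" using uD(2) by auto
      show "carrier C \<subseteq> u ` carrier C"
        using q lmod_homD(2)[OF q(1)] by (metis imageI subsetI)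
    qed
    then have "inj_on u (carrier C)"
      using khom_endo_inj_iff_surj[OF ks(3) fd_module.fin_dim[OF C] uD(1)] by simp
    then have u_inj: "c = \<zero>\<^bsub>C\<^esub>" if "c \<in> carrier C" "u c = \<zero>\<^bsub>C\<^esub>" for c
      using that unfolding khom_inj_iff[OF ks(3,3) uD(1)] by blast
    show "bij_betw s (carrier B) (carrier B)"
    proof (rule bij[OF s])
      fix b assume b: "b \<in> carrier B" "s b = \<zero>\<^bsub>B\<^esub>"
      then have "u (g b) = \<zero>\<^bsub>C\<^esub>" using u khom_zero[OF ks(2,3) gD(1)] by simp
      then have "g b = \<zero>\<^bsub>C\<^esub>" using u_inj[OF gD(2)[OF b(1)]] by simp
      then obtain a where "a \<in> carrier A" "b = f a" using fker[OF b(1)] by auto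
      then show "b = \<zero>\<^bsub>B\<^esub>" using sf b by simp
    qed
  qed
  with las show "minimal_left_almost_split L A B f" by (simp add: minimal_left_almost_split_def)
qed

section \<open>The maximal rank property in coordinates\<close>

declare One_nat_def [simp del]

lemma sum_triple:
  assumes "finite A" "\<And>i. finite (B i)" "\<And>i. finite (C i)"
  shows "(\<Sum>k\<in>(SIGMA i:A. B i \<times> C i). f k) = (\<Sum>i\<in>A. \<Sum>j\<in>B i. \<Sum>c\<in>C i. f (i, j, c))"
  using assms by (simp add: sum.Sigma sum.cartesian_product split_def)

text \<open>
  \<open>G i j a p\<close> are the entries of a linear map from the sum of the spaces \<open>k\<^sup>v\<close> with \<open>v = v i\<close>, over \<open>i\<close> and
  \<open>j \<in> {1..n i}\<close>, to \<open>k\<^sup>m\<close>. Subspaces of \<open>W\<^sub>i\<close> enter as images of idempotent matrices \<open>P i\<close> acting on the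
  index \<open>j\<close>. For \<open>g\<close> the tensor \<open>G\<close> consists of the entries of \<open>g\<close>, for \<open>f\<close> of those of the transpose of \<open>f\<close>.
\<close>

definition eval_tensor ::
    "nat \<Rightarrow> (nat \<Rightarrow> nat) \<Rightarrow> (nat \<Rightarrow> nat) \<Rightarrow> (nat \<Rightarrow> nat \<Rightarrow> nat \<Rightarrow> nat \<Rightarrow> 'k::field)
      \<Rightarrow> (nat \<Rightarrow> nat \<Rightarrow> nat \<Rightarrow> 'k) \<Rightarrow> nat \<Rightarrow> 'k"
  where "eval_tensor l n v G b p = (\<Sum>i\<in>{1..l}. \<Sum>j\<in>{1..n i}. \<Sum>a<v i. G i j a p * b i j a)"

text \<open>\<open>b\<close> stands for a point of the source and \<open>b P\<close> for its image
  under the idempotent. The alternatives are injectivity on the subspace of all \<open>b P\<close>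
  and surjectivity from it.\<close>

definition omnipresent ::
    "nat \<Rightarrow> (nat \<Rightarrow> nat) \<Rightarrow> (nat \<Rightarrow> nat) \<Rightarrow> nat \<Rightarrow> (nat \<Rightarrow> nat \<Rightarrow> nat \<Rightarrow> nat \<Rightarrow> 'k::field) \<Rightarrow> bool"
  where "omnipresent l n v m G \<longleftrightarrow>
    (\<forall>P. (\<forall>i\<in>{1..l}. \<forall>j\<in>{1..n i}. \<forall>j'\<in>{1..n i}. (\<Sum>j''\<in>{1..n i}. P i j j'' * P i j'' j') = P i j j') \<longrightarrow>
      (\<forall>b. (\<forall>p<m. eval_tensor l n v G (\<lambda>i j a. \<Sum>j'\<in>{1..n i}. b i j' a * P i j' j) p = 0) \<longrightarrow>
        (\<forall>i\<in>{1..l}. \<forall>j\<in>{1..n i}. \<forall>a<v i. (\<Sum>j'\<in>{1..n i}. b i j' a * P i j' j) = 0)) \<or>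
      (\<forall>y. \<exists>b. \<forall>p<m. eval_tensor l n v G (\<lambda>i j a. \<Sum>j'\<in>{1..n i}. b i j' a * P i j' j) p = y p))"

lemma eval_tensor_cong:
  assumes "\<And>i j a. i \<in> {1..l} \<Longrightarrow> j \<in> {1..n i} \<Longrightarrow> a < v i \<Longrightarrow> b i j a = b' i j a"
  shows "eval_tensor l n v G b p = eval_tensor l n v G b' p"
  unfolding eval_tensor_def using assms by (intro sum.cong refl) auto

text \<open>For matrices \<open>X i\<close>, the property applied to the idempotents \<open>Y i X i\<close> with generalized inverses \<open>Y i\<close>.\<close>

lemma omnipresent_factor:
  assumes omni: "omnipresent l n v m G"
  obtains Y :: "nat \<Rightarrow> nat \<Rightarrow> nat \<Rightarrow> 'k::field" where
    "\<And>i c j. i \<in> {1..l} \<Longrightarrow> c < d i \<Longrightarrow> j \<in> {1..n i} \<Longrightarrow>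
      (\<Sum>j'\<in>{1..n i}. X i c j' * (\<Sum>c'<d i. Y i j' c' * X i c' j)) = X i c j"
    "(\<forall>z. (\<forall>p<m. eval_tensor l n v G (\<lambda>i j a. \<Sum>c<d i. z i c a * X i c j) p = 0) \<longrightarrow>
        (\<forall>i\<in>{1..l}. \<forall>j\<in>{1..n i}. \<forall>a<v i. (\<Sum>c<d i. z i c a * X i c j) = 0)) \<or>
     (\<forall>y. \<exists>z. \<forall>p<m. eval_tensor l n v G (\<lambda>i j a. \<Sum>c<d i. z i c a * X i c j) p = y p)"
proof -
  have "\<exists>Y. \<forall>c\<in>{..<d i}. \<forall>j\<in>{1..n i}. (\<Sum>j'\<in>{1..n i}. X i c j' * (\<Sum>c'\<in>{..<d i}. Y j' c' * X i c' j)) = X i c j" for i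
    by (rule generalized_inverse) auto
  then have "\<exists>Y. \<forall>i. \<forall>c\<in>{..<d i}. \<forall>j\<in>{1..n i}.
      (\<Sum>j'\<in>{1..n i}. X i c j' * (\<Sum>c'<d i. Y i j' c' * X i c' j)) = X i c j"
    by (intro choice allI)
  then obtain Y where Y0: "\<And>i. \<forall>c\<in>{..<d i}. \<forall>j\<in>{1..n i}.
      (\<Sum>j'\<in>{1..n i}. X i c j' * (\<Sum>c'<d i. Y i j' c' * X i c' j)) = X i c j"
    by (elim exE) blast
  have Y: "(\<Sum>j'\<in>{1..n i}. X i c j' * (\<Sum>c'<d i. Y i j' c' * X i c' j)) = X i c j"
    if "c < d i" "j \<in> {1..n i}" for i c j
    using Y0[of i] that by blast
  define P where "P = (\<lambda>i j' j. \<Sum>c<d i. Y i j' c * X i c j)"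
  have idem: "(\<Sum>j''\<in>{1..n i}. P i j j'' * P i j'' j') = P i j j'"
    if "i \<in> {1..l}" "j \<in> {1..n i}" "j' \<in> {1..n i}" for i j j'
  proof -
    have "(\<Sum>j''\<in>{1..n i}. P i j j'' * P i j'' j') = (\<Sum>c<d i. Y i j c * (\<Sum>j''\<in>{1..n i}. X i c j'' * P i j'' j'))"
      unfolding P_def by (rule sum_mult_assoc[symmetric])
    also have "\<dots> = P i j j'" using Y that(3) by (simp add: P_def)
    finally show ?thesis .
  qed
  \<comment> \<open>\<open>b P = (b Y) X\<close> and \<open>(z X) P = z X\<close>: the image of
    \<open>P\<close> is exactly the set of all \<open>z X\<close>, so both alternatives carry
    over.\<close>
  have bP: "(\<Sum>j'\<in>{1..n i}. b i j' a * P i j' j) = (\<Sum>c<d i. (\<Sum>j'\<in>{1..n i}. b i j' a * Y i j' c) * X i c j)"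
    for b :: "nat \<Rightarrow> nat \<Rightarrow> nat \<Rightarrow> 'k" and i j a
    unfolding P_def by (rule sum_mult_assoc)
  have zX: "(\<Sum>j'\<in>{1..n i}. (\<Sum>c<d i. z i c a * X i c j') * P i j' j) = (\<Sum>c<d i. z i c a * X i c j)"
    if "j \<in> {1..n i}" for z :: "nat \<Rightarrow> nat \<Rightarrow> nat \<Rightarrow> 'k" and i j a
  proof -
    have "(\<Sum>j'\<in>{1..n i}. (\<Sum>c<d i. z i c a * X i c j') * P i j' j)
        = (\<Sum>c<d i. z i c a * (\<Sum>j'\<in>{1..n i}. X i c j' * P i j' j))"
      by (rule sum_mult_assoc[symmetric])
    also have "\<dots> = (\<Sum>c<d i. z i c a * X i c j)" using Y that by (simp add: P_def)
    finally show ?thesis .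
  qed
  have "(\<forall>b. (\<forall>p<m. eval_tensor l n v G (\<lambda>i j a. \<Sum>j'\<in>{1..n i}. b i j' a * P i j' j) p = 0) \<longrightarrow>
        (\<forall>i\<in>{1..l}. \<forall>j\<in>{1..n i}. \<forall>a<v i. (\<Sum>j'\<in>{1..n i}. b i j' a * P i j' j) = 0)) \<or>
      (\<forall>y. \<exists>b. \<forall>p<m. eval_tensor l n v G (\<lambda>i j a. \<Sum>j'\<in>{1..n i}. b i j' a * P i j' j) p = y p)"
    using omni[unfolded omnipresent_def, rule_format, of P] idem by simp
  then have "(\<forall>z. (\<forall>p<m. eval_tensor l n v G (\<lambda>i j a. \<Sum>c<d i. z i c a * X i c j) p = 0) \<longrightarrow>
        (\<forall>i\<in>{1..l}. \<forall>j\<in>{1..n i}. \<forall>a<v i. (\<Sum>c<d i. z i c a * X i c j) = 0)) \<or>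
     (\<forall>y. \<exists>z. \<forall>p<m. eval_tensor l n v G (\<lambda>i j a. \<Sum>c<d i. z i c a * X i c j) p = y p)"
  proof (elim disjE)
    assume inj: "\<forall>b. (\<forall>p<m. eval_tensor l n v G (\<lambda>i j a. \<Sum>j'\<in>{1..n i}. b i j' a * P i j' j) p = 0) \<longrightarrow>
        (\<forall>i\<in>{1..l}. \<forall>j\<in>{1..n i}. \<forall>a<v i. (\<Sum>j'\<in>{1..n i}. b i j' a * P i j' j) = 0)"
    show ?thesis
    proof (rule disjI1, intro allI impI)
      fix z :: "nat \<Rightarrow> nat \<Rightarrow> nat \<Rightarrow> 'k"
      assume z: "\<forall>p<m. eval_tensor l n v G (\<lambda>i j a. \<Sum>c<d i. z i c a * X i c j) p = 0"
      define b where "b = (\<lambda>i j a. \<Sum>c<d i. z i c a * X i c j)"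
      have b: "(\<Sum>j'\<in>{1..n i}. b i j' a * P i j' j) = (\<Sum>c<d i. z i c a * X i c j)" if "j \<in> {1..n i}" for i j a
        unfolding b_def by (rule zX[OF that])
      have "eval_tensor l n v G (\<lambda>i j a. \<Sum>j'\<in>{1..n i}. b i j' a * P i j' j) p
          = eval_tensor l n v G (\<lambda>i j a. \<Sum>c<d i. z i c a * X i c j) p" for p
        by (rule eval_tensor_cong) (rule b)
      then have "\<forall>p<m. eval_tensor l n v G (\<lambda>i j a. \<Sum>j'\<in>{1..n i}. b i j' a * P i j' j) p = 0"
        using z by simp
      then have "\<forall>i\<in>{1..l}. \<forall>j\<in>{1..n i}. \<forall>a<v i. (\<Sum>j'\<in>{1..n i}. b i j' a * P i j' j) = 0"
        using inj by (elim allE[of _ b]) simp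
      then show "\<forall>i\<in>{1..l}. \<forall>j\<in>{1..n i}. \<forall>a<v i. (\<Sum>c<d i. z i c a * X i c j) = 0"
        by (simp add: b)
    qed
  next
    assume surj: "\<forall>y. \<exists>b. \<forall>p<m. eval_tensor l n v G (\<lambda>i j a. \<Sum>j'\<in>{1..n i}. b i j' a * P i j' j) p = y p"
    show ?thesis
    proof (rule disjI2, intro allI)
      fix y :: "nat \<Rightarrow> 'k"
      obtain b where "\<forall>p<m. eval_tensor l n v G (\<lambda>i j a. \<Sum>j'\<in>{1..n i}. b i j' a * P i j' j) p = y p"
        using spec[OF surj, of y] by (elim exE)
      then show "\<exists>z. \<forall>p<m. eval_tensor l n v G (\<lambda>i j a. \<Sum>c<d i. z i c a * X i c j) p = y p"
        unfolding bP by (intro exI[of _ "\<lambda>i c a. \<Sum>j'\<in>{1..n i}. b i j' a * Y i j' c"])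
    qed
  qed
  with Y show thesis by (intro that[of Y])
qed

text \<open>A kernel vector \<open>b\<close> lies in the image of idempotents of rank at most \<open>v i\<close>, on which the map is
  therefore surjective without being injective.\<close>

lemma omnipresent_surjective_less:
  fixes G :: "nat \<Rightarrow> nat \<Rightarrow> nat \<Rightarrow> nat \<Rightarrow> 'k::field"
  assumes omni: "omnipresent l n v m G"
    and ker: "\<forall>p<m. eval_tensor l n v G b p = 0"
    and nz: "i0 \<in> {1..l}" "j0 \<in> {1..n i0}" "a0 < v i0" "b i0 j0 a0 \<noteq> 0"
  shows "m < (\<Sum>i = 1..l. (v i)\<^sup>2)"
proof -
  \<comment> \<open>Fixing \<open>a\<close> in \<open>b i j a\<close> gives \<open>v i\<close>
    vectors of \<open>W i\<close>; these rows span the \<open>W' i\<close> to which the property is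
    applied.\<close>
  define X where "X = (\<lambda>i a j. b i j a)"
  obtain Y :: "nat \<Rightarrow> nat \<Rightarrow> nat \<Rightarrow> 'k" where
    Y: "\<And>i c j. i \<in> {1..l} \<Longrightarrow> c < v i \<Longrightarrow> j \<in> {1..n i} \<Longrightarrow>
      (\<Sum>j'\<in>{1..n i}. X i c j' * (\<Sum>c'<v i. Y i j' c' * X i c' j)) = X i c j"
    and or: "(\<forall>z. (\<forall>p<m. eval_tensor l n v G (\<lambda>i j a. \<Sum>c<v i. z i c a * X i c j) p = 0) \<longrightarrow>
        (\<forall>i\<in>{1..l}. \<forall>j\<in>{1..n i}. \<forall>a<v i. (\<Sum>c<v i. z i c a * X i c j) = 0)) \<or>
     (\<forall>y. \<exists>z. \<forall>p<m. eval_tensor l n v G (\<lambda>i j a. \<Sum>c<v i. z i c a * X i c j) p = y p)"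
    by (rule omnipresent_factor[OF omni, of v X]) (rule that)
  \<comment> \<open>\<open>z0 = X Y\<close>, so that \<open>z0 X = X Y X = X\<close>: the kernel
    vector \<open>b\<close> itself is of the form \<open>z X\<close>.\<close>
  define z0 where "z0 = (\<lambda>i c a. \<Sum>j'\<in>{1..n i}. X i a j' * Y i j' c)"
  have z0: "(\<Sum>c<v i. z0 i c a * X i c j) = b i j a" if "i \<in> {1..l}" "a < v i" "j \<in> {1..n i}" for i j a
    using Y[OF that] unfolding z0_def sum_mult_assoc by (simp add: X_def)
  have ev0: "eval_tensor l n v G (\<lambda>i j a. \<Sum>c<v i. z0 i c a * X i c j) p = eval_tensor l n v G b p" for p
    by (rule eval_tensor_cong) (rule z0)
  \<comment> \<open>\<open>K\<close> indexes the variables of \<open>z \<mapsto> G (z X)\<close>,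
    and its size is the sum of the squares of the \<open>v i\<close>. On this source
    \<open>z0\<close> is a nonzero kernel vector, which makes the bound strict.\<close>
  define K where "K = (SIGMA i:{1..l}. {..<v i} \<times> {..<v i})"
  define M where "M = (\<lambda>p (i, c, a). \<Sum>j\<in>{1..n i}. G i j a p * X i c j)"
  have M: "(\<Sum>k\<in>K. M p k * (\<lambda>(i, c, a). z i c a) k) = eval_tensor l n v G (\<lambda>i j a. \<Sum>c<v i. z i c a * X i c j) p" for z p
  proof -
    have "(\<Sum>k\<in>K. M p k * (\<lambda>(i, c, a). z i c a) k)
        = (\<Sum>i\<in>{1..l}. \<Sum>c<v i. \<Sum>a<v i. (\<Sum>j\<in>{1..n i}. G i j a p * X i c j) * z i c a)"
      unfolding K_def by (subst sum_triple) (auto simp: M_def)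
    also have "\<dots> = eval_tensor l n v G (\<lambda>i j a. \<Sum>c<v i. z i c a * X i c j) p"
      unfolding eval_tensor_def
    proof (rule sum.cong[OF refl])
      fix i
      have "(\<Sum>c<v i. \<Sum>a<v i. (\<Sum>j\<in>{1..n i}. G i j a p * X i c j) * z i c a)
          = (\<Sum>c<v i. \<Sum>j\<in>{1..n i}. \<Sum>a<v i. G i j a p * (z i c a * X i c j))"
        by (rule sum.cong[OF refl], subst sum.swap) (simp add: sum_distrib_right sum_distrib_left mult.assoc mult.commute mult.left_commute)
      also have "\<dots> = (\<Sum>j\<in>{1..n i}. \<Sum>a<v i. \<Sum>c<v i. G i j a p * (z i c a * X i c j))"
        by (subst sum.swap, rule sum.cong[OF refl], rule sum.swap)
      finally show "(\<Sum>c<v i. \<Sum>a<v i. (\<Sum>j\<in>{1..n i}. G i j a p * X i c j) * z i c a)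
          = (\<Sum>j\<in>{1..n i}. \<Sum>a<v i. G i j a p * (\<Sum>c<v i. z i c a * X i c j))"
        by (simp add: sum_distrib_left)
    qed
    finally show ?thesis .
  qed
  have "\<not> (\<forall>z. (\<forall>p<m. eval_tensor l n v G (\<lambda>i j a. \<Sum>c<v i. z i c a * X i c j) p = 0) \<longrightarrow>
        (\<forall>i\<in>{1..l}. \<forall>j\<in>{1..n i}. \<forall>a<v i. (\<Sum>c<v i. z i c a * X i c j) = 0))"
  proof
    assume "\<forall>z. (\<forall>p<m. eval_tensor l n v G (\<lambda>i j a. \<Sum>c<v i. z i c a * X i c j) p = 0) \<longrightarrow>
        (\<forall>i\<in>{1..l}. \<forall>j\<in>{1..n i}. \<forall>a<v i. (\<Sum>c<v i. z i c a * X i c j) = 0)"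
    from spec[OF this, of z0] have "(\<Sum>c<v i0. z0 i0 c a0 * X i0 c j0) = 0"
      unfolding ev0 using ker nz by simp
    then show False using z0[OF nz(1,3,2)] nz(4) by simp
  qed
  with or have surj: "\<exists>z. \<forall>p<m. eval_tensor l n v G (\<lambda>i j a. \<Sum>c<v i. z i c a * X i c j) p = y p" for y
    by (elim disjE allE[of _ y]) simp_all
  have "\<exists>c<v i0. z0 i0 c a0 \<noteq> 0"
  proof (rule ccontr)
    assume "\<not> ?thesis"
    then have "(\<Sum>c<v i0. z0 i0 c a0 * X i0 c j0) = 0" by simp
    then show False using z0[OF nz(1,3,2)] nz(4) by simp
  qed
  then obtain c0 where c0: "c0 < v i0" "z0 i0 c0 a0 \<noteq> 0" by blast
  have "card {..<m} < card K"
  proof (rule surjective_not_injective_imp_less[where M = M and x = "\<lambda>(i, c, a). z0 i c a"])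
    show "finite K" unfolding K_def by auto
    fix y
    obtain z where "\<forall>p<m. eval_tensor l n v G (\<lambda>i j a. \<Sum>c<v i. z i c a * X i c j) p = y p"
      using surj[of y] by (elim exE)
    then have "\<forall>p\<in>{..<m}. (\<Sum>k\<in>K. M p k * (\<lambda>(i, c, a). z i c a) k) = y p" unfolding M by simp
    then show "\<exists>x. \<forall>p\<in>{..<m}. (\<Sum>k\<in>K. M p k * x k) = y p" by (rule exI[of _ "\<lambda>(i, c, a). z i c a"])
  next
    show "\<forall>p\<in>{..<m}. (\<Sum>k\<in>K. M p k * (case k of (i, c, a) \<Rightarrow> z0 i c a)) = 0"
      using M[of _ z0] ker ev0 by simp
    show "(i0, c0, a0) \<in> K" using nz c0 by (auto simp: K_def)
    show "(case (i0, c0, a0) of (i, c, a) \<Rightarrow> z0 i c a) \<noteq> 0" using c0 by simp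
  qed simp
  also have "card K = (\<Sum>i = 1..l. (v i)\<^sup>2)" by (simp add: K_def power2_eq_square)
  finally show ?thesis by simp
qed

text \<open>Independence of the \<open>d i\<close> vectors \<open>u i c\<close>, stated by a nonzero
  determinant so that along a line it can fail only at the zeros of a polynomial.\<close>

definition independent_frames :: "nat \<Rightarrow> (nat \<Rightarrow> nat) \<Rightarrow> (nat \<Rightarrow> nat) \<Rightarrow> (nat \<Rightarrow> nat \<Rightarrow> nat \<Rightarrow> 'k::field) \<Rightarrow> bool"
  where "independent_frames l d v u \<longleftrightarrow>
    (\<forall>i\<in>{1..l}. \<exists>\<phi>. det (mat (d i) (d i) (\<lambda>(r, c). \<Sum>a<v i. \<phi> r a * u i c a)) \<noteq> 0)"

definition frame_index :: "nat \<Rightarrow> (nat \<Rightarrow> nat) \<Rightarrow> (nat \<Rightarrow> nat) \<Rightarrow> (nat \<times> nat \<times> nat) set"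
  where "frame_index l n d = (SIGMA i:{1..l}. {1..n i} \<times> {..<d i})"

text \<open>For the tensor of \<open>g\<close>, the matrix of \<open>g\<close> on copies of
  subspaces with frames \<open>u i\<close>; for the tensor of \<open>f\<close>, the transposed
  matrix of \<open>f\<close> followed by the functionals with coefficients
  \<open>u i c\<close>.\<close>

definition frame_matrix ::
    "(nat \<Rightarrow> nat) \<Rightarrow> (nat \<Rightarrow> nat \<Rightarrow> nat \<Rightarrow> nat \<Rightarrow> 'k::field) \<Rightarrow> (nat \<Rightarrow> nat \<Rightarrow> nat \<Rightarrow> 'k) \<Rightarrow> nat \<Rightarrow> nat \<times> nat \<times> nat \<Rightarrow> 'k"
  where "frame_matrix v G u p = (\<lambda>(i, j, c). \<Sum>a<v i. G i j a p * u i c a)"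

lemma finite_frame_index: "finite (frame_index l n d)"
  by (auto simp: frame_index_def)

text \<open>The value is bilinear in \<open>u\<close> and \<open>x\<close>. For fixed
  \<open>x\<close> it is the tensor applied to \<open>u X\<close>, where the rows of
  \<open>X i c j = x (i, j, c)\<close> lie in \<open>W i\<close>; this exchanges the roles of
  \<open>V i\<close> and \<open>W i\<close>.\<close>

lemma frame_matrix_mult:
  "(\<Sum>k\<in>frame_index l n d. frame_matrix v G u p k * x k)
    = eval_tensor l n v G (\<lambda>i j a. \<Sum>c<d i. u i c a * x (i, j, c)) p"
proof -
  have "(\<Sum>k\<in>frame_index l n d. frame_matrix v G u p k * x k)
      = (\<Sum>i\<in>{1..l}. \<Sum>j\<in>{1..n i}. \<Sum>c<d i. (\<Sum>a<v i. G i j a p * u i c a) * x (i, j, c))"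
    unfolding frame_index_def by (subst sum_triple) (auto simp: frame_matrix_def)
  also have "\<dots> = eval_tensor l n v G (\<lambda>i j a. \<Sum>c<d i. u i c a * x (i, j, c)) p"
    unfolding eval_tensor_def by (simp only: sum_mult_assoc)
  finally show ?thesis .
qed

lemma independent_frames_kernel:
  assumes ind: "independent_frames l d v u" and i: "i \<in> {1..l}"
    and ker: "\<And>a. a < v i \<Longrightarrow> (\<Sum>c<d i. u i c a * x c) = 0" and c: "c < d i"
  shows "x c = 0"
proof -
  obtain \<phi> where "det (mat (d i) (d i) (\<lambda>(r, c). \<Sum>a<v i. \<phi> r a * u i c a)) \<noteq> 0"
    using ind i unfolding independent_frames_def by (elim ballE exE) auto
  then show ?thesis
    using injective_if_det_nonzero[where h = "\<lambda>c. c" and r = "d i" and K = "{..<d i}" and P = "{..<v i}"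
        and Y = \<phi> and M = "\<lambda>a c. u i c a" and x = x and k = c] ker c
    by (simp add: bij_betw_def)
qed

text \<open>The dichotomy for a fixed \<open>x\<close> comes from \<open>omnipresent_factor\<close>
  with the rows \<open>X i c\<close>. In its injective case \<open>u X = 0\<close>, and independence
  of the frame leaves \<open>X = 0\<close>; in its surjective case every target is reached by some
  \<open>u\<close>.\<close>

lemma omnipresent_generic:
  fixes G :: "nat \<Rightarrow> nat \<Rightarrow> nat \<Rightarrow> nat \<Rightarrow> 'k::alg_closed_field"
  assumes omni: "omnipresent l n v m G" and d: "\<And>i. i \<in> {1..l} \<Longrightarrow> d i \<le> v i"
  obtains u where "independent_frames l d v u"
    "(\<forall>x. (\<forall>p\<in>{..<m}. (\<Sum>k\<in>frame_index l n d. frame_matrix v G u p k * x k) = 0) \<longrightarrow>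
        (\<forall>k\<in>frame_index l n d. x k = 0)) \<or>
     (\<forall>y. \<exists>x. \<forall>p\<in>{..<m}. (\<Sum>k\<in>frame_index l n d. frame_matrix v G u p k * x k) = y p)"
proof -
  \<comment> \<open>\<open>exists_max_rank_parameter\<close> takes parameters as functions of a
    single index; \<open>un\<close> splits that index into three.\<close>
  define un :: "(nat \<times> nat \<times> nat \<Rightarrow> 'k) \<Rightarrow> nat \<Rightarrow> nat \<Rightarrow> nat \<Rightarrow> 'k" where "un = (\<lambda>u i c a. u (i, c, a))"
  have un_line: "un (\<lambda>e. u e + t * u' e) i c a = un u i c a + t * un u' i c a" for u u' t i c a
    by (simp add: un_def)
  let ?good = "\<lambda>u. independent_frames l d v (un u)"
  let ?M = "\<lambda>u. frame_matrix v G (un u)"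
  let ?K = "frame_index l n d"
  obtain u where "?good u" "(\<forall>x. (\<forall>p\<in>{..<m}. (\<Sum>k\<in>?K. ?M u p k * x k) = 0) \<longrightarrow> (\<forall>k\<in>?K. x k = 0)) \<or>
     (\<forall>y. \<exists>x. \<forall>p\<in>{..<m}. (\<Sum>k\<in>?K. ?M u p k * x k) = y p)"
  proof (rule exists_max_rank_parameter[of "{..<m}" ?K ?M ?good])
    show "?M (\<lambda>e. u e + t * u' e) p k = ?M u p k + t * ?M u' p k" for u u' t p k
      by (cases k) (simp add: frame_matrix_def un_line algebra_simps sum.distrib sum_distrib_left)
    show "\<exists>F. polyfun F \<and> F 0 \<noteq> 0 \<and> (\<forall>t. F t \<noteq> 0 \<longrightarrow> ?good (\<lambda>e. u e + t * u' e))" if good: "?good u" for u u'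
    proof -
      have "\<forall>i\<in>{1..l}. \<exists>\<phi>. det (mat (d i) (d i) (\<lambda>(r, c). \<Sum>a<v i. \<phi> r a * un u i c a)) \<noteq> 0"
        using good unfolding independent_frames_def .
      then have "\<exists>\<phi>. \<forall>i\<in>{1..l}. det (mat (d i) (d i) (\<lambda>(r, c). \<Sum>a<v i. \<phi> i r a * un u i c a)) \<noteq> 0"
        by (rule bchoice)
      then obtain \<phi> where \<phi>: "\<forall>i\<in>{1..l}. det (mat (d i) (d i) (\<lambda>(r, c). \<Sum>a<v i. \<phi> i r a * un u i c a)) \<noteq> 0"
        by (elim exE)
      define F where "F = (\<lambda>t. \<Prod>i\<in>{1..l}. det (mat (d i) (d i) (\<lambda>(r, c). \<Sum>a<v i. \<phi> i r a * (un u i c a + t * un u' i c a))))"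
      have "polyfun F"
        unfolding F_def by (intro polyfun_prod polyfun_det polyfun_sum polyfun_mult polyfun_const polyfun_add polyfun_id)
      moreover have "F 0 \<noteq> 0" using \<phi> by (simp add: F_def)
      moreover have "?good (\<lambda>e. u e + t * u' e)" if Ft: "F t \<noteq> 0" for t
        unfolding independent_frames_def un_line
      proof
        fix i assume "i \<in> {1..l}"
        then have "det (mat (d i) (d i) (\<lambda>(r, c). \<Sum>a<v i. \<phi> i r a * (un u i c a + t * un u' i c a))) \<noteq> 0"
          using Ft by (auto simp: F_def)
        then show "\<exists>\<phi>. det (mat (d i) (d i) (\<lambda>(r, c). \<Sum>a<v i. \<phi> r a * (un u i c a + t * un u' i c a))) \<noteq> 0"
          by (rule exI[of _ "\<phi> i"])
      qed
      ultimately show ?thesis by (intro exI[of _ F]) simp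
    qed
    \<comment> \<open>The first \<open>d i\<close> unit vectors are independent;
      \<open>d i \<le> v i\<close> enters here.\<close>
    show "\<exists>u. ?good u"
    proof (intro exI[of _ "\<lambda>(i, c, a). of_bool (c = a)"])
      have "det (mat (d i) (d i) (\<lambda>(r, c). \<Sum>a<v i. of_bool (r = a) * un (\<lambda>(i, c, a). of_bool (c = a)) i c a)) \<noteq> 0"
        if "i \<in> {1..l}" for i
        by (subst det_one_of_bool[of "\<lambda>x. x"]) (use d[OF that] in \<open>auto simp: un_def sum_of_bool_mult\<close>)
      then show "?good (\<lambda>(i, c, a). of_bool (c = a))"
        unfolding independent_frames_def by (intro ballI exI)
    qed
    fix x :: "nat \<times> nat \<times> nat \<Rightarrow> 'k"
    define X where "X = (\<lambda>i c j. x (i, j, c))"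
    have ev: "(\<Sum>k\<in>?K. ?M u p k * x k) = eval_tensor l n v G (\<lambda>i j a. \<Sum>c<d i. un u i c a * X i c j) p" for u p
      unfolding X_def by (rule frame_matrix_mult)
    have "(\<forall>z. (\<forall>p<m. eval_tensor l n v G (\<lambda>i j a. \<Sum>c<d i. z i c a * X i c j) p = 0) \<longrightarrow>
        (\<forall>i\<in>{1..l}. \<forall>j\<in>{1..n i}. \<forall>a<v i. (\<Sum>c<d i. z i c a * X i c j) = 0)) \<or>
     (\<forall>y. \<exists>z. \<forall>p<m. eval_tensor l n v G (\<lambda>i j a. \<Sum>c<d i. z i c a * X i c j) p = y p)"
      by (rule omnipresent_factor[OF omni, of d X])
    then show "(\<forall>y. \<exists>u. \<forall>p\<in>{..<m}. (\<Sum>k\<in>?K. ?M u p k * x k) = y p) \<or>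
      (\<forall>u. ?good u \<longrightarrow> (\<forall>p\<in>{..<m}. (\<Sum>k\<in>?K. ?M u p k * x k) = 0) \<longrightarrow> (\<forall>k\<in>?K. x k = 0))"
    proof (elim disjE)
      assume inj: "\<forall>z. (\<forall>p<m. eval_tensor l n v G (\<lambda>i j a. \<Sum>c<d i. z i c a * X i c j) p = 0) \<longrightarrow>
        (\<forall>i\<in>{1..l}. \<forall>j\<in>{1..n i}. \<forall>a<v i. (\<Sum>c<d i. z i c a * X i c j) = 0)"
      show ?thesis
      proof (rule disjI2, intro allI impI)
        fix u assume good: "?good u" and ker: "\<forall>p\<in>{..<m}. (\<Sum>k\<in>?K. ?M u p k * x k) = 0"
        have z: "\<forall>i\<in>{1..l}. \<forall>j\<in>{1..n i}. \<forall>a<v i. (\<Sum>c<d i. un u i c a * X i c j) = 0"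
          using spec[OF inj, of "un u"] ker unfolding ev by simp
        show "\<forall>k\<in>?K. x k = 0"
        proof
          fix k assume "k \<in> ?K"
          then obtain i j c where k: "k = (i, j, c)" "i \<in> {1..l}" "j \<in> {1..n i}" "c < d i"
            by (auto simp: frame_index_def)
          have "X i c j = 0"
            by (rule independent_frames_kernel[OF good k(2) _ k(4), of "\<lambda>c. X i c j"]) (use z k in auto)
          then show "x k = 0" by (simp add: X_def k)
        qed
      qed
    next
      assume surj: "\<forall>y. \<exists>z. \<forall>p<m. eval_tensor l n v G (\<lambda>i j a. \<Sum>c<d i. z i c a * X i c j) p = y p"
      show ?thesis
      proof (rule disjI1, rule allI)
        fix y :: "nat \<Rightarrow> 'k"
        obtain z where z: "\<forall>p<m. eval_tensor l n v G (\<lambda>i j a. \<Sum>c<d i. z i c a * X i c j) p = y p"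
          using spec[OF surj, of y] by (elim exE)
        have "un (\<lambda>(i, c, a). z i c a) = z" by (simp add: un_def)
        then show "\<exists>u. \<forall>p\<in>{..<m}. (\<Sum>k\<in>?K. ?M u p k * x k) = y p"
          unfolding ev using z by (intro exI[of _ "\<lambda>(i, c, a). z i c a"]) simp
      qed
    qed
  qed (auto simp: finite_frame_index)
  then show thesis by (intro that[of "un u"])
qed

section \<open>Direct sums\<close>

text \<open>A predicate on any record with these fields, so that the linear structure of a sum
  carrying an action of \<open>L\<close> can be treated apart from the action.\<close>

definition is_dir_sum ::
    "'i set \<Rightarrow> ('i \<Rightarrow> ('k::field, 'v, 'z) module_scheme) \<Rightarrow> ('k, 'i \<Rightarrow> 'v, 'y) module_scheme \<Rightarrow> bool"
  where "is_dir_sum I M N \<longleftrightarrow> carrier N = (\<Pi>\<^sub>E i\<in>I. carrier (M i)) \<and> zero N = (\<lambda>i\<in>I. \<zero>\<^bsub>M i\<^esub>) \<and>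
    add N = (\<lambda>v w. \<lambda>i\<in>I. v i \<oplus>\<^bsub>M i\<^esub> w i) \<and> smult N = (\<lambda>c v. \<lambda>i\<in>I. c \<odot>\<^bsub>M i\<^esub> v i)"

lemma is_dir_sum_lmod_dir_sum: "is_dir_sum I M (lmod_dir_sum I M)"
  by (simp add: is_dir_sum_def lmod_dir_sum_def dir_sum_def module.defs lmodule.defs)

lemma lact_lmod_dir_sum: "lact (lmod_dir_sum I M) x v = (\<lambda>i\<in>I. lact (M i) x (v i))"
  by (simp add: lmod_dir_sum_def dir_sum_def module.defs lmodule.defs)

locale direct_sum =
  fixes I :: "'i set" and M :: "'i \<Rightarrow> ('k::field, 'v, 'z) module_scheme" and N :: "('k, 'i \<Rightarrow> 'v, 'y) module_scheme"
  assumes sum: "is_dir_sum I M N" and fin: "finite I" and summand: "\<And>i. i \<in> I \<Longrightarrow> kspace (M i)"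
begin

lemma carrier_eq: "carrier N = (\<Pi>\<^sub>E i\<in>I. carrier (M i))"
  and zero_eq: "zero N = (\<lambda>i\<in>I. \<zero>\<^bsub>M i\<^esub>)"
  and add_eq: "v \<oplus>\<^bsub>N\<^esub> w = (\<lambda>i\<in>I. v i \<oplus>\<^bsub>M i\<^esub> w i)"
  and smult_eq: "c \<odot>\<^bsub>N\<^esub> v = (\<lambda>i\<in>I. c \<odot>\<^bsub>M i\<^esub> v i)"
  using sum by (auto simp: is_dir_sum_def)

lemma summand_simps:
  assumes "i \<in> I"
  shows "\<zero>\<^bsub>M i\<^esub> \<in> carrier (M i)"
    "x \<in> carrier (M i) \<Longrightarrow> y \<in> carrier (M i) \<Longrightarrow> x \<oplus>\<^bsub>M i\<^esub> y \<in> carrier (M i)"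
    "x \<in> carrier (M i) \<Longrightarrow> c \<odot>\<^bsub>M i\<^esub> x \<in> carrier (M i)"
    "x \<in> carrier (M i) \<Longrightarrow> x \<oplus>\<^bsub>M i\<^esub> \<zero>\<^bsub>M i\<^esub> = x"
    "x \<in> carrier (M i) \<Longrightarrow> \<zero>\<^bsub>M i\<^esub> \<oplus>\<^bsub>M i\<^esub> x = x"
    "c \<odot>\<^bsub>M i\<^esub> \<zero>\<^bsub>M i\<^esub> = \<zero>\<^bsub>M i\<^esub>"
    "x \<in> carrier (M i) \<Longrightarrow> 1 \<odot>\<^bsub>M i\<^esub> x = x"
    "x \<in> carrier (M i) \<Longrightarrow> 0 \<odot>\<^bsub>M i\<^esub> x = \<zero>\<^bsub>M i\<^esub>"
proof -
  interpret kspace "M i" by (rule summand[OF assms])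
  show "\<zero>\<^bsub>M i\<^esub> \<in> carrier (M i)" "c \<odot>\<^bsub>M i\<^esub> \<zero>\<^bsub>M i\<^esub> = \<zero>\<^bsub>M i\<^esub>" by simp_all
  show "x \<oplus>\<^bsub>M i\<^esub> y \<in> carrier (M i)" if "x \<in> carrier (M i)" "y \<in> carrier (M i)" using that by simp
  show "c \<odot>\<^bsub>M i\<^esub> x \<in> carrier (M i)" "x \<oplus>\<^bsub>M i\<^esub> \<zero>\<^bsub>M i\<^esub> = x" "\<zero>\<^bsub>M i\<^esub> \<oplus>\<^bsub>M i\<^esub> x = x"
    "1 \<odot>\<^bsub>M i\<^esub> x = x" "0 \<odot>\<^bsub>M i\<^esub> x = \<zero>\<^bsub>M i\<^esub>" if "x \<in> carrier (M i)" using that by simp_all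
qed

lemma component: "v \<in> carrier N \<Longrightarrow> i \<in> I \<Longrightarrow> v i \<in> carrier (M i)"
  by (auto simp: carrier_eq)

lemma restrict_closed: "(\<And>i. i \<in> I \<Longrightarrow> h i \<in> carrier (M i)) \<Longrightarrow> restrict h I \<in> carrier N"
  by (simp add: carrier_eq)

lemma kspace_sum: "kspace N"
proof (rule kspaceI)
  show "\<zero>\<^bsub>N\<^esub> \<in> carrier N" by (simp add: carrier_eq zero_eq summand_simps)
  show "x \<oplus>\<^bsub>N\<^esub> y \<in> carrier N" if "x \<in> carrier N" "y \<in> carrier N" for x y
    using that by (auto simp: carrier_eq add_eq intro!: summand_simps)
  show "c \<odot>\<^bsub>N\<^esub> x \<in> carrier N" if "x \<in> carrier N" for c x
    using that by (auto simp: carrier_eq smult_eq intro!: summand_simps)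
  show "x \<oplus>\<^bsub>N\<^esub> \<zero>\<^bsub>N\<^esub> = x" "1 \<odot>\<^bsub>N\<^esub> x = x" "0 \<odot>\<^bsub>N\<^esub> x = \<zero>\<^bsub>N\<^esub>" if "x \<in> carrier N" for x
  proof -
    have r: "restrict x I = x" using that unfolding carrier_eq by (rule PiE_restrict)
    show "x \<oplus>\<^bsub>N\<^esub> \<zero>\<^bsub>N\<^esub> = x"
      by (subst (2) r[symmetric]) (auto simp: add_eq zero_eq summand_simps component[OF that] intro!: restrict_ext)
    show "1 \<odot>\<^bsub>N\<^esub> x = x"
      by (subst (2) r[symmetric]) (auto simp: smult_eq summand_simps component[OF that] intro!: restrict_ext)
    show "0 \<odot>\<^bsub>N\<^esub> x = \<zero>\<^bsub>N\<^esub>"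
      by (auto simp: smult_eq zero_eq summand_simps component[OF that] intro!: restrict_ext)
  qed
  show "x \<oplus>\<^bsub>N\<^esub> y = y \<oplus>\<^bsub>N\<^esub> x" if "x \<in> carrier N" "y \<in> carrier N" for x y
  proof -
    have "x i \<oplus>\<^bsub>M i\<^esub> y i = y i \<oplus>\<^bsub>M i\<^esub> x i" if i: "i \<in> I" for i
    proof -
      interpret kspace "M i" by (rule summand[OF i])
      show ?thesis using component[OF \<open>x \<in> _\<close> i] component[OF \<open>y \<in> _\<close> i] by (rule M.a_comm)
    qed
    then show ?thesis by (auto simp: add_eq)
  qed
  show "x \<oplus>\<^bsub>N\<^esub> y \<oplus>\<^bsub>N\<^esub> z = x \<oplus>\<^bsub>N\<^esub> (y \<oplus>\<^bsub>N\<^esub> z)" if "x \<in> carrier N" "y \<in> carrier N" "z \<in> carrier N" for x y z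
  proof -
    have "x i \<oplus>\<^bsub>M i\<^esub> y i \<oplus>\<^bsub>M i\<^esub> z i = x i \<oplus>\<^bsub>M i\<^esub> (y i \<oplus>\<^bsub>M i\<^esub> z i)" if i: "i \<in> I" for i
    proof -
      interpret kspace "M i" by (rule summand[OF i])
      show ?thesis using component[OF \<open>x \<in> _\<close> i] component[OF \<open>y \<in> _\<close> i] component[OF \<open>z \<in> _\<close> i] by (rule M.a_assoc)
    qed
    then show ?thesis by (auto simp: add_eq)
  qed
  show "(a * b) \<odot>\<^bsub>N\<^esub> x = a \<odot>\<^bsub>N\<^esub> (b \<odot>\<^bsub>N\<^esub> x)" "(a + b) \<odot>\<^bsub>N\<^esub> x = a \<odot>\<^bsub>N\<^esub> x \<oplus>\<^bsub>N\<^esub> b \<odot>\<^bsub>N\<^esub> x"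
    if "x \<in> carrier N" for a b x
  proof -
    have "(a * b) \<odot>\<^bsub>M i\<^esub> x i = a \<odot>\<^bsub>M i\<^esub> (b \<odot>\<^bsub>M i\<^esub> x i)"
      "(a + b) \<odot>\<^bsub>M i\<^esub> x i = a \<odot>\<^bsub>M i\<^esub> x i \<oplus>\<^bsub>M i\<^esub> b \<odot>\<^bsub>M i\<^esub> x i" if i: "i \<in> I" for i
    proof -
      interpret kspace "M i" by (rule summand[OF i])
      show "(a * b) \<odot>\<^bsub>M i\<^esub> x i = a \<odot>\<^bsub>M i\<^esub> (b \<odot>\<^bsub>M i\<^esub> x i)"
        "(a + b) \<odot>\<^bsub>M i\<^esub> x i = a \<odot>\<^bsub>M i\<^esub> x i \<oplus>\<^bsub>M i\<^esub> b \<odot>\<^bsub>M i\<^esub> x i"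
        using component[OF \<open>x \<in> _\<close> i] by (simp_all add: smult_assoc smult_add_left)
    qed
    then show "(a * b) \<odot>\<^bsub>N\<^esub> x = a \<odot>\<^bsub>N\<^esub> (b \<odot>\<^bsub>N\<^esub> x)" "(a + b) \<odot>\<^bsub>N\<^esub> x = a \<odot>\<^bsub>N\<^esub> x \<oplus>\<^bsub>N\<^esub> b \<odot>\<^bsub>N\<^esub> x"
      by (auto simp: smult_eq add_eq)
  qed
  show "a \<odot>\<^bsub>N\<^esub> (x \<oplus>\<^bsub>N\<^esub> y) = a \<odot>\<^bsub>N\<^esub> x \<oplus>\<^bsub>N\<^esub> a \<odot>\<^bsub>N\<^esub> y" if "x \<in> carrier N" "y \<in> carrier N" for a x y
  proof -
    have "a \<odot>\<^bsub>M i\<^esub> (x i \<oplus>\<^bsub>M i\<^esub> y i) = a \<odot>\<^bsub>M i\<^esub> x i \<oplus>\<^bsub>M i\<^esub> a \<odot>\<^bsub>M i\<^esub> y i" if i: "i \<in> I" for i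
    proof -
      interpret kspace "M i" by (rule summand[OF i])
      show ?thesis using component[OF \<open>x \<in> _\<close> i] component[OF \<open>y \<in> _\<close> i] by (rule smult_add_right)
    qed
    then show ?thesis by (auto simp: smult_eq add_eq)
  qed
qed

lemma incl_hom: "i \<in> I \<Longrightarrow> dir_sum_incl I M i \<in> khom (M i) N"
  by (auto simp: khom_iff dir_sum_incl_def carrier_eq add_eq smult_eq summand_simps)

lemma incl_closed: "i \<in> I \<Longrightarrow> v \<in> carrier (M i) \<Longrightarrow> dir_sum_incl I M i v \<in> carrier N"
  using incl_hom by (auto simp: khom_iff)

lemma incl_apply: "k \<in> I \<Longrightarrow> dir_sum_incl I M i v k = (if k = i then v else \<zero>\<^bsub>M k\<^esub>)"
  by (simp add: dir_sum_incl_def)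

lemma functional_component: "i \<in> I \<Longrightarrow> functional (M i) \<phi> \<Longrightarrow> functional N (\<lambda>x. \<phi> (x i))"
  by (auto simp: functional_def add_eq smult_eq component)

lemma dual_basis_sum:
  assumes db: "\<And>i. i \<in> I \<Longrightarrow> dual_basis (M i) (J i) (e i) (\<xi> i)"
  shows "dual_basis N (Sigma I J) (\<lambda>(i, a). dir_sum_incl I M i (e i a)) (\<lambda>(i, a) x. \<xi> i a (x i))"
  unfolding dual_basis_def
proof (intro conjI ballI impI)
  note d = dual_basisD[OF db]
  show "finite (Sigma I J)" using fin d(1) by auto
  fix p assume p: "p \<in> Sigma I J"
  then obtain i a where ia: "p = (i, a)" "i \<in> I" "a \<in> J i" by auto
  show "(case p of (i, a) \<Rightarrow> dir_sum_incl I M i (e i a)) \<in> carrier N"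
    using ia d(2) by (simp add: incl_closed)
  show "functional N (case p of (i, a) \<Rightarrow> \<lambda>x. \<xi> i a (x i))"
    using ia d(3) by (simp add: functional_component)
  fix q assume q: "q \<in> Sigma I J"
  then obtain i' a' where ia': "q = (i', a')" "i' \<in> I" "a' \<in> J i'" by auto
  interpret kspace "M i" using ia(2) by (rule summand)
  show "(case p of (i, a) \<Rightarrow> \<lambda>x. \<xi> i a (x i)) (case q of (i, a) \<Rightarrow> dir_sum_incl I M i (e i a)) = of_bool (p = q)"
    using ia ia' functional_zero[OF d(3)[OF ia(2,3)]] d(4)[OF ia(2,3), of a']
    by (cases "i' = i") (auto simp: incl_apply)
next
  fix x assume x: "x \<in> carrier N" and z: "\<forall>p\<in>Sigma I J. (case p of (i, a) \<Rightarrow> \<lambda>x. \<xi> i a (x i)) x = 0"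
  have "x i = \<zero>\<^bsub>M i\<^esub>" if i: "i \<in> I" for i
  proof (rule dual_basisD(5)[OF db[OF i] component[OF x i]])
    fix a assume "a \<in> J i"
    then show "\<xi> i a (x i) = 0" using bspec[OF z, of "(i, a)"] i by simp
  qed
  then have "restrict x I = \<zero>\<^bsub>N\<^esub>" unfolding zero_eq by (rule restrict_ext)
  moreover have "restrict x I = x" using x unfolding carrier_eq by (rule PiE_restrict)
  ultimately show "x = \<zero>\<^bsub>N\<^esub>" by simp
qed

end

lemma khom_eq_on_basis:
  assumes "kspace N" "kspace P" and h: "h \<in> khom N P" and h': "h' \<in> khom N P" and db: "dual_basis N I e \<xi>"
    and eq: "\<And>a. a \<in> I \<Longrightarrow> h (e a) = h' (e a)" and x: "x \<in> carrier N"
  shows "h x = h' x"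
proof -
  interpret N: kspace N by fact
  interpret P: kspace P by fact
  note d = dual_basisD[OF db]
  have "h x = comb P I (\<lambda>a. \<xi> a x) (\<lambda>a. h (e a))"
    using hom_comb[OF assms(1,2) h, of I e "\<lambda>a. \<xi> a x"] N.dual_basis_expand[OF db x] d by simp
  also have "\<dots> = comb P I (\<lambda>a. \<xi> a x) (\<lambda>a. h' (e a))"
    using eq h h' d(2) by (intro P.comb_cong) (auto simp: khom_iff)
  also have "\<dots> = h' x"
    using hom_comb[OF assms(1,2) h', of I e "\<lambda>a. \<xi> a x"] N.dual_basis_expand[OF db x] d by simp
  finally show ?thesis .
qed

lemma fd_module_lmod_dir_sum:
  fixes I :: "'i set" and M :: "'i \<Rightarrow> ('k::field, 'v, 'r) lmodule"
  assumes fin: "finite I" and M: "\<And>i. i \<in> I \<Longrightarrow> fd_module L (M i)"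
  shows "fd_module L (lmod_dir_sum I M)" (is "fd_module L ?N")
proof -
  interpret direct_sum I M ?N
    by (rule direct_sum.intro[OF is_dir_sum_lmod_dir_sum fin fd_module_kspace[OF M]])
  interpret N: kspace ?N by (rule kspace_sum)
  have "\<exists>e \<xi>. dual_basis (M i) {..<vdim (M i)} e \<xi>" if "i \<in> I" for i
    by (rule kspace.dual_basis_exists[OF summand[OF that] fd_module.fin_dim[OF M[OF that]]])
  then have "\<exists>e. \<forall>i\<in>I. \<exists>\<xi>. dual_basis (M i) {..<vdim (M i)} (e i) \<xi>" by (intro bchoice ballI)
  then obtain e where "\<forall>i\<in>I. \<exists>\<xi>. dual_basis (M i) {..<vdim (M i)} (e i) \<xi>" by (elim exE)
  then have "\<exists>\<xi>. \<forall>i\<in>I. dual_basis (M i) {..<vdim (M i)} (e i) (\<xi> i)" by (rule bchoice)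
  then obtain \<xi> where db: "\<And>i. i \<in> I \<Longrightarrow> dual_basis (M i) {..<vdim (M i)} (e i) (\<xi> i)" by (elim exE) blast
  have fd: "vectorspace.fin_dim class_ring ?N"
    by (rule N.dual_basis_fin_dim[OF dual_basis_sum[OF db]])
  note lact = lact_lmod_dir_sum
  show ?thesis
  proof (intro fd_module.intro fd_module_axioms.intro N.vectorspace_axioms fd)
    fix x assume x: "x \<in> carrier L"
    show "lact ?N x \<in> khom ?N ?N"
      unfolding khom_iff lact
      using x by (auto simp: add_eq smult_eq component lact_closed[OF M] lact_add_right[OF M]
          lact_smult_right[OF M] intro!: restrict_closed restrict_ext)
    fix y v assume y: "y \<in> carrier L" and v: "v \<in> carrier ?N"
    show "lact ?N (x \<oplus>\<^bsub>L\<^esub> y) v = lact ?N x v \<oplus>\<^bsub>?N\<^esub> lact ?N y v"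
      using x y by (auto simp: lact add_eq fun_eq_iff fd_module.lact_add[OF M] component[OF v])
    show "lact ?N (x \<otimes>\<^bsub>L\<^esub> y) v = lact ?N x (lact ?N y v)"
      using x y by (auto simp: lact fun_eq_iff fd_module.lact_mult[OF M] component[OF v])
  next
    fix c x v assume x: "x \<in> carrier L" and v: "v \<in> carrier ?N"
    show "lact ?N (c \<odot>\<^bsub>L\<^esub> x) v = c \<odot>\<^bsub>?N\<^esub> lact ?N x v"
      using x by (auto simp: lact smult_eq fun_eq_iff fd_module.lact_smult[OF M] component[OF v])
  next
    fix v assume v: "v \<in> carrier ?N"
    show "lact ?N \<one>\<^bsub>L\<^esub> v = v"
      using v by (auto simp: lact fun_eq_iff fd_module.lact_one[OF M] component[OF v] carrier_eq[symmetric] PiE_arb[OF v[unfolded carrier_eq]])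
  qed
qed

section \<open>The middle term\<close>

locale middle =
  fixes L :: "('k::field, 'r) module" and l :: nat and n :: "nat \<Rightarrow> nat" and V :: "nat \<Rightarrow> ('k, 'v, 'r) lmodule"
  assumes V_mod: "\<And>i. i \<in> {1..l} \<Longrightarrow> fd_module L (V i)"
begin

definition v :: "nat \<Rightarrow> nat" where "v i = vdim (V i)"
definition B :: "('k, nat \<Rightarrow> nat \<Rightarrow> 'v, 'r) lmodule" where "B = middle_module l n V"

definition incl :: "nat \<Rightarrow> nat \<Rightarrow> 'v \<Rightarrow> nat \<Rightarrow> nat \<Rightarrow> 'v"
  where "incl i j x = dir_sum_incl {1..l} (\<lambda>k. lmod_power (V k) (n k)) i (dir_sum_incl {1..n i} (\<lambda>_. V i) j x)"

lemma V_space: "i \<in> {1..l} \<Longrightarrow> kspace (V i)"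
  using V_mod fd_module_kspace by blast

lemma power_mod: "i \<in> {1..l} \<Longrightarrow> fd_module L (lmod_power (V i) (n i))"
  unfolding lmod_power_def by (rule fd_module_lmod_dir_sum) (auto intro: V_mod)

lemma B_mod: "fd_module L B"
  unfolding B_def middle_module_def by (rule fd_module_lmod_dir_sum) (auto intro: power_mod)

lemma power_sum: "i \<in> {1..l} \<Longrightarrow> direct_sum {1..n i} (\<lambda>_. V i) (lmod_power (V i) (n i))"
  by (auto simp: direct_sum_def lmod_power_def is_dir_sum_lmod_dir_sum V_space)

lemma B_sum: "direct_sum {1..l} (\<lambda>k. lmod_power (V k) (n k)) B"
  unfolding B_def middle_module_def
  by (rule direct_sum.intro[OF is_dir_sum_lmod_dir_sum finite_atLeastAtMost fd_module_kspace[OF power_mod]])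

lemma B_carrier: "carrier B = (\<Pi>\<^sub>E i\<in>{1..l}. \<Pi>\<^sub>E j\<in>{1..n i}. carrier (V i))"
  unfolding direct_sum.carrier_eq[OF B_sum] by (intro PiE_cong) (rule direct_sum.carrier_eq[OF power_sum])

lemma B_component: "b \<in> carrier B \<Longrightarrow> i \<in> {1..l} \<Longrightarrow> j \<in> {1..n i} \<Longrightarrow> b i j \<in> carrier (V i)"
  unfolding B_carrier by (auto dest!: PiE_mem)

lemma B_eqI:
  assumes "b \<in> carrier B" "b' \<in> carrier B" "\<And>i j. i \<in> {1..l} \<Longrightarrow> j \<in> {1..n i} \<Longrightarrow> b i j = b' i j"
  shows "b = b'"
proof (rule PiE_ext[OF assms(1,2)[unfolded B_carrier]])
  fix i assume i: "i \<in> {1..l}"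
  show "b i = b' i"
    by (rule PiE_ext[OF PiE_mem[OF assms(1)[unfolded B_carrier] i] PiE_mem[OF assms(2)[unfolded B_carrier] i]])
      (rule assms(3)[OF i])
qed

lemma B_add: "i \<in> {1..l} \<Longrightarrow> j \<in> {1..n i} \<Longrightarrow> (b \<oplus>\<^bsub>B\<^esub> b') i j = b i j \<oplus>\<^bsub>V i\<^esub> b' i j"
  and B_smult: "i \<in> {1..l} \<Longrightarrow> j \<in> {1..n i} \<Longrightarrow> (c \<odot>\<^bsub>B\<^esub> b) i j = c \<odot>\<^bsub>V i\<^esub> b i j"
  and B_zero: "i \<in> {1..l} \<Longrightarrow> j \<in> {1..n i} \<Longrightarrow> \<zero>\<^bsub>B\<^esub> i j = \<zero>\<^bsub>V i\<^esub>"
  by (simp_all add: direct_sum.add_eq[OF B_sum] direct_sum.add_eq[OF power_sum] direct_sum.smult_eq[OF B_sum]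
      direct_sum.smult_eq[OF power_sum] direct_sum.zero_eq[OF B_sum] direct_sum.zero_eq[OF power_sum])

lemma B_lact: "i \<in> {1..l} \<Longrightarrow> j \<in> {1..n i} \<Longrightarrow> lact B x b i j = lact (V i) x (b i j)"
  by (simp add: B_def middle_module_def lmod_power_def lact_lmod_dir_sum)

lemma incl_hom: "i \<in> {1..l} \<Longrightarrow> j \<in> {1..n i} \<Longrightarrow> incl i j \<in> khom (V i) B"
  unfolding incl_def
  by (rule khom_comp[OF direct_sum.incl_hom[OF power_sum] direct_sum.incl_hom[OF B_sum]])

lemma incl_apply:
  assumes "i \<in> {1..l}" "j \<in> {1..n i}" "i' \<in> {1..l}" "j' \<in> {1..n i'}"
  shows "incl i j x i' j' = (if i' = i \<and> j' = j then x else \<zero>\<^bsub>V i'\<^esub>)"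
  using assms by (auto simp: incl_def direct_sum.incl_apply[OF B_sum] direct_sum.incl_apply[OF power_sum]
      direct_sum.zero_eq[OF power_sum])

lemma right_component_incl: "right_component l n V g i j x = g (incl i j x)"
  by (simp add: right_component_def incl_def)

lemma exists_dual_bases: "\<exists>\<epsilon> \<zeta>. \<forall>i\<in>{1..l}. dual_basis (V i) {..<v i} (\<epsilon> i) (\<zeta> i)"
proof -
  have "\<forall>i\<in>{1..l}. \<exists>e. \<exists>\<xi>. dual_basis (V i) {..<v i} e \<xi>"
    using kspace.dual_basis_exists[OF V_space fd_module.fin_dim[OF V_mod]] by (simp add: v_def)
  then have "\<exists>\<epsilon>. \<forall>i\<in>{1..l}. \<exists>\<xi>. dual_basis (V i) {..<v i} (\<epsilon> i) \<xi>" by (rule bchoice)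
  then obtain \<epsilon> where "\<forall>i\<in>{1..l}. \<exists>\<xi>. dual_basis (V i) {..<v i} (\<epsilon> i) \<xi>" by (elim exE)
  then show ?thesis by (intro exI[of _ \<epsilon>], rule bchoice)
qed

context
  fixes J :: "nat \<Rightarrow> 'a set" and \<epsilon> \<zeta> assumes db: "\<And>i. i \<in> {1..l} \<Longrightarrow> dual_basis (V i) (J i) (\<epsilon> i) (\<zeta> i)"
begin

lemma dual_basis_B:
  "dual_basis B (SIGMA i:{1..l}. {1..n i} \<times> J i) (\<lambda>(i, j, a). incl i j (\<epsilon> i a)) (\<lambda>(i, j, a) b. \<zeta> i a (b i j))"
proof -
  have "dual_basis (lmod_power (V i) (n i)) ({1..n i} \<times> J i)
      (\<lambda>(j, a). dir_sum_incl {1..n i} (\<lambda>_. V i) j (\<epsilon> i a)) (\<lambda>(j, a) x. \<zeta> i a (x j))" if i: "i \<in> {1..l}" for i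
    using direct_sum.dual_basis_sum[OF power_sum[OF i], of "\<lambda>_. J i" "\<lambda>_. \<epsilon> i" "\<lambda>_. \<zeta> i"] db[OF i] by simp
  from direct_sum.dual_basis_sum[OF B_sum this] show ?thesis
    by (simp add: incl_def split_def)
qed

lemma functional_B:
  assumes "functional B \<phi>" "b \<in> carrier B"
  shows "\<phi> b = (\<Sum>i\<in>{1..l}. \<Sum>j\<in>{1..n i}. \<phi> (incl i j (b i j)))"
proof -
  interpret B: kspace B by (rule fd_module_kspace[OF B_mod])
  have fin: "finite (J i)" if "i \<in> {1..l}" for i using dual_basisD(1)[OF db[OF that]] .
  have "\<phi> b = (\<Sum>(i, j, a)\<in>(SIGMA i:{1..l}. {1..n i} \<times> J i). \<zeta> i a (b i j) * \<phi> (incl i j (\<epsilon> i a)))"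
    using B.functional_expand[OF dual_basis_B assms] by (simp add: split_def)
  also have "\<dots> = (\<Sum>i\<in>{1..l}. \<Sum>j\<in>{1..n i}. \<Sum>a\<in>J i. \<zeta> i a (b i j) * \<phi> (incl i j (\<epsilon> i a)))"
    using fin by (simp add: sum.Sigma sum.cartesian_product split_def)
  also have "\<dots> = (\<Sum>i\<in>{1..l}. \<Sum>j\<in>{1..n i}. \<phi> (incl i j (b i j)))"
  proof (intro sum.cong refl)
    fix i j assume ij: "i \<in> {1..l}" "j \<in> {1..n i}"
    interpret kspace "V i" using ij(1) by (rule V_space)
    show "(\<Sum>a\<in>J i. \<zeta> i a (b i j) * \<phi> (incl i j (\<epsilon> i a))) = \<phi> (incl i j (b i j))"
      using functional_expand[OF db[OF ij(1)] functional_comp[OF assms(1) incl_hom[OF ij]] B_component[OF assms(2) ij]]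
      by simp
  qed
  finally show ?thesis .
qed

end

text \<open>On \<open>V i \<otimes> W i\<close> this is the identity tensored with the map that
  sends the basis vector \<open>j'\<close> to the combination of the basis vectors \<open>j\<close>
  with coefficients \<open>P i j' j\<close>: matrices act on row vectors. Scalar entries make it
  linear over \<open>L\<close>.\<close>

definition mat_endo :: "(nat \<Rightarrow> nat \<Rightarrow> nat \<Rightarrow> 'k) \<Rightarrow> (nat \<Rightarrow> nat \<Rightarrow> 'v) \<Rightarrow> nat \<Rightarrow> nat \<Rightarrow> 'v"
  where "mat_endo P b = (\<lambda>i\<in>{1..l}. \<lambda>j\<in>{1..n i}. comb (V i) {1..n i} (\<lambda>j'. P i j' j) (b i))"

lemma mat_endo_apply:
  "i \<in> {1..l} \<Longrightarrow> j \<in> {1..n i} \<Longrightarrow> mat_endo P b i j = comb (V i) {1..n i} (\<lambda>j'. P i j' j) (b i)"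
  by (simp add: mat_endo_def)

lemma mat_endo_closed:
  assumes "b \<in> carrier B"
  shows "mat_endo P b \<in> carrier B"
  unfolding B_carrier mat_endo_def
proof (intro restrict_PiE_iff[THEN iffD2] ballI)
  fix i j assume ij: "i \<in> {1..l}" "j \<in> {1..n i}"
  show "comb (V i) {1..n i} (\<lambda>j'. P i j' j) (b i) \<in> carrier (V i)"
    by (rule kspace.comb_closed[OF V_space[OF ij(1)]]) (rule B_component[OF assms ij(1)])
qed

lemma functional_mat_endo:
  assumes "b \<in> carrier B" "i \<in> {1..l}" "j \<in> {1..n i}" "functional (V i) \<phi>"
  shows "\<phi> (mat_endo P b i j) = (\<Sum>j'\<in>{1..n i}. P i j' j * \<phi> (b i j'))"
  unfolding mat_endo_apply[OF assms(2,3)]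
  by (rule kspace.functional_comb[OF V_space[OF assms(2)] assms(4)]) (rule B_component[OF assms(1,2)])

text \<open>Coordinates are functionals and separate points; this reduces identities between vectors
  of \<open>V i\<close> to identities between finite sums of scalars.\<close>

lemma V_eqI:
  assumes "i \<in> {1..l}" "x \<in> carrier (V i)" "y \<in> carrier (V i)" "\<And>\<phi>. functional (V i) \<phi> \<Longrightarrow> \<phi> x = \<phi> y"
  shows "x = y"
proof -
  obtain e \<xi> where db: "dual_basis (V i) {..<v i} e \<xi>" using exists_dual_bases assms(1) by blast
  show ?thesis
    by (rule kspace.dual_basis_eqI[OF V_space[OF assms(1)] db assms(2,3)])
      (rule assms(4), rule dual_basisD(3)[OF db])
qed

lemma mat_endo_hom: "mat_endo P \<in> lmod_hom L B B"
proof (rule lmod_homI)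
  interpret B: kspace B by (rule fd_module_kspace[OF B_mod])
  fix b assume b: "b \<in> carrier B"
  show "mat_endo P b \<in> carrier B" by (rule mat_endo_closed[OF b])
  show "mat_endo P (c \<odot>\<^bsub>B\<^esub> b) = c \<odot>\<^bsub>B\<^esub> mat_endo P b" for c
  proof (rule B_eqI)
    fix i j assume ij: "i \<in> {1..l}" "j \<in> {1..n i}"
    interpret kspace "V i" using ij(1) by (rule V_space)
    show "mat_endo P (c \<odot>\<^bsub>B\<^esub> b) i j = (c \<odot>\<^bsub>B\<^esub> mat_endo P b) i j"
    proof (rule V_eqI[OF ij(1)])
      fix \<phi> assume \<phi>: "functional (V i) \<phi>"
      show "\<phi> (mat_endo P (c \<odot>\<^bsub>B\<^esub> b) i j) = \<phi> ((c \<odot>\<^bsub>B\<^esub> mat_endo P b) i j)"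
        using ij b \<phi> by (simp add: functional_mat_endo B_smult functional_smult[OF \<phi>] B_component mat_endo_closed
            sum_distrib_left mult.left_commute)
    qed (use ij b in \<open>auto intro!: B_component mat_endo_closed\<close>)
  qed (use b in \<open>auto intro!: mat_endo_closed\<close>)
  show "mat_endo P (lact B x b) = lact B x (mat_endo P b)" if x: "x \<in> carrier L" for x
  proof (rule B_eqI)
    fix i j assume ij: "i \<in> {1..l}" "j \<in> {1..n i}"
    have "lact (V i) x (comb (V i) {1..n i} (\<lambda>j'. P i j' j) (b i))
        = comb (V i) {1..n i} (\<lambda>j'. P i j' j) (\<lambda>j'. lact (V i) x (b i j'))"
      using ij b B_component by (intro hom_comb V_space fd_module.lact_hom[OF V_mod x]) auto
    also have "\<dots> = comb (V i) {1..n i} (\<lambda>j'. P i j' j) (lact B x b i)"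
      using ij b x by (intro kspace.comb_cong[OF V_space]) (auto simp: B_lact B_component intro!: lact_closed[OF V_mod])
    finally show "mat_endo P (lact B x b) i j = lact B x (mat_endo P b) i j"
      using ij by (simp add: B_lact mat_endo_apply)
  qed (use b x in \<open>auto intro!: mat_endo_closed lact_closed[OF B_mod]\<close>)
  fix b' assume b': "b' \<in> carrier B"
  show "mat_endo P (b \<oplus>\<^bsub>B\<^esub> b') = mat_endo P b \<oplus>\<^bsub>B\<^esub> mat_endo P b'"
  proof (rule B_eqI)
    fix i j assume ij: "i \<in> {1..l}" "j \<in> {1..n i}"
    interpret kspace "V i" using ij(1) by (rule V_space)
    show "mat_endo P (b \<oplus>\<^bsub>B\<^esub> b') i j = (mat_endo P b \<oplus>\<^bsub>B\<^esub> mat_endo P b') i j"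
    proof (rule V_eqI[OF ij(1)])
      fix \<phi> assume \<phi>: "functional (V i) \<phi>"
      show "\<phi> (mat_endo P (b \<oplus>\<^bsub>B\<^esub> b') i j) = \<phi> ((mat_endo P b \<oplus>\<^bsub>B\<^esub> mat_endo P b') i j)"
        using ij b b' \<phi> by (simp add: functional_mat_endo B_add functional_add[OF \<phi>] B_component mat_endo_closed
            sum.distrib distrib_left)
    qed (use ij b b' in \<open>auto intro!: B_component mat_endo_closed\<close>)
  qed (use b b' in \<open>auto intro!: mat_endo_closed\<close>)
qed

lemma mat_endo_idem:
  assumes P: "\<And>i j j'. i \<in> {1..l} \<Longrightarrow> j \<in> {1..n i} \<Longrightarrow> j' \<in> {1..n i} \<Longrightarrow>
      (\<Sum>j''\<in>{1..n i}. P i j j'' * P i j'' j') = P i j j'"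
    and b: "b \<in> carrier B"
  shows "mat_endo P (mat_endo P b) = mat_endo P b"
proof (rule B_eqI)
  fix i j assume ij: "i \<in> {1..l}" "j \<in> {1..n i}"
  show "mat_endo P (mat_endo P b) i j = mat_endo P b i j"
  proof (rule V_eqI[OF ij(1)])
    fix \<phi> assume \<phi>: "functional (V i) \<phi>"
    have "\<phi> (mat_endo P (mat_endo P b) i j) = (\<Sum>j'\<in>{1..n i}. P i j' j * (\<Sum>j''\<in>{1..n i}. P i j'' j' * \<phi> (b i j'')))"
      using ij b \<phi> by (simp add: functional_mat_endo mat_endo_closed)
    also have "\<dots> = (\<Sum>j''\<in>{1..n i}. (\<Sum>j'\<in>{1..n i}. P i j' j * P i j'' j') * \<phi> (b i j''))"
      by (rule sum_mult_assoc)
    also have "\<dots> = (\<Sum>j''\<in>{1..n i}. (\<Sum>j'\<in>{1..n i}. P i j'' j' * P i j' j) * \<phi> (b i j''))"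
      by (simp add: mult.commute)
    also have "\<dots> = \<phi> (mat_endo P b i j)"
      using P ij b \<phi> by (simp add: functional_mat_endo)
    finally show "\<phi> (mat_endo P (mat_endo P b) i j) = \<phi> (mat_endo P b i j)" .
  qed (use ij b in \<open>auto intro!: B_component mat_endo_closed\<close>)
qed (use b in \<open>auto intro!: mat_endo_closed\<close>)

end

section \<open>Almost split morphisms are omnipresent\<close>

context middle
begin

context
  fixes \<epsilon> \<zeta> assumes db: "\<And>i. i \<in> {1..l} \<Longrightarrow> dual_basis (V i) {..<v i} (\<epsilon> i) (\<zeta> i)"
begin

definition B_index :: "(nat \<times> nat \<times> nat) set" where "B_index = (SIGMA i:{1..l}. {1..n i} \<times> {..<v i})"
definition B_basis :: "nat \<times> nat \<times> nat \<Rightarrow> nat \<Rightarrow> nat \<Rightarrow> 'v" where "B_basis = (\<lambda>(i, j, a). incl i j (\<epsilon> i a))"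
definition B_coord :: "nat \<times> nat \<times> nat \<Rightarrow> (nat \<Rightarrow> nat \<Rightarrow> 'v) \<Rightarrow> 'k" where "B_coord = (\<lambda>(i, j, a) b. \<zeta> i a (b i j))"

lemma db_B: "dual_basis B B_index B_basis B_coord"
  unfolding B_index_def B_basis_def B_coord_def by (rule dual_basis_B[OF db])

lemma finite_B_index: "finite B_index"
  by (rule dual_basisD(1)[OF db_B])

lemma eval_tensor_B_index: "eval_tensor l n v G b p = (\<Sum>k\<in>B_index. (\<lambda>(i, j, a). G i j a p * b i j a) k)"
  unfolding B_index_def eval_tensor_def by (subst sum_triple) auto

lemma coord_mat_endo:
  assumes "b \<in> carrier B" "i \<in> {1..l}" "j \<in> {1..n i}" "a < v i"
  shows "\<zeta> i a (mat_endo P b i j) = (\<Sum>j'\<in>{1..n i}. \<zeta> i a (b i j') * P i j' j)"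
  using functional_mat_endo[OF assms(1-3) dual_basisD(3)[OF db[OF assms(2)]], of a P] assms(4)
  by (simp add: mult.commute)

lemma functional_eval:
  assumes "functional B \<phi>" "b \<in> carrier B"
  shows "\<phi> b = (\<Sum>i\<in>{1..l}. \<Sum>j\<in>{1..n i}. \<Sum>a<v i. \<phi> (incl i j (\<epsilon> i a)) * \<zeta> i a (b i j))"
proof -
  have "\<phi> b = (\<Sum>k\<in>B_index. B_coord k b * \<phi> (B_basis k))"
    by (rule kspace.functional_expand[OF fd_module_kspace[OF B_mod] db_B assms])
  then show ?thesis
    unfolding B_index_def by (subst (asm) sum_triple) (auto simp: B_coord_def B_basis_def mult.commute)
qed

text \<open>This is \<open>minimal_right_idempotent\<close> for \<open>mat_endo P\<close>, read in
  coordinates: the index triples of the tensor are the coordinates on \<open>B\<close>, and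
  \<open>b P\<close> collects those of the image under the idempotent.\<close>

lemma omnipresent_right:
  assumes C: "fd_module L C" and g: "minimal_right_almost_split L B C g"
    and dbC: "dual_basis C {..<m} \<gamma> \<chi>"
  shows "omnipresent l n v m (\<lambda>i j a p. \<chi> p (g (incl i j (\<epsilon> i a))))"
    (is "omnipresent l n v m ?G")
  unfolding omnipresent_def
proof (intro allI impI)
  fix P :: "nat \<Rightarrow> nat \<Rightarrow> nat \<Rightarrow> 'k" assume "\<forall>i\<in>{1..l}. \<forall>j\<in>{1..n i}. \<forall>j'\<in>{1..n i}. (\<Sum>j''\<in>{1..n i}. P i j j'' * P i j'' j') = P i j j'"
  then have idem: "mat_endo P (mat_endo P b) = mat_endo P b" if "b \<in> carrier B" for b
    using mat_endo_idem that by simp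
  interpret B: kspace B by (rule fd_module_kspace[OF B_mod])
  interpret C: kspace C using C by (rule fd_module_kspace)
  have gh: "g \<in> lmod_hom L B C"
    using g by (simp add: minimal_right_almost_split_def right_almost_split_def)
  note gD = lmod_homD[OF gh] and eD = lmod_homD[OF mat_endo_hom[of P]] and dC = dual_basisD[OF dbC]
  have mr: "max_rank g (mat_endo P ` carrier B) (carrier C)"
    by (rule minimal_right_idempotent[OF B_mod C g mat_endo_hom idem])
  have ev: "\<chi> p (g (mat_endo P b))
      = eval_tensor l n v ?G (\<lambda>i j a. \<Sum>j'\<in>{1..n i}. \<zeta> i a (b i j') * P i j' j) p" if "b \<in> carrier B" "p < m" for b p
  proof -
    have "\<chi> p (g (mat_endo P b)) = eval_tensor l n v ?G (\<lambda>i j a. \<zeta> i a (mat_endo P b i j)) p"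
      unfolding eval_tensor_def
      by (rule functional_eval[OF functional_comp[OF dC(3) gD(1)]]) (use that eD in auto)
    also have "\<dots> = eval_tensor l n v ?G (\<lambda>i j a. \<Sum>j'\<in>{1..n i}. \<zeta> i a (b i j') * P i j' j) p"
      by (rule eval_tensor_cong) (rule coord_mat_endo[OF that(1)])
    finally show ?thesis .
  qed
  from mr show "(\<forall>b. (\<forall>p<m. eval_tensor l n v ?G (\<lambda>i j a. \<Sum>j'\<in>{1..n i}. b i j' a * P i j' j) p = 0) \<longrightarrow>
        (\<forall>i\<in>{1..l}. \<forall>j\<in>{1..n i}. \<forall>a<v i. (\<Sum>j'\<in>{1..n i}. b i j' a * P i j' j) = 0)) \<or>
      (\<forall>y. \<exists>b. \<forall>p<m. eval_tensor l n v ?G (\<lambda>i j a. \<Sum>j'\<in>{1..n i}. b i j' a * P i j' j) p = y p)"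
    unfolding max_rank_def
  proof (elim disjE)
    assume inj: "inj_on g (mat_endo P ` carrier B)"
    show ?thesis
    proof (rule disjI1, intro allI impI)
      fix b :: "nat \<Rightarrow> nat \<Rightarrow> nat \<Rightarrow> 'k"
      assume z: "\<forall>p<m. eval_tensor l n v ?G (\<lambda>i j a. \<Sum>j'\<in>{1..n i}. b i j' a * P i j' j) p = 0"
      define \<beta> where "\<beta> = comb B B_index (\<lambda>(i, j, a). b i j a) B_basis"
      have \<beta>: "\<beta> \<in> carrier B"
        unfolding \<beta>_def by (rule B.comb_closed) (rule dual_basisD(2)[OF db_B])
      have co: "\<zeta> i a (\<beta> i j) = b i j a" if "i \<in> {1..l}" "j \<in> {1..n i}" "a < v i" for i j a
        using B.dual_basis_comb[OF db_B, of "(i, j, a)" "\<lambda>(i, j, a). b i j a"] that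
        unfolding \<beta>_def[symmetric] by (simp add: B_coord_def B_index_def)
      have bP: "(\<Sum>j'\<in>{1..n i}. \<zeta> i a (\<beta> i j') * P i j' j) = (\<Sum>j'\<in>{1..n i}. b i j' a * P i j' j)"
        if "i \<in> {1..l}" "j \<in> {1..n i}" "a < v i" for i j a
        using co that by simp
      have "g (mat_endo P \<beta>) = \<zero>\<^bsub>C\<^esub>"
      proof (rule dC(5))
        show "g (mat_endo P \<beta>) \<in> carrier C" using gD eD \<beta> by simp
        fix p assume p: "p \<in> {..<m}"
        have "eval_tensor l n v ?G (\<lambda>i j a. \<Sum>j'\<in>{1..n i}. \<zeta> i a (\<beta> i j') * P i j' j) p
            = eval_tensor l n v ?G (\<lambda>i j a. \<Sum>j'\<in>{1..n i}. b i j' a * P i j' j) p"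
          by (rule eval_tensor_cong) (rule bP)
        then show "\<chi> p (g (mat_endo P \<beta>)) = 0" using z p ev[OF \<beta>, of p] by simp
      qed
      moreover have "g (mat_endo P \<zero>\<^bsub>B\<^esub>) = \<zero>\<^bsub>C\<^esub>"
        by (simp add: khom_zero[OF B.kspace_axioms B.kspace_axioms eD(1)] khom_zero[OF B.kspace_axioms C.kspace_axioms gD(1)])
      ultimately have "mat_endo P \<beta> = mat_endo P \<zero>\<^bsub>B\<^esub>"
        using \<beta> by (intro inj_onD[OF inj]) auto
      then have e0: "mat_endo P \<beta> = \<zero>\<^bsub>B\<^esub>"
        by (simp add: khom_zero[OF B.kspace_axioms B.kspace_axioms eD(1)])
      show "\<forall>i\<in>{1..l}. \<forall>j\<in>{1..n i}. \<forall>a<v i. (\<Sum>j'\<in>{1..n i}. b i j' a * P i j' j) = 0"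
      proof (intro ballI allI impI)
        fix i j a assume ija: "i \<in> {1..l}" "j \<in> {1..n i}" "a < v i"
        have "\<zeta> i a (mat_endo P \<beta> i j) = 0"
          unfolding e0 using ija B_zero kspace.functional_zero[OF V_space dual_basisD(3)[OF db]] by simp
        then show "(\<Sum>j'\<in>{1..n i}. b i j' a * P i j' j) = 0"
          unfolding coord_mat_endo[OF \<beta> ija] bP[OF ija] .
      qed
    qed
  next
    assume surj: "g ` mat_endo P ` carrier B = carrier C"
    show ?thesis
    proof (rule disjI2, rule allI)
      fix y :: "nat \<Rightarrow> 'k"
      have "comb C {..<m} y \<gamma> \<in> carrier C" by (rule C.comb_closed) (rule dC(2))
      then obtain \<beta> where \<beta>: "\<beta> \<in> carrier B" "comb C {..<m} y \<gamma> = g (mat_endo P \<beta>)"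
        unfolding surj[symmetric] by auto
      have "\<forall>p<m. eval_tensor l n v ?G (\<lambda>i j a. \<Sum>j'\<in>{1..n i}. \<zeta> i a (\<beta> i j') * P i j' j) p = y p"
        using ev[OF \<beta>(1)] C.dual_basis_comb[OF dbC, of _ y] \<beta>(2) by simp
      then show "\<exists>b. \<forall>p<m. eval_tensor l n v ?G (\<lambda>i j a. \<Sum>j'\<in>{1..n i}. b i j' a * P i j' j) p = y p"
        by (rule exI[of _ "\<lambda>i j' a. \<zeta> i a (\<beta> i j')"])
    qed
  qed
qed

text \<open>Here \<open>b\<close> is a linear functional on \<open>B\<close> and the tensor is the
  transpose of \<open>f\<close>, so the alternatives of \<open>max_rank\<close> change places: an
  injective map has a surjective transpose, and a functional that vanishes on the image of
  \<open>e f\<close> vanishes on \<open>e B\<close> when the two images agree.\<close>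

lemma omnipresent_left:
  assumes A: "fd_module L A" and f: "minimal_left_almost_split L A B f"
    and dbA: "dual_basis A {..<m} \<alpha> \<chi>"
  shows "omnipresent l n v m (\<lambda>i j a p. \<zeta> i a (f (\<alpha> p) i j))"
    (is "omnipresent l n v m ?G")
  unfolding omnipresent_def
proof (intro allI impI)
  fix P :: "nat \<Rightarrow> nat \<Rightarrow> nat \<Rightarrow> 'k" assume P: "\<forall>i\<in>{1..l}. \<forall>j\<in>{1..n i}. \<forall>j'\<in>{1..n i}. (\<Sum>j''\<in>{1..n i}. P i j j'' * P i j'' j') = P i j j'"
  \<comment> \<open>The transpose of \<open>P\<close>: composing the functional \<open>b\<close>
    with \<open>mat_endo Q\<close> amounts to replacing \<open>b\<close> by \<open>b P\<close>, as
    \<open>pairP\<close> shows.\<close>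
  define Q where "Q = (\<lambda>i j j'. P i j' j)"
  have idem: "mat_endo Q (mat_endo Q b) = mat_endo Q b" if "b \<in> carrier B" for b
    using mat_endo_idem[OF _ that, of Q] P by (simp add: Q_def mult.commute)
  interpret B: kspace B by (rule fd_module_kspace[OF B_mod])
  interpret A: kspace A using A by (rule fd_module_kspace)
  have fh: "f \<in> lmod_hom L A B"
    using f by (simp add: minimal_left_almost_split_def left_almost_split_def)
  note fD = lmod_homD[OF fh] and eD = lmod_homD[OF mat_endo_hom[of Q]] and dA = dual_basisD[OF dbA]
  note dB = dual_basisD[OF db_B]
  have mr: "max_rank (\<lambda>a. mat_endo Q (f a)) (carrier A) (mat_endo Q ` carrier B)"
    by (rule minimal_left_idempotent[OF A B_mod f mat_endo_hom idem])
  define pair where "pair = (\<lambda>b x. \<Sum>k\<in>B_index. (\<lambda>(i, j, a). b i j a) k * B_coord k x)"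
  have pair: "functional B (pair b)" for b
    unfolding pair_def by (rule functional_sum) (rule dB(3))
  have ev: "eval_tensor l n v ?G b p = pair b (f (\<alpha> p))" for b p
    unfolding eval_tensor_B_index pair_def by (intro sum.cong refl) (auto simp: B_coord_def)
  have pairP: "pair (\<lambda>i j a. \<Sum>j'\<in>{1..n i}. b i j' a * P i j' j) x = pair b (mat_endo Q x)"
    if x: "x \<in> carrier B" for b x
  proof -
    have "pair (\<lambda>i j a. \<Sum>j'\<in>{1..n i}. b i j' a * P i j' j) x
        = (\<Sum>i\<in>{1..l}. \<Sum>j\<in>{1..n i}. \<Sum>a<v i. (\<Sum>j'\<in>{1..n i}. b i j' a * P i j' j) * \<zeta> i a (x i j))"
      unfolding pair_def B_index_def by (subst sum_triple) (auto simp: B_coord_def)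
    also have "\<dots> = (\<Sum>i\<in>{1..l}. \<Sum>a<v i. \<Sum>j\<in>{1..n i}. (\<Sum>j'\<in>{1..n i}. b i j' a * P i j' j) * \<zeta> i a (x i j))"
      by (intro sum.cong refl sum.swap)
    also have "\<dots> = (\<Sum>i\<in>{1..l}. \<Sum>a<v i. \<Sum>j'\<in>{1..n i}. b i j' a * (\<Sum>j\<in>{1..n i}. P i j' j * \<zeta> i a (x i j)))"
      by (simp only: sum_mult_assoc)
    also have "\<dots> = (\<Sum>i\<in>{1..l}. \<Sum>j'\<in>{1..n i}. \<Sum>a<v i. b i j' a * (\<Sum>j\<in>{1..n i}. P i j' j * \<zeta> i a (x i j)))"
      by (intro sum.cong refl sum.swap)
    also have "\<dots> = (\<Sum>i\<in>{1..l}. \<Sum>j'\<in>{1..n i}. \<Sum>a<v i. b i j' a * \<zeta> i a (mat_endo Q x i j'))"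
      by (intro sum.cong refl, subst coord_mat_endo[OF x]) (auto simp: Q_def mult.commute)
    also have "\<dots> = pair b (mat_endo Q x)"
      unfolding pair_def B_index_def by (subst sum_triple) (auto simp: B_coord_def)
    finally show ?thesis .
  qed
  have evP: "eval_tensor l n v ?G (\<lambda>i j a. \<Sum>j'\<in>{1..n i}. b i j' a * P i j' j) p = pair b (mat_endo Q (f (\<alpha> p)))"
    if "p < m" for b p
    unfolding ev by (rule pairP) (use that dA(2) fD in auto)
  from mr show "(\<forall>b. (\<forall>p<m. eval_tensor l n v ?G (\<lambda>i j a. \<Sum>j'\<in>{1..n i}. b i j' a * P i j' j) p = 0) \<longrightarrow>
        (\<forall>i\<in>{1..l}. \<forall>j\<in>{1..n i}. \<forall>a<v i. (\<Sum>j'\<in>{1..n i}. b i j' a * P i j' j) = 0)) \<or>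
      (\<forall>y. \<exists>b. \<forall>p<m. eval_tensor l n v ?G (\<lambda>i j a. \<Sum>j'\<in>{1..n i}. b i j' a * P i j' j) p = y p)"
    unfolding max_rank_def
  proof (elim disjE)
    assume inj: "inj_on (\<lambda>a. mat_endo Q (f a)) (carrier A)"
    define M where "M = (\<lambda>k p. B_coord k (mat_endo Q (f (\<alpha> p))))"
    have efh: "(\<lambda>a. mat_endo Q (f a)) \<in> khom A B" by (rule khom_comp[OF fD(1) eD(1)])
    have M: "B_coord k (mat_endo Q (f x)) = (\<Sum>p<m. M k p * \<chi> p x)" if "x \<in> carrier A" "k \<in> B_index" for x k
      using khom_matrix[OF A.kspace_axioms B.kspace_axioms efh dbA db_B that] by (simp add: M_def)
    have li: "\<forall>p\<in>{..<m}. x p = 0" if z: "\<forall>k\<in>B_index. (\<Sum>p\<in>{..<m}. M k p * x p) = 0" for x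
    proof -
      define a where "a = comb A {..<m} x \<alpha>"
      have a: "a \<in> carrier A" unfolding a_def by (rule A.comb_closed) (rule dA(2))
      have \<chi>a: "\<chi> p a = x p" if "p \<in> {..<m}" for p unfolding a_def by (rule A.dual_basis_comb[OF dbA that])
      have "mat_endo Q (f a) = \<zero>\<^bsub>B\<^esub>"
      proof (rule dB(5))
        show "mat_endo Q (f a) \<in> carrier B" using a fD eD by simp
        show "B_coord k (mat_endo Q (f a)) = 0" if "k \<in> B_index" for k using M[OF a that] z that \<chi>a by simp
      qed
      then have "a = \<zero>\<^bsub>A\<^esub>"
        using inj a unfolding khom_inj_iff[OF A.kspace_axioms B.kspace_axioms efh] by blast
      then show ?thesis using \<chi>a A.functional_zero[OF dA(3)] by simp
    qed
    obtain Y where Y: "\<And>p p'. p \<in> {..<m} \<Longrightarrow> p' \<in> {..<m} \<Longrightarrow> (\<Sum>k\<in>B_index. Y p k * M k p') = of_bool (p = p')"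
    proof (rule left_inverse_of_injective[OF finite_B_index finite_lessThan, where M = M])
      show "\<forall>p\<in>{..<m}. x p = 0" if "\<forall>k\<in>B_index. (\<Sum>p\<in>{..<m}. M k p * x p) = 0" for x
        using that by (rule li)
    qed (rule that)
    show ?thesis
    proof (rule disjI2, rule allI)
      fix y :: "nat \<Rightarrow> 'k"
      \<comment> \<open>The rows of the left inverse \<open>Y\<close> with weights \<open>y\<close>:
        this functional takes the value \<open>y p\<close> on the image of
        \<open>\<alpha> p\<close>.\<close>
      define b where "b = (\<lambda>i j a. \<Sum>p<m. y p * Y p (i, j, a))"
      have "eval_tensor l n v ?G (\<lambda>i j a. \<Sum>j'\<in>{1..n i}. b i j' a * P i j' j) p' = y p'" if p': "p' < m" for p'
      proof -
        have "(case k of (i, j, a) \<Rightarrow> b i j a) = (\<Sum>p<m. y p * Y p k)" for k by (cases k) (simp add: b_def)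
        then have "pair b (mat_endo Q (f (\<alpha> p'))) = (\<Sum>k\<in>B_index. (\<Sum>p<m. y p * Y p k) * M k p')"
          unfolding pair_def M_def by simp
        also have "\<dots> = (\<Sum>p<m. y p * (\<Sum>k\<in>B_index. Y p k * M k p'))" by (simp only: sum_mult_assoc)
        also have "\<dots> = (\<Sum>p<m. y p * of_bool (p = p'))" using Y p' by (intro sum.cong) auto
        also have "\<dots> = y p'" using p' by (simp add: sum_of_bool_mult)
        finally show ?thesis unfolding evP[OF p'] .
      qed
      then show "\<exists>b. \<forall>p<m. eval_tensor l n v ?G (\<lambda>i j a. \<Sum>j'\<in>{1..n i}. b i j' a * P i j' j) p = y p"
        by (intro exI[of _ b]) simp
    qed
  next
    assume surj: "(\<lambda>a. mat_endo Q (f a)) ` carrier A = mat_endo Q ` carrier B"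
    show ?thesis
    proof (rule disjI1, intro allI impI)
      fix b :: "nat \<Rightarrow> nat \<Rightarrow> nat \<Rightarrow> 'k"
      assume "\<forall>p<m. eval_tensor l n v ?G (\<lambda>i j a. \<Sum>j'\<in>{1..n i}. b i j' a * P i j' j) p = 0"
      then have z: "pair b (mat_endo Q (f (\<alpha> p))) = 0" if "p < m" for p using evP that by simp
      have fct: "functional A (\<lambda>a. pair b (mat_endo Q (f a)))"
        by (rule functional_comp[OF functional_comp[OF pair eD(1)] fD(1)])
      have zA: "pair b (mat_endo Q (f x)) = 0" if "x \<in> carrier A" for x
        using A.functional_expand[OF dbA fct that] z by simp
      have zB: "pair b (mat_endo Q x) = 0" if "x \<in> carrier B" for x
      proof -
        have "mat_endo Q x \<in> (\<lambda>a. mat_endo Q (f a)) ` carrier A" unfolding surj using that by simp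
        then show ?thesis using zA by auto
      qed
      show "\<forall>i\<in>{1..l}. \<forall>j\<in>{1..n i}. \<forall>a<v i. (\<Sum>j'\<in>{1..n i}. b i j' a * P i j' j) = 0"
      proof (intro ballI allI impI)
        fix i j a assume ija: "i \<in> {1..l}" "j \<in> {1..n i}" "a < v i"
        let ?k = "(i, j, a)"
        have k: "?k \<in> B_index" using ija by (simp add: B_index_def)
        let ?b = "\<lambda>i j a. \<Sum>j'\<in>{1..n i}. b i j' a * P i j' j"
        \<comment> \<open>The functional \<open>b P\<close> vanishes on all of \<open>B\<close>; on
          the basis vector \<open>k\<close> it returns the entry \<open>k\<close> of
          \<open>b P\<close>.\<close>
        have "0 = pair ?b (B_basis ?k)" using pairP[OF dB(2)[OF k], of b] zB[OF dB(2)[OF k]] by simp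
        also have "\<dots> = (\<Sum>k\<in>B_index. (\<lambda>(i, j, a). ?b i j a) k * of_bool (k = ?k))"
          unfolding pair_def using dB(4)[OF _ k] by (intro sum.cong refl) simp
        also have "\<dots> = ?b i j a" using k finite_B_index by (simp add: sum_of_bool_mult)
        finally show "?b i j a = 0" by simp
      qed
    qed
  qed
qed

text \<open>If the surjection \<open>g\<close> were injective too, it would be an isomorphism and
  hence split. So its kernel contains a nonzero vector, to which
  \<open>omnipresent_surjective_less\<close> applies.\<close>

lemma minimal_right_dim_less:
  assumes C: "fd_module L C" and g: "minimal_right_almost_split L B C g" and surj: "g ` carrier B = carrier C"
  shows "vdim C < (\<Sum>i = 1..l. (v i)\<^sup>2)"
proof -
  interpret B: kspace B by (rule fd_module_kspace[OF B_mod])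
  interpret C: kspace C using C by (rule fd_module_kspace)
  have gh: "g \<in> lmod_hom L B C" and ns: "\<not> split_epi L B C g"
    using g by (simp_all add: minimal_right_almost_split_def right_almost_split_def)
  note gD = lmod_homD[OF gh]
  obtain \<gamma> \<chi> where dbC: "dual_basis C {..<C.dim} \<gamma> \<chi>"
    using C.dual_basis_exists[OF fd_module.fin_dim[OF C]] by blast
  have "\<not> inj_on g (carrier B)"
  proof
    assume "inj_on g (carrier B)"
    then have "split_epi L B C g"
      using lmod_hom_inverse[OF B_mod C gh _ surj] unfolding split_epi_def by blast
    with ns show False by simp
  qed
  then obtain b where b: "b \<in> carrier B" "g b = \<zero>\<^bsub>C\<^esub>" "b \<noteq> \<zero>\<^bsub>B\<^esub>"
    unfolding khom_inj_iff[OF B.kspace_axioms C.kspace_axioms gD(1)] by blast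
  then obtain k where "k \<in> B_index" "B_coord k b \<noteq> 0" using dual_basisD(5)[OF db_B b(1)] by blast
  then obtain i j a where ija: "i \<in> {1..l}" "j \<in> {1..n i}" "a < v i" "\<zeta> i a (b i j) \<noteq> 0"
    by (auto simp: B_index_def B_coord_def)
  have "eval_tensor l n v (\<lambda>i j a p. \<chi> p (g (incl i j (\<epsilon> i a)))) (\<lambda>i j a. \<zeta> i a (b i j)) p = 0" if "p < C.dim" for p
  proof -
    have \<chi>: "functional C (\<chi> p)" using dual_basisD(3)[OF dbC] that by simp
    have "\<chi> p (g b) = eval_tensor l n v (\<lambda>i j a p. \<chi> p (g (incl i j (\<epsilon> i a)))) (\<lambda>i j a. \<zeta> i a (b i j)) p"
      unfolding eval_tensor_def by (rule functional_eval[OF functional_comp[OF \<chi> gD(1)] b(1)])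
    then show ?thesis using b(2) C.functional_zero[OF \<chi>] by simp
  qed
  then show ?thesis
    using omnipresent_surjective_less[OF omnipresent_right[OF C g dbC], of "\<lambda>i j a. \<zeta> i a (b i j)" i j a] ija by simp
qed

text \<open>The injection \<open>f\<close> cannot be surjective, or it would split. A nonzero
  functional \<open>y\<close> that annihilates its image is a kernel vector of the transposed
  tensor.\<close>

lemma minimal_left_dim_less:
  assumes A: "fd_module L A" and f: "minimal_left_almost_split L A B f" and inj: "inj_on f (carrier A)"
  shows "vdim A < (\<Sum>i = 1..l. (v i)\<^sup>2)"
proof -
  interpret B: kspace B by (rule fd_module_kspace[OF B_mod])
  interpret A: kspace A using A by (rule fd_module_kspace)
  have fh: "f \<in> lmod_hom L A B" and ns: "\<not> split_mono L A B f"
    using f by (simp_all add: minimal_left_almost_split_def left_almost_split_def)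
  note fD = lmod_homD[OF fh]
  obtain \<alpha> \<chi> where dbA: "dual_basis A {..<A.dim} \<alpha> \<chi>"
    using A.dual_basis_exists[OF fd_module.fin_dim[OF A]] by blast
  note dA = dual_basisD[OF dbA]
  have "f ` carrier A \<noteq> carrier B"
  proof
    assume "f ` carrier A = carrier B"
    then have "split_mono L A B f"
      using lmod_hom_inverse[OF A B_mod fh inj] unfolding split_mono_def by blast
    with ns show False by simp
  qed
  then obtain b where b: "b \<in> carrier B" "b \<notin> f ` carrier A" using fD(2) by auto
  define N where "N = (\<lambda>k p. B_coord k (f (\<alpha> p)))"
  have "\<not> (\<exists>x. \<forall>k\<in>B_index. (\<Sum>p\<in>{..<A.dim}. N k p * x p) = B_coord k b)"
  proof
    assume "\<exists>x. \<forall>k\<in>B_index. (\<Sum>p\<in>{..<A.dim}. N k p * x p) = B_coord k b"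
    then obtain x where x: "\<forall>k\<in>B_index. (\<Sum>p\<in>{..<A.dim}. N k p * x p) = B_coord k b" by (elim exE)
    define a where "a = comb A {..<A.dim} x \<alpha>"
    have a: "a \<in> carrier A" unfolding a_def by (rule A.comb_closed) (rule dA(2))
    have "f a = b"
    proof (rule B.dual_basis_eqI[OF db_B fD(2)[OF a] b(1)])
      fix k assume k: "k \<in> B_index"
      have "\<chi> p a = x p" if "p \<in> {..<A.dim}" for p unfolding a_def by (rule A.dual_basis_comb[OF dbA that])
      then show "B_coord k (f a) = B_coord k b"
        using khom_matrix[OF A.kspace_axioms B.kspace_axioms fD(1) dbA db_B a k] x k by (simp add: N_def)
    qed
    with a b(2) show False by blast
  qed
  then obtain k0 y where y: "k0 \<in> B_index" "y k0 \<noteq> 0" "\<And>p. p \<in> {..<A.dim} \<Longrightarrow> (\<Sum>k\<in>B_index. y k * N k p) = 0"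
    by (rule left_kernel_of_non_surjective[OF finite_B_index finite_lessThan]) (rule that)
  obtain i j a where k0: "k0 = (i, j, a)" by (cases k0)
  have "eval_tensor l n v (\<lambda>i j a p. \<zeta> i a (f (\<alpha> p) i j)) (\<lambda>i j a. y (i, j, a)) p = (\<Sum>k\<in>B_index. y k * N k p)" for p
    unfolding eval_tensor_B_index by (intro sum.cong refl) (auto simp: N_def B_coord_def)
  then show ?thesis
    using omnipresent_surjective_less[OF omnipresent_left[OF A f dbA], of "\<lambda>i j a. y (i, j, a)" i j a] y k0
    by (simp add: B_index_def)
qed

end

end

section \<open>Plucker forms\<close>

lemma det_replace_row:
  fixes A :: "nat \<Rightarrow> nat \<Rightarrow> 'k::field"
  assumes c: "c < d"
  shows "det (mat d d (\<lambda>(r, c'). if r = c then y c' else A r c'))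
    = (\<Sum>j<d. y j * cofactor (mat d d (\<lambda>(r, c'). A r c')) c j)"
proof -
  let ?R = "mat d d (\<lambda>(r, c'). if r = c then y c' else A r c')"
  have "det ?R = (\<Sum>j<d. ?R $$ (c, j) * cofactor ?R c j)"
    using c by (intro laplace_expansion_row) auto
  also have "\<dots> = (\<Sum>j<d. y j * cofactor (mat d d (\<lambda>(r, c'). A r c')) c j)"
  proof (rule sum.cong[OF refl])
    fix j assume j: "j \<in> {..<d}"
    have "mat_delete ?R c j = mat_delete (mat d d (\<lambda>(r, c'). A r c')) c j"
      unfolding mat_delete_def using c j by (intro eq_matI) auto
    then show "?R $$ (c, j) * cofactor ?R c j = y j * cofactor (mat d d (\<lambda>(r, c'). A r c')) c j"
      using c j by (simp add: cofactor_def)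
  qed
  finally show ?thesis .
qed

text \<open>Cramer's rule without division. It comes from the adjugate and so holds whether or not
  the determinant vanishes.\<close>

lemma cramer_rows:
  fixes A :: "nat \<Rightarrow> nat \<Rightarrow> 'k::field"
  assumes c': "c' < d"
  shows "(\<Sum>c<d. det (mat d d (\<lambda>(r, c'). if r = c then y c' else A r c')) * A c c')
    = det (mat d d (\<lambda>(r, c'). A r c')) * y c'"
proof -
  let ?A = "mat d d (\<lambda>(r, c'). A r c')"
  have adj: "(\<Sum>c<d. cofactor ?A c j * A c c') = det ?A * of_bool (j = c')" if "j < d" for j
  proof -
    have "(adj_mat ?A * ?A) $$ (j, c') = (\<Sum>c<d. cofactor ?A c j * A c c')"
      using that c' by (simp add: adj_mat_def scalar_prod_def atLeast0LessThan)
    moreover have "adj_mat ?A * ?A = det ?A \<cdot>\<^sub>m 1\<^sub>m d" by (rule adj_mat(3)) simp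
    ultimately show ?thesis using that c' by (simp split: if_splits)
  qed
  have "(\<Sum>c<d. det (mat d d (\<lambda>(r, c'). if r = c then y c' else A r c')) * A c c')
      = (\<Sum>c<d. (\<Sum>j<d. y j * cofactor ?A c j) * A c c')"
    by (intro sum.cong refl) (simp add: det_replace_row)
  also have "\<dots> = (\<Sum>j<d. y j * (\<Sum>c<d. cofactor ?A c j * A c c'))"
    by (rule sum_mult_assoc[symmetric])
  also have "\<dots> = (\<Sum>j<d. y j * det ?A * of_bool (j = c'))"
    using adj by (intro sum.cong refl) (simp add: mult.assoc)
  also have "\<dots> = det ?A * y c'" using c' by (simp add: sum_of_bool_mult)
  finally show ?thesis .
qed

lemma det_repeat_row:
  fixes A :: "nat \<Rightarrow> nat \<Rightarrow> 'k::field"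
  assumes "c < d" "r < d"
  shows "det (mat d d (\<lambda>(r', c'). if r' = c then A r c' else A r' c'))
    = det (mat d d (\<lambda>(r, c'). A r c')) * of_bool (r = c)"
proof -
  let ?A = "mat d d (\<lambda>(r, c'). A r c')"
  have "(?A * adj_mat ?A) $$ (r, c) = (\<Sum>j<d. A r j * cofactor ?A c j)"
    using assms by (simp add: adj_mat_def scalar_prod_def atLeast0LessThan)
  moreover have "?A * adj_mat ?A = det ?A \<cdot>\<^sub>m 1\<^sub>m d" by (rule adj_mat(2)) simp
  ultimately show ?thesis using assms by (simp add: det_replace_row split: if_splits)
qed

section \<open>Closure properties of Plucker forms\<close>

context
  fixes l :: nat and d :: "nat \<Rightarrow> nat" and V :: "nat \<Rightarrow> ('k::field, 'v, 'r) lmodule"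
begin

lemma plucker_scale: "(e, F) \<in> plucker_forms l d V \<Longrightarrow> (e, \<lambda>b. c * F b) \<in> plucker_forms l d V"
  using plucker_forms.mult[OF plucker_forms.const[of c]] by force

text \<open>Forms carry a degree, so sums need a zero of that degree to start from; scaling any form
  of the degree by 0 provides it.\<close>

lemma plucker_zero: "(e, F) \<in> plucker_forms l d V \<Longrightarrow> (e, \<lambda>b. 0) \<in> plucker_forms l d V"
  using plucker_scale[of e F 0] by simp

lemma plucker_sum:
  assumes "(e, \<lambda>b. 0) \<in> plucker_forms l d V" "\<And>x. x \<in> X \<Longrightarrow> (e, F x) \<in> plucker_forms l d V"
  shows "(e, \<lambda>b. \<Sum>x\<in>X. F x b) \<in> plucker_forms l d V"
  using assms(2) by (induct X rule: infinite_finite_induct) (auto intro: plucker_forms.add assms(1))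

lemma plucker_prod:
  assumes "finite X" "\<And>x. x \<in> X \<Longrightarrow> (e x, F x) \<in> plucker_forms l d V"
  shows "((\<lambda>k. \<Sum>x\<in>X. e x k), \<lambda>b. \<Prod>x\<in>X. F x b) \<in> plucker_forms l d V"
  using assms
proof (induct X)
  case empty
  then show ?case using plucker_forms.const[of 1] by simp
next
  case (insert x X)
  then have "((\<lambda>k. e x k + (\<Sum>x\<in>X. e x k)), \<lambda>b. F x b * (\<Prod>x\<in>X. F x b)) \<in> plucker_forms l d V"
    by (intro plucker_forms.mult) auto
  then show ?case using insert by simp
qed

text \<open>Each term of the Leibniz formula is a product of \<open>N\<close> entries of the same
  degree \<open>e\<close>, so all terms have the same degree.\<close>

lemma plucker_det:
  assumes "\<And>a c. a < N \<Longrightarrow> c < N \<Longrightarrow> (e, F a c) \<in> plucker_forms l d V"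
  shows "((\<lambda>k. \<Sum>i\<in>{0..<N}. e k), \<lambda>b. det (mat N N (\<lambda>(a, c). F a c b))) \<in> plucker_forms l d V"
proof -
  have less: "p i < N" if "p permutes {0..<N}" "i < N" for p i
    using permutes_in_image[OF that(1), of i] that(2) by simp
  have eq: "det (mat N N (\<lambda>(a, c). F a c b))
      = (\<Sum>p\<in>{p. p permutes {0..<N}}. of_int (sign p) * (\<Prod>i\<in>{0..<N}. F i (p i) b))" for b
    by (subst det_def'[of _ N]) (auto intro!: sum.cong arg_cong[of _ _ "\<lambda>x. _ * x"] prod.cong simp: less)
  have pr: "((\<lambda>k. \<Sum>i\<in>{0..<N}. e k), \<lambda>b. of_int (sign p) * (\<Prod>i\<in>{0..<N}. F i (p i) b)) \<in> plucker_forms l d V"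
    if "p permutes {0..<N}" for p
    using that assms less by (intro plucker_scale plucker_prod) auto
  show ?thesis unfolding eq
    by (rule plucker_sum[OF plucker_zero[OF pr[OF permutes_id]]]) (use pr in auto)
qed

lemma plucker_coord:
  assumes "i \<in> {1..l}" "\<And>r. r < d i \<Longrightarrow> functional (V i) (\<phi> r)"
  shows "((\<lambda>k. if k = i then 1 else 0), (\<lambda>b. det (mat (d i) (d i) (\<lambda>(r, c). \<phi> r (b i c))))) \<in> plucker_forms l d V"
  by (rule plucker_forms.coord[OF assms(1)]) (use assms(2) in \<open>simp add: functional_iff\<close>)

lemma plucker_cong:
  assumes "(e, F) \<in> plucker_forms l d V" "\<And>i c. i \<in> {1..l} \<Longrightarrow> c < d i \<Longrightarrow> b i c = b' i c"
  shows "F b = F b'"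
  using assms(1)
proof (induct rule: plucker_forms.induct)
  case (coord i \<phi>)
  then show ?case
    using assms(2)[OF coord(1)] by (intro arg_cong[of _ _ det] eq_matI) auto
qed auto

definition line :: "(nat \<Rightarrow> nat \<Rightarrow> 'v) \<Rightarrow> (nat \<Rightarrow> nat \<Rightarrow> 'v) \<Rightarrow> 'k \<Rightarrow> nat \<Rightarrow> nat \<Rightarrow> 'v"
  where "line b b' t = (\<lambda>i c. (1 - t) \<odot>\<^bsub>V i\<^esub> b i c \<oplus>\<^bsub>V i\<^esub> t \<odot>\<^bsub>V i\<^esub> b' i c)"

lemma plucker_polyfun:
  assumes "(e, F) \<in> plucker_forms l d V" and V: "\<And>i. i \<in> {1..l} \<Longrightarrow> kspace (V i)"
    and b: "\<And>i c. i \<in> {1..l} \<Longrightarrow> c < d i \<Longrightarrow> b i c \<in> carrier (V i)"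
      "\<And>i c. i \<in> {1..l} \<Longrightarrow> c < d i \<Longrightarrow> b' i c \<in> carrier (V i)"
  shows "polyfun (\<lambda>t. F (line b b' t))"
  using assms(1)
proof (induct rule: plucker_forms.induct)
  case (coord i \<phi>)
  interpret kspace "V i" by (rule V[OF coord(1)])
  have "\<phi> r (line b b' t i c) = (1 + (- 1) * t) * \<phi> r (b i c) + t * \<phi> r (b' i c)" if "r < d i" "c < d i" for r c t
  proof -
    have "functional (V i) (\<phi> r)" using coord(2)[OF that(1)] by (simp add: functional_iff)
    then show ?thesis
      using b[OF coord(1) that(2)] by (simp add: line_def functional_add functional_smult)
  qed
  then have "(\<lambda>t. det (mat (d i) (d i) (\<lambda>(r, c). \<phi> r (line b b' t i c))))
      = (\<lambda>t. det (mat (d i) (d i) (\<lambda>(r, c). (1 + (- 1) * t) * \<phi> r (b i c) + t * \<phi> r (b' i c))))"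
    by (intro ext arg_cong[of _ _ det] eq_matI) auto
  then show ?case
    by (simp only:) (intro polyfun_det polyfun_add polyfun_mult polyfun_const polyfun_id)
qed (auto intro: polyfun_const polyfun_add polyfun_mult)

end

section \<open>Frames\<close>

text \<open>A nonzero determinant against functionals makes the coordinate rows \<open>X\<close> of
  the given vectors right invertible; completing \<open>X\<close> to an invertible matrix gives the
  change of basis.\<close>

lemma adapted_basis:
  fixes M :: "('k::field, 'v, 'z) module_scheme"
  assumes "kspace M" and db: "dual_basis M {..<m} \<epsilon> \<zeta>" and b: "\<And>c. c < d \<Longrightarrow> b c \<in> carrier M"
    and \<phi>: "\<And>r. r < d \<Longrightarrow> functional M (\<phi> r)" and nz: "det (mat d d (\<lambda>(r, c). \<phi> r (b c))) \<noteq> 0"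
  obtains e \<xi> where "dual_basis M {..<m} e \<xi>" "\<And>c. c < d \<Longrightarrow> e c = b c" "d \<le> m"
proof -
  interpret kspace M by fact
  note D = dual_basisD[OF db]
  define X where "X = (\<lambda>c a. \<zeta> a (b c))"
  have "mat d d (\<lambda>(c, r). \<Sum>a\<in>{..<m}. X c a * \<phi> r (\<epsilon> a)) = (mat d d (\<lambda>(r, c). \<phi> r (b c)))\<^sup>T"
  proof (rule eq_matI)
    fix c r assume "c < dim_row (mat d d (\<lambda>(r, c). \<phi> r (b c)))\<^sup>T" "r < dim_col (mat d d (\<lambda>(r, c). \<phi> r (b c)))\<^sup>T"
    then have cr: "c < d" "r < d" by simp_all
    show "mat d d (\<lambda>(c, r). \<Sum>a\<in>{..<m}. X c a * \<phi> r (\<epsilon> a)) $$ (c, r) = (mat d d (\<lambda>(r, c). \<phi> r (b c)))\<^sup>T $$ (c, r)"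
      using cr functional_expand[OF db \<phi>[OF cr(2)] b[OF cr(1)]] by (simp add: X_def)
  qed auto
  then have "det (mat d d (\<lambda>(c, r). \<Sum>a\<in>{..<m}. X c a * \<phi> r (\<epsilon> a))) = det (mat d d (\<lambda>(r, c). \<phi> r (b c)))"
    by (simp add: det_transpose[of _ d])
  then have nz': "det (mat d d (\<lambda>(c, r). \<Sum>a\<in>{..<m}. X c a * \<phi> r (\<epsilon> a))) \<noteq> 0" using nz by simp
  have surj: "\<exists>x. \<forall>c\<in>{..<d}. (\<Sum>a\<in>{..<m}. X c a * x a) = y c" for y
    by (rule surjective_if_det_nonzero[where h = "\<lambda>c. c" and Y = "\<lambda>a r. \<phi> r (\<epsilon> a)" and r = d])
      (use nz' in \<open>auto simp: bij_betw_def\<close>)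
  obtain Y where Y: "\<And>c c'. c \<in> {..<d} \<Longrightarrow> c' \<in> {..<d} \<Longrightarrow> (\<Sum>a\<in>{..<m}. X c a * Y a c') = of_bool (c = c')"
    by (rule right_inverse_of_surjective[OF surj]) (rule that)
  have dm: "d \<le> m" using right_inverse_le_card[of "{..<d}" "{..<m}" X Y] Y by simp
  obtain X' Y' where XY: "\<forall>c<d. X' c = X c" "\<forall>a<card {..<m}. \<forall>c<card {..<m}. (\<Sum>j\<in>{..<m}. X' a j * Y' j c) = of_bool (a = c)"
    using extend_right_invertible[of "{..<m}" d X Y] Y dm by auto
  have db': "dual_basis M {..<m} (\<lambda>a. comb M {..<m} (\<lambda>j. X' a j) \<epsilon>) (\<lambda>a x. \<Sum>j<m. Y' j a * \<zeta> j x)"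
    by (rule dual_basis_change[OF db]) (use XY(2) in simp)
  have "comb M {..<m} (\<lambda>j. X' c j) \<epsilon> = b c" if "c < d" for c
    using dual_basis_expand[OF db b[OF that]] XY(1) that by (simp add: X_def)
  with db' dm show thesis by (intro that)
qed

lemma dual_basis_reindex:
  assumes db: "dual_basis M I e \<xi>" and h: "bij_betw h I' I"
  shows "dual_basis M I' (\<lambda>a. e (h a)) (\<lambda>a. \<xi> (h a))"
proof -
  have hI: "h a \<in> I" if "a \<in> I'" for a using h that by (auto simp: bij_betw_def)
  have inj: "(h a = h b) = (a = b)" if "a \<in> I'" "b \<in> I'" for a b
    using h that by (auto simp: bij_betw_def inj_on_def)
  have surj: "\<exists>a'\<in>I'. a = h a'" if "a \<in> I" for a using h that by (auto simp: bij_betw_def)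
  show ?thesis
    unfolding dual_basis_def
  proof (intro conjI ballI impI)
    show "finite I'" using h dual_basisD(1)[OF db] bij_betw_finite by blast
    fix a assume a: "a \<in> I'"
    show "e (h a) \<in> carrier M" "functional M (\<xi> (h a))" using dual_basisD(2,3)[OF db hI[OF a]] by simp_all
    show "\<xi> (h a) (e (h b)) = of_bool (a = b)" if "b \<in> I'" for b
      using dual_basisD(4)[OF db hI[OF a] hI[OF that]] inj[OF a that] by simp
  next
    fix x assume "x \<in> carrier M" "\<forall>a\<in>I'. \<xi> (h a) x = 0"
    then show "x = \<zero>\<^bsub>M\<^esub>" using surj by (intro dual_basisD(5)[OF db]) auto
  qed
qed

lemma coordinate_subspace:
  fixes M :: "('k::field, 'v, 'z) module_scheme" and d m :: nat
  assumes "kspace M" and db: "dual_basis M {..<m} e \<xi>" and dm: "d \<le> m"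
  defines "U \<equiv> {x \<in> carrier M. \<forall>a\<in>{d..<m}. \<xi> a x = 0}"
  shows "VectorSpace.subspace class_ring U M" "dual_basis (M\<lparr>carrier := U\<rparr>) {..<d} e \<xi>"
proof -
  interpret kspace M by fact
  note D = dual_basisD[OF db]
  have f: "functional M (\<xi> a)" if "a \<in> {d..<m}" for a using that D(3) by simp
  show "VectorSpace.subspace class_ring U M"
    unfolding subspace_iff[OF vectorspace_axioms]
    using functional_zero[OF f] functional_add[OF f] functional_smult[OF f] by (auto simp: U_def)
  show "dual_basis (M\<lparr>carrier := U\<rparr>) {..<d} e \<xi>"
    unfolding dual_basis_def
  proof (intro conjI ballI impI)
    fix a assume a: "a \<in> {..<d}"
    then have am: "a \<in> {..<m}" using dm by simp
    have "\<xi> a' (e a) = 0" if "a' \<in> {d..<m}" for a' using D(4)[of a' a] that a am by auto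
    then show "e a \<in> carrier (M\<lparr>carrier := U\<rparr>)" using D(2)[OF am] by (simp add: U_def)
    show "functional (M\<lparr>carrier := U\<rparr>) (\<xi> a)"
      by (rule functional_subset[OF D(3)[OF am]]) (auto simp: U_def)
    show "\<xi> a (e b) = of_bool (a = b)" if "b \<in> {..<d}" for b by (rule D(4)[OF am]) (use that dm in auto)
  next
    fix x assume x: "x \<in> carrier (M\<lparr>carrier := U\<rparr>)" "\<forall>a\<in>{..<d}. \<xi> a x = 0"
    have "x = \<zero>\<^bsub>M\<^esub>"
    proof (rule D(5))
      show "x \<in> carrier M" using x by (simp add: U_def)
      show "\<xi> a x = 0" if a: "a \<in> {..<m}" for a
      proof (cases "a < d")
        case True then show ?thesis using bspec[OF x(2), of a] by simp
      next
        case False then show ?thesis using x(1) a by (simp add: U_def)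
      qed
    qed
    then show "x = \<zero>\<^bsub>M\<lparr>carrier := U\<rparr>\<^esub>" by simp
  qed (rule finite_lessThan)
qed

context middle
begin

definition spans :: "(nat \<Rightarrow> nat) \<Rightarrow> (nat \<Rightarrow> nat \<Rightarrow> 'v) \<Rightarrow> bool"
  where "spans d b \<longleftrightarrow> (\<exists>U\<in>grass_prod l d V. b \<in> frames l d V U)"

lemma grass_frame:
  assumes "U \<in> grass_prod l d V" "b \<in> frames l d V U" "i \<in> {1..l}"
  shows "VectorSpace.subspace class_ring (U i) (V i)" "\<exists>\<eta>. dual_basis ((V i)\<lparr>carrier := U i\<rparr>) {..<d i} (b i) \<eta>"
proof -
  show U: "VectorSpace.subspace class_ring (U i) (V i)" using assms by (auto simp: grass_prod_def dest!: PiE_mem)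
  interpret kspace "(V i)\<lparr>carrier := U i\<rparr>" by (rule kspace_subspace[OF V_space[OF assms(3)] U])
  show "\<exists>\<eta>. dual_basis ((V i)\<lparr>carrier := U i\<rparr>) {..<d i} (b i) \<eta>"
    using assms(2,3) by (intro basis_dual_basis) (auto simp: frames_def)
qed

lemma frame_in: 
  assumes "U \<in> grass_prod l d V" "b \<in> frames l d V U" "i \<in> {1..l}" "c < d i"
  shows "b i c \<in> U i" "b i c \<in> carrier (V i)"
proof -
  obtain \<eta> where "dual_basis ((V i)\<lparr>carrier := U i\<rparr>) {..<d i} (b i) \<eta>" using grass_frame[OF assms(1-3)] by blast
  from dual_basisD(2)[OF this] show "b i c \<in> U i" using assms(4) by simp
  then show "b i c \<in> carrier (V i)"
    using grass_frame(1)[OF assms(1-3)] subspace_iff[of "V i"] V_space[OF assms(3)] by (auto simp: kspace_def)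
qed

lemma frame_expand:
  assumes "U \<in> grass_prod l d V" "b \<in> frames l d V U" "i \<in> {1..l}" "x \<in> U i"
  shows "\<exists>t. x = comb (V i) {..<d i} t (b i)"
proof -
  obtain \<eta> where \<eta>: "dual_basis ((V i)\<lparr>carrier := U i\<rparr>) {..<d i} (b i) \<eta>" using grass_frame[OF assms(1-3)] by blast
  have U: "kspace ((V i)\<lparr>carrier := U i\<rparr>)" by (rule kspace_subspace[OF V_space[OF assms(3)] grass_frame(1)[OF assms(1-3)]])
  have sub: "U i \<subseteq> carrier (V i)"
    using grass_frame(1)[OF assms(1-3)] subspace_iff[of "V i"] V_space[OF assms(3)] by (auto simp: kspace_def)
  have "(\<lambda>x. x) \<in> khom ((V i)\<lparr>carrier := U i\<rparr>) (V i)" using sub by (auto simp: khom_iff)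
  then have "comb ((V i)\<lparr>carrier := U i\<rparr>) {..<d i} (\<lambda>a. \<eta> a x) (b i) = comb (V i) {..<d i} (\<lambda>a. \<eta> a x) (b i)"
    by (rule hom_comb[OF U V_space[OF assms(3)]]) (use dual_basisD(2)[OF \<eta>] in simp)
  moreover have "comb ((V i)\<lparr>carrier := U i\<rparr>) {..<d i} (\<lambda>a. \<eta> a x) (b i) = x"
    by (rule kspace.dual_basis_expand[OF U \<eta>]) (use assms(4) in simp)
  ultimately show ?thesis by metis
qed

text \<open>Some Plucker coordinate of a frame is nonzero: the coordinates of independent vectors
  form an injective matrix, and the rows of a left inverse are functionals dual to the
  frame.\<close>

lemma frame_det:
  assumes "U \<in> grass_prod l d V" "b \<in> frames l d V U" "i \<in> {1..l}"
  shows "\<exists>\<phi>. (\<forall>r<d i. functional (V i) (\<phi> r)) \<and> det (mat (d i) (d i) (\<lambda>(r, c). \<phi> r (b i c))) \<noteq> 0"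
proof -
  interpret kspace "V i" by (rule V_space[OF assms(3)])
  obtain \<eta> where \<eta>: "dual_basis ((V i)\<lparr>carrier := U i\<rparr>) {..<d i} (b i) \<eta>" using grass_frame[OF assms] by blast
  interpret U: kspace "(V i)\<lparr>carrier := U i\<rparr>" by (rule kspace_subspace[OF kspace_axioms grass_frame(1)[OF assms]])
  obtain e \<xi> where db: "dual_basis (V i) {..<v i} e \<xi>" using exists_dual_bases assms(3) by blast
  have sub: "U i \<subseteq> carrier (V i)" using grass_frame(1)[OF assms] subspace_iff[OF vectorspace_axioms] by auto
  have ih: "(\<lambda>x. x) \<in> khom ((V i)\<lparr>carrier := U i\<rparr>) (V i)" using sub by (auto simp: khom_iff)
  have inj: "\<forall>c\<in>{..<d i}. x c = 0" if z: "\<forall>a\<in>{..<v i}. (\<Sum>c\<in>{..<d i}. \<xi> a (b i c) * x c) = 0" for x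
  proof -
    have bc: "b i c \<in> carrier (V i)" if "c \<in> {..<d i}" for c using frame_in[OF assms] that by simp
    have eq: "comb ((V i)\<lparr>carrier := U i\<rparr>) {..<d i} x (b i) = comb (V i) {..<d i} x (b i)"
      by (rule hom_comb[OF U.kspace_axioms kspace_axioms ih]) (use dual_basisD(2)[OF \<eta>] in simp)
    have "comb (V i) {..<d i} x (b i) = \<zero>\<^bsub>V i\<^esub>"
    proof (rule dual_basisD(5)[OF db comb_closed[OF bc]])
      fix a assume a: "a \<in> {..<v i}"
      have "\<xi> a (comb (V i) {..<d i} x (b i)) = (\<Sum>c\<in>{..<d i}. x c * \<xi> a (b i c))"
        by (rule functional_comb[OF dual_basisD(3)[OF db a] bc])
      then show "\<xi> a (comb (V i) {..<d i} x (b i)) = 0" using z a by (simp add: mult.commute)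
    qed
    then have "comb ((V i)\<lparr>carrier := U i\<rparr>) {..<d i} x (b i) = \<zero>\<^bsub>(V i)\<lparr>carrier := U i\<rparr>\<^esub>" using eq by simp
    then show ?thesis
      using U.dual_basis_comb[OF \<eta>, of _ x] U.functional_zero[OF dual_basisD(3)[OF \<eta>]] by simp
  qed
  obtain Y where Y: "\<And>r c. r \<in> {..<d i} \<Longrightarrow> c \<in> {..<d i} \<Longrightarrow> (\<Sum>a\<in>{..<v i}. Y r a * \<xi> a (b i c)) = of_bool (r = c)"
  proof (rule left_inverse_of_injective[OF finite_lessThan finite_lessThan, where M = "\<lambda>a c. \<xi> a (b i c)"])
    show "\<forall>c\<in>{..<d i}. x c = 0" if "\<forall>a\<in>{..<v i}. (\<Sum>c\<in>{..<d i}. \<xi> a (b i c) * x c) = 0" for x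
      by (rule inj[OF that])
  qed (rule that)
  have "functional (V i) (\<lambda>x. \<Sum>a\<in>{..<v i}. Y r a * \<xi> a x)" for r
    by (rule functional_sum) (rule dual_basisD(3)[OF db])
  moreover have "det (mat (d i) (d i) (\<lambda>(r, c). \<Sum>a\<in>{..<v i}. Y r a * \<xi> a (b i c))) = 1"
    by (rule det_one_of_bool[of "\<lambda>x. x"]) (use Y in auto)
  ultimately show ?thesis by (intro exI[of _ "\<lambda>r x. \<Sum>a\<in>{..<v i}. Y r a * \<xi> a x"]) simp
qed

text \<open>The converse of \<open>frame_det\<close>: a nonzero determinant certifies independence,
  and an adapted basis exhibits the span as a coordinate subspace of dimension
  \<open>d i\<close>.\<close>

lemma spansI:
  assumes b: "\<And>i c. i \<in> {1..l} \<Longrightarrow> c < d i \<Longrightarrow> b i c \<in> carrier (V i)"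
    and \<phi>: "\<And>i r. i \<in> {1..l} \<Longrightarrow> r < d i \<Longrightarrow> functional (V i) (\<phi> i r)"
    and nz: "\<And>i. i \<in> {1..l} \<Longrightarrow> det (mat (d i) (d i) (\<lambda>(r, c). \<phi> i r (b i c))) \<noteq> 0"
  shows "spans d b"
proof -
  have "\<exists>U. VectorSpace.subspace class_ring U (V i) \<and> vdim ((V i)\<lparr>carrier := U\<rparr>) = d i \<and>
      inj_on (b i) {..<d i} \<and> vectorspace.basis class_ring ((V i)\<lparr>carrier := U\<rparr>) (b i ` {..<d i})" if i: "i \<in> {1..l}" for i
  proof -
    obtain \<epsilon> \<zeta> where db0: "dual_basis (V i) {..<v i} \<epsilon> \<zeta>" using exists_dual_bases i by blast
    obtain e \<xi> where e: "dual_basis (V i) {..<v i} e \<xi>" "\<And>c. c < d i \<Longrightarrow> e c = b i c" "d i \<le> v i"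
      by (rule adapted_basis[OF V_space[OF i] db0 b[OF i] \<phi>[OF i] nz[OF i]]) (assumption | rule that)+
    let ?U = "{x \<in> carrier (V i). \<forall>a\<in>{d i..<v i}. \<xi> a x = 0}"
    note U = coordinate_subspace[OF V_space[OF i] e(1,3)]
    interpret kspace "(V i)\<lparr>carrier := ?U\<rparr>" by (rule kspace_subspace[OF V_space[OF i] U(1)])
    have im: "b i ` {..<d i} = e ` {..<d i}" using e(2) by auto
    have inj: "inj_on (b i) {..<d i}" using dual_basis_inj[OF U(2)] e(2) by (simp add: inj_on_def)
    show ?thesis
      using U(1) dual_basis_dim[OF U(2)] dual_basis_basis[OF U(2)] inj im by (intro exI[of _ ?U]) simp
  qed
  then have "\<exists>U. \<forall>i\<in>{1..l}. VectorSpace.subspace class_ring (U i) (V i) \<and> vdim ((V i)\<lparr>carrier := U i\<rparr>) = d i \<and>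
      inj_on (b i) {..<d i} \<and> vectorspace.basis class_ring ((V i)\<lparr>carrier := U i\<rparr>) (b i ` {..<d i})"
    by (intro bchoice ballI)
  then obtain U where U: "\<forall>i\<in>{1..l}. VectorSpace.subspace class_ring (U i) (V i) \<and> vdim ((V i)\<lparr>carrier := U i\<rparr>) = d i \<and>
      inj_on (b i) {..<d i} \<and> vectorspace.basis class_ring ((V i)\<lparr>carrier := U i\<rparr>) (b i ` {..<d i})"
    by (elim exE)
  have "restrict U {1..l} \<in> grass_prod l d V" using U by (simp add: grass_prod_def)
  moreover have "b \<in> frames l d V (restrict U {1..l})" using U by (simp add: frames_def)
  ultimately show ?thesis by (auto simp: spans_def)
qed

end

section \<open>Density of nonempty open sets\<close>

locale middle_alg_closed = middle L l n V
  for L :: "('k::alg_closed_field, 'r) module" and l :: nat and n :: "nat \<Rightarrow> nat" and V :: "nat \<Rightarrow> ('k, 'v, 'r) lmodule"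
begin

text \<open>Irreducibility of the product of Grassmannians. Along the line joining the two frames
  both forms are polynomials in \<open>t\<close>, one nonzero at \<open>t = 0\<close> and the other
  at \<open>t = 1\<close>, so some point of the line suits both.\<close>

lemma plucker_common_nonzero:
  assumes F: "(e, F) \<in> plucker_forms l d V" "spans d b" "F b \<noteq> 0"
    and G: "(e', G) \<in> plucker_forms l d V" "spans d b'" "G b' \<noteq> 0"
  shows "\<exists>b''. spans d b'' \<and> F b'' * G b'' \<noteq> 0"
proof -
  obtain U where U: "U \<in> grass_prod l d V" "b \<in> frames l d V U" using F(2) by (auto simp: spans_def)
  obtain U' where U': "U' \<in> grass_prod l d V" "b' \<in> frames l d V U'" using G(2) by (auto simp: spans_def)
  have "\<forall>i\<in>{1..l}. \<exists>\<phi>. (\<forall>r<d i. functional (V i) (\<phi> r)) \<and> det (mat (d i) (d i) (\<lambda>(r, c). \<phi> r (b i c))) \<noteq> 0"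
    using frame_det[OF U] by blast
  then have "\<exists>\<phi>. \<forall>i\<in>{1..l}. (\<forall>r<d i. functional (V i) (\<phi> i r)) \<and> det (mat (d i) (d i) (\<lambda>(r, c). \<phi> i r (b i c))) \<noteq> 0"
    by (rule bchoice)
  then obtain \<phi> where \<phi>: "\<forall>i\<in>{1..l}. (\<forall>r<d i. functional (V i) (\<phi> i r)) \<and> det (mat (d i) (d i) (\<lambda>(r, c). \<phi> i r (b i c))) \<noteq> 0"
    by (elim exE)
  \<comment> \<open>A product of Plucker coordinates that is nonzero at \<open>b\<close>. Where it
    does not vanish on the line, the tuple is still independent and so represents a point.\<close>
  define D where "D = (\<lambda>b. \<Prod>i\<in>{1..l}. det (mat (d i) (d i) (\<lambda>(r, c). \<phi> i r (b i c))))"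
  have D: "((\<lambda>k. \<Sum>i\<in>{1..l}. if k = i then 1 else 0), D) \<in> plucker_forms l d V"
    unfolding D_def by (rule plucker_prod) (use \<phi> in \<open>auto intro!: plucker_coord\<close>)
  note FD = plucker_forms.mult[OF F(1) D]
  note b = frame_in(2)[OF U] frame_in(2)[OF U']
  let ?l = "line V b b'"
  have l0: "H (?l 0) = H b" if "(e, H) \<in> plucker_forms l d V" for e H
  proof (rule plucker_cong[OF that])
    fix i c assume ic: "i \<in> {1..l}" "c < d i"
    interpret kspace "V i" by (rule V_space[OF ic(1)])
    show "?l 0 i c = b i c" using b[OF ic] by (simp add: line_def)
  qed
  have l1: "H (?l 1) = H b'" if "(e, H) \<in> plucker_forms l d V" for e H
  proof (rule plucker_cong[OF that])
    fix i c assume ic: "i \<in> {1..l}" "c < d i"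
    interpret kspace "V i" by (rule V_space[OF ic(1)])
    show "?l 1 i c = b' i c" using b[OF ic] by (simp add: line_def)
  qed
  have pF: "polyfun (\<lambda>t. F (?l t) * D (?l t))" by (rule plucker_polyfun[OF FD V_space b])
  have pG: "polyfun (\<lambda>t. G (?l t))" by (rule plucker_polyfun[OF G(1) V_space b])
  have "D b \<noteq> 0" using \<phi> by (simp add: D_def)
  then have nF: "F (?l 0) * D (?l 0) \<noteq> 0" using l0[OF F(1)] l0[OF D] F(3) by simp
  have nG: "G (?l 1) \<noteq> 0" using l1[OF G(1)] G(3) by simp
  obtain t where t: "F (?l t) * D (?l t) \<noteq> 0" "G (?l t) \<noteq> 0"
    by (rule polyfun_common_nonzero[OF pF pG nF nG]) (rule that)
  have "spans d (?l t)"
  proof (rule spansI)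
    fix i assume i: "i \<in> {1..l}"
    interpret kspace "V i" by (rule V_space[OF i])
    show "?l t i c \<in> carrier (V i)" if "c < d i" for c using b[OF i that] by (simp add: line_def)
    show "functional (V i) (\<phi> i r)" if "r < d i" for r using \<phi> i that by blast
    have "D (?l t) \<noteq> 0" using t by simp
    then show "det (mat (d i) (d i) (\<lambda>(r, c). \<phi> i r (?l t i c))) \<noteq> 0" using i by (auto simp: D_def)
  qed
  with t show ?thesis by (intro exI[of _ "?l t"]) simp
qed

text \<open>The topology is given by generators, hence the induction. For an intersection the
  product of the two forms is taken; that it is nonzero somewhere is
  \<open>plucker_common_nonzero\<close>.\<close>

lemma open_contains_plucker_set:
  assumes "openin (zariski_topology l d V) T" "T \<noteq> {}"
  shows "\<exists>e F. (e, F) \<in> plucker_forms l d V \<and> (\<exists>b. spans d b \<and> F b \<noteq> 0) \<and>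
    (\<forall>U\<in>grass_prod l d V. \<forall>b\<in>frames l d V U. F b \<noteq> 0 \<longrightarrow> U \<in> T)"
proof -
  have "generate_topology_on
      {{U \<in> grass_prod l d V. \<exists>b\<in>frames l d V U. F b \<noteq> 0} |e F. (e, F) \<in> plucker_forms l d V} T"
    using assms(1) unfolding zariski_topology_def openin_topology_generated_by_iff .
  then show ?thesis using assms(2)
  proof (induct rule: generate_topology_on.induct)
    case (Int T T')
    then obtain e F b e' F' b' where F: "(e, F) \<in> plucker_forms l d V" "spans d b" "F b \<noteq> 0"
      and F': "(e', F') \<in> plucker_forms l d V" "spans d b'" "F' b' \<noteq> 0"
      and sub: "\<forall>U\<in>grass_prod l d V. \<forall>b\<in>frames l d V U. F b \<noteq> 0 \<longrightarrow> U \<in> T"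
        "\<forall>U\<in>grass_prod l d V. \<forall>b\<in>frames l d V U. F' b \<noteq> 0 \<longrightarrow> U \<in> T'"
      by (metis (no_types, lifting) Int_empty_left Int_empty_right)
    show ?case
      using plucker_forms.mult[OF F(1) F'(1)] plucker_common_nonzero[OF F F'] sub
      by (intro exI[of _ "\<lambda>k. e k + e' k"] exI[of _ "\<lambda>b. F b * F' b"]) auto
  next
    case (UN K)
    then obtain T' where T': "T' \<in> K" "T' \<noteq> {}" by blast
    from UN(2)[OF this] obtain e F where F: "(e, F) \<in> plucker_forms l d V \<and> (\<exists>b. spans d b \<and> F b \<noteq> 0) \<and>
      (\<forall>U\<in>grass_prod l d V. \<forall>b\<in>frames l d V U. F b \<noteq> 0 \<longrightarrow> U \<in> T')" by (elim exE)
    show ?case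
    proof (intro exI[of _ e] exI[of _ F] conjI ballI impI)
      show "(e, F) \<in> plucker_forms l d V" "\<exists>b. spans d b \<and> F b \<noteq> 0" using F by simp_all
      show "U \<in> \<Union>K" if "U \<in> grass_prod l d V" "b \<in> frames l d V U" "F b \<noteq> 0" for U b
        using F that T'(1) by blast
    qed
  next
    case (Basis T)
    then obtain e F where "(e, F) \<in> plucker_forms l d V" "T = {U \<in> grass_prod l d V. \<exists>b\<in>frames l d V U. F b \<noteq> 0}"
      by auto
    then show ?case using Basis(2) by (intro exI[of _ e] exI[of _ F]) (auto simp: spans_def)
  qed simp
qed

lemma plucker_set_dense:
  assumes F: "(e, F) \<in> plucker_forms l d V" "spans d b" "F b \<noteq> 0"
  defines "Q \<equiv> {U \<in> grass_prod l d V. \<exists>b\<in>frames l d V U. F b \<noteq> 0}"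
  shows "openin (zariski_topology l d V) Q"
    "zariski_topology l d V closure_of Q = topspace (zariski_topology l d V)"
proof -
  show "openin (zariski_topology l d V) Q"
    unfolding zariski_topology_def Q_def using F(1) by (intro topology_generated_by_Basis) auto
  show "zariski_topology l d V closure_of Q = topspace (zariski_topology l d V)"
  proof (rule antisym[OF closure_of_subset_topspace], rule subsetI)
    fix U assume U: "U \<in> topspace (zariski_topology l d V)"
    show "U \<in> zariski_topology l d V closure_of Q"
      unfolding in_closure_of
    proof (intro conjI allI impI U)
      fix T assume T: "U \<in> T \<and> openin (zariski_topology l d V) T"
      then obtain e' G where G: "(e', G) \<in> plucker_forms l d V" "\<exists>b. spans d b \<and> G b \<noteq> 0"
        "\<forall>U\<in>grass_prod l d V. \<forall>b\<in>frames l d V U. G b \<noteq> 0 \<longrightarrow> U \<in> T"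
        using open_contains_plucker_set[of d T] by blast
      then obtain b' where "spans d b'" "G b' \<noteq> 0" by blast
      from plucker_common_nonzero[OF F G(1) this] obtain b'' where "spans d b''" "F b'' \<noteq> 0" "G b'' \<noteq> 0" by auto
      then show "\<exists>y. y \<in> Q \<and> y \<in> T" using G(3) unfolding spans_def Q_def by blast
    qed
  qed
qed

text \<open>Maximal rank of a matrix of forms of equal degree is detected by a product of such a matrix with a constant one.\<close>

lemma plucker_max_rank_form:
  fixes M :: "(nat \<Rightarrow> nat \<Rightarrow> 'v) \<Rightarrow> 'p \<Rightarrow> 'x \<Rightarrow> 'k"
  assumes fin: "finite P" "finite K"
    and M: "\<And>p k. p \<in> P \<Longrightarrow> k \<in> K \<Longrightarrow> (e, \<lambda>b. M b p k) \<in> plucker_forms l d V"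
    and zero: "(e, \<lambda>b. 0) \<in> plucker_forms l d V"
    and rank: "(\<forall>x. (\<forall>p\<in>P. (\<Sum>k\<in>K. M b0 p k * x k) = 0) \<longrightarrow> (\<forall>k\<in>K. x k = 0)) \<or>
     (\<forall>y. \<exists>x. \<forall>p\<in>P. (\<Sum>k\<in>K. M b0 p k * x k) = y p)"
  obtains e' F where "(e', F) \<in> plucker_forms l d V" "F b0 \<noteq> 0"
    "\<And>b. F b \<noteq> 0 \<Longrightarrow> (\<forall>x. (\<forall>p\<in>P. (\<Sum>k\<in>K. M b p k * x k) = 0) \<longrightarrow> (\<forall>k\<in>K. x k = 0)) \<or>
     (\<forall>y. \<exists>x. \<forall>p\<in>P. (\<Sum>k\<in>K. M b p k * x k) = y p)"
  using rank
proof (elim disjE)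
  assume inj: "\<forall>x. (\<forall>p\<in>P. (\<Sum>k\<in>K. M b0 p k * x k) = 0) \<longrightarrow> (\<forall>k\<in>K. x k = 0)"
  obtain Y where Y: "\<And>k k'. k \<in> K \<Longrightarrow> k' \<in> K \<Longrightarrow> (\<Sum>p\<in>P. Y k p * M b0 p k') = of_bool (k = k')"
  proof (rule left_inverse_of_injective[OF fin, where M = "M b0"])
    show "\<forall>k\<in>K. x k = 0" if "\<forall>p\<in>P. (\<Sum>k\<in>K. M b0 p k * x k) = 0" for x using inj that by (elim allE impE)
  qed (rule that)
  obtain h where h: "bij_betw h {..<card K} K"
    using ex_bij_betw_nat_finite[OF fin(2)] by (auto simp: atLeast0LessThan)
  then have hK: "h a \<in> K" if "a < card K" for a using that by (auto simp: bij_betw_def)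
  let ?F = "\<lambda>b. det (mat (card K) (card K) (\<lambda>(a, c). \<Sum>p\<in>P. Y (h a) p * M b p (h c)))"
  show thesis
  proof (rule that)
    show "((\<lambda>k. \<Sum>i\<in>{0..<card K}. e k), ?F) \<in> plucker_forms l d V"
      by (rule plucker_det) (intro plucker_sum plucker_scale zero M hK)
    have "?F b0 = 1"
      by (rule det_one_of_bool[of h]) (use h Y hK in \<open>auto simp: bij_betw_def\<close>)
    then show "?F b0 \<noteq> 0" by simp
    fix b assume "?F b \<noteq> 0"
    then show "(\<forall>x. (\<forall>p\<in>P. (\<Sum>k\<in>K. M b p k * x k) = 0) \<longrightarrow> (\<forall>k\<in>K. x k = 0)) \<or>
     (\<forall>y. \<exists>x. \<forall>p\<in>P. (\<Sum>k\<in>K. M b p k * x k) = y p)"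
      by (intro disjI1 allI impI ballI) (rule injective_if_det_nonzero[OF h])
  qed
next
  assume surj: "\<forall>y. \<exists>x. \<forall>p\<in>P. (\<Sum>k\<in>K. M b0 p k * x k) = y p"
  obtain Y where Y: "\<And>p p'. p \<in> P \<Longrightarrow> p' \<in> P \<Longrightarrow> (\<Sum>k\<in>K. M b0 p k * Y k p') = of_bool (p = p')"
    by (rule right_inverse_of_surjective[OF spec[OF surj]]) (rule that)
  obtain h where h: "bij_betw h {..<card P} P"
    using ex_bij_betw_nat_finite[OF fin(1)] by (auto simp: atLeast0LessThan)
  then have hP: "h a \<in> P" if "a < card P" for a using that by (auto simp: bij_betw_def)
  let ?F = "\<lambda>b. det (mat (card P) (card P) (\<lambda>(a, c). \<Sum>k\<in>K. M b (h a) k * Y k (h c)))"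
  show thesis
  proof (rule that)
    have "(e, \<lambda>b. \<Sum>k\<in>K. M b (h a) k * Y k (h c)) \<in> plucker_forms l d V" if "a < card P" "c < card P" for a c
      unfolding mult.commute[of "M _ _ _"] using that by (intro plucker_sum plucker_scale zero M hP)
    then show "((\<lambda>k. \<Sum>i\<in>{0..<card P}. e k), ?F) \<in> plucker_forms l d V"
      by (rule plucker_det)
    have "?F b0 = 1"
      by (rule det_one_of_bool[of h]) (use h Y hP in \<open>auto simp: bij_betw_def\<close>)
    then show "?F b0 \<noteq> 0" by simp
    fix b assume "?F b \<noteq> 0"
    then show "(\<forall>x. (\<forall>p\<in>P. (\<Sum>k\<in>K. M b p k * x k) = 0) \<longrightarrow> (\<forall>k\<in>K. x k = 0)) \<or>
     (\<forall>y. \<exists>x. \<forall>p\<in>P. (\<Sum>k\<in>K. M b p k * x k) = y p)"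
      by (intro disjI2 allI) (rule surjective_if_det_nonzero[OF h])
  qed
qed

end

section \<open>Quotient spaces\<close>

context kspace
begin

context
  fixes U assumes U: "VectorSpace.subspace class_ring U M"
begin

lemma subspaceD:
  "x \<in> U \<Longrightarrow> x \<in> carrier M" "\<zero> \<in> U" "x \<in> U \<Longrightarrow> y \<in> U \<Longrightarrow> x \<oplus> y \<in> U" "x \<in> U \<Longrightarrow> c \<odot> x \<in> U"
  "x \<in> U \<Longrightarrow> y \<in> U \<Longrightarrow> x \<ominus> y \<in> U"
proof -
  show *: "x \<in> U \<Longrightarrow> x \<in> carrier M" "\<zero> \<in> U" "x \<in> U \<Longrightarrow> y \<in> U \<Longrightarrow> x \<oplus> y \<in> U" "x \<in> U \<Longrightarrow> c \<odot> x \<in> U" for x y c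
    using U unfolding subspace_iff[OF vectorspace_axioms] by auto
  show "x \<in> U \<Longrightarrow> y \<in> U \<Longrightarrow> x \<ominus> y \<in> U" using * by (simp add: minus_conv)
qed

lemma mem_coset_iff:
  assumes x: "x \<in> carrier M"
  shows "z \<in> U +> x \<longleftrightarrow> z \<in> carrier M \<and> z \<ominus> x \<in> U"
proof
  assume "z \<in> U +> x"
  then obtain h where h: "h \<in> U" "z = h \<oplus> x" by (auto simp: a_r_coset_def')
  have hc: "h \<in> carrier M" by (rule subspaceD(1)[OF h(1)])
  have "z \<ominus> x = h" using hc x h(2) by (simp add: a_minus_def M.a_assoc M.r_neg)
  then show "z \<in> carrier M \<and> z \<ominus> x \<in> U" using h hc x by simp
next
  assume z: "z \<in> carrier M \<and> z \<ominus> x \<in> U"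
  then have "z = (z \<ominus> x) \<oplus> x" using x by (simp add: a_minus_def M.a_assoc M.l_neg)
  then show "z \<in> U +> x" using z by (auto simp: a_r_coset_def')
qed

lemma coset_eq_iff:
  assumes x: "x \<in> carrier M" and y: "y \<in> carrier M"
  shows "U +> x = U +> y \<longleftrightarrow> x \<ominus> y \<in> U"
proof
  assume "U +> x = U +> y"
  moreover have "x \<in> U +> x" using x subspaceD(2) by (simp add: mem_coset_iff a_minus_def M.r_neg)
  ultimately show "x \<ominus> y \<in> U" using y by (simp add: mem_coset_iff)
next
  assume xy: "x \<ominus> y \<in> U"
  have 1: "z \<ominus> y = (z \<ominus> x) \<oplus> (x \<ominus> y)" if "z \<in> carrier M" for z
  proof -
    have "\<ominus> x \<oplus> (x \<oplus> \<ominus> y) = \<ominus> y" using x y by (simp add: M.l_neg flip: M.a_assoc)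
    moreover have "z \<oplus> \<ominus> x \<oplus> (x \<oplus> \<ominus> y) = z \<oplus> (\<ominus> x \<oplus> (x \<oplus> \<ominus> y))"
      by (rule M.a_assoc) (use x y that in simp_all)
    ultimately show ?thesis unfolding a_minus_def by (simp only:)
  qed
  have 2: "z \<ominus> x = (z \<ominus> y) \<ominus> (x \<ominus> y)" if "z \<in> carrier M" for z
  proof -
    have "(z \<ominus> y) \<ominus> (x \<ominus> y) = (z \<ominus> x) \<oplus> (x \<ominus> y) \<oplus> \<ominus> (x \<ominus> y)"
      unfolding 1[OF that] by (rule a_minus_def)
    also have "\<dots> = (z \<ominus> x) \<oplus> ((x \<ominus> y) \<oplus> \<ominus> (x \<ominus> y))"
      by (rule M.a_assoc) (use x y that in simp_all)
    also have "(x \<ominus> y) \<oplus> \<ominus> (x \<ominus> y) = \<zero>" by (rule M.r_neg) (use x y in simp)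
    finally show ?thesis using x y that by simp
  qed
  show "U +> x = U +> y"
  proof (rule Set.set_eqI)
    fix z
    have "z \<ominus> x \<in> U \<longleftrightarrow> z \<ominus> y \<in> U" if z: "z \<in> carrier M"
      using subspaceD(3)[OF _ xy, of "z \<ominus> x", folded 1[OF z]] subspaceD(5)[OF _ xy, of "z \<ominus> y", folded 2[OF z]]
      by blast
    then show "z \<in> U +> x \<longleftrightarrow> z \<in> U +> y" using x y by (auto simp: mem_coset_iff)
  qed
qed

lemma carrier_quot: "carrier (quot_space M U) = (\<lambda>x. U +> x) ` carrier M"
  by (auto simp: quot_space_def A_RCOSETS_def' a_r_coset_def')

lemma add_quot:
  assumes "x \<in> carrier M" "y \<in> carrier M"
  shows "(U +> x) \<oplus>\<^bsub>quot_space M U\<^esub> (U +> y) = U +> (x \<oplus> y)"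
proof -
  have "(U +> x) \<oplus>\<^bsub>quot_space M U\<^esub> (U +> y) = {p \<oplus> q |p q. p \<in> U +> x \<and> q \<in> U +> y}"
    by (auto simp: quot_space_def set_add_def')
  also have "\<dots> = U +> (x \<oplus> y)"
  proof (intro Set.set_eqI iffI)
    fix z assume "z \<in> {p \<oplus> q |p q. p \<in> U +> x \<and> q \<in> U +> y}"
    then obtain h k where h: "h \<in> U" "k \<in> U" "z = (h \<oplus> x) \<oplus> (k \<oplus> y)" by (auto simp: a_r_coset_def')
    have "z = (h \<oplus> k) \<oplus> (x \<oplus> y)"
      using assms subspaceD(1)[OF h(1)] subspaceD(1)[OF h(2)] h(3) by (simp add: M.a_ac)
    then show "z \<in> U +> (x \<oplus> y)" using subspaceD(3)[OF h(1,2)] by (auto simp: a_r_coset_def')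
  next
    fix z assume "z \<in> U +> (x \<oplus> y)"
    then obtain h where h: "h \<in> U" "z = h \<oplus> (x \<oplus> y)" by (auto simp: a_r_coset_def')
    have "z = (h \<oplus> x) \<oplus> (\<zero> \<oplus> y)" using assms subspaceD(1)[OF h(1)] h(2) by (simp add: M.a_ac)
    then show "z \<in> {p \<oplus> q |p q. p \<in> U +> x \<and> q \<in> U +> y}"
      using h(1) subspaceD(2) unfolding a_r_coset_def' by blast
  qed
  finally show ?thesis .
qed

text \<open>All representatives \<open>z\<close> give the same coset, so the union in the definition
  of the scalar multiple is that single coset.\<close>

lemma smult_quot:
  assumes "x \<in> carrier M"
  shows "c \<odot>\<^bsub>quot_space M U\<^esub> (U +> x) = U +> (c \<odot> x)"
proof -
  have "U +> (c \<odot> z) = U +> (c \<odot> x)" if "z \<in> U +> x" for z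
  proof -
    have z: "z \<in> carrier M" "z \<ominus> x \<in> U" using that assms by (simp_all add: mem_coset_iff)
    have "c \<odot> z \<ominus> c \<odot> x = c \<odot> (z \<ominus> x)"
      using z(1) assms by (simp add: minus_conv smult_add_right flip: smult_assoc)
    then show ?thesis using subspaceD(4)[OF z(2), of c] z(1) assms by (simp add: coset_eq_iff)
  qed
  then have "(\<Union>z\<in>U +> x. U +> (c \<odot> z)) = (\<Union>z\<in>U +> x. U +> (c \<odot> x))" by (intro SUP_cong refl)
  moreover have "x \<in> U +> x" using assms subspaceD(2) by (simp add: mem_coset_iff a_minus_def M.r_neg)
  then have "(\<Union>z\<in>U +> x. U +> (c \<odot> x)) = U +> (c \<odot> x)" by (intro SUP_const) blast
  ultimately show ?thesis by (simp add: quot_space_def)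
qed

lemma zero_quot: "\<zero>\<^bsub>quot_space M U\<^esub> = U +> \<zero>"
proof -
  have "U +> \<zero> = U"
  proof (rule Set.set_eqI)
    fix z show "z \<in> U +> \<zero> \<longleftrightarrow> z \<in> U" using subspaceD(1)[of z] by (auto simp: mem_coset_iff minus_conv)
  qed
  then show ?thesis by (simp add: quot_space_def)
qed

lemma kspace_quot: "kspace (quot_space M U)"
  by (rule kspaceI)
    (auto simp: carrier_quot zero_quot add_quot smult_quot M.a_ac smult_add_left smult_add_right smult_assoc)

lemma quot_hom: "(\<lambda>x. U +> x) \<in> khom M (quot_space M U)"
  by (auto simp: khom_iff carrier_quot add_quot smult_quot)

end

end

section \<open>A chart of the Grassmannian\<close>

definition chart_det :: "nat \<Rightarrow> (nat \<Rightarrow> 'v \<Rightarrow> 'k::field) \<Rightarrow> (nat \<Rightarrow> 'v) \<Rightarrow> 'k"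
  where "chart_det d \<xi> b = det (mat d d (\<lambda>(r, c). \<xi> r (b c)))"

text \<open>The numerator in Cramer's rule: divided by \<open>chart_det\<close>, it is the
  coefficient of \<open>\<xi> c\<close> when the functional \<open>\<psi>\<close> is expressed, on
  the span of \<open>b\<close>, through the first \<open>d\<close> coordinates. It is itself a
  Plucker coordinate.\<close>

definition chart_minor :: "nat \<Rightarrow> (nat \<Rightarrow> 'v \<Rightarrow> 'k::field) \<Rightarrow> ('v \<Rightarrow> 'k) \<Rightarrow> nat \<Rightarrow> (nat \<Rightarrow> 'v) \<Rightarrow> 'k"
  where "chart_minor d \<xi> \<psi> c b = det (mat d d (\<lambda>(r, c'). if r = c then \<psi> (b c') else \<xi> r (b c')))"

text \<open>The frame of the span of \<open>b\<close> that is dual, up to the factor \<^const>\<open>chart_det\<close>, to the first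
  coordinates, and the equations of that span.\<close>

definition chart_frame ::
    "('k::field, 'v, 'z) module_scheme \<Rightarrow> nat \<Rightarrow> nat \<Rightarrow> (nat \<Rightarrow> 'v) \<Rightarrow> (nat \<Rightarrow> 'v \<Rightarrow> 'k) \<Rightarrow> (nat \<Rightarrow> 'v) \<Rightarrow> nat \<Rightarrow> 'v"
  where "chart_frame M m d e \<xi> b c = comb M {..<m} (\<lambda>a. chart_minor d \<xi> (\<xi> a) c b) e"

definition chart_equation :: "nat \<Rightarrow> (nat \<Rightarrow> 'v \<Rightarrow> 'k::field) \<Rightarrow> (nat \<Rightarrow> 'v) \<Rightarrow> nat \<Rightarrow> 'v \<Rightarrow> 'k"
  where "chart_equation d \<xi> b c x = chart_det d \<xi> b * \<xi> (d + c) x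
    - (\<Sum>c'<d. chart_minor d \<xi> (\<xi> (d + c)) c' b * \<xi> c' x)"

context kspace
begin

context
  fixes m d :: nat and e \<xi> assumes db: "dual_basis M {..<m} e \<xi>" and dm: "d \<le> m"
begin

text \<open>At the center of the chart, frame and equations reduce to the given basis and its
  coordinates. This links the matrices of forms to the generic frame found in coordinates.\<close>

lemma chart_at_basis:
  assumes b: "\<And>c. c < d \<Longrightarrow> b c = e c"
  shows "chart_det d \<xi> b = 1" "a < m \<Longrightarrow> c < d \<Longrightarrow> chart_minor d \<xi> (\<xi> a) c b = of_bool (a = c)"
proof -
  have \<xi>: "\<xi> r (b c) = of_bool (r = c)" if "r < m" "c < d" for r c
    using dual_basisD(4)[OF db, of r c] b[OF that(2)] that dm by simp
  show 1: "chart_det d \<xi> b = 1"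
    unfolding chart_det_def by (rule det_one_of_bool[of "\<lambda>x. x"]) (use \<xi> dm in auto)
  assume a: "a < m" "c < d"
  show "chart_minor d \<xi> (\<xi> a) c b = of_bool (a = c)"
  proof (cases "a < d")
    case True
    then show ?thesis
      using det_repeat_row[OF a(2) True, of "\<lambda>r c'. \<xi> r (b c')"] 1 by (simp add: chart_minor_def chart_det_def)
  next
    case False
    have "chart_minor d \<xi> (\<xi> a) c b = (\<Sum>j<d. \<xi> a (b j) * cofactor (mat d d (\<lambda>(r, c'). \<xi> r (b c'))) c j)"
      unfolding chart_minor_def by (rule det_replace_row[OF a(2)])
    also have "\<dots> = 0" using False \<xi>[OF a(1)] by (intro sum.neutral) auto
    finally show ?thesis using False a(2) by auto
  qed
qed

context
  fixes U b \<eta> assumes U: "VectorSpace.subspace class_ring U M"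
    and bU: "\<And>c. c < d \<Longrightarrow> b c \<in> U" and span: "\<And>x. x \<in> U \<Longrightarrow> \<exists>t. x = comb M {..<d} t b"
begin

lemma e_closed: "a \<in> {..<m} \<Longrightarrow> e a \<in> carrier M" by (rule dual_basisD(2)[OF db])

lemma b_closed: "c \<in> {..<d} \<Longrightarrow> b c \<in> carrier M" using subspaceD(1)[OF U bU] by simp

lemma \<xi>_functional: "a < m \<Longrightarrow> functional M (\<xi> a)" by (rule dual_basisD(3)[OF db]) simp

text \<open>On each frame vector this is Cramer's rule, and both sides are linear in
  \<open>x\<close>.\<close>

lemma chart_relation:
  assumes \<psi>: "functional M \<psi>" and x: "x \<in> U"
  shows "(\<Sum>c<d. chart_minor d \<xi> \<psi> c b * \<xi> c x) = chart_det d \<xi> b * \<psi> x"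
proof -
  obtain t where t: "x = comb M {..<d} t b" using span[OF x] by blast
  have f: "functional M (\<lambda>x. \<Sum>c<d. chart_minor d \<xi> \<psi> c b * \<xi> c x)"
    by (rule functional_sum) (use dm \<xi>_functional in simp)
  have "(\<Sum>c<d. chart_minor d \<xi> \<psi> c b * \<xi> c x) = (\<Sum>j<d. t j * (\<Sum>c<d. chart_minor d \<xi> \<psi> c b * \<xi> c (b j)))"
    unfolding t by (rule functional_comb[OF f b_closed])
  also have "\<dots> = (\<Sum>j<d. t j * (chart_det d \<xi> b * \<psi> (b j)))"
    unfolding chart_minor_def chart_det_def
    by (intro sum.cong refl arg_cong[of _ _ "(*) _"] cramer_rows[of _ d "\<lambda>j. \<psi> (b j)" "\<lambda>r j. \<xi> r (b j)"]) simp
  also have "\<dots> = chart_det d \<xi> b * (\<Sum>j<d. t j * \<psi> (b j))" by (simp add: sum_distrib_left mult.left_commute)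
  also have "(\<Sum>j<d. t j * \<psi> (b j)) = \<psi> x" unfolding t by (rule functional_comb[OF \<psi> b_closed, symmetric])
  finally show ?thesis .
qed

lemma chart_frame_closed: "chart_frame M m d e \<xi> b c \<in> carrier M"
  unfolding chart_frame_def by (rule comb_closed[OF e_closed])

lemma chart_frame_coord: "a < m \<Longrightarrow> \<xi> a (chart_frame M m d e \<xi> b c) = chart_minor d \<xi> (\<xi> a) c b"
  unfolding chart_frame_def by (rule dual_basis_comb[OF db]) simp

text \<open>Expanding the minors along the replaced row writes the vector as a combination of the
  \<open>b j\<close> with cofactors as coefficients.\<close>

lemma chart_frame_in:
  assumes c: "c < d"
  shows "chart_frame M m d e \<xi> b c \<in> U"
proof -
  let ?k = "\<lambda>j. cofactor (mat d d (\<lambda>(r, c'). \<xi> r (b c'))) c j"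
  have "chart_frame M m d e \<xi> b c = comb M {..<d} ?k b"
  proof (rule dual_basis_eqI[OF db chart_frame_closed comb_closed[OF b_closed]])
    fix a assume a: "a \<in> {..<m}"
    have "\<xi> a (comb M {..<d} ?k b) = (\<Sum>j<d. ?k j * \<xi> a (b j))"
      by (rule functional_comb[OF dual_basisD(3)[OF db a] b_closed])
    then show "\<xi> a (chart_frame M m d e \<xi> b c) = \<xi> a (comb M {..<d} ?k b)"
      using a chart_frame_coord det_replace_row[OF c, of "\<lambda>j. \<xi> a (b j)" "\<lambda>r j. \<xi> r (b j)"]
      by (simp add: chart_minor_def mult.commute)
  qed
  then show ?thesis using comb_in_subspace[OF U, of "{..<d}" b] bU by simp
qed

text \<open>The relations are kept as a hypothesis because they come from membership in
  \<open>U\<close> in one use and from the equations in the other.\<close>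

lemma chart_frame_expand_coords:
  assumes x: "x \<in> carrier M"
    and rel: "\<And>a. a < m \<Longrightarrow> (\<Sum>c<d. chart_minor d \<xi> (\<xi> a) c b * \<xi> c x) = chart_det d \<xi> b * \<xi> a x"
  shows "chart_det d \<xi> b \<odot> x = comb M {..<d} (\<lambda>c. \<xi> c x) (chart_frame M m d e \<xi> b)"
proof (rule dual_basis_eqI[OF db _ comb_closed[OF chart_frame_closed]])
  show "chart_det d \<xi> b \<odot> x \<in> carrier M" using x by simp
  fix a assume a: "a \<in> {..<m}"
  have "\<xi> a (comb M {..<d} (\<lambda>c. \<xi> c x) (chart_frame M m d e \<xi> b)) = (\<Sum>c<d. \<xi> c x * chart_minor d \<xi> (\<xi> a) c b)"
    using a by (subst functional_comb[OF dual_basisD(3)[OF db a] chart_frame_closed]) (simp add: chart_frame_coord)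
  then show "\<xi> a (chart_det d \<xi> b \<odot> x) = \<xi> a (comb M {..<d} (\<lambda>c. \<xi> c x) (chart_frame M m d e \<xi> b))"
    using rel[of a] a functional_smult[OF dual_basisD(3)[OF db a] x] by (simp add: mult.commute)
qed

lemma chart_frame_expand:
  assumes "x \<in> U"
  shows "chart_det d \<xi> b \<odot> x = comb M {..<d} (\<lambda>c. \<xi> c x) (chart_frame M m d e \<xi> b)"
  by (rule chart_frame_expand_coords[OF subspaceD(1)[OF U assms]]) (rule chart_relation[OF \<xi>_functional assms])

lemma chart_equation_functional:
  assumes "c < m - d"
  shows "functional M (chart_equation d \<xi> b c)"
proof -
  have 1: "functional M (\<xi> (d + c))" using assms \<xi>_functional by simp
  have 2: "functional M (\<lambda>x. \<Sum>c'<d. chart_minor d \<xi> (\<xi> (d + c)) c' b * \<xi> c' x)"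
    by (rule functional_sum) (use dm \<xi>_functional in simp)
  show ?thesis
    using functional_lin[OF 1 2, of "chart_det d \<xi> b" "- 1"] by (simp add: chart_equation_def[abs_def])
qed

lemma chart_equation_iff:
  assumes nz: "chart_det d \<xi> b \<noteq> 0" and x: "x \<in> carrier M"
  shows "x \<in> U \<longleftrightarrow> (\<forall>c<m - d. chart_equation d \<xi> b c x = 0)"
proof
  assume xU: "x \<in> U"
  show "\<forall>c<m - d. chart_equation d \<xi> b c x = 0"
    using chart_relation[OF \<xi>_functional xU] by (simp add: chart_equation_def)
next
  assume z: "\<forall>c<m - d. chart_equation d \<xi> b c x = 0"
  have "chart_det d \<xi> b \<odot> x = comb M {..<d} (\<lambda>c. \<xi> c x) (chart_frame M m d e \<xi> b)"
  proof (rule chart_frame_expand_coords[OF x])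
    fix a assume a: "a < m"
    show "(\<Sum>c<d. chart_minor d \<xi> (\<xi> a) c b * \<xi> c x) = chart_det d \<xi> b * \<xi> a x"
    proof (cases "a < d")
      case True
      \<comment> \<open>For the first \<open>d\<close> coordinates the relation holds for every
        \<open>x\<close>: a minor with a repeated row vanishes, and only \<open>c = a\<close>
        survives. Hence the other \<open>m - d\<close> equations already cut out
        \<open>U\<close>.\<close>
      have "(\<Sum>c<d. chart_minor d \<xi> (\<xi> a) c b * \<xi> c x) = (\<Sum>c\<in>{..<d}. of_bool (a = c) * (chart_det d \<xi> b * \<xi> c x))"
        using det_repeat_row[OF _ True, of _ "\<lambda>r c'. \<xi> r (b c')"]
        by (intro sum.cong refl) (simp add: chart_minor_def chart_det_def)
      then show ?thesis using True by (simp add: sum_of_bool_mult)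
    next
      case False
      then have "chart_equation d \<xi> b (a - d) x = 0" using z a by simp
      then show ?thesis using False by (simp add: chart_equation_def)
    qed
  qed
  also have "\<dots> \<in> U" by (rule comb_in_subspace[OF U]) (use chart_frame_in in simp)
  finally have "(1 / chart_det d \<xi> b) \<odot> (chart_det d \<xi> b \<odot> x) \<in> U" by (rule subspaceD(4)[OF U])
  moreover have "(1 / chart_det d \<xi> b) \<odot> (chart_det d \<xi> b \<odot> x) = x"
    using smult_assoc[OF x, of "1 / chart_det d \<xi> b" "chart_det d \<xi> b"] nz x by simp
  ultimately show "x \<in> U" by simp
qed

end

end

end

section \<open>General choices\<close>

text \<open>The counterpart of \<open>adapted_basis\<close> for functionals: the \<open>u c\<close>
  become the last \<open>d'\<close> coordinates, that is, the equations of the span of the first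
  \<open>d\<close> basis vectors.\<close>

lemma adapted_equations:
  fixes M :: "('k::field, 'v, 'z) module_scheme"
  assumes "kspace M" and db: "dual_basis M {..<m} \<epsilon> \<zeta>" and m: "d + d' = m"
    and nz: "det (mat d' d' (\<lambda>(r, c). \<Sum>a<m. \<phi> r a * u c a)) \<noteq> 0"
  obtains e \<xi> where "dual_basis M {..<m} e \<xi>" "\<And>c x. c < d' \<Longrightarrow> \<xi> (d + c) x = (\<Sum>a<m. u c a * \<zeta> a x)"
proof -
  interpret kspace M by fact
  have "mat d' d' (\<lambda>(c, r). \<Sum>a<m. u c a * \<phi> r a) = (mat d' d' (\<lambda>(r, c). \<Sum>a<m. \<phi> r a * u c a))\<^sup>T"
    by (rule eq_matI) (auto simp: mult.commute)
  then have "det (mat d' d' (\<lambda>(c, r). \<Sum>a<m. u c a * \<phi> r a)) = det (mat d' d' (\<lambda>(r, c). \<Sum>a<m. \<phi> r a * u c a))"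
    by (simp add: det_transpose[of _ d'])
  then have nz': "det (mat d' d' (\<lambda>(c, r). \<Sum>a\<in>{..<m}. u c a * \<phi> r a)) \<noteq> 0" using nz by simp
  have surj: "\<exists>x. \<forall>c\<in>{..<d'}. (\<Sum>a\<in>{..<m}. u c a * x a) = y c" for y
    by (rule surjective_if_det_nonzero[where h = "\<lambda>c. c" and Y = "\<lambda>a r. \<phi> r a" and r = d'])
      (use nz' in \<open>auto simp: bij_betw_def\<close>)
  obtain Y where Y: "\<And>c c'. c \<in> {..<d'} \<Longrightarrow> c' \<in> {..<d'} \<Longrightarrow> (\<Sum>a\<in>{..<m}. u c a * Y a c') = of_bool (c = c')"
    by (rule right_inverse_of_surjective[OF surj]) (rule that)
  obtain X' Y' where XY: "\<forall>c<d'. X' c = u c" "\<forall>a<card {..<m}. \<forall>c<card {..<m}. (\<Sum>j\<in>{..<m}. X' a j * Y' j c) = of_bool (a = c)"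
    using extend_right_invertible[of "{..<m}" d' u Y] Y m by auto
  have db': "dual_basis M {..<m} (\<lambda>a. comb M {..<m} (\<lambda>j. Y' j a) \<epsilon>) (\<lambda>a x. \<Sum>j<m. X' a j * \<zeta> j x)"
    by (rule dual_basis_change[OF db]) (use XY(2) in \<open>auto simp: mult.commute\<close>)
  \<comment> \<open>The completed matrix lists the prescribed functionals first; the rotation
    \<open>h\<close> moves them to the positions from \<open>d\<close> to
    \<open>m - 1\<close>.\<close>
  define h where "h a = (if a < d then a + d' else a - d)" for a
  have h: "bij_betw h {..<m} {..<m}"
    by (rule bij_betw_byWitness[of _ "\<lambda>a. if a < d' then a + d else a - d'"]) (use m in \<open>auto simp: h_def\<close>)
  show thesis
    by (rule that[OF dual_basis_reindex[OF db' h]]) (use XY(1) in \<open>simp add: h_def\<close>)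
qed

context middle
begin

lemma functional_B_component:
  assumes "i \<in> {1..l}" "j \<in> {1..n i}" "functional (V i) \<phi>"
  shows "functional B (\<lambda>b. \<phi> (b i j))"
  unfolding functional_def
  using assms B_component[OF _ assms(1,2)]
  by (simp add: B_add B_smult functional_add[OF assms(3)] functional_smult[OF assms(3)])

lemma functional_incl:
  assumes "i \<in> {1..l}" "j \<in> {1..n i}" "functional B \<phi>"
  shows "functional (V i) (\<lambda>x. \<phi> (incl i j x))"
  by (rule functional_comp[OF assms(3) incl_hom[OF assms(1,2)]])

end

context middle_alg_closed
begin

context
  fixes d :: "nat \<Rightarrow> nat" and e :: "nat \<Rightarrow> nat \<Rightarrow> 'v" and \<xi> :: "nat \<Rightarrow> nat \<Rightarrow> 'v \<Rightarrow> 'k"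
  assumes db: "\<And>i. i \<in> {1..l} \<Longrightarrow> dual_basis (V i) {..<v i} (e i) (\<xi> i)"
    and dv: "\<And>i. i \<in> {1..l} \<Longrightarrow> d i \<le> v i"
begin

lemma \<xi>_functional: "i \<in> {1..l} \<Longrightarrow> a < v i \<Longrightarrow> functional (V i) (\<xi> i a)"
  using dual_basisD(3)[OF db, of i a] by simp

definition total_degree :: "nat \<Rightarrow> nat" where "total_degree = (\<lambda>k. \<Sum>i\<in>{1..l}. if k = i then 1 else 0)"

text \<open>An entry built from the factor \<open>i\<close> alone has degree one in that factor and
  zero in the others. The determinants of the other factors bring all entries to the multidegree
  with value one in every factor, as \<open>plucker_max_rank_form\<close> needs equal
  degrees.\<close>

definition other_dets :: "nat \<Rightarrow> (nat \<Rightarrow> nat \<Rightarrow> 'v) \<Rightarrow> 'k"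
  where "other_dets i b = (\<Prod>i'\<in>{1..l} - {i}. chart_det (d i') (\<xi> i') (b i'))"

lemma plucker_chart_det:
  "i \<in> {1..l} \<Longrightarrow> ((\<lambda>k. if k = i then 1 else 0), \<lambda>b. chart_det (d i) (\<xi> i) (b i)) \<in> plucker_forms l d V"
  unfolding chart_det_def by (rule plucker_coord) (use dv \<xi>_functional in \<open>auto intro: less_le_trans\<close>)

lemma plucker_chart_minor:
  assumes i: "i \<in> {1..l}" and \<psi>: "functional (V i) \<psi>"
  shows "((\<lambda>k. if k = i then 1 else 0), \<lambda>b. chart_minor (d i) (\<xi> i) \<psi> c (b i)) \<in> plucker_forms l d V"
proof -
  have "functional (V i) (\<lambda>x. if r = c then \<psi> x else \<xi> i r x)" if "r < d i" for r
    using \<psi> \<xi>_functional[OF i, of r] dv[OF i] that by (cases "r = c") auto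
  then show ?thesis
    unfolding chart_minor_def by (rule plucker_coord[OF i, where d = d and \<phi> = "\<lambda>r x. if r = c then \<psi> x else \<xi> i r x"])
qed

lemma plucker_other_dets:
  assumes i: "i \<in> {1..l}" and F: "((\<lambda>k. if k = i then 1 else 0), F) \<in> plucker_forms l d V"
  shows "(total_degree, \<lambda>b. other_dets i b * F b) \<in> plucker_forms l d V"
proof -
  have O: "((\<lambda>k. \<Sum>i'\<in>{1..l} - {i}. if k = i' then 1 else 0), other_dets i) \<in> plucker_forms l d V"
    unfolding other_dets_def[abs_def] by (rule plucker_prod) (auto intro: plucker_chart_det)
  have "(\<lambda>k. (\<Sum>i'\<in>{1..l} - {i}. if k = i' then 1 else 0) + (if k = i then 1 else 0)) = total_degree"
    unfolding total_degree_def by (rule ext) (use i in \<open>simp add: sum.remove[of "{1..l}" i]\<close>)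
  then show ?thesis using plucker_forms.mult[OF O F] by simp
qed

lemma plucker_all_dets:
  "(total_degree, \<lambda>b. \<Prod>i\<in>{1..l}. chart_det (d i) (\<xi> i) (b i)) \<in> plucker_forms l d V"
  unfolding total_degree_def by (rule plucker_prod) (auto intro: plucker_chart_det)

text \<open>The matrix \<open>M b\<close> is only meaningful in the chart, so the form is multiplied by the chart determinants.\<close>

lemma dense_open_from_chart:
  fixes M :: "(nat \<Rightarrow> nat \<Rightarrow> 'v) \<Rightarrow> 'p \<Rightarrow> 'x \<Rightarrow> 'k"
  assumes fin: "finite P" "finite K"
    and M: "\<And>p k. p \<in> P \<Longrightarrow> k \<in> K \<Longrightarrow> (total_degree, \<lambda>b. M b p k) \<in> plucker_forms l d V"
    and \<beta>: "\<And>i c. i \<in> {1..l} \<Longrightarrow> c < d i \<Longrightarrow> \<beta> i c = e i c"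
    and rank: "(\<forall>x. (\<forall>p\<in>P. (\<Sum>k\<in>K. M \<beta> p k * x k) = 0) \<longrightarrow> (\<forall>k\<in>K. x k = 0)) \<or>
     (\<forall>y. \<exists>x. \<forall>p\<in>P. (\<Sum>k\<in>K. M \<beta> p k * x k) = y p)"
    and R: "\<And>U b. U \<in> grass_prod l d V \<Longrightarrow> b \<in> frames l d V U \<Longrightarrow> \<forall>i\<in>{1..l}. chart_det (d i) (\<xi> i) (b i) \<noteq> 0 \<Longrightarrow>
     (\<forall>x. (\<forall>p\<in>P. (\<Sum>k\<in>K. M b p k * x k) = 0) \<longrightarrow> (\<forall>k\<in>K. x k = 0)) \<or>
     (\<forall>y. \<exists>x. \<forall>p\<in>P. (\<Sum>k\<in>K. M b p k * x k) = y p) \<Longrightarrow> R U"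
  shows "\<exists>Q. openin (zariski_topology l d V) Q \<and>
    zariski_topology l d V closure_of Q = topspace (zariski_topology l d V) \<and> (\<forall>U\<in>Q. R U)"
proof -
  obtain e' F where F: "(e', F) \<in> plucker_forms l d V" "F \<beta> \<noteq> 0"
    "\<And>b. F b \<noteq> 0 \<Longrightarrow> (\<forall>x. (\<forall>p\<in>P. (\<Sum>k\<in>K. M b p k * x k) = 0) \<longrightarrow> (\<forall>k\<in>K. x k = 0)) \<or>
     (\<forall>y. \<exists>x. \<forall>p\<in>P. (\<Sum>k\<in>K. M b p k * x k) = y p)"
    by (rule plucker_max_rank_form[OF fin M plucker_zero[OF plucker_all_dets] rank]) (assumption | rule that)+
  let ?D = "\<lambda>b. \<Prod>i\<in>{1..l}. chart_det (d i) (\<xi> i) (b i)"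
  let ?Q = "{U \<in> grass_prod l d V. \<exists>b\<in>frames l d V U. F b * ?D b \<noteq> 0}"
  have det1: "chart_det (d i) (\<xi> i) (\<beta> i) = 1" if i: "i \<in> {1..l}" for i
    by (rule kspace.chart_at_basis(1)[OF V_space[OF i] db[OF i] dv[OF i]]) (rule \<beta>[OF i])
  have sp: "spans d \<beta>"
  proof (rule spansI)
    fix i assume i: "i \<in> {1..l}"
    show "\<beta> i c \<in> carrier (V i)" if "c < d i" for c
      using dual_basisD(2)[OF db[OF i], of c] \<beta>[OF i that] dv[OF i] that by simp
    show "functional (V i) (\<xi> i r)" if "r < d i" for r using \<xi>_functional[OF i, of r] dv[OF i] that by simp
    show "det (mat (d i) (d i) (\<lambda>(r, c). \<xi> i r (\<beta> i c))) \<noteq> 0" using det1[OF i] by (simp add: chart_det_def)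
  qed
  have "F \<beta> * ?D \<beta> \<noteq> 0" using F(2) det1 by simp
  note Q = plucker_set_dense[OF plucker_forms.mult[OF F(1) plucker_all_dets] sp this]
  have "R U" if U: "U \<in> ?Q" for U
  proof -
    obtain b where b: "b \<in> frames l d V U" "F b * ?D b \<noteq> 0" using U by blast
    have "F b \<noteq> 0" "\<forall>i\<in>{1..l}. chart_det (d i) (\<xi> i) (b i) \<noteq> 0" using b(2) by auto
    then show "R U" using R[of U b] U b(1) F(3)[of b] by blast
  qed
  then show ?thesis using Q by (intro exI[of _ ?Q] conjI ballI)
qed

context
  fixes U b
  assumes U: "U \<in> grass_prod l d V" "b \<in> frames l d V U" and nz: "\<forall>i\<in>{1..l}. chart_det (d i) (\<xi> i) (b i) \<noteq> 0"
begin

lemma other_dets_nonzero: "other_dets i b \<noteq> 0" using nz by (simp add: other_dets_def)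

lemma U_subspace: "i \<in> {1..l} \<Longrightarrow> VectorSpace.subspace class_ring (U i) (V i)" by (rule grass_frame(1)[OF U])

text \<open>\<open>M\<close> is the matrix of \<open>g\<close> for the frames from the chart, with
  columns scaled by the nonzero factors \<open>other_dets i b\<close>; this scaling affects neither
  injectivity nor surjectivity.\<close>

lemma max_rank_right_from_chart:
  assumes C: "kspace C" and g: "g \<in> khom B C" and dbC: "dual_basis C P \<gamma> \<chi>"
    and M: "\<And>p i j c. M p (i, j, c) = other_dets i b * \<chi> p (g (incl i j (chart_frame (V i) (v i) (d i) (e i) (\<xi> i) (b i) c)))"
    and rank: "(\<forall>x. (\<forall>p\<in>P. (\<Sum>k\<in>frame_index l n d. M p k * x k) = 0) \<longrightarrow> (\<forall>k\<in>frame_index l n d. x k = 0)) \<or>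
     (\<forall>y. \<exists>x. \<forall>p\<in>P. (\<Sum>k\<in>frame_index l n d. M p k * x k) = y p)"
  shows "max_rank g (\<Pi>\<^sub>E i\<in>{1..l}. \<Pi>\<^sub>E j\<in>{1..n i}. U i) (carrier C)" (is "max_rank g ?X _")
proof -
  interpret C: kspace C by fact
  let ?u = "\<lambda>i. chart_frame (V i) (v i) (d i) (e i) (\<xi> i) (b i)"
  let ?D = "\<lambda>i. chart_det (d i) (\<xi> i) (b i)"
  have X_comp: "x i j \<in> U i" if "x \<in> ?X" "i \<in> {1..l}" "j \<in> {1..n i}" for x i j
    using that by (auto simp: PiE_iff)
  have u: "?u i c \<in> carrier (V i)" if "i \<in> {1..l}" for i c
    using that by (intro kspace.chart_frame_closed[OF V_space db dv U_subspace frame_in(1)[OF U] frame_expand[OF U]])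
  have uU: "?u i c \<in> U i" if "i \<in> {1..l}" "c < d i" for i c
    using that by (intro kspace.chart_frame_in[OF V_space db dv U_subspace frame_in(1)[OF U] frame_expand[OF U]])
  have expand: "?D i \<odot>\<^bsub>V i\<^esub> x = comb (V i) {..<d i} (\<lambda>c. \<xi> i c x) (?u i)" if "i \<in> {1..l}" "x \<in> U i" for i x
    using that by (intro kspace.chart_frame_expand[OF V_space db dv U_subspace frame_in(1)[OF U] frame_expand[OF U]])
  have Uc: "x \<in> carrier (V i)" if "i \<in> {1..l}" "x \<in> U i" for i x
    by (rule kspace.subspaceD(1)[OF V_space U_subspace]) (use that in auto)
  have XB: "x \<in> carrier B" if "x \<in> ?X" for x
    unfolding B_carrier using that Uc by (auto simp: PiE_iff)
  have f: "functional B (\<lambda>x. \<chi> p (g x))" if "p \<in> P" for p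
    by (rule functional_comp[OF dual_basisD(3)[OF dbC that] g])
  \<comment> \<open>Coordinates of \<open>x\<close> in the chart frame: that frame is dual to the
    \<open>\<xi> i c\<close> up to the factor \<open>?D i\<close>, and the division by
    \<open>other_dets\<close> undoes the scaling of \<open>M\<close>.\<close>
  let ?t = "\<lambda>x. \<lambda>(i, j, c). \<xi> i c (x i j) / (other_dets i b * ?D i)"
  have sums: "(\<Sum>k\<in>frame_index l n d. M p k * z k) = (\<Sum>i\<in>{1..l}. \<Sum>j\<in>{1..n i}. \<Sum>c<d i. M p (i, j, c) * z (i, j, c))" for p z
    unfolding frame_index_def by (rule sum_triple) auto
  have eval: "(\<Sum>k\<in>frame_index l n d. M p k * ?t x k) = \<chi> p (g x)" if x: "x \<in> ?X" and p: "p \<in> P" for x p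
  proof -
    have "\<chi> p (g x) = (\<Sum>i\<in>{1..l}. \<Sum>j\<in>{1..n i}. \<chi> p (g (incl i j (x i j))))"
      by (rule functional_B[OF db f[OF p] XB[OF x]])
    also have "\<dots> = (\<Sum>i\<in>{1..l}. \<Sum>j\<in>{1..n i}. \<Sum>c<d i. M p (i, j, c) * ?t x (i, j, c))"
    proof (intro sum.cong refl)
      fix i j assume ij: "i \<in> {1..l}" "j \<in> {1..n i}"
      interpret kspace "V i" by (rule V_space[OF ij(1)])
      have fi: "functional (V i) (\<lambda>y. \<chi> p (g (incl i j y)))" by (rule functional_incl[OF ij f[OF p]])
      have xU: "x i j \<in> U i" by (rule X_comp[OF x ij])
      have "?D i * \<chi> p (g (incl i j (x i j))) = \<chi> p (g (incl i j (?D i \<odot>\<^bsub>V i\<^esub> x i j)))"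
        by (rule functional_smult[OF fi Uc[OF ij(1) xU], symmetric])
      also have "\<dots> = (\<Sum>c<d i. \<xi> i c (x i j) * \<chi> p (g (incl i j (?u i c))))"
        unfolding expand[OF ij(1) xU] by (rule functional_comb[OF fi u[OF ij(1)]])
      finally have "\<chi> p (g (incl i j (x i j))) = (\<Sum>c<d i. \<xi> i c (x i j) * \<chi> p (g (incl i j (?u i c)))) / ?D i"
        using nz ij(1) by (simp add: field_simps)
      also have "\<dots> = (\<Sum>c<d i. M p (i, j, c) * ?t x (i, j, c))"
        unfolding sum_divide_distrib
        by (intro sum.cong refl) (use other_dets_nonzero in \<open>simp add: M\<close>)
      finally show "\<chi> p (g (incl i j (x i j))) = (\<Sum>c<d i. M p (i, j, c) * ?t x (i, j, c))" .
    qed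
    finally show ?thesis using sums[of p "?t x"] by simp
  qed
  show ?thesis
    using rank unfolding max_rank_def
  proof (elim disjE)
    assume inj: "\<forall>z. (\<forall>p\<in>P. (\<Sum>k\<in>frame_index l n d. M p k * z k) = 0) \<longrightarrow> (\<forall>k\<in>frame_index l n d. z k = 0)"
    have "inj_on g ?X"
    proof (rule inj_onI)
      fix x y assume x: "x \<in> ?X" and y: "y \<in> ?X" and eq: "g x = g y"
      have "(\<Sum>k\<in>frame_index l n d. M p k * (?t x k - ?t y k)) = 0" if "p \<in> P" for p
        using eval[OF x that] eval[OF y that] eq by (simp add: right_diff_distrib sum_subtractf)
      then have t: "?t x k - ?t y k = 0" if "k \<in> frame_index l n d" for k
        using spec[OF inj, of "\<lambda>k. ?t x k - ?t y k"] that by blast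
      show "x = y"
      proof (rule B_eqI[OF XB[OF x] XB[OF y]])
        fix i j assume ij: "i \<in> {1..l}" "j \<in> {1..n i}"
        interpret kspace "V i" by (rule V_space[OF ij(1)])
        note xy = X_comp[OF x ij] X_comp[OF y ij]
        have D: "?D i \<noteq> 0" using nz ij(1) by blast
        have "\<xi> i c (x i j) = \<xi> i c (y i j)" if "c < d i" for c
          using t[of "(i, j, c)"] that ij D other_dets_nonzero[of i] by (simp add: frame_index_def)
        then have "comb (V i) {..<d i} (\<lambda>c. \<xi> i c (x i j)) (?u i) = comb (V i) {..<d i} (\<lambda>c. \<xi> i c (y i j)) (?u i)"
          using u[OF ij(1)] by (intro comb_cong) auto
        then have "?D i \<odot>\<^bsub>V i\<^esub> x i j = ?D i \<odot>\<^bsub>V i\<^esub> y i j" using expand[OF ij(1)] xy by simp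
        then have "(1 / ?D i) \<odot>\<^bsub>V i\<^esub> (?D i \<odot>\<^bsub>V i\<^esub> x i j) = (1 / ?D i) \<odot>\<^bsub>V i\<^esub> (?D i \<odot>\<^bsub>V i\<^esub> y i j)" by simp
        then show "x i j = y i j"
          using D smult_assoc[OF Uc[OF ij(1) xy(1)], of "1 / ?D i" "?D i"]
            smult_assoc[OF Uc[OF ij(1) xy(2)], of "1 / ?D i" "?D i"] Uc[OF ij(1)] xy by simp
      qed
    qed
    then show "inj_on g ?X \<or> g ` ?X = carrier C" ..
  next
    assume surj: "\<forall>y. \<exists>z. \<forall>p\<in>P. (\<Sum>k\<in>frame_index l n d. M p k * z k) = y p"
    have "y \<in> g ` ?X" if y: "y \<in> carrier C" for y
    proof -
      obtain z where z: "\<forall>p\<in>P. (\<Sum>k\<in>frame_index l n d. M p k * z k) = \<chi> p y"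
        by (rule exE[OF spec[OF surj, of "\<lambda>p. \<chi> p y"]])
      define x where "x = (\<lambda>i\<in>{1..l}. \<lambda>j\<in>{1..n i}. comb (V i) {..<d i} (\<lambda>c. other_dets i b * z (i, j, c)) (?u i))"
      have "comb (V i) {..<d i} (\<lambda>c. other_dets i b * z (i, j, c)) (?u i) \<in> U i" if "i \<in> {1..l}" for i j
        by (rule kspace.comb_in_subspace[OF V_space U_subspace]) (use uU that in auto)
      then have x: "x \<in> ?X" unfolding x_def restrict_PiE_iff by (intro ballI)
      have "g x = y"
      proof (rule C.dual_basis_eqI[OF dbC _ y])
        show "g x \<in> carrier C" using g XB[OF x] by (simp add: khom_iff)
        fix p assume p: "p \<in> P"
        have "\<chi> p (g x) = (\<Sum>i\<in>{1..l}. \<Sum>j\<in>{1..n i}. \<chi> p (g (incl i j (x i j))))"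
          by (rule functional_B[OF db f[OF p] XB[OF x]])
        also have "\<dots> = (\<Sum>i\<in>{1..l}. \<Sum>j\<in>{1..n i}. \<Sum>c<d i. M p (i, j, c) * z (i, j, c))"
        proof (intro sum.cong refl)
          fix i j assume ij: "i \<in> {1..l}" "j \<in> {1..n i}"
          interpret kspace "V i" by (rule V_space[OF ij(1)])
          have xij: "x i j = comb (V i) {..<d i} (\<lambda>c. other_dets i b * z (i, j, c)) (?u i)"
            using ij by (simp add: x_def)
          have fi: "functional (V i) (\<lambda>y. \<chi> p (g (incl i j y)))" by (rule functional_incl[OF ij f[OF p]])
          have "\<chi> p (g (incl i j (x i j))) = (\<Sum>c<d i. (other_dets i b * z (i, j, c)) * \<chi> p (g (incl i j (?u i c))))"
            unfolding xij by (rule functional_comb[OF fi u[OF ij(1)]])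
          then show "\<chi> p (g (incl i j (x i j))) = (\<Sum>c<d i. M p (i, j, c) * z (i, j, c))"
            by (simp add: M mult_ac)
        qed
        finally show "\<chi> p (g x) = \<chi> p y" using bspec[OF z p] sums[of p z] by simp
      qed
      with x show ?thesis by blast
    qed
    moreover have "g x \<in> carrier C" if "x \<in> ?X" for x using g XB[OF that] by (simp add: khom_iff)
    ultimately have "g ` ?X = carrier C" by blast
    then show "inj_on g ?X \<or> g ` ?X = carrier C" ..
  qed
qed

text \<open>The chart equations serve as coordinates on the quotients, and \<open>M\<close> is the
  transpose of the resulting matrix of the composite, up to the factors \<open>other_dets\<close>.
  So a surjective \<open>M\<close> makes the composite injective, and an injective \<open>M\<close>
  makes it surjective.\<close>

lemma max_rank_left_from_chart:
  assumes A: "kspace A" and f: "f \<in> khom A B" and dbA: "dual_basis A P \<alpha> \<chi>"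
    and M: "\<And>p i j c. M p (i, j, c) = other_dets i b * chart_equation (d i) (\<xi> i) (b i) c (f (\<alpha> p) i j)"
    and rank: "(\<forall>x. (\<forall>p\<in>P. (\<Sum>k\<in>frame_index l n (\<lambda>i. v i - d i). M p k * x k) = 0) \<longrightarrow>
        (\<forall>k\<in>frame_index l n (\<lambda>i. v i - d i). x k = 0)) \<or>
     (\<forall>y. \<exists>x. \<forall>p\<in>P. (\<Sum>k\<in>frame_index l n (\<lambda>i. v i - d i). M p k * x k) = y p)"
  shows "max_rank (\<lambda>a. \<lambda>i\<in>{1..l}. \<lambda>j\<in>{1..n i}. U i +>\<^bsub>V i\<^esub> f a i j) (carrier A)
     (carrier (dir_sum {1..l} (\<lambda>i. dir_sum {1..n i} (\<lambda>j. quot_space (V i) (U i)))))" (is "max_rank ?h _ ?Y")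
proof -
  interpret A: kspace A by fact
  let ?K = "frame_index l n (\<lambda>i. v i - d i)"
  let ?E = "\<lambda>i. chart_equation (d i) (\<xi> i) (b i)"
  note fin = dual_basisD(1)[OF dbA] finite_frame_index[of l n "\<lambda>i. v i - d i"]
  have fab: "f a i j \<in> carrier (V i)" if "a \<in> carrier A" "i \<in> {1..l}" "j \<in> {1..n i}" for a i j
    using f that by (intro B_component) (auto simp: khom_iff)
  have Ef: "functional (V i) (?E i c)" if "i \<in> {1..l}" "c < v i - d i" for i c
    using that by (intro kspace.chart_equation_functional[OF V_space db dv U_subspace frame_in(1)[OF U] frame_expand[OF U]])
  have mem: "x \<in> U i \<longleftrightarrow> (\<forall>c<v i - d i. ?E i c x = 0)" if "i \<in> {1..l}" "x \<in> carrier (V i)" for i x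
    using that nz by (intro kspace.chart_equation_iff[OF V_space db dv U_subspace frame_in(1)[OF U] frame_expand[OF U]]) auto
  have coset: "U i +>\<^bsub>V i\<^esub> x = U i +>\<^bsub>V i\<^esub> y \<longleftrightarrow> (\<forall>c<v i - d i. ?E i c x = ?E i c y)"
    if i: "i \<in> {1..l}" and xy: "x \<in> carrier (V i)" "y \<in> carrier (V i)" for i x y
  proof -
    interpret kspace "V i" by (rule V_space[OF i])
    have "U i +>\<^bsub>V i\<^esub> x = U i +>\<^bsub>V i\<^esub> y \<longleftrightarrow> x \<ominus>\<^bsub>V i\<^esub> y \<in> U i" by (rule coset_eq_iff[OF U_subspace[OF i] xy])
    then show ?thesis using mem[OF i, of "x \<ominus>\<^bsub>V i\<^esub> y"] functional_minus[OF Ef[OF i] xy] xy by simp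
  qed
  have eval: "other_dets i b * ?E i c (f a i j) = (\<Sum>p\<in>P. \<chi> p a * M p (i, j, c))"
    if k: "(i, j, c) \<in> ?K" and a: "a \<in> carrier A" for i j c a
  proof -
    have ijc: "i \<in> {1..l}" "j \<in> {1..n i}" "c < v i - d i" using k by (auto simp: frame_index_def)
    have "functional A (\<lambda>a. ?E i c (f a i j))"
      by (rule functional_comp[OF functional_B_component[OF ijc(1,2) Ef[OF ijc(1,3)]] f])
    then have "?E i c (f a i j) = (\<Sum>p\<in>P. \<chi> p a * ?E i c (f (\<alpha> p) i j))" by (rule A.functional_expand[OF dbA _ a])
    then show ?thesis by (simp add: M sum_distrib_left mult_ac)
  qed
  have h: "?h a \<in> ?Y" if "a \<in> carrier A" for a
    using fab[OF that] kspace.carrier_quot[OF V_space U_subspace] by (auto simp: dir_sum_def)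
  show ?thesis
    using rank unfolding max_rank_def
  proof (elim disjE)
    assume surj: "\<forall>y. \<exists>z. \<forall>p\<in>P. (\<Sum>k\<in>?K. M p k * z k) = y p"
    have "inj_on ?h (carrier A)"
    proof (rule inj_onI)
      fix x y assume x: "x \<in> carrier A" and y: "y \<in> carrier A" and eq: "?h x = ?h y"
      have E: "?E i c (f x i j) = ?E i c (f y i j)" if "(i, j, c) \<in> ?K" for i j c
      proof -
        have ijc: "i \<in> {1..l}" "j \<in> {1..n i}" "c < v i - d i" using that by (auto simp: frame_index_def)
        have "?h x i j = ?h y i j" using eq by simp
        then have "U i +>\<^bsub>V i\<^esub> f x i j = U i +>\<^bsub>V i\<^esub> f y i j" using ijc by simp
        then show ?thesis using coset[OF ijc(1) fab[OF x ijc(1,2)] fab[OF y ijc(1,2)]] ijc(3) by simp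
      qed
      have z: "(\<Sum>p\<in>P. (\<chi> p x - \<chi> p y) * M p k) = 0" if k: "k \<in> ?K" for k
      proof -
        obtain i j c where ijc: "k = (i, j, c)" by (cases k)
        then have k': "(i, j, c) \<in> ?K" using k by simp
        show ?thesis using eval[OF k' x] eval[OF k' y] E[OF k'] unfolding ijc by (simp add: left_diff_distrib sum_subtractf)
      qed
      show "x = y"
      proof (rule A.dual_basis_eqI[OF dbA x y])
        fix p assume p: "p \<in> P"
        \<comment> \<open>A vector that \<open>M\<close> sends to the unit vector at
          \<open>p\<close> extracts from the relations \<open>z\<close> the difference of the
          coordinates \<open>p\<close> of \<open>x\<close> and \<open>y\<close>.\<close>
        obtain w where w: "\<forall>p'\<in>P. (\<Sum>k\<in>?K. M p' k * w k) = of_bool (p' = p)"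
          by (rule exE[OF spec[OF surj, of "\<lambda>p'. of_bool (p' = p)"]])
        have "\<chi> p x - \<chi> p y = (\<Sum>p'\<in>P. (\<chi> p' x - \<chi> p' y) * of_bool (p' = p))"
          using fin(1) p by (simp add: sum_of_bool_mult)
        also have "\<dots> = (\<Sum>p'\<in>P. (\<chi> p' x - \<chi> p' y) * (\<Sum>k\<in>?K. M p' k * w k))"
          using w by (intro sum.cong refl) simp
        also have "\<dots> = (\<Sum>k\<in>?K. (\<Sum>p'\<in>P. (\<chi> p' x - \<chi> p' y) * M p' k) * w k)" by (rule sum_mult_assoc)
        also have "\<dots> = 0" using z by (intro sum.neutral) simp
        finally show "\<chi> p x = \<chi> p y" by simp
      qed
    qed
    then show "inj_on ?h (carrier A) \<or> ?h ` carrier A = ?Y" ..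
  next
    assume inj: "\<forall>z. (\<forall>p\<in>P. (\<Sum>k\<in>?K. M p k * z k) = 0) \<longrightarrow> (\<forall>k\<in>?K. z k = 0)"
    obtain Y where Y: "\<And>k k'. k \<in> ?K \<Longrightarrow> k' \<in> ?K \<Longrightarrow> (\<Sum>p\<in>P. Y k p * M p k') = of_bool (k = k')"
    proof (rule left_inverse_of_injective[OF fin, where M = M])
      show "\<forall>k\<in>?K. x k = 0" if "\<forall>p\<in>P. (\<Sum>k\<in>?K. M p k * x k) = 0" for x using inj that by (elim allE impE)
    qed (rule that)
    have "y \<in> ?h ` carrier A" if y: "y \<in> ?Y" for y
    proof -
      \<comment> \<open>One choice for all pairs \<open>(i, j)\<close> of a representative in
        \<open>V i\<close> of the coset \<open>y i j\<close>.\<close>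
      have "\<forall>k\<in>{1..l} \<times> UNIV. \<exists>x. snd k \<in> {1..n (fst k)} \<longrightarrow>
          x \<in> carrier (V (fst k)) \<and> y (fst k) (snd k) = U (fst k) +>\<^bsub>V (fst k)\<^esub> x"
      proof
        fix k assume k: "k \<in> {1..l} \<times> (UNIV :: nat set)"
        obtain i j where ij: "k = (i, j)" by (cases k)
        then have i: "i \<in> {1..l}" using k by simp
        have "y i j \<in> carrier (quot_space (V i) (U i))" if "j \<in> {1..n i}"
          using y i that by (auto simp: dir_sum_def PiE_iff)
        then show "\<exists>x. snd k \<in> {1..n (fst k)} \<longrightarrow>
          x \<in> carrier (V (fst k)) \<and> y (fst k) (snd k) = U (fst k) +>\<^bsub>V (fst k)\<^esub> x"
          unfolding ij kspace.carrier_quot[OF V_space[OF i] U_subspace[OF i]] by auto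
      qed
      then obtain w where w: "\<forall>k\<in>{1..l} \<times> UNIV. snd k \<in> {1..n (fst k)} \<longrightarrow>
          w k \<in> carrier (V (fst k)) \<and> y (fst k) (snd k) = U (fst k) +>\<^bsub>V (fst k)\<^esub> w k"
        by (rule bchoice[THEN exE])
      have wc: "w (i, j) \<in> carrier (V i)" "y i j = U i +>\<^bsub>V i\<^esub> w (i, j)" if "i \<in> {1..l}" "j \<in> {1..n i}" for i j
        using bspec[OF w, of "(i, j)"] that by auto
      \<comment> \<open>The values that the equations take at the chosen representatives, multiplied
        by the left inverse \<open>Y\<close>, are the coordinates of the preimage
        \<open>a\<close>.\<close>
      define t where "t p = (\<Sum>k\<in>?K. (case k of (i, j, c) \<Rightarrow> other_dets i b * ?E i c (w (i, j))) * Y k p)" for p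
      define a where "a = comb A P t \<alpha>"
      have a: "a \<in> carrier A" unfolding a_def by (rule A.comb_closed) (rule dual_basisD(2)[OF dbA])
      have \<chi>a: "\<chi> p a = t p" if "p \<in> P" for p unfolding a_def by (rule A.dual_basis_comb[OF dbA that])
      have E: "?E i c (f a i j) = ?E i c (w (i, j))" if k: "(i, j, c) \<in> ?K" for i j c
      proof -
        have "other_dets i b * ?E i c (f a i j) = (\<Sum>p\<in>P. t p * M p (i, j, c))" using eval[OF k a] \<chi>a by simp
        also have "\<dots> = (\<Sum>k\<in>?K. (case k of (i, j, c) \<Rightarrow> other_dets i b * ?E i c (w (i, j))) * (\<Sum>p\<in>P. Y k p * M p (i, j, c)))"
          unfolding t_def by (rule sum_mult_assoc[symmetric])
        also have "\<dots> = (\<Sum>k\<in>?K. (case k of (i, j, c) \<Rightarrow> other_dets i b * ?E i c (w (i, j))) * of_bool (k = (i, j, c)))"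
          using Y[OF _ k] by (intro sum.cong refl) simp
        also have "\<dots> = other_dets i b * ?E i c (w (i, j))" using fin(2) k by (simp add: sum_of_bool_mult)
        finally show ?thesis using other_dets_nonzero[of i] by simp
      qed
      have "y = ?h a"
      proof
        fix i
        show "y i = ?h a i"
        proof (cases "i \<in> {1..l}")
          case i: True
          have "y i j = ?h a i j" for j
          proof (cases "j \<in> {1..n i}")
            case True
            then show ?thesis
              using i wc[OF i True] coset[OF i wc(1)[OF i True] fab[OF a i True]] E[of i j] by (simp add: frame_index_def)
          next
            case False
            have "y i \<in> extensional {1..n i}" using y i by (auto simp: dir_sum_def PiE_iff)
            from extensional_arb[OF this False] show ?thesis using i False by (simp del: atLeastAtMost_iff)
          qed
          then show ?thesis by (rule ext)
        next
          case False
          have "y \<in> extensional {1..l}" using y by (auto simp: dir_sum_def PiE_iff)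
          from extensional_arb[OF this False] show ?thesis using False by (simp del: atLeastAtMost_iff)
        qed
      qed
      then show ?thesis using a by (rule image_eqI)
    qed
    then have "?Y \<subseteq> ?h ` carrier A" by (rule subsetI)
    moreover have "?h ` carrier A \<subseteq> ?Y" by (rule image_subsetI) (rule h)
    ultimately have "?h ` carrier A = ?Y" by (rule equalityI[rotated])
    then show "inj_on ?h (carrier A) \<or> ?h ` carrier A = ?Y" ..
  qed
qed

end

end

text \<open>The generic frame \<open>u\<close> gives vectors \<open>b0\<close>, which are completed
  to a basis \<open>e\<close>. In the chart centered at their span the entries of \<open>M\<close>
  are forms of one degree, and at \<open>b0\<close> the matrix \<open>M\<close> is the generic one,
  of maximal rank, so that \<open>dense_open_from_chart\<close> applies.\<close>

lemma general_choice_right: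
  assumes C: "fd_module L C" and g: "minimal_right_almost_split L B C g"
  shows "general_choice l V (\<lambda>U. max_rank g (\<Pi>\<^sub>E i\<in>{1..l}. \<Pi>\<^sub>E j\<in>{1..n i}. U i) (carrier C))"
  unfolding general_choice_def
proof (intro allI impI)
  fix d assume "\<forall>i\<in>{1..l}. d i \<le> vdim (V i)"
  then have dv: "d i \<le> v i" if "i \<in> {1..l}" for i using that by (simp add: v_def)
  interpret C: kspace C by (rule fd_module_kspace[OF C])
  have gh: "g \<in> khom B C"
    using g by (auto simp: minimal_right_almost_split_def right_almost_split_def lmod_hom_def)
  obtain \<epsilon> \<zeta> where db0: "\<forall>i\<in>{1..l}. dual_basis (V i) {..<v i} (\<epsilon> i) (\<zeta> i)" using exists_dual_bases by blast
  then have db0': "dual_basis (V i) {..<v i} (\<epsilon> i) (\<zeta> i)" if "i \<in> {1..l}" for i using that by blast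
  obtain \<gamma> \<chi> where dbC: "dual_basis C {..<C.dim} \<gamma> \<chi>" using C.dual_basis_exists fd_module.fin_dim[OF C] by blast
  obtain u where u: "independent_frames l d v u"
    "(\<forall>x. (\<forall>p\<in>{..<C.dim}. (\<Sum>k\<in>frame_index l n d. frame_matrix v (\<lambda>i j a p. \<chi> p (g (incl i j (\<epsilon> i a)))) u p k * x k) = 0) \<longrightarrow>
        (\<forall>k\<in>frame_index l n d. x k = 0)) \<or>
     (\<forall>y. \<exists>x. \<forall>p\<in>{..<C.dim}. (\<Sum>k\<in>frame_index l n d. frame_matrix v (\<lambda>i j a p. \<chi> p (g (incl i j (\<epsilon> i a)))) u p k * x k) = y p)"
    by (rule omnipresent_generic[where d = d, OF omnipresent_right[OF db0' C g dbC] dv]) (assumption | rule that)+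
  define b0 where "b0 i c = comb (V i) {..<v i} (u i c) (\<epsilon> i)" for i c
  have "\<exists>e \<xi>. dual_basis (V i) {..<v i} e \<xi> \<and> (\<forall>c<d i. e c = b0 i c)" if i: "i \<in> {1..l}" for i
  proof -
    interpret kspace "V i" by (rule V_space[OF i])
    note D = dual_basisD[OF db0'[OF i]]
    obtain \<phi> where \<phi>: "det (mat (d i) (d i) (\<lambda>(r, c). \<Sum>a<v i. \<phi> r a * u i c a)) \<noteq> 0"
      by (rule exE[OF bspec[OF u(1)[unfolded independent_frames_def] i]])
    have b0: "b0 i c \<in> carrier (V i)" for c unfolding b0_def by (rule comb_closed[OF D(2)])
    have f: "functional (V i) (\<lambda>x. \<Sum>a<v i. \<phi> r a * \<zeta> i a x)" for r by (rule functional_sum[OF D(3)])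
    have "\<zeta> i a (b0 i c) = u i c a" if "a \<in> {..<v i}" for a c
      unfolding b0_def by (rule dual_basis_comb[OF db0'[OF i] that])
    then have nz: "det (mat (d i) (d i) (\<lambda>(r, c). \<Sum>a<v i. \<phi> r a * \<zeta> i a (b0 i c))) \<noteq> 0" using \<phi> by simp
    obtain e \<xi> where "dual_basis (V i) {..<v i} e \<xi>" "\<And>c. c < d i \<Longrightarrow> e c = b0 i c"
      by (rule adapted_basis[OF kspace_axioms db0'[OF i] b0 f nz]) (rule that)
    then show ?thesis by (intro exI conjI allI impI)
  qed
  then have "\<forall>i\<in>{1..l}. \<exists>x. dual_basis (V i) {..<v i} (fst x) (snd x) \<and> (\<forall>c<d i. fst x c = b0 i c)" by simp
  then obtain E where E: "\<forall>i\<in>{1..l}. dual_basis (V i) {..<v i} (fst (E i)) (snd (E i)) \<and> (\<forall>c<d i. fst (E i) c = b0 i c)"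
    by (rule bchoice[THEN exE])
  define e where "e i = fst (E i)" for i
  define \<xi> where "\<xi> i = snd (E i)" for i
  have db: "dual_basis (V i) {..<v i} (e i) (\<xi> i)" if "i \<in> {1..l}" for i using E that by (simp add: e_def \<xi>_def)
  have eb: "b0 i c = e i c" if "i \<in> {1..l}" "c < d i" for i c using E that by (simp add: e_def)
  let ?u = "\<lambda>b i. chart_frame (V i) (v i) (d i) (e i) (\<xi> i) (b i)"
  define M where "M b p = (\<lambda>(i, j, c). other_dets d \<xi> i b * \<chi> p (g (incl i j (?u b i c))))" for b p
  have f: "functional (V i) (\<lambda>x. \<chi> p (g (incl i j x)))" if "i \<in> {1..l}" "j \<in> {1..n i}" "p \<in> {..<C.dim}" for p i j
    by (rule functional_incl[OF that(1,2) functional_comp[OF dual_basisD(3)[OF dbC that(3)] gh]])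
  have eval: "\<chi> p (g (incl i j (?u b i c))) = (\<Sum>a<v i. \<chi> p (g (incl i j (e i a))) * chart_minor (d i) (\<xi> i) (\<xi> i a) c (b i))"
    if "i \<in> {1..l}" "j \<in> {1..n i}" "p \<in> {..<C.dim}" for p i j c b
    unfolding chart_frame_def
    by (subst kspace.functional_comb[OF V_space[OF that(1)] f[OF that] dual_basisD(2)[OF db[OF that(1)]]])
      (simp_all add: mult.commute)
  show "\<exists>Q. openin (zariski_topology l d V) Q \<and>
      zariski_topology l d V closure_of Q = topspace (zariski_topology l d V) \<and>
      (\<forall>U\<in>Q. max_rank g (\<Pi>\<^sub>E i\<in>{1..l}. \<Pi>\<^sub>E j\<in>{1..n i}. U i) (carrier C))"
  proof (rule dense_open_from_chart[OF db dv finite_lessThan finite_frame_index, where M = M and \<beta> = b0])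
    fix p k assume p: "p \<in> {..<C.dim}" and k: "k \<in> frame_index l n d"
    obtain i j c where ijc: "k = (i, j, c)" by (cases k)
    have ij: "i \<in> {1..l}" "j \<in> {1..n i}" using k ijc by (auto simp: frame_index_def)
    have eq: "(\<lambda>b. M b p k)
        = (\<lambda>b. \<Sum>a<v i. \<chi> p (g (incl i j (e i a))) * (other_dets d \<xi> i b * chart_minor (d i) (\<xi> i) (\<xi> i a) c (b i)))"
      by (rule ext) (simp add: M_def ijc eval[OF ij p] sum_distrib_left mult_ac)
    show "(total_degree, \<lambda>b. M b p k) \<in> plucker_forms l d V"
      unfolding eq
      by (intro plucker_sum plucker_zero[OF plucker_all_dets[OF db dv]] plucker_scale plucker_other_dets[OF db dv ij(1)]
          plucker_chart_minor[OF db dv ij(1)] dual_basisD(3)[OF db[OF ij(1)]])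
  next
    fix U b assume *: "U \<in> grass_prod l d V" "b \<in> frames l d V U" "\<forall>i\<in>{1..l}. chart_det (d i) (\<xi> i) (b i) \<noteq> 0"
      "(\<forall>x. (\<forall>p\<in>{..<C.dim}. (\<Sum>k\<in>frame_index l n d. M b p k * x k) = 0) \<longrightarrow> (\<forall>k\<in>frame_index l n d. x k = 0)) \<or>
       (\<forall>y. \<exists>x. \<forall>p\<in>{..<C.dim}. (\<Sum>k\<in>frame_index l n d. M b p k * x k) = y p)"
    show "max_rank g (\<Pi>\<^sub>E i\<in>{1..l}. \<Pi>\<^sub>E j\<in>{1..n i}. U i) (carrier C)"
      by (rule max_rank_right_from_chart[OF db dv *(1-3) C.kspace_axioms gh dbC _ *(4)]) (simp_all add: M_def)
  next
    \<comment> \<open>At the center all chart determinants are 1 and the chart frame is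
      \<open>b0\<close> itself.\<close>
    have "M b0 p k = frame_matrix v (\<lambda>i j a p. \<chi> p (g (incl i j (\<epsilon> i a)))) u p k"
      if p: "p \<in> {..<C.dim}" and k: "k \<in> frame_index l n d" for p k
    proof -
      obtain i j c where ijc: "k = (i, j, c)" by (cases k)
      have ij: "i \<in> {1..l}" "j \<in> {1..n i}" "c < d i" using k ijc by (auto simp: frame_index_def)
      interpret kspace "V i" by (rule V_space[OF ij(1)])
      have "other_dets d \<xi> i b0 = 1"
        by (subst other_dets_def[OF db dv]) (auto intro!: prod.neutral kspace.chart_at_basis(1)[OF V_space db dv] eb)
      then have "M b0 p k = (\<Sum>a<v i. \<chi> p (g (incl i j (e i a))) * of_bool (a = c))"
        unfolding M_def ijc using eval[OF ij(1,2) p] ij(3) chart_at_basis(2)[OF db[OF ij(1)] dv[OF ij(1)], of "b0 i"] eb[OF ij(1)]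
        by simp
      also have "\<dots> = \<chi> p (g (incl i j (b0 i c)))"
        using ij(3) dv[OF ij(1)] eb[OF ij(1,3)] by (simp add: sum_of_bool_mult)
      also have "\<dots> = (\<Sum>a<v i. u i c a * \<chi> p (g (incl i j (\<epsilon> i a))))"
        unfolding b0_def by (rule functional_comb[OF f[OF ij(1,2) p] dual_basisD(2)[OF db0'[OF ij(1)]]])
      finally show ?thesis by (simp add: ijc frame_matrix_def mult.commute)
    qed
    then show "(\<forall>x. (\<forall>p\<in>{..<C.dim}. (\<Sum>k\<in>frame_index l n d. M b0 p k * x k) = 0) \<longrightarrow> (\<forall>k\<in>frame_index l n d. x k = 0)) \<or>
       (\<forall>y. \<exists>x. \<forall>p\<in>{..<C.dim}. (\<Sum>k\<in>frame_index l n d. M b0 p k * x k) = y p)"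
      using u(2) by simp
  qed (assumption | rule eb)+
qed

text \<open>Here \<open>u\<close> supplies \<open>v i - d i\<close> equations for each
  \<open>i\<close> where \<open>general_choice_right\<close> uses a frame. The coordinates
  \<open>\<xi>\<close> are adapted to these equations, so that the base point is the span of the
  first \<open>d i\<close> vectors of \<open>e\<close>.\<close>

lemma general_choice_left:
  assumes A: "fd_module L A" and f: "minimal_left_almost_split L A B f"
  shows "general_choice l V (\<lambda>U. max_rank (\<lambda>a. \<lambda>i\<in>{1..l}. \<lambda>j\<in>{1..n i}. U i +>\<^bsub>V i\<^esub> f a i j) (carrier A)
     (carrier (dir_sum {1..l} (\<lambda>i. dir_sum {1..n i} (\<lambda>j. quot_space (V i) (U i))))))"
  unfolding general_choice_def
proof (intro allI impI)
  fix d assume "\<forall>i\<in>{1..l}. d i \<le> vdim (V i)"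
  then have dv: "d i \<le> v i" if "i \<in> {1..l}" for i using that by (simp add: v_def)
  let ?K = "frame_index l n (\<lambda>i. v i - d i)"
  interpret A: kspace A by (rule fd_module_kspace[OF A])
  have fh: "f \<in> khom A B"
    using f by (auto simp: minimal_left_almost_split_def left_almost_split_def lmod_hom_def)
  obtain \<epsilon> \<zeta> where db0: "\<forall>i\<in>{1..l}. dual_basis (V i) {..<v i} (\<epsilon> i) (\<zeta> i)" using exists_dual_bases by blast
  then have db0': "dual_basis (V i) {..<v i} (\<epsilon> i) (\<zeta> i)" if "i \<in> {1..l}" for i using that by blast
  obtain \<alpha> \<chi> where dbA: "dual_basis A {..<A.dim} \<alpha> \<chi>" using A.dual_basis_exists fd_module.fin_dim[OF A] by blast
  obtain u where u: "independent_frames l (\<lambda>i. v i - d i) v u"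
    "(\<forall>x. (\<forall>p\<in>{..<A.dim}. (\<Sum>k\<in>?K. frame_matrix v (\<lambda>i j a p. \<zeta> i a (f (\<alpha> p) i j)) u p k * x k) = 0) \<longrightarrow>
        (\<forall>k\<in>?K. x k = 0)) \<or>
     (\<forall>y. \<exists>x. \<forall>p\<in>{..<A.dim}. (\<Sum>k\<in>?K. frame_matrix v (\<lambda>i j a p. \<zeta> i a (f (\<alpha> p) i j)) u p k * x k) = y p)"
    by (rule omnipresent_generic[where d = "\<lambda>i. v i - d i", OF omnipresent_left[OF db0' A f dbA] diff_le_self]) (assumption | rule that)+
  have "\<exists>e \<xi>. dual_basis (V i) {..<v i} e \<xi> \<and> (\<forall>c<v i - d i. \<forall>x. \<xi> (d i + c) x = (\<Sum>a<v i. u i c a * \<zeta> i a x))"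
    if i: "i \<in> {1..l}" for i
  proof -
    obtain \<phi> where \<phi>: "det (mat (v i - d i) (v i - d i) (\<lambda>(r, c). \<Sum>a<v i. \<phi> r a * u i c a)) \<noteq> 0"
      by (rule exE[OF bspec[OF u(1)[unfolded independent_frames_def] i]])
    obtain e \<xi> where "dual_basis (V i) {..<v i} e \<xi>"
        "\<And>c x. c < v i - d i \<Longrightarrow> \<xi> (d i + c) x = (\<Sum>a<v i. u i c a * \<zeta> i a x)"
      by (rule adapted_equations[OF V_space[OF i] db0'[OF i] le_add_diff_inverse[OF dv[OF i]] \<phi>]) (rule that)
    then show ?thesis by (intro exI conjI allI impI)
  qed
  then have "\<forall>i\<in>{1..l}. \<exists>y. dual_basis (V i) {..<v i} (fst y) (snd y) \<and>
      (\<forall>c<v i - d i. \<forall>x. snd y (d i + c) x = (\<Sum>a<v i. u i c a * \<zeta> i a x))" by simp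
  then obtain E where E: "\<forall>i\<in>{1..l}. dual_basis (V i) {..<v i} (fst (E i)) (snd (E i)) \<and>
      (\<forall>c<v i - d i. \<forall>x. snd (E i) (d i + c) x = (\<Sum>a<v i. u i c a * \<zeta> i a x))"
    by (rule bchoice[THEN exE])
  define e where "e i = fst (E i)" for i
  define \<xi> where "\<xi> i = snd (E i)" for i
  have db: "dual_basis (V i) {..<v i} (e i) (\<xi> i)" if "i \<in> {1..l}" for i using E that by (simp add: e_def \<xi>_def)
  have \<xi>u: "\<xi> i (d i + c) x = (\<Sum>a<v i. u i c a * \<zeta> i a x)" if "i \<in> {1..l}" "c < v i - d i" for i c x
    using E that by (simp add: \<xi>_def)
  define M where "M b p = (\<lambda>(i, j, c). other_dets d \<xi> i b * chart_equation (d i) (\<xi> i) (b i) c (f (\<alpha> p) i j))" for b p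
  show "\<exists>Q. openin (zariski_topology l d V) Q \<and>
      zariski_topology l d V closure_of Q = topspace (zariski_topology l d V) \<and>
      (\<forall>U\<in>Q. max_rank (\<lambda>a. \<lambda>i\<in>{1..l}. \<lambda>j\<in>{1..n i}. U i +>\<^bsub>V i\<^esub> f a i j) (carrier A)
        (carrier (dir_sum {1..l} (\<lambda>i. dir_sum {1..n i} (\<lambda>j. quot_space (V i) (U i))))))"
  proof (rule dense_open_from_chart[OF db dv finite_lessThan[of A.dim] finite_frame_index[of l n "\<lambda>i. v i - d i"], where M = M and \<beta> = e])
    fix p k assume p: "p \<in> {..<A.dim}" and k: "k \<in> ?K"
    obtain i j c where ijc: "k = (i, j, c)" by (cases k)
    have ij: "i \<in> {1..l}" "j \<in> {1..n i}" "c < v i - d i" using k ijc by (auto simp: frame_index_def)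
    have f1: "functional (V i) (\<xi> i (d i + c))" using dual_basisD(3)[OF db[OF ij(1)]] ij(3) by simp
    have eq: "(\<lambda>b. M b p k)
        = (\<lambda>b. \<xi> i (d i + c) (f (\<alpha> p) i j) * (other_dets d \<xi> i b * chart_det (d i) (\<xi> i) (b i))
          + (\<Sum>c'<d i. (- \<xi> i c' (f (\<alpha> p) i j)) *
            (other_dets d \<xi> i b * chart_minor (d i) (\<xi> i) (\<xi> i (d i + c)) c' (b i))))"
      by (rule ext) (simp add: M_def ijc chart_equation_def sum_distrib_left sum_negf right_diff_distrib mult_ac)
    show "(total_degree, \<lambda>b. M b p k) \<in> plucker_forms l d V"
      unfolding eq
      by (intro plucker_forms.add plucker_sum plucker_zero[OF plucker_all_dets[OF db dv]] plucker_scale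
          plucker_other_dets[OF db dv ij(1)] plucker_chart_minor[OF db dv ij(1)] plucker_chart_det[OF db dv ij(1)] f1)
  next
    fix U b assume *: "U \<in> grass_prod l d V" "b \<in> frames l d V U" "\<forall>i\<in>{1..l}. chart_det (d i) (\<xi> i) (b i) \<noteq> 0"
      "(\<forall>x. (\<forall>p\<in>{..<A.dim}. (\<Sum>k\<in>?K. M b p k * x k) = 0) \<longrightarrow> (\<forall>k\<in>?K. x k = 0)) \<or>
       (\<forall>y. \<exists>x. \<forall>p\<in>{..<A.dim}. (\<Sum>k\<in>?K. M b p k * x k) = y p)"
    show "max_rank (\<lambda>a. \<lambda>i\<in>{1..l}. \<lambda>j\<in>{1..n i}. U i +>\<^bsub>V i\<^esub> f a i j) (carrier A)
        (carrier (dir_sum {1..l} (\<lambda>i. dir_sum {1..n i} (\<lambda>j. quot_space (V i) (U i)))))"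
      by (rule max_rank_left_from_chart[OF db dv *(1-3) A.kspace_axioms fh dbA _ *(4)]) (simp_all add: M_def)
  next
    have "M e p k = frame_matrix v (\<lambda>i j a p. \<zeta> i a (f (\<alpha> p) i j)) u p k"
      if p: "p \<in> {..<A.dim}" and k: "k \<in> ?K" for p k
    proof -
      obtain i j c where ijc: "k = (i, j, c)" by (cases k)
      have ij: "i \<in> {1..l}" "j \<in> {1..n i}" "c < v i - d i" using k ijc by (auto simp: frame_index_def)
      interpret kspace "V i" by (rule V_space[OF ij(1)])
      have o: "other_dets d \<xi> i e = 1"
        by (subst other_dets_def[OF db dv]) (auto intro!: prod.neutral kspace.chart_at_basis(1)[OF V_space db dv])
      \<comment> \<open>The coordinate \<open>d i + c\<close> vanishes on the first
        \<open>d i\<close> basis vectors, so at the center the chart equation is this coordinate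
        alone.\<close>
      have "chart_minor (d i) (\<xi> i) (\<xi> i (d i + c)) c' (e i) = 0" if "c' < d i" for c'
        using chart_at_basis(2)[OF db[OF ij(1)] dv[OF ij(1)], of "e i" "d i + c" c'] that ij(3) by simp
      then have "chart_equation (d i) (\<xi> i) (e i) c x = \<xi> i (d i + c) x" for x
        using chart_at_basis(1)[OF db[OF ij(1)] dv[OF ij(1)], of "e i"] by (simp add: chart_equation_def)
      then show ?thesis using o by (simp add: M_def ijc \<xi>u[OF ij(1,3)] frame_matrix_def mult.commute)
    qed
    then show "(\<forall>x. (\<forall>p\<in>{..<A.dim}. (\<Sum>k\<in>?K. M e p k * x k) = 0) \<longrightarrow> (\<forall>k\<in>?K. x k = 0)) \<or>
       (\<forall>y. \<exists>x. \<forall>p\<in>{..<A.dim}. (\<Sum>k\<in>?K. M e p k * x k) = y p)"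
      using u(2) by simp
  qed (assumption | rule refl)+
qed

end

section \<open>Subspaces and free spaces\<close>

text \<open>Independence in \<open>U\<close> is independence in \<open>M\<close>, which bounds the
  size of independent sets; one that is maximal generates \<open>U\<close>.\<close>

lemma (in kspace) fin_dim_subspace:
  assumes fd: "fin_dim" and U: "VectorSpace.subspace class_ring U M"
  shows "vectorspace.fin_dim class_ring (M\<lparr>carrier := U\<rparr>)"
proof -
  interpret U: kspace "M\<lparr>carrier := U\<rparr>" by (rule kspace_subspace[OF kspace_axioms U])
  let ?P = "\<lambda>S. S \<subseteq> U \<and> U.lin_indpt S"
  have sub: "U \<subseteq> carrier M" using subspaceD(1)[OF U] by blast
  have li: "lin_indpt S" if "?P S" for S
    using span_li_not_depend(2)[of S U] U that by (auto simp: VectorSpace.subspace_def)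
  have "\<exists>A. finite A \<and> maximal A ?P"
  proof (rule maximal_exists)
    fix A assume A: "?P A"
    then show "finite A \<and> card A \<le> dim" using li_le_dim[OF fd _ li[OF A]] sub by auto
  next
    show "?P {}" using U.lin_dep_def by auto
  qed
  then obtain A where A: "finite A" "maximal A ?P" by (elim exE conjE)
  have "U.gen_set A" using U.max_li_is_gen[of A] A(2) by simp
  then show ?thesis using A by (auto simp: U.fin_dim_def maximal_def)
qed

lemma khom_preimage_subspace:
  assumes M: "kspace M" and N: "kspace N" and h: "h \<in> khom M N" and U: "VectorSpace.subspace class_ring U N"
  shows "VectorSpace.subspace class_ring {x \<in> carrier M. h x \<in> U} M"
proof -
  interpret M: kspace M by fact
  interpret N: kspace N by fact
  note UD = N.subspaceD[OF U]
  show ?thesis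
    unfolding subspace_iff[OF M.vectorspace_axioms]
    using h UD khom_zero[OF M N h] by (auto simp: khom_iff)
qed

lemma (in kspace) functional_kernel_subspace:
  assumes "functional M \<phi>"
  shows "VectorSpace.subspace class_ring {x \<in> carrier M. \<phi> x = 0} M"
  unfolding subspace_iff[OF vectorspace_axioms]
  using functional_zero[OF assms] functional_add[OF assms] functional_smult[OF assms] by auto

lemma (in kspace) functional_quot:
  assumes U: "VectorSpace.subspace class_ring U M" and \<phi>: "functional M \<phi>" and z: "\<And>x. x \<in> U \<Longrightarrow> \<phi> x = 0"
  shows "\<exists>\<psi>. functional (quot_space M U) \<psi> \<and> (\<forall>x\<in>carrier M. \<psi> (U +> x) = \<phi> x)"
proof (intro exI conjI)
  let ?\<psi> = "\<lambda>X. \<phi> (SOME x. x \<in> carrier M \<and> U +> x = X)"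
  show eq: "\<forall>x\<in>carrier M. ?\<psi> (U +> x) = \<phi> x"
  proof
    fix x assume x: "x \<in> carrier M"
    define y where "y = (SOME y. y \<in> carrier M \<and> U +> y = U +> x)"
    have y: "y \<in> carrier M \<and> U +> y = U +> x"
      unfolding y_def by (rule someI[of _ x]) (use x in simp)
    then have "\<phi> (y \<ominus> x) = 0" using coset_eq_iff[OF U, of y x] x z by simp
    then have "\<phi> y = \<phi> x" using functional_minus[OF \<phi>, of y x] y x by simp
    then show "?\<psi> (U +> x) = \<phi> x" by (simp add: y_def)
  qed
  show "functional (quot_space M U) ?\<psi>"
    unfolding functional_def carrier_quot[OF U]
    using eq by (auto simp: add_quot[OF U] smult_quot[OF U] functional_add[OF \<phi>] functional_smult[OF \<phi>])
qed

lemma lookup_scale [simp]: "Poly_Mapping.lookup (Poly_Mapping.map ((*) c) u) x = (c :: 'k::field) * Poly_Mapping.lookup u x"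
  by (simp add: Poly_Mapping.map.rep_eq when_def)

lemma free_space_simps:
  "carrier (free_space X) = {u. Poly_Mapping.keys u \<subseteq> X}"
  "u \<oplus>\<^bsub>free_space X\<^esub> u' = u + u'" "c \<odot>\<^bsub>free_space X\<^esub> u = Poly_Mapping.map ((*) c) u" "\<zero>\<^bsub>free_space X\<^esub> = 0"
  by (simp_all add: free_space_def)

lemma keys_scale: "Poly_Mapping.keys (Poly_Mapping.map ((*) (c :: 'k::field)) u) \<subseteq> Poly_Mapping.keys u"
  by (auto simp: in_keys_iff)

lemma kspace_free_space: "kspace (free_space X :: ('k::field, 'x \<Rightarrow>\<^sub>0 'k) module)"
proof (rule kspaceI)
  fix u w :: "'x \<Rightarrow>\<^sub>0 'k" assume "u \<in> carrier (free_space X)" "w \<in> carrier (free_space X)"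
  then show "u \<oplus>\<^bsub>free_space X\<^esub> w \<in> carrier (free_space X)"
    using Poly_Mapping.keys_add[of u w] by (auto simp: free_space_simps)
next
  fix c and u :: "'x \<Rightarrow>\<^sub>0 'k" assume "u \<in> carrier (free_space X)"
  then show "c \<odot>\<^bsub>free_space X\<^esub> u \<in> carrier (free_space X)" using keys_scale[of c u] by (auto simp: free_space_simps)
qed (auto simp: free_space_simps lookup_add algebra_simps intro!: poly_mapping_eqI)

lemma minus_free_space:
  assumes "u \<in> carrier (free_space X)" "u' \<in> carrier (free_space X)"
  shows "u \<ominus>\<^bsub>free_space X\<^esub> u' = u - (u' :: 'x \<Rightarrow>\<^sub>0 'k::field)"
proof -
  interpret kspace "free_space X :: ('k, 'x \<Rightarrow>\<^sub>0 'k) module" by (rule kspace_free_space)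
  show ?thesis
    unfolding minus_conv[OF assms] by (auto simp: free_space_simps lookup_add lookup_minus intro!: poly_mapping_eqI)
qed

definition extend_linear :: "('x \<Rightarrow> 'k::field) \<Rightarrow> ('x \<Rightarrow>\<^sub>0 'k) \<Rightarrow> 'k"
  where "extend_linear h u = (\<Sum>x\<in>Poly_Mapping.keys u. Poly_Mapping.lookup u x * h x)"

lemma extend_linear_superset:
  assumes "finite F" "Poly_Mapping.keys u \<subseteq> F"
  shows "extend_linear h u = (\<Sum>x\<in>F. Poly_Mapping.lookup u x * h x)"
  unfolding extend_linear_def by (rule sum.mono_neutral_left[OF assms]) (simp add: in_keys_iff)

lemma extend_linear_add: "extend_linear h (u + u') = extend_linear h u + extend_linear h u'"
proof -
  let ?F = "Poly_Mapping.keys u \<union> Poly_Mapping.keys u'"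
  have F: "finite ?F" "Poly_Mapping.keys u \<subseteq> ?F" "Poly_Mapping.keys u' \<subseteq> ?F" by auto
  show ?thesis
    unfolding extend_linear_superset[OF F(1,2)] extend_linear_superset[OF F(1,3)]
      extend_linear_superset[OF F(1) Poly_Mapping.keys_add[of u u']]
    by (simp add: lookup_add distrib_right sum.distrib)
qed

lemma extend_linear_scale: "extend_linear h (Poly_Mapping.map ((*) c) u) = c * extend_linear h u"
  unfolding extend_linear_superset[OF finite_keys keys_scale[of c u]]
  by (simp add: extend_linear_def sum_distrib_left mult.assoc)

lemma extend_linear_diff: "extend_linear h (u - u') = extend_linear h u - extend_linear h u'"
  using extend_linear_add[of h "u - u'" u'] by simp

lemma extend_linear_single: "extend_linear h (Poly_Mapping.single x c) = c * h x"
  by (simp add: extend_linear_superset[of "{x}"])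

lemma functional_extend_linear: "functional (free_space X) (extend_linear h)"
  by (simp add: functional_def free_space_simps extend_linear_add extend_linear_scale)

section \<open>Tensor products\<close>

definition push_forward :: "('v \<Rightarrow> 'v2) \<Rightarrow> ('w \<Rightarrow> 'w2) \<Rightarrow> ('v \<times> 'w \<Rightarrow>\<^sub>0 'k::field) \<Rightarrow> ('v2 \<times> 'w2 \<Rightarrow>\<^sub>0 'k)"
  where "push_forward p q u =
    (\<Sum>x\<in>Poly_Mapping.keys u. Poly_Mapping.single (p (fst x), q (snd x)) (Poly_Mapping.lookup u x))"

lemma lookup_push_forward:
  "Poly_Mapping.lookup (push_forward p q u) y = extend_linear (\<lambda>x. of_bool ((p (fst x), q (snd x)) = y)) u"
  unfolding push_forward_def extend_linear_def lookup_sum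
  by (intro sum.cong refl) (simp add: lookup_single when_def)

lemma push_forward_add: "push_forward p q (u + u') = push_forward p q u + push_forward p q u'"
  and push_forward_diff: "push_forward p q (u - u') = push_forward p q u - push_forward p q u'"
  and push_forward_scale: "push_forward p q (Poly_Mapping.map ((*) c) u) = Poly_Mapping.map ((*) c) (push_forward p q u)"
  and push_forward_single: "push_forward p q (Poly_Mapping.single (v, w) c) = Poly_Mapping.single (p v, q w) c"
  by (auto simp: lookup_push_forward lookup_add lookup_minus extend_linear_add extend_linear_diff extend_linear_scale
      extend_linear_single lookup_single when_def intro!: poly_mapping_eqI)

lemma tensor_rels_cases:
  assumes "u \<in> tensor_rels V W"
  obtains (add_left) v v' w where "v \<in> carrier V" "v' \<in> carrier V" "w \<in> carrier W"
      "u = Poly_Mapping.single (v \<oplus>\<^bsub>V\<^esub> v', w) 1 - Poly_Mapping.single (v, w) 1 - Poly_Mapping.single (v', w) 1"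
    | (add_right) v w w' where "v \<in> carrier V" "w \<in> carrier W" "w' \<in> carrier W"
      "u = Poly_Mapping.single (v, w \<oplus>\<^bsub>W\<^esub> w') 1 - Poly_Mapping.single (v, w) 1 - Poly_Mapping.single (v, w') 1"
    | (scale_left) c v w where "v \<in> carrier V" "w \<in> carrier W"
      "u = Poly_Mapping.single (c \<odot>\<^bsub>V\<^esub> v, w) 1 - Poly_Mapping.single (v, w) c"
    | (scale_right) c v w where "v \<in> carrier V" "w \<in> carrier W"
      "u = Poly_Mapping.single (v, c \<odot>\<^bsub>W\<^esub> w) 1 - Poly_Mapping.single (v, w) c"
  using assms unfolding tensor_rels_def by blast

locale tensor_pair = V: kspace V + W: kspace W
  for V :: "('k::field, 'v, 'z) module_scheme" and W :: "('k, 'w, 'y) module_scheme"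
begin

abbreviation free :: "('k, 'v \<times> 'w \<Rightarrow>\<^sub>0 'k) module" where "free \<equiv> free_space (carrier V \<times> carrier W)"

sublocale free: kspace free by (rule kspace_free_space)

lemma single_closed: "v \<in> carrier V \<Longrightarrow> w \<in> carrier W \<Longrightarrow> Poly_Mapping.single (v, w) c \<in> carrier free"
  by (simp add: free_space_simps)

lemma diff_closed: "u \<in> carrier free \<Longrightarrow> u' \<in> carrier free \<Longrightarrow> u - u' \<in> carrier free"
  using free.M.minus_closed[of u u'] by (simp add: minus_free_space)

lemma tensor_rels_subset: "tensor_rels V W \<subseteq> carrier free"
  unfolding tensor_rels_def by (auto intro!: diff_closed single_closed)

lemma null_subspace: "VectorSpace.subspace class_ring (tensor_null V W) free"
  unfolding tensor_null_def by (rule free.span_is_subspace[OF tensor_rels_subset])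

lemma null_subset:
  assumes "VectorSpace.subspace class_ring N free" "tensor_rels V W \<subseteq> N"
  shows "tensor_null V W \<subseteq> N"
  unfolding tensor_null_def
  by (rule free.span_is_subset) (use assms in \<open>auto simp: VectorSpace.subspace_def\<close>)

lemma rels_null: "x \<in> tensor_rels V W \<Longrightarrow> x \<in> tensor_null V W"
  using free.in_own_span[OF tensor_rels_subset] by (auto simp: tensor_null_def)

lemma kspace_tensor: "kspace (tensor V W)"
  unfolding tensor_def by (rule free.kspace_quot[OF null_subspace])

lemma coset_hom: "tensor_coset V W \<in> khom free (tensor V W)"
  using free.quot_hom[OF null_subspace] unfolding tensor_def tensor_coset_def[abs_def] .

lemma carrier_tensor: "carrier (tensor V W) = tensor_coset V W ` carrier free"
  unfolding tensor_def free.carrier_quot[OF null_subspace] tensor_coset_def[abs_def] ..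

lemma coset_eq:
  assumes "u \<in> carrier free" "u' \<in> carrier free"
  shows "tensor_coset V W u = tensor_coset V W u' \<longleftrightarrow> u - u' \<in> tensor_null V W"
  unfolding tensor_coset_def free.coset_eq_iff[OF null_subspace assms] minus_free_space[OF assms] ..

lemma coset_add: "u \<in> carrier free \<Longrightarrow> u' \<in> carrier free \<Longrightarrow>
    tensor_coset V W u \<oplus>\<^bsub>tensor V W\<^esub> tensor_coset V W u' = tensor_coset V W (u + u')"
  and coset_scale: "u \<in> carrier free \<Longrightarrow>
    c \<odot>\<^bsub>tensor V W\<^esub> tensor_coset V W u = tensor_coset V W (Poly_Mapping.map ((*) c) u)"
  using coset_hom by (simp_all add: khom_iff free_space_simps)

lemma pure_closed: "v \<in> carrier V \<Longrightarrow> w \<in> carrier W \<Longrightarrow> pure_tensor V W v w \<in> carrier (tensor V W)"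
  unfolding pure_tensor_def carrier_tensor by (intro imageI single_closed)

lemma scale_single: "Poly_Mapping.map ((*) c) (Poly_Mapping.single x 1) = Poly_Mapping.single x (c :: 'k)"
  by (auto simp: lookup_single when_def intro!: poly_mapping_eqI)

lemma pure_hom_left:
  assumes w: "w \<in> carrier W"
  shows "(\<lambda>v. pure_tensor V W v w) \<in> khom V (tensor V W)"
  unfolding khom_iff
proof (intro conjI ballI allI)
  fix v v' assume v: "v \<in> carrier V" "v' \<in> carrier V"
  have "Poly_Mapping.single (v \<oplus>\<^bsub>V\<^esub> v', w) 1 - Poly_Mapping.single (v, w) 1 - Poly_Mapping.single (v', w) 1 \<in> tensor_null V W"
    by (rule rels_null) (use v w in \<open>auto simp: tensor_rels_def\<close>)
  then have "Poly_Mapping.single (v \<oplus>\<^bsub>V\<^esub> v', w) 1 - (Poly_Mapping.single (v, w) 1 + Poly_Mapping.single (v', w) 1) \<in> tensor_null V W"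
    by (simp add: diff_diff_eq)
  moreover have "Poly_Mapping.single (v, w) 1 + Poly_Mapping.single (v', w) 1 \<in> carrier free"
    using free.M.add.m_closed[OF single_closed[OF v(1) w] single_closed[OF v(2) w]] by (simp add: free_space_simps)
  ultimately show "pure_tensor V W (v \<oplus>\<^bsub>V\<^esub> v') w = pure_tensor V W v w \<oplus>\<^bsub>tensor V W\<^esub> pure_tensor V W v' w"
    unfolding pure_tensor_def using v w by (simp add: coset_add coset_eq single_closed)
next
  fix c v assume v: "v \<in> carrier V"
  have "Poly_Mapping.single (c \<odot>\<^bsub>V\<^esub> v, w) 1 - Poly_Mapping.single (v, w) c \<in> tensor_null V W"
    by (rule rels_null) (use v w in \<open>auto simp: tensor_rels_def\<close>)
  then show "pure_tensor V W (c \<odot>\<^bsub>V\<^esub> v) w = c \<odot>\<^bsub>tensor V W\<^esub> pure_tensor V W v w"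
    unfolding pure_tensor_def using v w by (simp add: coset_scale coset_eq single_closed scale_single)
qed (use w pure_closed in simp)

lemma pure_hom_right:
  assumes v: "v \<in> carrier V"
  shows "pure_tensor V W v \<in> khom W (tensor V W)"
  unfolding khom_iff
proof (intro conjI ballI allI)
  fix w w' assume w: "w \<in> carrier W" "w' \<in> carrier W"
  have "Poly_Mapping.single (v, w \<oplus>\<^bsub>W\<^esub> w') 1 - Poly_Mapping.single (v, w) 1 - Poly_Mapping.single (v, w') 1 \<in> tensor_null V W"
    by (rule rels_null) (use v w in \<open>auto simp: tensor_rels_def\<close>)
  then have "Poly_Mapping.single (v, w \<oplus>\<^bsub>W\<^esub> w') 1 - (Poly_Mapping.single (v, w) 1 + Poly_Mapping.single (v, w') 1) \<in> tensor_null V W"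
    by (simp add: diff_diff_eq)
  moreover have "Poly_Mapping.single (v, w) 1 + Poly_Mapping.single (v, w') 1 \<in> carrier free"
    using free.M.add.m_closed[OF single_closed[OF v w(1)] single_closed[OF v w(2)]] by (simp add: free_space_simps)
  ultimately show "pure_tensor V W v (w \<oplus>\<^bsub>W\<^esub> w') = pure_tensor V W v w \<oplus>\<^bsub>tensor V W\<^esub> pure_tensor V W v w'"
    unfolding pure_tensor_def using v w by (simp add: coset_add coset_eq single_closed)
next
  fix c w assume w: "w \<in> carrier W"
  have "Poly_Mapping.single (v, c \<odot>\<^bsub>W\<^esub> w) 1 - Poly_Mapping.single (v, w) c \<in> tensor_null V W"
    by (rule rels_null) (use v w in \<open>auto simp: tensor_rels_def\<close>)
  then show "pure_tensor V W v (c \<odot>\<^bsub>W\<^esub> w) = c \<odot>\<^bsub>tensor V W\<^esub> pure_tensor V W v w"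
    unfolding pure_tensor_def using v w by (simp add: coset_scale coset_eq single_closed scale_single)
qed (use v pure_closed in simp)

text \<open>Every coset has a finitely supported representative; removing the points of the support
  one at a time splits off scalar multiples of pure tensors.\<close>

lemma tensor_generated:
  assumes N: "VectorSpace.subspace class_ring N (tensor V W)"
    and pure: "\<And>v w. v \<in> carrier V \<Longrightarrow> w \<in> carrier W \<Longrightarrow> pure_tensor V W v w \<in> N"
  shows "carrier (tensor V W) \<subseteq> N"
proof -
  interpret T: kspace "tensor V W" by (rule kspace_tensor)
  note ND = T.subspaceD[OF N]
  have gen: "tensor_coset V W u \<in> N" if "finite F" "F \<subseteq> carrier V \<times> carrier W" "Poly_Mapping.keys u \<subseteq> F" for F u
    using that
  proof (induct F arbitrary: u)
    case empty
    then have "u = \<zero>\<^bsub>free\<^esub>" by (simp add: free_space_simps)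
    then show ?case using khom_zero[OF free.kspace_axioms kspace_tensor coset_hom] ND(2) by simp
  next
    case (insert x F)
    obtain v w where x: "x = (v, w)" by (cases x)
    then have vw: "v \<in> carrier V" "w \<in> carrier W" using insert.prems(1) by auto
    let ?s = "Poly_Mapping.single x (Poly_Mapping.lookup u x)"
    have k: "Poly_Mapping.keys (u - ?s) \<subseteq> F"
    proof
      fix y assume "y \<in> Poly_Mapping.keys (u - ?s)"
      then have "Poly_Mapping.lookup u y \<noteq> 0" "y \<noteq> x"
        by (auto simp: in_keys_iff lookup_minus lookup_single when_def split: if_splits)
      then show "y \<in> F" using insert.prems(2) by (auto simp: in_keys_iff)
    qed
    have 1: "u - ?s \<in> carrier free" using k insert.prems(1) by (auto simp: free_space_simps)
    have 2: "?s \<in> carrier free" unfolding x by (rule single_closed[OF vw])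
    have "tensor_coset V W (u - ?s) \<in> N" using insert.hyps(3)[OF _ k] insert.prems(1) by simp
    moreover have "tensor_coset V W ?s = Poly_Mapping.lookup u x \<odot>\<^bsub>tensor V W\<^esub> pure_tensor V W v w"
      unfolding pure_tensor_def coset_scale[OF single_closed[OF vw]] scale_single x ..
    then have "tensor_coset V W ?s \<in> N" using ND(4)[OF pure[OF vw]] by simp
    ultimately have "tensor_coset V W (u - ?s) \<oplus>\<^bsub>tensor V W\<^esub> tensor_coset V W ?s \<in> N" by (rule ND(3))
    then show ?case unfolding coset_add[OF 1 2] by simp
  qed
  have "tensor_coset V W u \<in> N" if "u \<in> carrier free" for u
    using gen[OF finite_keys _ subset_refl] that by (simp add: free_space_simps(1))
  then show ?thesis unfolding carrier_tensor by (rule image_subsetI)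
qed

text \<open>The product \<open>\<phi> v * \<eta> w\<close> is bilinear and so kills the relations.
  Such functionals are the means of telling elements of a tensor product apart.\<close>

lemma tensor_functional:
  assumes \<phi>: "functional V \<phi>" and \<eta>: "functional W \<eta>"
  shows "\<exists>\<tau>. functional (tensor V W) \<tau> \<and> (\<forall>v\<in>carrier V. \<forall>w\<in>carrier W. \<tau> (pure_tensor V W v w) = \<phi> v * \<eta> w)"
proof -
  let ?h = "extend_linear (\<lambda>x. \<phi> (fst x) * \<eta> (snd x))"
  have "?h u = 0" if "u \<in> tensor_rels V W" for u
    using that by (cases rule: tensor_rels_cases)
      (simp_all add: extend_linear_diff extend_linear_single functional_add[OF \<phi>] functional_add[OF \<eta>]
        functional_smult[OF \<phi>] functional_smult[OF \<eta>] ring_distribs mult_ac)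
  then have "tensor_rels V W \<subseteq> {u \<in> carrier free. ?h u = 0}" using tensor_rels_subset by blast
  then have null: "tensor_null V W \<subseteq> {u \<in> carrier free. ?h u = 0}"
    by (rule null_subset[OF free.functional_kernel_subspace[OF functional_extend_linear]])
  obtain \<tau> where \<tau>: "functional (quot_space free (tensor_null V W)) \<tau> \<and>
      (\<forall>x\<in>carrier free. \<tau> (tensor_null V W +>\<^bsub>free\<^esub> x) = ?h x)"
    using free.functional_quot[OF null_subspace functional_extend_linear, of "\<lambda>x. \<phi> (fst x) * \<eta> (snd x)"] null
    by (elim exE[rotated]) auto
  show ?thesis
  proof (intro exI[of _ \<tau>] conjI ballI)
    show "functional (tensor V W) \<tau>" using \<tau> by (simp add: tensor_def)
    fix v w assume "v \<in> carrier V" "w \<in> carrier W"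
    then show "\<tau> (pure_tensor V W v w) = \<phi> v * \<eta> w"
      using \<tau> single_closed[of v w 1] by (simp add: pure_tensor_def tensor_coset_def extend_linear_single)
  qed
qed

end

text \<open>\<open>push_forward\<close> sends each relation to a relation of the same kind, hence
  null elements to null elements; so the union in \<open>tensor_map\<close> is over a constant
  family.\<close>

lemma tensor_map_coset:
  assumes P: "tensor_pair V W" and P': "tensor_pair V' W'" and p: "p \<in> khom V V'" and q: "q \<in> khom W W'"
    and u: "u \<in> carrier (free_space (carrier V \<times> carrier W))"
  shows "push_forward p q u \<in> carrier (free_space (carrier V' \<times> carrier W'))"
    "tensor_map V' W' p q (tensor_coset V W u) = tensor_coset V' W' (push_forward p q u)"
proof -
  interpret tensor_pair V W by fact
  interpret T': tensor_pair V' W' by fact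
  have closed: "push_forward p q u \<in> carrier T'.free" if "u \<in> carrier free" for u
  proof -
    have "(p (fst x), q (snd x)) \<in> carrier V' \<times> carrier W'" if "x \<in> Poly_Mapping.keys u" for x
      using that \<open>u \<in> carrier free\<close> p q by (auto simp: free_space_simps khom_iff)
    moreover have "Poly_Mapping.keys (push_forward p q u) \<subseteq> (\<lambda>x. (p (fst x), q (snd x))) ` Poly_Mapping.keys u"
      unfolding push_forward_def by (rule order.trans[OF Poly_Mapping.keys_sum]) auto
    ultimately show ?thesis unfolding free_space_simps by blast
  qed
  show "push_forward p q u \<in> carrier T'.free" by (rule closed[OF u])
  have hom: "push_forward p q \<in> khom free T'.free"
    using closed by (simp add: khom_iff free_space_simps push_forward_add push_forward_scale)
  have "tensor_rels V W \<subseteq> {u \<in> carrier free. push_forward p q u \<in> tensor_null V' W'}"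
  proof -
    have "push_forward p q u \<in> tensor_rels V' W'" if "u \<in> tensor_rels V W" for u
      using that
    proof (cases rule: tensor_rels_cases)
      case (add_left v v' w)
      then show ?thesis
        using p q unfolding tensor_rels_def
        by (intro UnI1 CollectI exI[of _ "p v"] exI[of _ "p v'"] exI[of _ "q w"])
          (simp add: push_forward_diff push_forward_single khom_iff)
    next
      case (add_right v w w')
      then show ?thesis
        using p q unfolding tensor_rels_def
        by (intro UnI1[OF UnI1[OF UnI2]] CollectI exI[of _ "p v"] exI[of _ "q w"] exI[of _ "q w'"])
          (simp add: push_forward_diff push_forward_single khom_iff)
    next
      case (scale_left c v w)
      then show ?thesis
        using p q unfolding tensor_rels_def
        by (intro UnI1[OF UnI2] CollectI exI[of _ c] exI[of _ "p v"] exI[of _ "q w"])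
          (simp add: push_forward_diff push_forward_single khom_iff)
    next
      case (scale_right c v w)
      then show ?thesis
        using p q unfolding tensor_rels_def
        by (intro UnI2 CollectI exI[of _ c] exI[of _ "p v"] exI[of _ "q w"])
          (simp add: push_forward_diff push_forward_single khom_iff)
    qed
    then show ?thesis using tensor_rels_subset T'.rels_null by blast
  qed
  then have null: "tensor_null V W \<subseteq> {u \<in> carrier free. push_forward p q u \<in> tensor_null V' W'}"
    by (rule null_subset[OF khom_preimage_subspace[OF free.kspace_axioms T'.free.kspace_axioms hom T'.null_subspace]])
  have const: "tensor_coset V' W' (push_forward p q u') = tensor_coset V' W' (push_forward p q u)"
    if "u' \<in> tensor_coset V W u" for u'
  proof -
    have u': "u' \<in> carrier free" "u' - u \<in> tensor_null V W"
      using that free.mem_coset_iff[OF null_subspace u] by (auto simp: tensor_coset_def minus_free_space[OF _ u])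
    then have "push_forward p q (u' - u) \<in> tensor_null V' W'" using null by blast
    then show ?thesis using T'.coset_eq[OF closed[OF u'(1)] closed[OF u]] by (simp add: push_forward_diff)
  qed
  have "u \<in> tensor_coset V W u"
    using free.mem_coset_iff[OF null_subspace u, of u] u free.subspaceD(2)[OF null_subspace]
    by (simp add: tensor_coset_def minus_free_space free_space_simps(4))
  then have "(\<Union>u'\<in>tensor_coset V W u. tensor_coset V' W' (push_forward p q u)) = tensor_coset V' W' (push_forward p q u)"
    by (intro SUP_const) blast
  moreover have "tensor_map V' W' p q (tensor_coset V W u)
      = (\<Union>u'\<in>tensor_coset V W u. tensor_coset V' W' (push_forward p q u))"
    unfolding tensor_map_def push_forward_def[symmetric] by (rule SUP_cong[OF refl const])
  ultimately show "tensor_map V' W' p q (tensor_coset V W u) = tensor_coset V' W' (push_forward p q u)" by simp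
qed

lemma tensor_map_hom:
  assumes P: "tensor_pair V W" and P': "tensor_pair V' W'" and p: "p \<in> khom V V'" and q: "q \<in> khom W W'"
  shows "tensor_map V' W' p q \<in> khom (tensor V W) (tensor V' W')"
    "v \<in> carrier V \<Longrightarrow> w \<in> carrier W \<Longrightarrow> tensor_map V' W' p q (pure_tensor V W v w) = pure_tensor V' W' (p v) (q w)"
proof -
  interpret tensor_pair V W by fact
  interpret T': tensor_pair V' W' by fact
  note map = tensor_map_coset[OF P P' p q]
  show "tensor_map V' W' p q \<in> khom (tensor V W) (tensor V' W')"
    unfolding khom_iff carrier_tensor
  proof (intro conjI ballI allI; elim imageE; hypsubst)
    fix u assume u: "u \<in> carrier free"
    show "tensor_map V' W' p q (tensor_coset V W u) \<in> carrier (tensor V' W')"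
      unfolding map(2)[OF u] T'.carrier_tensor by (rule imageI[OF map(1)[OF u]])
    show "tensor_map V' W' p q (c \<odot>\<^bsub>tensor V W\<^esub> tensor_coset V W u)
        = c \<odot>\<^bsub>tensor V' W'\<^esub> tensor_map V' W' p q (tensor_coset V W u)" for c
      using map(2)[OF free.smult_simps(4)[OF u], of c] map(2)[OF u] T'.coset_scale[OF map(1)[OF u]]
      by (simp add: coset_scale[OF u] free_space_simps push_forward_scale)
    fix u' assume u': "u' \<in> carrier free"
    show "tensor_map V' W' p q (tensor_coset V W u \<oplus>\<^bsub>tensor V W\<^esub> tensor_coset V W u')
        = tensor_map V' W' p q (tensor_coset V W u) \<oplus>\<^bsub>tensor V' W'\<^esub> tensor_map V' W' p q (tensor_coset V W u')"
      using map(2)[OF free.M.add.m_closed[OF u u']] map(2)[OF u] map(2)[OF u'] T'.coset_add[OF map(1)[OF u] map(1)[OF u']]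
      by (simp add: coset_add[OF u u'] free_space_simps push_forward_add)
  qed
  assume "v \<in> carrier V" "w \<in> carrier W"
  then show "tensor_map V' W' p q (pure_tensor V W v w) = pure_tensor V' W' (p v) (q w)"
    using map(2)[OF single_closed[of v w 1]] by (simp add: pure_tensor_def push_forward_single)
qed

section \<open>Linear combinations and projections\<close>

context kspace
begin

lemma comb_empty [simp]: "comb M {} s v = \<zero>"
  by (simp add: comb_def)

lemma comb_insert:
  assumes "finite J" "j \<notin> J" "\<And>i. i \<in> insert j J \<Longrightarrow> v i \<in> carrier M"
  shows "comb M (insert j J) s v = s j \<odot> v j \<oplus> comb M J s v"
  unfolding comb_def using assms by (intro finsum_insert) auto

lemma comb_scale:
  assumes "\<And>j. j \<in> J \<Longrightarrow> v j \<in> carrier M"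
  shows "c \<odot> comb M J s v = comb M J (\<lambda>j. c * s j) v"
proof -
  have "(\<lambda>x. c \<odot> x) \<in> khom M M"
    by (simp add: khom_iff smult_add_right mult.commute flip: smult_assoc)
  then have "c \<odot> comb M J s v = comb M J s (\<lambda>j. c \<odot> v j)" by (rule hom_comb[OF kspace_axioms kspace_axioms _ assms])
  also have "\<dots> = comb M J (\<lambda>j. c * s j) v"
    using assms by (intro comb_cong) (auto simp: mult.commute simp flip: smult_assoc)
  finally show ?thesis .
qed

lemma comb_add:
  assumes "\<And>j. j \<in> J \<Longrightarrow> v j \<in> carrier M" "\<And>j. j \<in> J \<Longrightarrow> w j \<in> carrier M"
  shows "comb M J s (\<lambda>j. v j \<oplus> w j) = comb M J s v \<oplus> comb M J s w"
proof -
  have "comb M J s (\<lambda>j. v j \<oplus> w j) = finsum M (\<lambda>j. s j \<odot> v j \<oplus> s j \<odot> w j) J"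
    unfolding comb_def using assms by (intro finsum_cong') (auto simp: smult_add_right)
  then show ?thesis unfolding comb_def using assms by (simp add: M.finsum_addf Pi_iff)
qed

lemma comb_zeros: "(\<And>j. j \<in> J \<Longrightarrow> v j = \<zero>) \<Longrightarrow> comb M J s v = \<zero>"
proof -
  assume "\<And>j. j \<in> J \<Longrightarrow> v j = \<zero>"
  then have "finsum M (\<lambda>j. s j \<odot> v j) J = finsum M (\<lambda>j. \<zero>) J" by (intro M.finsum_cong') auto
  then show ?thesis by (simp add: comb_def M.finsum_zero)
qed

lemma comb_single:
  assumes "finite J" "j \<in> J" "v j \<in> carrier M" "\<And>i. i \<in> J \<Longrightarrow> i \<noteq> j \<Longrightarrow> v i = \<zero>"
  shows "comb M J s v = s j \<odot> v j"
proof -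
  have J: "J = insert j (J - {j})" using assms(2) by blast
  have "comb M (insert j (J - {j})) s v = s j \<odot> v j \<oplus> comb M (J - {j}) s v"
    by (rule comb_insert) (use assms in \<open>auto, metis M.zero_closed\<close>)
  moreover have "comb M (J - {j}) s v = \<zero>" using assms(4) by (intro comb_zeros) auto
  ultimately show ?thesis using J assms(3) by simp
qed

lemma comb_swap:
  assumes "finite J" and x: "\<And>j k. j \<in> J \<Longrightarrow> k \<in> K \<Longrightarrow> x j k \<in> carrier M"
  shows "comb M J s (\<lambda>j. comb M K (t j) (x j)) = comb M K (\<lambda>_. 1) (\<lambda>k. comb M J (\<lambda>j. s j * t j k) (\<lambda>j. x j k))"
  using assms
proof (induct J)
  case empty
  show ?case by (simp add: comb_zeros)
next
  case (insert j J)
  have c: "comb M K (t i) (x i) \<in> carrier M" if "i \<in> insert j J" for i using insert.prems that by simp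
  have c': "comb M J' r (\<lambda>j. x j k) \<in> carrier M" if "k \<in> K" "J' \<subseteq> insert j J" for J' r k
    by (rule comb_closed) (use insert.prems that in blast)
  have xj: "x j k \<in> carrier M" if "k \<in> K" for k using insert.prems that by simp
  have "comb M K (\<lambda>_. 1) (\<lambda>k. comb M (insert j J) (\<lambda>j. s j * t j k) (\<lambda>j. x j k))
      = comb M K (\<lambda>_. 1) (\<lambda>k. (s j * t j k) \<odot> x j k \<oplus> comb M J (\<lambda>j. s j * t j k) (\<lambda>j. x j k))"
  proof (rule comb_cong)
    fix k assume k: "k \<in> K"
    have "comb M (insert j J) (\<lambda>j. s j * t j k) (\<lambda>j. x j k)
        = (s j * t j k) \<odot> x j k \<oplus> comb M J (\<lambda>j. s j * t j k) (\<lambda>j. x j k)"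
      by (rule comb_insert) (use insert k in auto)
    then show "1 \<odot> comb M (insert j J) (\<lambda>j. s j * t j k) (\<lambda>j. x j k)
        = 1 \<odot> ((s j * t j k) \<odot> x j k \<oplus> comb M J (\<lambda>j. s j * t j k) (\<lambda>j. x j k))" by simp
  next
    fix k assume k: "k \<in> K"
    show "comb M (insert j J) (\<lambda>j. s j * t j k) (\<lambda>j. x j k) \<in> carrier M" by (rule c'[OF k subset_refl])
    show "(s j * t j k) \<odot> x j k \<oplus> comb M J (\<lambda>j. s j * t j k) (\<lambda>j. x j k) \<in> carrier M"
      using c'[OF k, of J] xj[OF k] by (simp add: subset_insertI)
  qed
  also have "\<dots> = comb M K (\<lambda>_. 1) (\<lambda>k. (s j * t j k) \<odot> x j k) \<oplus> comb M K (\<lambda>_. 1) (\<lambda>k. comb M J (\<lambda>j. s j * t j k) (\<lambda>j. x j k))"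
    by (rule comb_add) (use c' xj in \<open>simp_all add: subset_insertI\<close>)
  also have "comb M K (\<lambda>_. 1) (\<lambda>k. (s j * t j k) \<odot> x j k) = comb M K (\<lambda>k. s j * t j k) (x j)"
    using xj by (intro comb_cong) simp_all
  also have "\<dots> = s j \<odot> comb M K (t j) (x j)" using insert.prems by (intro comb_scale[symmetric]) simp
  also have "comb M K (\<lambda>_. 1) (\<lambda>k. comb M J (\<lambda>j. s j * t j k) (\<lambda>j. x j k)) = comb M J s (\<lambda>j. comb M K (t j) (x j))"
    by (rule insert.hyps(3)[symmetric]) (use insert.prems in simp)
  also have "s j \<odot> comb M K (t j) (x j) \<oplus> \<dots> = comb M (insert j J) s (\<lambda>j. comb M K (t j) (x j))"
    by (rule comb_insert[symmetric]) (use insert.hyps c in auto)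
  finally show ?case by simp
qed

lemma comb_subspace:
  assumes U: "VectorSpace.subspace class_ring U M" and v: "\<And>j. j \<in> J \<Longrightarrow> v j \<in> U"
  shows "comb (M\<lparr>carrier := U\<rparr>) J s v = comb M J s v"
proof -
  have "(\<lambda>x. x) \<in> khom (M\<lparr>carrier := U\<rparr>) M" using subspaceD(1)[OF U] by (auto simp: khom_iff)
  then show ?thesis by (rule hom_comb[OF kspace_subspace[OF kspace_axioms U] kspace_axioms]) (use v in simp)
qed

text \<open>The matrix of a projection onto \<open>U\<close>, in row convention.\<close>

lemma exists_projection:
  assumes db: "dual_basis M I e \<xi>" and U: "VectorSpace.subspace class_ring U M"
  shows "\<exists>P. (\<forall>a\<in>I. comb M I (P a) e \<in> U) \<and> (\<forall>x\<in>U. \<forall>b\<in>I. (\<Sum>a\<in>I. \<xi> a x * P a b) = \<xi> b x)"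
proof -
  note D = dual_basisD[OF db]
  interpret U: kspace "M\<lparr>carrier := U\<rparr>" by (rule kspace_subspace[OF kspace_axioms U])
  obtain u \<eta> where u: "dual_basis (M\<lparr>carrier := U\<rparr>) {..<U.dim} u \<eta>"
    using U.dual_basis_exists fin_dim_subspace[OF dual_basis_fin_dim[OF db] U] by blast
  have uU: "u c \<in> U" if "c \<in> {..<U.dim}" for c using dual_basisD(2)[OF u that] by simp
  have uM: "u c \<in> carrier M" if "c \<in> {..<U.dim}" for c by (rule subspaceD(1)[OF U uU[OF that]])
  \<comment> \<open>The rows of \<open>X\<close> are the coordinates of a basis of \<open>U\<close>.
    With a generalized inverse \<open>Y\<close>, the matrix \<open>Y X\<close> has its rows in
    \<open>U\<close> and fixes the vectors of \<open>U\<close>.\<close>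
  define X where "X c b = \<xi> b (u c)" for c b
  obtain Y where Y: "\<forall>c\<in>{..<U.dim}. \<forall>b\<in>I. (\<Sum>a\<in>I. X c a * (\<Sum>c'\<in>{..<U.dim}. Y a c' * X c' b)) = X c b"
    by (rule exE[OF generalized_inverse[OF finite_lessThan D(1)]])
  define P where "P a b = (\<Sum>c\<in>{..<U.dim}. Y a c * X c b)" for a b
  show ?thesis
  proof (intro exI[of _ P] conjI ballI)
    fix a assume "a \<in> I"
    have "comb M I (P a) e = comb M {..<U.dim} (Y a) u"
    proof (rule dual_basis_eqI[OF db comb_closed[OF D(2)] comb_closed[OF uM]])
      fix b assume b: "b \<in> I"
      have "\<xi> b (comb M {..<U.dim} (Y a) u) = (\<Sum>c\<in>{..<U.dim}. Y a c * \<xi> b (u c))"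
        by (rule functional_comb[OF D(3)[OF b] uM])
      then show "\<xi> b (comb M I (P a) e) = \<xi> b (comb M {..<U.dim} (Y a) u)"
        by (simp add: dual_basis_comb[OF db b] P_def X_def)
    qed
    then show "comb M I (P a) e \<in> U" using comb_in_subspace[OF U, of "{..<U.dim}" u "Y a"] uU by simp
  next
    fix x b assume x: "x \<in> U" and b: "b \<in> I"
    have "comb (M\<lparr>carrier := U\<rparr>) {..<U.dim} (\<lambda>c. \<eta> c x) u = x" by (rule U.dual_basis_expand[OF u]) (use x in simp)
    then have x': "x = comb M {..<U.dim} (\<lambda>c. \<eta> c x) u"
      using comb_subspace[OF U, of "{..<U.dim}" u "\<lambda>c. \<eta> c x"] uU by simp
    have \<xi>: "\<xi> a x = (\<Sum>c\<in>{..<U.dim}. \<eta> c x * X c a)" if "a \<in> I" for a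
    proof -
      have "\<xi> a (comb M {..<U.dim} (\<lambda>c. \<eta> c x) u) = (\<Sum>c\<in>{..<U.dim}. \<eta> c x * X c a)"
        unfolding X_def by (rule functional_comb[OF D(3)[OF that] uM])
      then show ?thesis using x' by simp
    qed
    have "(\<Sum>a\<in>I. \<xi> a x * P a b) = (\<Sum>a\<in>I. (\<Sum>c\<in>{..<U.dim}. \<eta> c x * X c a) * P a b)" using \<xi> by simp
    also have "\<dots> = (\<Sum>c\<in>{..<U.dim}. \<eta> c x * (\<Sum>a\<in>I. X c a * P a b))" by (rule sum_mult_assoc[symmetric])
    also have "\<dots> = (\<Sum>c\<in>{..<U.dim}. \<eta> c x * X c b)" using Y b by (simp add: P_def)
    finally show "(\<Sum>a\<in>I. \<xi> a x * P a b) = \<xi> b x" using \<xi>[OF b] by simp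
  qed
qed

end

lemma khom_comb:
  assumes "kspace M" "kspace N" and h: "\<And>j. j \<in> J \<Longrightarrow> h j \<in> khom M N"
  shows "(\<lambda>x. comb N J s (\<lambda>j. h j x)) \<in> khom M N"
proof -
  interpret M: kspace M by fact
  interpret N: kspace N by fact
  have c: "h j x \<in> carrier N" if "j \<in> J" "x \<in> carrier M" for j x using h[OF that(1)] that(2) by (simp add: khom_iff)
  show ?thesis
    unfolding khom_iff
  proof (intro conjI ballI allI)
    fix x assume x: "x \<in> carrier M"
    show "comb N J s (\<lambda>j. h j x) \<in> carrier N" using c x by simp
    fix y assume y: "y \<in> carrier M"
    have "comb N J s (\<lambda>j. h j (x \<oplus>\<^bsub>M\<^esub> y)) = comb N J s (\<lambda>j. h j x \<oplus>\<^bsub>N\<^esub> h j y)"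
      using h x y c by (intro N.comb_cong) (auto simp: khom_iff)
    then show "comb N J s (\<lambda>j. h j (x \<oplus>\<^bsub>M\<^esub> y)) = comb N J s (\<lambda>j. h j x) \<oplus>\<^bsub>N\<^esub> comb N J s (\<lambda>j. h j y)"
      using N.comb_add[of J "\<lambda>j. h j x" "\<lambda>j. h j y" s] c x y by simp
  next
    fix a x assume x: "x \<in> carrier M"
    have "comb N J s (\<lambda>j. h j (a \<odot>\<^bsub>M\<^esub> x)) = comb N J (\<lambda>j. a * s j) (\<lambda>j. h j x)"
      using h x c by (intro N.comb_cong) (auto simp: khom_iff mult.commute simp flip: N.smult_assoc)
    then show "comb N J s (\<lambda>j. h j (a \<odot>\<^bsub>M\<^esub> x)) = a \<odot>\<^bsub>N\<^esub> comb N J s (\<lambda>j. h j x)"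
      using N.comb_scale[of J "\<lambda>j. h j x" a s] c x by simp
  qed
qed

section \<open>Multiplicity spaces\<close>

lemma kspace_mult_space: "kspace (mult_space m)"
  unfolding mult_space_def by (rule kspace_free_space)

lemma dual_basis_mult_space: "dual_basis (mult_space m) {1..m} mult_basis (\<lambda>j w. Poly_Mapping.lookup w j)"
  unfolding dual_basis_def functional_def mult_space_def mult_basis_def free_space_simps
  by (auto simp: lookup_single lookup_add when_def in_keys_iff intro!: poly_mapping_eqI)

context middle
begin

text \<open>Kept general in \<open>q\<close>: the basis of \<open>W i\<close> gives the comparison
  of the copies of \<open>V i\<close> with \<open>V i \<otimes> W i\<close>, and the cosets of that
  basis give its composite with the projection to \<open>V i \<otimes> (W i / W' i)\<close>.\<close>

definition tensor_comb ::
    "nat \<Rightarrow> ('k, 'q, 'y) module_scheme \<Rightarrow> (nat \<Rightarrow> 'q) \<Rightarrow> (nat \<Rightarrow> nat \<Rightarrow> 'v) \<Rightarrow> ('v \<times> 'q \<Rightarrow>\<^sub>0 'k) set"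
  where "tensor_comb i Q q b = comb (tensor (V i) Q) {1..n i} (\<lambda>_. 1) (\<lambda>j. pure_tensor (V i) Q (b i j) (q j))"

lemma component_hom: "i \<in> {1..l} \<Longrightarrow> j \<in> {1..n i} \<Longrightarrow> (\<lambda>b. b i j) \<in> khom B (V i)"
  by (simp add: khom_iff B_component B_add B_smult)

lemma S_of_tensor_comb:
  assumes i: "i \<in> {1..l}" and f: "f a \<in> carrier B"
  shows "S_of l n V f a i = tensor_comb i (mult_space (n i)) mult_basis (f a)"
proof -
  interpret V: kspace "V i" by (rule V_space[OF i])
  interpret tensor_pair "V i" "mult_space (n i)" by (intro tensor_pair.intro V.kspace_axioms kspace_mult_space)
  interpret T: kspace "tensor (V i) (mult_space (n i))" by (rule kspace_tensor)
  have p: "pure_tensor (V i) (mult_space (n i)) (f a i j) (mult_basis j) \<in> carrier (tensor (V i) (mult_space (n i)))" if "j \<in> {1..n i}" for j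
    by (rule pure_closed[OF B_component[OF f i that] dual_basisD(2)[OF dual_basis_mult_space that]])
  have "finsum (tensor (V i) (mult_space (n i))) (\<lambda>j. pure_tensor (V i) (mult_space (n i)) (f a i j) (mult_basis j)) {1..n i}
      = tensor_comb i (mult_space (n i)) mult_basis (f a)"
    unfolding tensor_comb_def comb_def by (rule T.finsum_cong') (use p in \<open>simp_all add: Pi_iff\<close>)
  then show ?thesis using i by (simp add: S_of_def)
qed

context
  fixes i :: nat and Q :: "('k, 'q, 'y) module_scheme" and q :: "nat \<Rightarrow> 'q"
  assumes i: "i \<in> {1..l}" and Q: "kspace Q" and q: "\<And>j. j \<in> {1..n i} \<Longrightarrow> q j \<in> carrier Q"
begin

lemma tensor_pair_V: "tensor_pair (V i) Q" by (rule tensor_pair.intro[OF V_space[OF i] Q])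

lemma pure_closed_V: "x \<in> carrier (V i) \<Longrightarrow> w \<in> carrier Q \<Longrightarrow> pure_tensor (V i) Q x w \<in> carrier (tensor (V i) Q)"
  by (rule tensor_pair.pure_closed[OF tensor_pair_V])

lemma kspace_tensor_V: "kspace (tensor (V i) Q)" by (rule tensor_pair.kspace_tensor[OF tensor_pair_V])

lemma tensor_comb_hom: "tensor_comb i Q q \<in> khom B (tensor (V i) Q)"
  unfolding tensor_comb_def[abs_def]
  by (rule khom_comb[OF fd_module_kspace[OF B_mod] kspace_tensor_V])
    (rule khom_comp[OF component_hom[OF i] tensor_pair.pure_hom_left[OF tensor_pair_V q]])

lemma tensor_comb_closed: "b \<in> carrier B \<Longrightarrow> tensor_comb i Q q b \<in> carrier (tensor (V i) Q)"
  using tensor_comb_hom by (simp add: khom_iff)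

lemma tensor_comb_incl:
  assumes i': "i' \<in> {1..l}" and j: "j \<in> {1..n i'}" and x: "x \<in> carrier (V i')"
  shows "tensor_comb i Q q (incl i' j x) = (if i = i' then pure_tensor (V i) Q x (q j) else \<zero>\<^bsub>tensor (V i) Q\<^esub>)"
proof -
  interpret T: kspace "tensor (V i) Q" by (rule kspace_tensor_V)
  have zero: "pure_tensor (V i) Q \<zero>\<^bsub>V i\<^esub> w = \<zero>\<^bsub>tensor (V i) Q\<^esub>" if "w \<in> carrier Q" for w
    by (rule khom_zero[OF V_space[OF i] kspace_tensor_V tensor_pair.pure_hom_left[OF tensor_pair_V that]])
  show ?thesis
  proof (cases "i = i'")
    case True
    then have x': "x \<in> carrier (V i)" and j': "j \<in> {1..n i}" using x j by simp_all
    have e: "incl i' j x i k = (if k = j then x else \<zero>\<^bsub>V i\<^esub>)" if "k \<in> {1..n i}" for k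
      using incl_apply[OF i' j i that, of x] True by simp
    have "tensor_comb i Q q (incl i' j x) = 1 \<odot>\<^bsub>tensor (V i) Q\<^esub> pure_tensor (V i) Q (incl i' j x i j) (q j)"
      unfolding tensor_comb_def
      by (rule T.comb_single) (use e q zero j' x' pure_closed_V in auto)
    also have "\<dots> = pure_tensor (V i) Q x (q j)"
      using pure_closed_V[OF x' q[OF j']] unfolding e[OF j'] if_P[OF refl] by (rule T.smult_simps(1))
    finally show ?thesis unfolding if_P[OF True] .
  next
    case False
    have "incl i' j x i k = \<zero>\<^bsub>V i\<^esub>" if "k \<in> {1..n i}" for k
      using incl_apply[OF i' j i that, of x] False by simp
    then have "tensor_comb i Q q (incl i' j x) = \<zero>\<^bsub>tensor (V i) Q\<^esub>"
      unfolding tensor_comb_def by (intro T.comb_zeros) (simp add: zero q)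
    then show ?thesis using False by simp
  qed
qed

lemma tensor_comb_cong:
  assumes "b \<in> carrier B" "b' \<in> carrier B" "\<And>j. j \<in> {1..n i} \<Longrightarrow> b i j = b' i j"
  shows "tensor_comb i Q q b = tensor_comb i Q q b'"
proof -
  interpret T: kspace "tensor (V i) Q" by (rule kspace_tensor_V)
  show ?thesis
    unfolding tensor_comb_def
    by (rule T.comb_cong) (use assms pure_closed_V[OF B_component[OF _ i] q] in simp_all)
qed

text \<open>The matrix moves across the tensor sign, from \<open>b P \<otimes> q\<close> to
  \<open>b \<otimes> P q\<close>. This turns statements on idempotents of \<open>B\<close> into
  statements on subspaces and quotients of \<open>W i\<close>.\<close>

lemma tensor_comb_mat_endo:
  assumes b: "b \<in> carrier B"
  shows "tensor_comb i Q q (mat_endo P b)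
    = comb (tensor (V i) Q) {1..n i} (\<lambda>_. 1) (\<lambda>j. pure_tensor (V i) Q (b i j) (comb Q {1..n i} (P i j) q))"
proof -
  interpret Q: kspace Q by (rule Q)
  interpret T: kspace "tensor (V i) Q" by (rule kspace_tensor_V)
  let ?J = "{1..n i}" and ?x = "\<lambda>j j'. pure_tensor (V i) Q (b i j') (q j)"
  have bV: "b i j \<in> carrier (V i)" if "j \<in> ?J" for j by (rule B_component[OF b i that])
  have x: "?x j j' \<in> carrier (tensor (V i) Q)" if "j \<in> ?J" "j' \<in> ?J" for j j' by (rule pure_closed_V[OF bV[OF that(2)] q[OF that(1)]])
  have m: "pure_tensor (V i) Q (mat_endo P b i j) (q j) = comb (tensor (V i) Q) ?J (\<lambda>j'. P i j' j) (?x j)" if j: "j \<in> ?J" for j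
    unfolding mat_endo_apply[OF i j]
    by (rule hom_comb[OF V_space[OF i] kspace_tensor_V tensor_pair.pure_hom_left[OF tensor_pair_V q[OF j]] bV])
  have r: "pure_tensor (V i) Q (b i j') (comb Q ?J (P i j') q) = comb (tensor (V i) Q) ?J (P i j') (\<lambda>j. ?x j j')" if j: "j' \<in> ?J" for j'
    by (rule hom_comb[OF Q kspace_tensor_V tensor_pair.pure_hom_right[OF tensor_pair_V bV[OF j]] q])
  have c1: "pure_tensor (V i) Q (mat_endo P b i j) (q j) \<in> carrier (tensor (V i) Q)" if "j \<in> ?J" for j
    by (rule pure_closed_V[OF B_component[OF mat_endo_closed[OF b] i that] q[OF that]])
  have c2: "pure_tensor (V i) Q (b i j) (comb Q ?J (P i j) q) \<in> carrier (tensor (V i) Q)" if "j \<in> ?J" for j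
    by (rule pure_closed_V[OF bV[OF that] Q.comb_closed[OF q]])
  have "tensor_comb i Q q (mat_endo P b) = comb (tensor (V i) Q) ?J (\<lambda>_. 1) (\<lambda>j. comb (tensor (V i) Q) ?J (\<lambda>j'. P i j' j) (?x j))"
    unfolding tensor_comb_def
  proof (rule T.comb_cong)
    fix j assume j: "j \<in> ?J"
    show "1 \<odot>\<^bsub>tensor (V i) Q\<^esub> pure_tensor (V i) Q (mat_endo P b i j) (q j)
        = 1 \<odot>\<^bsub>tensor (V i) Q\<^esub> comb (tensor (V i) Q) ?J (\<lambda>j'. P i j' j) (?x j)" unfolding m[OF j] ..
    show "pure_tensor (V i) Q (mat_endo P b i j) (q j) \<in> carrier (tensor (V i) Q)" by (rule c1[OF j])
    show "comb (tensor (V i) Q) ?J (\<lambda>j'. P i j' j) (?x j) \<in> carrier (tensor (V i) Q)" by (rule T.comb_closed[OF x[OF j]])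
  qed
  also have "\<dots> = comb (tensor (V i) Q) ?J (\<lambda>_. 1) (\<lambda>j'. comb (tensor (V i) Q) ?J (\<lambda>j. 1 * P i j' j) (\<lambda>j. ?x j j'))"
    by (rule T.comb_swap[OF finite_atLeastAtMost]) (rule x)
  also have "\<dots> = comb (tensor (V i) Q) ?J (\<lambda>_. 1) (\<lambda>j. pure_tensor (V i) Q (b i j) (comb Q ?J (P i j) q))"
  proof (rule T.comb_cong)
    fix j assume j: "j \<in> ?J"
    show "1 \<odot>\<^bsub>tensor (V i) Q\<^esub> comb (tensor (V i) Q) ?J (\<lambda>j'. 1 * P i j j') (\<lambda>j'. ?x j' j)
        = 1 \<odot>\<^bsub>tensor (V i) Q\<^esub> pure_tensor (V i) Q (b i j) (comb Q ?J (P i j) q)" unfolding r[OF j] by simp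
    show "comb (tensor (V i) Q) ?J (\<lambda>j'. 1 * P i j j') (\<lambda>j'. ?x j' j) \<in> carrier (tensor (V i) Q)"
      by (rule T.comb_closed[OF x[OF _ j]])
    show "pure_tensor (V i) Q (b i j) (comb Q ?J (P i j) q) \<in> carrier (tensor (V i) Q)" by (rule c2[OF j])
  qed
  finally show ?thesis .
qed

lemma tensor_comb_preimage:
  fixes x and t :: "nat \<Rightarrow> 'k"
  assumes x: "x \<in> carrier (V i)"
  defines "b \<equiv> \<lambda>i'\<in>{1..l}. \<lambda>j\<in>{1..n i'}. if i' = i then t j \<odot>\<^bsub>V i\<^esub> x else \<zero>\<^bsub>V i'\<^esub>"
  shows "b \<in> carrier B" "\<And>j. j \<in> {1..n i} \<Longrightarrow> b i j = t j \<odot>\<^bsub>V i\<^esub> x"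
    "tensor_comb i Q q b = pure_tensor (V i) Q x (comb Q {1..n i} t q)"
proof -
  interpret V: kspace "V i" by (rule V_space[OF i])
  interpret T: kspace "tensor (V i) Q" by (rule kspace_tensor_V)
  have z: "\<zero>\<^bsub>V i'\<^esub> \<in> carrier (V i')" if "i' \<in> {1..l}" for i'
  proof -
    interpret kspace "V i'" by (rule V_space[OF that])
    show ?thesis by simp
  qed
  show "b \<in> carrier B" unfolding B_carrier b_def using z x by (auto simp: PiE_iff)
  show b: "b i j = t j \<odot>\<^bsub>V i\<^esub> x" if "j \<in> {1..n i}" for j using i that by (simp add: b_def)
  have p: "pure_tensor (V i) Q (t j \<odot>\<^bsub>V i\<^esub> x) (q j) = t j \<odot>\<^bsub>tensor (V i) Q\<^esub> pure_tensor (V i) Q x (q j)" if "j \<in> {1..n i}" for j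
    using tensor_pair.pure_hom_left[OF tensor_pair_V q[OF that]] x by (simp add: khom_iff)
  have "tensor_comb i Q q b = comb (tensor (V i) Q) {1..n i} t (\<lambda>j. pure_tensor (V i) Q x (q j))"
    unfolding tensor_comb_def by (rule T.comb_cong) (use b p x q pure_closed_V in simp_all)
  also have "\<dots> = pure_tensor (V i) Q x (comb Q {1..n i} t q)"
    by (rule hom_comb[OF Q kspace_tensor_V tensor_pair.pure_hom_right[OF tensor_pair_V x] q, symmetric])
  finally show "tensor_comb i Q q b = pure_tensor (V i) Q x (comb Q {1..n i} t q)" .
qed

end

end

section \<open>The morphisms \<open>T\<close> and \<open>S\<close>\<close>

lemma lmod_tensor_simps:
  "carrier (lmod_tensor V W) = carrier (tensor V W)" "zero (lmod_tensor V W) = zero (tensor V W)"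
  "add (lmod_tensor V W) = add (tensor V W)" "smult (lmod_tensor V W) = smult (tensor V W)"
  by (simp_all add: lmod_tensor_def tensor_def quot_space_def module.defs lmodule.defs)

context middle
begin

lemma B_glue:
  assumes b: "\<And>i. i \<in> {1..l} \<Longrightarrow> b i \<in> carrier B"
  shows "(\<lambda>i\<in>{1..l}. \<lambda>j\<in>{1..n i}. b i i j) \<in> carrier B"
  using B_component[OF b] unfolding B_carrier by auto

lemma mat_endo_cong:
  assumes "i \<in> {1..l}" "b \<in> carrier B" "b' \<in> carrier B" "\<And>j. j \<in> {1..n i} \<Longrightarrow> b i j = b' i j" "j \<in> {1..n i}"
  shows "mat_endo P b i j = mat_endo P b' i j"
proof -
  interpret kspace "V i" by (rule V_space[OF assms(1)])
  show ?thesis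
    unfolding mat_endo_apply[OF assms(1,5)]
    by (rule comb_cong) (use assms B_component[OF _ assms(1)] in simp_all)
qed

text \<open>Idempotence follows from the first two properties: each row of \<open>P i\<close> lies
  in \<open>W' i\<close>, and \<open>P i\<close> fixes the elements of \<open>W' i\<close>.\<close>

lemma exists_multiplicity_projections:
  assumes W': "\<forall>i\<in>{1..l}. VectorSpace.subspace class_ring (W' i) (mult_space (n i) :: ('k, nat \<Rightarrow>\<^sub>0 'k) module)"
  obtains P where
    "\<And>i j. i \<in> {1..l} \<Longrightarrow> j \<in> {1..n i} \<Longrightarrow> comb (mult_space (n i)) {1..n i} (P i j) mult_basis \<in> W' i"
    "\<And>i j w. i \<in> {1..l} \<Longrightarrow> j \<in> {1..n i} \<Longrightarrow> w \<in> W' i \<Longrightarrow>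
      (\<Sum>j'\<in>{1..n i}. Poly_Mapping.lookup w j' * P i j' j) = Poly_Mapping.lookup w j"
    "\<And>i j j'. i \<in> {1..l} \<Longrightarrow> j \<in> {1..n i} \<Longrightarrow> j' \<in> {1..n i} \<Longrightarrow>
      (\<Sum>j''\<in>{1..n i}. P i j j'' * P i j'' j') = P i j j'"
proof -
  have "\<forall>i\<in>{1..l}. \<exists>P. (\<forall>j\<in>{1..n i}. comb (mult_space (n i)) {1..n i} (P j) mult_basis \<in> W' i) \<and>
     (\<forall>w\<in>W' i. \<forall>j\<in>{1..n i}. (\<Sum>j'\<in>{1..n i}. Poly_Mapping.lookup w j' * P j' j) = Poly_Mapping.lookup w j)"
    using W' by (intro ballI kspace.exists_projection[OF kspace_mult_space dual_basis_mult_space]) blast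
  then obtain P where P: "\<forall>i\<in>{1..l}. (\<forall>j\<in>{1..n i}. comb (mult_space (n i)) {1..n i} (P i j) mult_basis \<in> W' i) \<and>
     (\<forall>w\<in>W' i. \<forall>j\<in>{1..n i}. (\<Sum>j'\<in>{1..n i}. Poly_Mapping.lookup w j' * P i j' j) = Poly_Mapping.lookup w j)"
    by (rule bchoice[THEN exE])
  show thesis
  proof (rule that[of P])
    fix i j assume ij: "i \<in> {1..l}" "j \<in> {1..n i}"
    show row: "comb (mult_space (n i)) {1..n i} (P i j) mult_basis \<in> W' i"
      by (rule bspec[OF conjunct1[OF bspec[OF P ij(1)]] ij(2)])
    show fix_W': "(\<Sum>j'\<in>{1..n i}. Poly_Mapping.lookup w j' * P i j' j) = Poly_Mapping.lookup w j" if "w \<in> W' i" for w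
      by (rule bspec[OF bspec[OF conjunct2[OF bspec[OF P ij(1)]] that] ij(2)])
  next
    fix i j j' assume ij: "i \<in> {1..l}" "j \<in> {1..n i}" "j' \<in> {1..n i}"
    let ?w = "comb (mult_space (n i)) {1..n i} (P i j) mult_basis"
    have w: "?w \<in> W' i" by (rule bspec[OF conjunct1[OF bspec[OF P ij(1)]] ij(2)])
    have l: "Poly_Mapping.lookup ?w k = P i j k" if "k \<in> {1..n i}" for k
      by (rule kspace.dual_basis_comb[OF kspace_mult_space dual_basis_mult_space that])
    have "(\<Sum>k\<in>{1..n i}. Poly_Mapping.lookup ?w k * P i k j') = Poly_Mapping.lookup ?w j'"
      by (rule bspec[OF bspec[OF conjunct2[OF bspec[OF P ij(1)]] w] ij(3)])
    then show "(\<Sum>j''\<in>{1..n i}. P i j j'' * P i j'' j') = P i j j'"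
      using l[OF ij(3)] l by simp
  qed
qed

lemma mult_basis_closed: "j \<in> {1..m} \<Longrightarrow> mult_basis j \<in> carrier (mult_space m :: ('k, nat \<Rightarrow>\<^sub>0 'k) module)"
  by (rule dual_basisD(2)[OF dual_basis_mult_space])

definition tensor_iso :: "(nat \<Rightarrow> nat \<Rightarrow> 'v) \<Rightarrow> nat \<Rightarrow> ('v \<times> (nat \<Rightarrow>\<^sub>0 'k) \<Rightarrow>\<^sub>0 'k) set"
  where "tensor_iso b = (\<lambda>i\<in>{1..l}. tensor_comb i (mult_space (n i)) mult_basis b)"

lemma tensor_iso_hom: "tensor_iso \<in> khom B (middle_tensor l n V)"
proof -
  have h: "tensor_comb i (mult_space (n i)) mult_basis \<in> khom B (tensor (V i) (mult_space (n i)))" if "i \<in> {1..l}" for i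
    by (rule tensor_comb_hom[OF that kspace_mult_space mult_basis_closed])
  have "is_dir_sum {1..l} (\<lambda>i. lmod_tensor (V i) (mult_space (n i) :: ('k, nat \<Rightarrow>\<^sub>0 'k) module)) (middle_tensor l n V)"
    unfolding middle_tensor_def by (rule is_dir_sum_lmod_dir_sum)
  then show ?thesis
    using h unfolding khom_iff is_dir_sum_def lmod_tensor_simps tensor_iso_def by (auto intro!: restrict_ext)
qed

text \<open>Both sides are linear in \<open>b\<close>, and on the basis of \<open>B\<close> their
  equality is the defining property of \<open>T\<close>.\<close>

lemma T_tensor_iso:
  assumes C: "kspace C" and g: "g \<in> khom B C" and T: "T_of L l n V C g T" and b: "b \<in> carrier B"
  shows "T (tensor_iso b) = g b"
proof -
  have Th: "T \<in> khom (middle_tensor l n V) C" using T by (auto simp: T_of_def lmod_hom_def)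
  obtain \<epsilon> \<zeta> where "\<forall>i\<in>{1..l}. dual_basis (V i) {..<v i} (\<epsilon> i) (\<zeta> i)" using exists_dual_bases by blast
  then have db: "dual_basis (V i) {..<v i} (\<epsilon> i) (\<zeta> i)" if "i \<in> {1..l}" for i using that by blast
  show ?thesis
  proof (rule khom_eq_on_basis[OF fd_module_kspace[OF B_mod] C khom_comp[OF tensor_iso_hom Th] g dual_basis_B[OF db] _ b])
    fix k assume k: "k \<in> (SIGMA i:{1..l}. {1..n i} \<times> {..<v i})"
    obtain i j a where k': "k = (i, j, a)" by (cases k)
    have ij: "i \<in> {1..l}" "j \<in> {1..n i}" "a \<in> {..<v i}" using k k' by auto
    note x = dual_basisD(2)[OF db[OF ij(1)] ij(3)]
    have "tensor_iso (incl i j (\<epsilon> i a)) = dir_sum_incl {1..l} (\<lambda>k. lmod_tensor (V k) (mult_space (n k))) i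
        (pure_tensor (V i) (mult_space (n i)) (\<epsilon> i a) (mult_basis j))"
      unfolding tensor_iso_def dir_sum_incl_def
    proof (rule restrict_ext)
      fix k assume "k \<in> {1..l}"
      from tensor_comb_incl[OF this kspace_mult_space mult_basis_closed ij(1,2) x]
      show "tensor_comb k (mult_space (n k)) mult_basis (incl i j (\<epsilon> i a))
          = (if k = i then pure_tensor (V i) (mult_space (n i)) (\<epsilon> i a) (mult_basis j)
             else \<zero>\<^bsub>lmod_tensor (V k) (mult_space (n k))\<^esub>)"
        by (simp add: lmod_tensor_simps)
    qed
    then have "T (tensor_iso (incl i j (\<epsilon> i a))) = g (incl i j (\<epsilon> i a))"
      using T ij x unfolding T_of_def right_component_incl by simp
    then show "T (tensor_iso ((\<lambda>(i, j, a). incl i j (\<epsilon> i a)) k)) = g ((\<lambda>(i, j, a). incl i j (\<epsilon> i a)) k)"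
      by (simp add: k')
  qed
qed

text \<open>Moving \<open>P\<close> across the tensor sign makes the second factors rows of
  \<open>P i\<close>, which lie in \<open>W' i\<close>. Conversely \<open>x \<otimes> w\<close> with
  \<open>w\<close> in \<open>W' i\<close> comes from an element whose component \<open>i\<close> is
  fixed by \<open>mat_endo P\<close>.\<close>

lemma tensor_iso_image:
  assumes W': "\<forall>i\<in>{1..l}. VectorSpace.subspace class_ring (W' i) (mult_space (n i) :: ('k, nat \<Rightarrow>\<^sub>0 'k) module)"
    and row: "\<And>i j. i \<in> {1..l} \<Longrightarrow> j \<in> {1..n i} \<Longrightarrow> comb (mult_space (n i)) {1..n i} (P i j) mult_basis \<in> W' i"
    and fix_W': "\<And>i j w. i \<in> {1..l} \<Longrightarrow> j \<in> {1..n i} \<Longrightarrow> w \<in> W' i \<Longrightarrow>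
      (\<Sum>j'\<in>{1..n i}. Poly_Mapping.lookup w j' * P i j' j) = Poly_Mapping.lookup w j"
  shows "tensor_iso ` (mat_endo P ` carrier B) = (\<Pi>\<^sub>E i\<in>{1..l}. subtensor (V i) (mult_space (n i)) (W' i))"
proof (intro equalityI subsetI)
  fix y assume "y \<in> tensor_iso ` (mat_endo P ` carrier B)"
  then obtain b where b: "b \<in> carrier B" "y = tensor_iso (mat_endo P b)" by blast
  have "tensor_comb i (mult_space (n i)) mult_basis (mat_endo P b) \<in> subtensor (V i) (mult_space (n i)) (W' i)" if i: "i \<in> {1..l}" for i
  proof -
    interpret W: kspace "mult_space (n i) :: ('k, nat \<Rightarrow>\<^sub>0 'k) module" by (rule kspace_mult_space)
    interpret tensor_pair "V i" "mult_space (n i)" by (rule tensor_pair_V[OF i kspace_mult_space mult_basis_closed])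
    interpret T: kspace "tensor (V i) (mult_space (n i))" by (rule kspace_tensor)
    have sub: "W' i \<subseteq> carrier (mult_space (n i))" using W.subspaceD(1) W' i by blast
    let ?S = "{pure_tensor (V i) (mult_space (n i)) v w |v w. v \<in> carrier (V i) \<and> w \<in> W' i}"
    have S: "?S \<subseteq> carrier (tensor (V i) (mult_space (n i)))" using pure_closed sub by blast
    have eq: "tensor_comb i (mult_space (n i)) mult_basis (mat_endo P b) = comb (tensor (V i) (mult_space (n i))) {1..n i} (\<lambda>_. 1)
        (\<lambda>j. pure_tensor (V i) (mult_space (n i)) (b i j) (comb (mult_space (n i)) {1..n i} (P i j) mult_basis))"
      by (rule tensor_comb_mat_endo[OF i kspace_mult_space mult_basis_closed b(1)])
    show ?thesis
      unfolding eq subtensor_def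
    proof (rule T.comb_in_subspace[OF T.span_is_subspace[OF S]])
      fix j assume j: "j \<in> {1..n i}"
      have "pure_tensor (V i) (mult_space (n i)) (b i j) (comb (mult_space (n i)) {1..n i} (P i j) mult_basis) \<in> ?S"
        using B_component[OF b(1) i j] row[OF i j] by blast
      then show "pure_tensor (V i) (mult_space (n i)) (b i j) (comb (mult_space (n i)) {1..n i} (P i j) mult_basis) \<in> T.span ?S"
        using T.in_own_span[OF S] by blast
    qed
  qed
  then show "y \<in> (\<Pi>\<^sub>E i\<in>{1..l}. subtensor (V i) (mult_space (n i)) (W' i))"
    unfolding b(2) tensor_iso_def by simp
next
  fix y assume y: "y \<in> (\<Pi>\<^sub>E i\<in>{1..l}. subtensor (V i) (mult_space (n i)) (W' i))"
  have "\<forall>i\<in>{1..l}. \<exists>b. b \<in> carrier B \<and> y i = tensor_comb i (mult_space (n i)) mult_basis (mat_endo P b)"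
  proof
    fix i assume i: "i \<in> {1..l}"
    let ?W = "mult_space (n i) :: ('k, nat \<Rightarrow>\<^sub>0 'k) module"
    interpret W: kspace ?W by (rule kspace_mult_space)
    interpret V: kspace "V i" by (rule V_space[OF i])
    interpret T: kspace "tensor (V i) ?W" by (rule kspace_tensor_V[OF i kspace_mult_space mult_basis_closed])
    let ?h = "\<lambda>b. tensor_comb i ?W mult_basis (mat_endo P b)"
    have W'i: "VectorSpace.subspace class_ring (W' i) ?W" using W' i by blast
    have h: "?h \<in> khom B (tensor (V i) ?W)"
      by (rule khom_comp[OF lmod_homD(1)[OF mat_endo_hom] tensor_comb_hom[OF i kspace_mult_space mult_basis_closed]])
    have N: "VectorSpace.subspace class_ring (?h ` carrier B) (tensor (V i) ?W)"
      by (rule khom_image_subspace[OF fd_module_kspace[OF B_mod] T.kspace_axioms h])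
    have "pure_tensor (V i) ?W x w \<in> ?h ` carrier B" if x: "x \<in> carrier (V i)" and w: "w \<in> W' i" for x w
    proof -
      have wc: "w \<in> carrier ?W" by (rule W.subspaceD(1)[OF W'i w])
      define b where "b = (\<lambda>i'\<in>{1..l}. \<lambda>j\<in>{1..n i'}. if i' = i then Poly_Mapping.lookup w j \<odot>\<^bsub>V i\<^esub> x else \<zero>\<^bsub>V i'\<^esub>)"
      have b: "b \<in> carrier B"
        unfolding b_def by (rule tensor_comb_preimage(1)[OF i kspace_mult_space mult_basis_closed x])
      have bi: "b i j = Poly_Mapping.lookup w j \<odot>\<^bsub>V i\<^esub> x" if "j \<in> {1..n i}" for j
        using i that by (simp add: b_def)
      have bt: "tensor_comb i ?W mult_basis b = pure_tensor (V i) ?W x (comb ?W {1..n i} (Poly_Mapping.lookup w) mult_basis)"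
        unfolding b_def by (rule tensor_comb_preimage(3)[OF i kspace_mult_space mult_basis_closed x])
      have "mat_endo P b i j = b i j" if j: "j \<in> {1..n i}" for j
      proof (rule V_eqI[OF i B_component[OF mat_endo_closed[OF b] i j] B_component[OF b i j]])
        fix \<phi> assume \<phi>: "functional (V i) \<phi>"
        have "\<phi> (mat_endo P b i j) = (\<Sum>j'\<in>{1..n i}. Poly_Mapping.lookup w j' * P i j' j) * \<phi> x"
          unfolding functional_mat_endo[OF b i j \<phi>] sum_distrib_right
          by (intro sum.cong refl) (simp add: bi functional_smult[OF \<phi> x] mult_ac)
        then show "\<phi> (mat_endo P b i j) = \<phi> (b i j)"
          using fix_W'[OF i j w] bi[OF j] functional_smult[OF \<phi> x] by simp
      qed
      then have "?h b = tensor_comb i ?W mult_basis b"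
        by (intro tensor_comb_cong[OF i kspace_mult_space mult_basis_closed mat_endo_closed[OF b] b])
      also have "\<dots> = pure_tensor (V i) ?W x w"
        using bt W.dual_basis_expand[OF dual_basis_mult_space wc] by simp
      finally show ?thesis using b by (intro image_eqI) simp_all
    qed
    then have S: "{pure_tensor (V i) ?W v w |v w. v \<in> carrier (V i) \<and> w \<in> W' i} \<subseteq> ?h ` carrier B" by blast
    have "subtensor (V i) ?W (W' i) \<subseteq> ?h ` carrier B"
      unfolding subtensor_def by (rule T.span_is_subset[OF S]) (use N in \<open>simp add: VectorSpace.subspace_def\<close>)
    moreover have "y i \<in> subtensor (V i) ?W (W' i)" using y i by (rule PiE_mem)
    ultimately show "\<exists>b. b \<in> carrier B \<and> y i = ?h b" by blast
  qed
  then obtain b where b: "\<forall>i\<in>{1..l}. b i \<in> carrier B \<and> y i = tensor_comb i (mult_space (n i)) mult_basis (mat_endo P (b i))"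
    by (rule bchoice[THEN exE])
  then have bB: "b i \<in> carrier B" if "i \<in> {1..l}" for i using that by blast
  \<comment> \<open>The value at \<open>i\<close> depends on the component \<open>i\<close> of
    \<open>b i\<close> alone, so one element can be assembled from these components.\<close>
  define b' where "b' = (\<lambda>i\<in>{1..l}. \<lambda>j\<in>{1..n i}. b i i j)"
  have b'B: "b' \<in> carrier B" unfolding b'_def by (rule B_glue) (rule bB)
  have b': "b i i j = b' i j" if "i \<in> {1..l}" "j \<in> {1..n i}" for i j using that by (simp add: b'_def)
  have "y = tensor_iso (mat_endo P b')"
  proof (rule extensionalityI[of _ "{1..l}"])
    show "y \<in> extensional {1..l}" using y by (simp add: PiE_iff)
    show "tensor_iso (mat_endo P b') \<in> extensional {1..l}" by (simp add: tensor_iso_def)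
    fix i assume i: "i \<in> {1..l}"
    have "tensor_comb i (mult_space (n i)) mult_basis (mat_endo P (b i)) = tensor_comb i (mult_space (n i)) mult_basis (mat_endo P b')"
      by (rule tensor_comb_cong[OF i kspace_mult_space mult_basis_closed mat_endo_closed[OF bB[OF i]] mat_endo_closed[OF b'B]])
        (assumption | rule mat_endo_cong[OF i bB[OF i] b'B] b'[OF i])+
    then show "y i = tensor_iso (mat_endo P b') i" using b i by (simp add: tensor_iso_def)
  qed
  then show "y \<in> tensor_iso ` (mat_endo P ` carrier B)" using b'B by blast
qed

lemma T_omnipresent_minimal_right:
  assumes C: "fd_module L C" and g: "minimal_right_almost_split L B C g" and T: "T_of L l n V C g T"
  shows "T_omnipresent l n V C T"
  unfolding T_omnipresent_def
proof (intro allI impI)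
  fix W' assume W': "\<forall>i\<in>{1..l}. VectorSpace.subspace class_ring (W' i) (mult_space (n i) :: ('k, nat \<Rightarrow>\<^sub>0 'k) module)"
  obtain P where P:
    "\<And>i j. i \<in> {1..l} \<Longrightarrow> j \<in> {1..n i} \<Longrightarrow> comb (mult_space (n i)) {1..n i} (P i j) mult_basis \<in> W' i"
    "\<And>i j w. i \<in> {1..l} \<Longrightarrow> j \<in> {1..n i} \<Longrightarrow> w \<in> W' i \<Longrightarrow>
      (\<Sum>j'\<in>{1..n i}. Poly_Mapping.lookup w j' * P i j' j) = Poly_Mapping.lookup w j"
    "\<And>i j j'. i \<in> {1..l} \<Longrightarrow> j \<in> {1..n i} \<Longrightarrow> j' \<in> {1..n i} \<Longrightarrow>
      (\<Sum>j''\<in>{1..n i}. P i j j'' * P i j'' j') = P i j j'"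
    by (rule exists_multiplicity_projections[OF W']) (rule that)
  have gh: "g \<in> khom B C" using g by (auto simp: minimal_right_almost_split_def right_almost_split_def lmod_hom_def)
  have Tg: "T (tensor_iso b) = g b" if "b \<in> mat_endo P ` carrier B" for b
    by (rule T_tensor_iso[OF fd_module_kspace[OF C] gh T]) (use that mat_endo_closed in blast)
  have "max_rank g (mat_endo P ` carrier B) (carrier C)"
    by (rule minimal_right_idempotent[OF B_mod C g mat_endo_hom mat_endo_idem[OF P(3)]])
  then have "max_rank T (tensor_iso ` (mat_endo P ` carrier B)) (carrier C)"
    unfolding max_rank_def
  proof (elim disjE)
    assume inj: "inj_on g (mat_endo P ` carrier B)"
    have "inj_on T (tensor_iso ` (mat_endo P ` carrier B))"
    proof (rule inj_onI, elim imageE[of _ tensor_iso])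
      fix x y b b' assume eq: "T x = T y" and b: "x = tensor_iso b" "b \<in> mat_endo P ` carrier B"
        and b': "y = tensor_iso b'" "b' \<in> mat_endo P ` carrier B"
      have "g b = g b'" using eq Tg[OF b(2)] Tg[OF b'(2)] unfolding b(1) b'(1) by simp
      then have "b = b'" using inj b(2) b'(2) by (simp add: inj_on_eq_iff)
      then show "x = y" unfolding b(1) b'(1) by simp
    qed
    then show "inj_on T (tensor_iso ` (mat_endo P ` carrier B)) \<or> T ` (tensor_iso ` (mat_endo P ` carrier B)) = carrier C" ..
  next
    assume "g ` (mat_endo P ` carrier B) = carrier C"
    moreover have "T ` (tensor_iso ` (mat_endo P ` carrier B)) = g ` (mat_endo P ` carrier B)"
      unfolding image_image[of T tensor_iso] by (rule image_cong[OF refl Tg])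
    ultimately show "inj_on T (tensor_iso ` (mat_endo P ` carrier B)) \<or> T ` (tensor_iso ` (mat_endo P ` carrier B)) = carrier C"
      by simp
  qed
  moreover have "tensor_iso ` (mat_endo P ` carrier B) = (\<Pi>\<^sub>E i\<in>{1..l}. subtensor (V i) (mult_space (n i)) (W' i))"
    by (rule tensor_iso_image[OF W' P(1,2)])
  ultimately show "max_rank T (\<Pi>\<^sub>E i\<in>{1..l}. subtensor (V i) (mult_space (n i)) (W' i)) (carrier C)"
    by (simp only:)
qed

section \<open>Quotients of the multiplicity spaces\<close>

context
  fixes W' and P :: "nat \<Rightarrow> nat \<Rightarrow> nat \<Rightarrow> 'k"
  assumes W': "\<forall>i\<in>{1..l}. VectorSpace.subspace class_ring (W' i) (mult_space (n i) :: ('k, nat \<Rightarrow>\<^sub>0 'k) module)"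
    and row: "\<And>i j. i \<in> {1..l} \<Longrightarrow> j \<in> {1..n i} \<Longrightarrow> comb (mult_space (n i)) {1..n i} (P i j) mult_basis \<in> W' i"
    and fix_W': "\<And>i j w. i \<in> {1..l} \<Longrightarrow> j \<in> {1..n i} \<Longrightarrow> w \<in> W' i \<Longrightarrow>
      (\<Sum>j'\<in>{1..n i}. Poly_Mapping.lookup w j' * P i j' j) = Poly_Mapping.lookup w j"
begin

abbreviation W :: "nat \<Rightarrow> ('k, nat \<Rightarrow>\<^sub>0 'k) module" where "W i \<equiv> mult_space (n i)"
abbreviation Q :: "nat \<Rightarrow> ('k, (nat \<Rightarrow>\<^sub>0 'k) set) module" where "Q i \<equiv> quot_space (W i) (W' i)"
abbreviation coset :: "nat \<Rightarrow> (nat \<Rightarrow>\<^sub>0 'k) \<Rightarrow> (nat \<Rightarrow>\<^sub>0 'k) set" where "coset i w \<equiv> W' i +>\<^bsub>W i\<^esub> w"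
abbreviation quot_comb :: "nat \<Rightarrow> (nat \<Rightarrow> nat \<Rightarrow> 'v) \<Rightarrow> ('v \<times> (nat \<Rightarrow>\<^sub>0 'k) set \<Rightarrow>\<^sub>0 'k) set"
  where "quot_comb i b \<equiv> tensor_comb i (Q i) (\<lambda>j. coset i (mult_basis j)) b"
text \<open>The idempotent \<open>1 - P\<close>. Its image is complementary to that of
  \<open>P\<close> and so a copy of the tensor products with the quotients by the
  \<open>W' i\<close>.\<close>

abbreviation co_endo :: "(nat \<Rightarrow> nat \<Rightarrow> 'v) \<Rightarrow> nat \<Rightarrow> nat \<Rightarrow> 'v"
  where "co_endo b \<equiv> mat_endo (\<lambda>i j j'. of_bool (j = j') - P i j j') b"

lemma W'_subspace: "i \<in> {1..l} \<Longrightarrow> VectorSpace.subspace class_ring (W' i) (W i)" using W' by blast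

lemma kspace_Q: "i \<in> {1..l} \<Longrightarrow> kspace (Q i)"
  by (rule kspace.kspace_quot[OF kspace_mult_space W'_subspace])

lemma coset_hom_Q: "i \<in> {1..l} \<Longrightarrow> coset i \<in> khom (W i) (Q i)"
  by (rule kspace.quot_hom[OF kspace_mult_space W'_subspace])

lemma coset_basis_closed: "i \<in> {1..l} \<Longrightarrow> j \<in> {1..n i} \<Longrightarrow> coset i (mult_basis j) \<in> carrier (Q i)"
  using coset_hom_Q mult_basis_closed by (simp add: khom_iff)

lemma tensor_map_comb:
  assumes i: "i \<in> {1..l}" and b: "b \<in> carrier B"
  shows "tensor_map (V i) (Q i) (\<lambda>v. v) (coset i) (tensor_comb i (W i) mult_basis b) = quot_comb i b"
proof -
  have P1: "tensor_pair (V i) (W i)" by (rule tensor_pair.intro[OF V_space[OF i] kspace_mult_space])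
  have P2: "tensor_pair (V i) (Q i)" by (rule tensor_pair.intro[OF V_space[OF i] kspace_Q[OF i]])
  interpret TQ: kspace "tensor (V i) (Q i)" by (rule tensor_pair.kspace_tensor[OF P2])
  have id: "(\<lambda>v. v) \<in> khom (V i) (V i)" by (simp add: khom_iff)
  note h = tensor_map_hom[OF P1 P2 id coset_hom_Q[OF i]]
  have p: "pure_tensor (V i) (W i) (b i j) (mult_basis j) \<in> carrier (tensor (V i) (W i))" if "j \<in> {1..n i}" for j
    by (rule tensor_pair.pure_closed[OF P1 B_component[OF b i that] mult_basis_closed[OF that]])
  have p': "pure_tensor (V i) (Q i) (b i j) (coset i (mult_basis j)) \<in> carrier (tensor (V i) (Q i))" if "j \<in> {1..n i}" for j
    by (rule tensor_pair.pure_closed[OF P2 B_component[OF b i that] coset_basis_closed[OF i that]])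
  have m: "tensor_map (V i) (Q i) (\<lambda>v. v) (coset i) (pure_tensor (V i) (W i) (b i j) (mult_basis j))
      = pure_tensor (V i) (Q i) (b i j) (coset i (mult_basis j))" if "j \<in> {1..n i}" for j
    by (rule h(2)[OF B_component[OF b i that] mult_basis_closed[OF that]])
  have "tensor_map (V i) (Q i) (\<lambda>v. v) (coset i) (tensor_comb i (W i) mult_basis b)
      = comb (tensor (V i) (Q i)) {1..n i} (\<lambda>_. 1)
        (\<lambda>j. tensor_map (V i) (Q i) (\<lambda>v. v) (coset i) (pure_tensor (V i) (W i) (b i j) (mult_basis j)))"
    unfolding tensor_comb_def by (rule hom_comb[OF tensor_pair.kspace_tensor[OF P1] TQ.kspace_axioms h(1) p])
  also have "\<dots> = quot_comb i b"
    unfolding tensor_comb_def by (rule TQ.comb_cong) (use m p' in simp_all)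
  finally show ?thesis .
qed

text \<open>Across the tensor sign \<open>1 - P\<close> alters the basis vector \<open>j\<close> by
  a row of \<open>P i\<close>, an element of \<open>W' i\<close>, which disappears in the
  quotient.\<close>

lemma quot_comb_co_endo:
  assumes i: "i \<in> {1..l}" and b: "b \<in> carrier B"
  shows "quot_comb i (co_endo b) = quot_comb i b"
proof -
  interpret W: kspace "W i" by (rule kspace_mult_space)
  have P2: "tensor_pair (V i) (Q i)" by (rule tensor_pair.intro[OF V_space[OF i] kspace_Q[OF i]])
  interpret TQ: kspace "tensor (V i) (Q i)" by (rule tensor_pair.kspace_tensor[OF P2])
  note db = dual_basis_mult_space[of "n i", where 'a = 'k]
  have r: "comb (Q i) {1..n i} (\<lambda>j'. of_bool (j = j') - P i j j') (\<lambda>j. coset i (mult_basis j)) = coset i (mult_basis j)"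
    if j: "j \<in> {1..n i}" for j
  proof -
    let ?c = "comb (W i) {1..n i} (\<lambda>j'. of_bool (j = j') - P i j j') mult_basis"
    let ?r = "comb (W i) {1..n i} (P i j) mult_basis"
    have c: "?c \<in> carrier (W i)" by (rule W.comb_closed[OF mult_basis_closed])
    have rW: "?r \<in> W' i" by (rule row[OF i j])
    note rc = W.subspaceD(1)[OF W'_subspace[OF i] rW]
    have e: "mult_basis j \<in> carrier (W i)" by (rule mult_basis_closed[OF j])
    have "?c \<ominus>\<^bsub>W i\<^esub> mult_basis j = (- 1) \<odot>\<^bsub>W i\<^esub> ?r"
    proof (rule W.dual_basis_eqI[OF db])
      show "?c \<ominus>\<^bsub>W i\<^esub> mult_basis j \<in> carrier (W i)" by (rule W.M.minus_closed[OF c e])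
      show "(- 1) \<odot>\<^bsub>W i\<^esub> ?r \<in> carrier (W i)" by (rule W.smult_simps(4)[OF rc])
      fix k assume k: "k \<in> {1..n i}"
      note f = dual_basisD(3)[OF db k]
      show "Poly_Mapping.lookup (?c \<ominus>\<^bsub>W i\<^esub> mult_basis j) k = Poly_Mapping.lookup ((- 1) \<odot>\<^bsub>W i\<^esub> ?r) k"
        unfolding W.functional_minus[OF f c e] functional_smult[OF f rc] W.dual_basis_comb[OF db k]
        by (simp add: mult_basis_def lookup_single when_def)
    qed
    also have "\<dots> \<in> W' i" by (rule W.subspaceD(4)[OF W'_subspace[OF i] rW])
    finally have "coset i ?c = coset i (mult_basis j)" using W.coset_eq_iff[OF W'_subspace[OF i] c e] by simp
    moreover have "coset i ?c = comb (Q i) {1..n i} (\<lambda>j'. of_bool (j = j') - P i j j') (\<lambda>j. coset i (mult_basis j))"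
      by (rule hom_comb[OF W.kspace_axioms kspace_Q[OF i] coset_hom_Q[OF i] mult_basis_closed])
    ultimately show ?thesis by simp
  qed
  have p: "pure_tensor (V i) (Q i) (b i j) (coset i (mult_basis j)) \<in> carrier (tensor (V i) (Q i))" if "j \<in> {1..n i}" for j
    by (rule tensor_pair.pure_closed[OF P2 B_component[OF b i that] coset_basis_closed[OF i that]])
  have "quot_comb i (co_endo b) = comb (tensor (V i) (Q i)) {1..n i} (\<lambda>_. 1)
      (\<lambda>j. pure_tensor (V i) (Q i) (b i j) (comb (Q i) {1..n i} (\<lambda>j'. of_bool (j = j') - P i j j') (\<lambda>j. coset i (mult_basis j))))"
    by (rule tensor_comb_mat_endo[OF i kspace_Q[OF i] coset_basis_closed[OF i] b])
  also have "\<dots> = quot_comb i b"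
    unfolding tensor_comb_def by (rule TQ.comb_cong) (use r p in simp_all)
  finally show ?thesis .
qed

lemma quot_comb_surj:
  assumes i: "i \<in> {1..l}" and y: "y \<in> carrier (tensor (V i) (Q i))"
  shows "\<exists>b. b \<in> carrier B \<and> y = quot_comb i b"
proof -
  interpret W: kspace "W i" by (rule kspace_mult_space)
  have P2: "tensor_pair (V i) (Q i)" by (rule tensor_pair.intro[OF V_space[OF i] kspace_Q[OF i]])
  have h: "tensor_comb i (Q i) (\<lambda>j. coset i (mult_basis j)) \<in> khom B (tensor (V i) (Q i))"
    by (rule tensor_comb_hom[OF i kspace_Q[OF i] coset_basis_closed[OF i]])
  have "carrier (tensor (V i) (Q i)) \<subseteq> tensor_comb i (Q i) (\<lambda>j. coset i (mult_basis j)) ` carrier B"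
  proof (rule tensor_pair.tensor_generated[OF P2])
    show "VectorSpace.subspace class_ring (tensor_comb i (Q i) (\<lambda>j. coset i (mult_basis j)) ` carrier B) (tensor (V i) (Q i))"
      by (rule khom_image_subspace[OF fd_module_kspace[OF B_mod] tensor_pair.kspace_tensor[OF P2] h])
    fix x w' assume x: "x \<in> carrier (V i)" and "w' \<in> carrier (Q i)"
    then obtain w where w: "w \<in> carrier (W i)" "w' = coset i w"
      using W.carrier_quot[OF W'_subspace[OF i]] by blast
    define b where "b = (\<lambda>i'\<in>{1..l}. \<lambda>j\<in>{1..n i'}. if i' = i then Poly_Mapping.lookup w j \<odot>\<^bsub>V i\<^esub> x else \<zero>\<^bsub>V i'\<^esub>)"
    have b: "b \<in> carrier B"
      unfolding b_def by (rule tensor_comb_preimage(1)[OF i kspace_Q[OF i] coset_basis_closed[OF i] x])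
    have "quot_comb i b = pure_tensor (V i) (Q i) x (comb (Q i) {1..n i} (Poly_Mapping.lookup w) (\<lambda>j. coset i (mult_basis j)))"
      unfolding b_def by (rule tensor_comb_preimage(3)[OF i kspace_Q[OF i] coset_basis_closed[OF i] x])
    also have "comb (Q i) {1..n i} (Poly_Mapping.lookup w) (\<lambda>j. coset i (mult_basis j))
        = coset i (comb (W i) {1..n i} (Poly_Mapping.lookup w) mult_basis)"
      by (rule hom_comb[OF W.kspace_axioms kspace_Q[OF i] coset_hom_Q[OF i] mult_basis_closed, symmetric])
    also have "comb (W i) {1..n i} (Poly_Mapping.lookup w) mult_basis = w"
      by (rule W.dual_basis_expand[OF dual_basis_mult_space w(1)])
    finally have "pure_tensor (V i) (Q i) x w' = quot_comb i b" unfolding w(2) ..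
    then show "pure_tensor (V i) (Q i) x w' \<in> tensor_comb i (Q i) (\<lambda>j. coset i (mult_basis j)) ` carrier B"
      using b by (rule image_eqI)
  qed
  then show ?thesis using y by blast
qed

text \<open>Column \<open>j\<close> of \<open>1 - P\<close> is a functional on \<open>W i\<close>
  that vanishes on \<open>W' i\<close>, as \<open>P\<close> fixes \<open>W' i\<close>. It descends
  to the quotient, and tensored with \<open>\<phi>\<close> it recovers from
  \<open>quot_comb i b\<close> the value of \<open>\<phi>\<close> at the component \<open>j\<close>
  of \<open>co_endo b\<close>.\<close>

lemma quot_comb_inj:
  assumes i: "i \<in> {1..l}" and b: "b \<in> carrier B" "b' \<in> carrier B" and eq: "quot_comb i b = quot_comb i b'" and j: "j \<in> {1..n i}"
  shows "co_endo b i j = co_endo b' i j"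
proof (rule V_eqI[OF i B_component[OF mat_endo_closed[OF b(1)] i j] B_component[OF mat_endo_closed[OF b(2)] i j]])
  fix \<phi> assume \<phi>: "functional (V i) \<phi>"
  interpret W: kspace "W i" by (rule kspace_mult_space)
  have P2: "tensor_pair (V i) (Q i)" by (rule tensor_pair.intro[OF V_space[OF i] kspace_Q[OF i]])
  interpret TQ: kspace "tensor (V i) (Q i)" by (rule tensor_pair.kspace_tensor[OF P2])
  note db = dual_basis_mult_space[of "n i", where 'a = 'k]
  let ?\<eta> = "\<lambda>w. \<Sum>j'\<in>{1..n i}. (of_bool (j' = j) - P i j' j) * Poly_Mapping.lookup w j'"
  have \<eta>: "functional (W i) ?\<eta>" by (rule functional_sum[OF dual_basisD(3)[OF db]])
  have z: "?\<eta> w = 0" if w: "w \<in> W' i" for w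
    using fix_W'[OF i j w] j by (simp add: right_diff_distrib sum_subtractf sum_of_bool_mult mult.commute)
  have \<eta>e: "?\<eta> (mult_basis k) = of_bool (k = j) - P i k j" if "k \<in> {1..n i}" for k
    using that dual_basisD(4)[OF db _ that] by (simp add: sum_of_bool_mult)
  obtain \<eta>' where \<eta>': "functional (Q i) \<eta>' \<and> (\<forall>x\<in>carrier (W i). \<eta>' (coset i x) = ?\<eta> x)"
    by (rule exE[OF W.functional_quot[OF W'_subspace[OF i] \<eta> z]])
  obtain \<tau> where \<tau>: "functional (tensor (V i) (Q i)) \<tau> \<and>
      (\<forall>v\<in>carrier (V i). \<forall>w\<in>carrier (Q i). \<tau> (pure_tensor (V i) (Q i) v w) = \<phi> v * \<eta>' w)"
    by (rule exE[OF tensor_pair.tensor_functional[OF P2 \<phi> conjunct1[OF \<eta>']]])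
  have val: "\<tau> (quot_comb i c) = \<phi> (co_endo c i j)" if c: "c \<in> carrier B" for c
  proof -
    have p: "pure_tensor (V i) (Q i) (c i k) (coset i (mult_basis k)) \<in> carrier (tensor (V i) (Q i))" if "k \<in> {1..n i}" for k
      by (rule tensor_pair.pure_closed[OF P2 B_component[OF c i that] coset_basis_closed[OF i that]])
    have "\<tau> (quot_comb i c) = (\<Sum>k\<in>{1..n i}. 1 * \<tau> (pure_tensor (V i) (Q i) (c i k) (coset i (mult_basis k))))"
      unfolding tensor_comb_def by (rule TQ.functional_comb[OF conjunct1[OF \<tau>] p])
    also have "\<dots> = (\<Sum>k\<in>{1..n i}. (of_bool (k = j) - P i k j) * \<phi> (c i k))"
    proof (rule sum.cong[OF refl])
      fix k assume k: "k \<in> {1..n i}"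
      have "\<eta>' (coset i (mult_basis k)) = of_bool (k = j) - P i k j"
        using bspec[OF conjunct2[OF \<eta>'] mult_basis_closed[OF k]] \<eta>e[OF k] by (rule trans)
      then show "1 * \<tau> (pure_tensor (V i) (Q i) (c i k) (coset i (mult_basis k))) = (of_bool (k = j) - P i k j) * \<phi> (c i k)"
        using bspec[OF bspec[OF conjunct2[OF \<tau>] B_component[OF c i k]] coset_basis_closed[OF i k]] by simp
    qed
    also have "\<dots> = \<phi> (co_endo c i j)" by (rule functional_mat_endo[OF c i j \<phi>, symmetric])
    finally show ?thesis .
  qed
  show "\<phi> (co_endo b i j) = \<phi> (co_endo b' i j)" using val[OF b(1)] val[OF b(2)] eq by simp
qed

end

text \<open>After the image of \<open>1 - P\<close> is identified with the sum of the tensor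
  products with the quotients, the composite of \<open>S\<close> with the projection is
  \<open>f\<close> followed by \<open>1 - P\<close>, and \<open>minimal_left_idempotent\<close>
  applies.\<close>

lemma S_omnipresent_minimal_left:
  assumes A: "fd_module L A" and f: "minimal_left_almost_split L A B f"
  shows "S_omnipresent l n V A (S_of l n V f)"
  unfolding S_omnipresent_def
proof (intro allI impI)
  fix W' assume W': "\<forall>i\<in>{1..l}. VectorSpace.subspace class_ring (W' i) (mult_space (n i) :: ('k, nat \<Rightarrow>\<^sub>0 'k) module)"
  obtain P where P:
    "\<And>i j. i \<in> {1..l} \<Longrightarrow> j \<in> {1..n i} \<Longrightarrow> comb (mult_space (n i)) {1..n i} (P i j) mult_basis \<in> W' i"
    "\<And>i j w. i \<in> {1..l} \<Longrightarrow> j \<in> {1..n i} \<Longrightarrow> w \<in> W' i \<Longrightarrow>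
      (\<Sum>j'\<in>{1..n i}. Poly_Mapping.lookup w j' * P i j' j) = Poly_Mapping.lookup w j"
    "\<And>i j j'. i \<in> {1..l} \<Longrightarrow> j \<in> {1..n i} \<Longrightarrow> j' \<in> {1..n i} \<Longrightarrow>
      (\<Sum>j''\<in>{1..n i}. P i j j'' * P i j'' j') = P i j j'"
    by (rule exists_multiplicity_projections[OF W']) (rule that)
  note co = W' P(1,2)
  let ?Q = "\<lambda>i. quot_space (mult_space (n i)) (W' i)"
  let ?q = "\<lambda>i b. tensor_comb i (?Q i) (\<lambda>j. W' i +>\<^bsub>mult_space (n i)\<^esub> mult_basis j) b"
  let ?e = "mat_endo (\<lambda>i j j'. of_bool (j = j') - P i j j')"
  let ?Y = "carrier (dir_sum {1..l} (\<lambda>i. tensor (V i) (?Q i)))"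
  let ?h = "\<lambda>a. \<lambda>i\<in>{1..l}. tensor_map (V i) (?Q i) (\<lambda>v. v) (\<lambda>w. W' i +>\<^bsub>mult_space (n i)\<^esub> w) (S_of l n V f a i)"
  have fB: "f a \<in> carrier B" if "a \<in> carrier A" for a
    using f that by (auto simp: minimal_left_almost_split_def left_almost_split_def lmod_hom_def khom_iff)
  have h: "?h a = (\<lambda>i\<in>{1..l}. ?q i (f a))" if a: "a \<in> carrier A" for a
  proof (rule restrict_ext)
    fix i assume i: "i \<in> {1..l}"
    show "tensor_map (V i) (?Q i) (\<lambda>v. v) (\<lambda>w. W' i +>\<^bsub>mult_space (n i)\<^esub> w) (S_of l n V f a i) = ?q i (f a)"
      unfolding S_of_tensor_comb[OF i, of f a, OF fB[OF a]] by (rule tensor_map_comb[OF co i fB[OF a]])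
  qed
  have idem: "(\<Sum>j''\<in>{1..n i}. (of_bool (j = j'') - P i j j'') * (of_bool (j'' = j') - P i j'' j')) = of_bool (j = j') - P i j j'"
    if "i \<in> {1..l}" "j \<in> {1..n i}" "j' \<in> {1..n i}" for i j j'
  proof -
    have "(\<Sum>j''\<in>{1..n i}. (of_bool (j = j'') - P i j j'') * (of_bool (j'' = j') - P i j'' j'))
        = (\<Sum>j''\<in>{1..n i}. of_bool (j = j'') * of_bool (j'' = j')) - (\<Sum>j''\<in>{1..n i}. P i j j'' * of_bool (j'' = j'))
          - ((\<Sum>j''\<in>{1..n i}. of_bool (j = j'') * P i j'' j') - (\<Sum>j''\<in>{1..n i}. P i j j'' * P i j'' j'))"
      by (simp only: left_diff_distrib right_diff_distrib sum_subtractf)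
    then show ?thesis using P(3)[OF that] that by (simp add: sum_of_bool_mult)
  qed
  have "max_rank (\<lambda>a. ?e (f a)) (carrier A) (?e ` carrier B)"
    by (rule minimal_left_idempotent[OF A B_mod f mat_endo_hom mat_endo_idem[OF idem]])
  then show "max_rank ?h (carrier A) ?Y"
    unfolding max_rank_def
  proof (elim disjE)
    assume inj: "inj_on (\<lambda>a. ?e (f a)) (carrier A)"
    have "inj_on ?h (carrier A)"
    proof (rule inj_onI)
      fix a a' assume a: "a \<in> carrier A" and a': "a' \<in> carrier A" and eq: "?h a = ?h a'"
      have "?q i (f a) = ?q i (f a')" if "i \<in> {1..l}" for i
        using fun_cong[OF eq[unfolded h[OF a] h[OF a']], of i] that by (simp del: atLeastAtMost_iff)
      then have "?e (f a) = ?e (f a')"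
        by (intro B_eqI mat_endo_closed fB a a' quot_comb_inj[OF co])
      then show "a = a'" by (rule inj_onD[OF inj _ a a'])
    qed
    then show "inj_on ?h (carrier A) \<or> ?h ` carrier A = ?Y" ..
  next
    assume surj: "(\<lambda>a. ?e (f a)) ` carrier A = ?e ` carrier B"
    have "?h a \<in> ?Y" if a: "a \<in> carrier A" for a
      unfolding h[OF a] dir_sum_def
      using tensor_comb_closed[OF _ kspace_Q[OF co] coset_basis_closed[OF co] fB[OF a]] by simp
    moreover have "y \<in> ?h ` carrier A" if y: "y \<in> ?Y" for y
    proof -
      have yi: "y i \<in> carrier (tensor (V i) (?Q i))" if "i \<in> {1..l}" for i
        using y that by (auto simp: dir_sum_def PiE_iff)
      have "\<forall>i\<in>{1..l}. \<exists>b. b \<in> carrier B \<and> y i = ?q i b"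
        by (intro ballI quot_comb_surj[OF co] yi)
      then obtain b where b: "\<forall>i\<in>{1..l}. b i \<in> carrier B \<and> y i = ?q i (b i)"
        by (rule bchoice[THEN exE])
      then have bB: "b i \<in> carrier B" if "i \<in> {1..l}" for i using that by blast
      define b' where "b' = (\<lambda>i\<in>{1..l}. \<lambda>j\<in>{1..n i}. b i i j)"
      have b'B: "b' \<in> carrier B" unfolding b'_def by (rule B_glue) (rule bB)
      have b': "b i i j = b' i j" if "i \<in> {1..l}" "j \<in> {1..n i}" for i j using that by (simp add: b'_def)
      have "?e b' \<in> (\<lambda>a. ?e (f a)) ` carrier A" unfolding surj using b'B by (rule imageI)
      then obtain a where a: "?e b' = ?e (f a)" "a \<in> carrier A" by (rule imageE)
      have "y i = ?q i (f a)" if i: "i \<in> {1..l}" for i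
      proof -
        have "y i = ?q i (b i)" using b i by blast
        also have "\<dots> = ?q i b'"
          by (rule tensor_comb_cong[OF i kspace_Q[OF co i] coset_basis_closed[OF co i] bB[OF i] b'B b'[OF i]])
        also have "\<dots> = ?q i (?e b')" by (rule quot_comb_co_endo[OF co i b'B, symmetric])
        also have "\<dots> = ?q i (f a)" unfolding a(1) by (rule quot_comb_co_endo[OF co i fB[OF a(2)]])
        finally show ?thesis .
      qed
      moreover have "y \<in> extensional {1..l}" using y by (auto simp: dir_sum_def PiE_iff)
      ultimately have "y = ?h a"
        unfolding h[OF a(2)] by (intro extensionalityI[of y "{1..l}"]) simp_all
      then show ?thesis using a(2) by (rule image_eqI)
    qed
    ultimately have "?h ` carrier A = ?Y" by (intro equalityI image_subsetI subsetI)
    then show "inj_on ?h (carrier A) \<or> ?h ` carrier A = ?Y" ..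
  qed
qed

end

lemma exact_dim:
  assumes A: "fd_module L A" and B: "fd_module L B" and C: "kspace C" and f: "f \<in> khom A B" and g: "g \<in> khom B C"
    and inj: "inj_on f (carrier A)" and exact: "f ` carrier A = {b \<in> carrier B. g b = \<zero>\<^bsub>C\<^esub>}"
    and surj: "g ` carrier B = carrier C"
  shows "vdim B = vdim A + vdim C"
proof -
  interpret A: kspace A by (rule fd_module_kspace[OF A])
  interpret B: kspace B by (rule fd_module_kspace[OF B])
  interpret C: kspace C by fact
  interpret mod_hom class_ring B C g by (unfold_locales, rule g)
  interpret linear_map class_ring B C g by unfold_locales
  have "f \<in> khom A (B\<lparr>carrier := f ` carrier A\<rparr>)" using f by (auto simp: khom_iff)
  then have "vdim A = vdim (B\<lparr>carrier := f ` carrier A\<rparr>)"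
    by (rule khom_bij_dim[OF A.kspace_axioms kspace_subspace[OF B.kspace_axioms khom_image_subspace[OF A.kspace_axioms B.kspace_axioms f]]])
      (use inj fd_module.fin_dim[OF A] in simp_all)
  moreover have k: "kerT = f ` carrier A" unfolding exact by (rule ker_def)
  moreover have i: "imT = carrier C" unfolding surj[symmetric] by (rule im_def)
  moreover have "C\<lparr>carrier := carrier C\<rparr> = C" by simp
  ultimately show ?thesis using rank_nullity[OF fd_module.fin_dim[OF B], unfolded k i] by (simp only: add.commute)
qed

theorem proposition3p1:
  fixes L :: "('k::alg_closed_field, 'r) module"
    and A :: "('k, 'a, 'r) lmodule"
    and C :: "('k, 'c, 'r) lmodule"
    and V :: "nat \<Rightarrow> ('k, 'v, 'r) lmodule"
    and l :: nat and n :: "nat \<Rightarrow> nat"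
    and B :: "('k, nat \<Rightarrow> nat \<Rightarrow> 'v, 'r) lmodule"
    and f :: "'a \<Rightarrow> nat \<Rightarrow> nat \<Rightarrow> 'v"
    and g :: "(nat \<Rightarrow> nat \<Rightarrow> 'v) \<Rightarrow> 'c"
    and T :: "(nat \<Rightarrow> ('v \<times> (nat \<Rightarrow>\<^sub>0 'k) \<Rightarrow>\<^sub>0 'k) set) \<Rightarrow> 'c"
    and S :: "'a \<Rightarrow> nat \<Rightarrow> ('v \<times> (nat \<Rightarrow>\<^sub>0 'k) \<Rightarrow>\<^sub>0 'k) set"
  assumes L: "k_algebra L"
    and A: "fd_module L A"
    and C: "fd_module L C"
    and V: "\<And>i. i \<in> {1..l} \<Longrightarrow> fd_module L (V i) \<and> indecomposable L (V i)"
    and V_noniso: "\<And>i j. i \<in> {1..l} \<Longrightarrow> j \<in> {1..l} \<Longrightarrow> i \<noteq> j \<Longrightarrow> \<not> lmod_isomorphic L (V i) (V j)"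
    and B: "B = middle_module l n V"
    and f: "f \<in> lmod_hom L A B"
    and g: "g \<in> lmod_hom L B C"
    and T: "T_of L l n V C g T"
    and S: "S = S_of l n V f"
  shows
    "(minimal_right_almost_split L B C g \<longrightarrow>
        T_omnipresent l n V C T \<and>
        general_choice l V (\<lambda>U. max_rank g (\<Pi>\<^sub>E i\<in>{1..l}. \<Pi>\<^sub>E j\<in>{1..n i}. U i) (carrier C)) \<and>
        (g ` carrier B = carrier C \<longrightarrow> vdim C < (\<Sum>i = 1..l. (vdim (V i))\<^sup>2))) \<and>
     (minimal_left_almost_split L A B f \<longrightarrow>
        S_omnipresent l n V A S \<and>
        general_choice l V (\<lambda>U. max_rank
          (\<lambda>a. \<lambda>i\<in>{1..l}. \<lambda>j\<in>{1..n i}. U i +>\<^bsub>V i\<^esub> f a i j)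
          (carrier A)
          (carrier (dir_sum {1..l} (\<lambda>i. dir_sum {1..n i} (\<lambda>j. quot_space (V i) (U i)))))) \<and>
        (inj_on f (carrier A) \<longrightarrow> vdim A < (\<Sum>i = 1..l. (vdim (V i))\<^sup>2))) \<and>
     (almost_split_sequence L A f B g C \<longrightarrow>
        int (vdim B) < 2 * (\<Sum>i = 1..l. (int (vdim (V i)))\<^sup>2) - 1)"
proof -
  interpret middle_alg_closed L l n V by (intro middle_alg_closed.intro middle.intro conjunct1[OF V])
  have BB: "B = middle.B l n V" unfolding B_def by (rule B)
  obtain \<epsilon> \<zeta> where "\<forall>i\<in>{1..l}. dual_basis (V i) {..<v i} (\<epsilon> i) (\<zeta> i)" using exists_dual_bases by blast
  then have db: "dual_basis (V i) {..<v i} (\<epsilon> i) (\<zeta> i)" if "i \<in> {1..l}" for i using that by blast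
  have right: "vdim C < (\<Sum>i = 1..l. (vdim (V i))\<^sup>2)"
    if "minimal_right_almost_split L B C g" "g ` carrier B = carrier C"
    using minimal_right_dim_less[OF db C, of g] that unfolding BB v_def by blast
  have left: "vdim A < (\<Sum>i = 1..l. (vdim (V i))\<^sup>2)"
    if "minimal_left_almost_split L A B f" "inj_on f (carrier A)"
    using minimal_left_dim_less[OF db A, of f] that unfolding BB v_def by blast
  have seq: "int (vdim B) < 2 * (\<Sum>i = 1..l. (int (vdim (V i)))\<^sup>2) - 1" if seq: "almost_split_sequence L A f B g C"
  proof -
    have Bm: "fd_module L B" using B_mod by (simp add: BB)
    have ex: "inj_on f (carrier A)" "f ` carrier A = {b \<in> carrier B. g b = \<zero>\<^bsub>C\<^esub>}" "g ` carrier B = carrier C"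
      using seq by (simp_all add: almost_split_sequence_def)
    have "vdim B = vdim A + vdim C"
      by (rule exact_dim[OF A Bm fd_module_kspace[OF C] lmod_homD(1)[OF f] lmod_homD(1)[OF g] ex])
    moreover have "vdim A < (\<Sum>i = 1..l. (vdim (V i))\<^sup>2)"
      by (rule left[OF almost_split_sequence_minimal(1)[OF A Bm C seq] ex(1)])
    moreover have "vdim C < (\<Sum>i = 1..l. (vdim (V i))\<^sup>2)"
      by (rule right[OF almost_split_sequence_minimal(2)[OF A Bm C seq] ex(3)])
    \<comment> \<open>The bound is stated over the integers, where subtraction is not truncated.
      Each strict inequality between natural numbers gains 1, so \<open>vdim B\<close> is at most
      twice the sum minus 2, which is below the stated bound.\<close>
    moreover have "(\<Sum>i = 1..l. (int (vdim (V i)))\<^sup>2) = int (\<Sum>i = 1..l. (vdim (V i))\<^sup>2)" by simp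
    ultimately show ?thesis by linarith
  qed
  show ?thesis
  proof (intro conjI impI)
    assume m: "minimal_right_almost_split L B C g"
    show "T_omnipresent l n V C T" using T_omnipresent_minimal_right[OF C _ T] m by (simp add: BB)
    show "general_choice l V (\<lambda>U. max_rank g (\<Pi>\<^sub>E i\<in>{1..l}. \<Pi>\<^sub>E j\<in>{1..n i}. U i) (carrier C))"
      using general_choice_right[OF C] m by (simp add: BB)
    show "vdim C < (\<Sum>i = 1..l. (vdim (V i))\<^sup>2)" if "g ` carrier B = carrier C" by (rule right[OF m that])
  next
    assume m: "minimal_left_almost_split L A B f"
    show "S_omnipresent l n V A S" unfolding S using S_omnipresent_minimal_left[OF A] m by (simp add: BB)
    show "general_choice l V (\<lambda>U. max_rank
          (\<lambda>a. \<lambda>i\<in>{1..l}. \<lambda>j\<in>{1..n i}. U i +>\<^bsub>V i\<^esub> f a i j)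
          (carrier A)
          (carrier (dir_sum {1..l} (\<lambda>i. dir_sum {1..n i} (\<lambda>j. quot_space (V i) (U i))))))"
      using general_choice_left[OF A] m by (simp add: BB)
    show "vdim A < (\<Sum>i = 1..l. (vdim (V i))\<^sup>2)" if "inj_on f (carrier A)" by (rule left[OF m that])
  qed (rule seq)
qed

end
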